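(* Let $k$ be a field, $H$ a finite-dimensional Hopf algebra over $k$, and $\Lambda\in H$ a nonzero left integral. Let $R$ be a left $H$-module algebra and $T=R\# H$ the associated smash product. Assume that $R$ is noetherian as a left module over the subalgebra $R^H$ of $H$-invariants and that $R^H/\Lambda R$ is finite-dimensional over $k$. Let $\delta$ denote the greatest common divisor of the dimensions $\dim_k P$ of all finitely generated projective $H$-modules $P$. Then, for every $T$-module $M$ with $\dim_k M<\infty$, the order of $[M]\in G_0(T)$ is divisible by $\delta/(\delta,\dim_k M)$, where $(\delta,\dim_kM)$ denotes the greatest common divisor and every integer is understood to divide $\infty$.
   Context: Modules are left modules. $H$ has counit $\varepsilon$ and comultiplication $\Delta(h)=\sum h_1\otimes h_2$. A left integral of $H$ is an element $\Lambda$ with $h\Lambda=\varepsilon(h)\Lambda$ for all $h\in H$. A left $H$-module algebra is a $k$-algebra $R$ that is a left $H$-module with $h(rr')=\sum (h_1r)(h_2r')$ and $h1_R=\varepsilon(h)1_R$ for all $h\in H$, $r,r'\in R$. Its invariants are $R^H=\{r\in R\mid hr=\varepsilon(h)r\ \forall h\in H\}$, a subalgebra of $R$ containing $\Lambda R=\{\Lambda r\mid r\in R\}$. The smash product $T=R\# H$ is $R\otimes_k H$ with multiplication $(r\# h)(r'\# h')=\sum r(h_1r')\# h_2h'$, where $r\# h$ stands for $r\otimes h$. Under the noetherian hypothesis, $T$ is left noetherian, and $G_0(T)$ is the Grothendieck group of the category of finitely generated left $T$-modules: generated by classes $[M]$ of finitely generated $T$-modules, with a relation $[M]=[M']+[M'']$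 for each short exact sequence $0\to M'\to M\to M''\to 0$. The order of an element of an abelian group is $\infty$ if no positive multiple of it is zero. *)

theory Defs
  imports
    "Jordan_Normal_Form.Missing_VectorSpace"
    "HOL-Algebra.AbelCoset"
    "HOL-Algebra.Multiplicative_Group"
    "HOL-Algebra.Free_Abelian_Groups"
begin

section \<open>Left modules over a not necessarily commutative ring\<close>

text \<open>
  The locale \<open>module\<close> requires a commutative ring of scalars, so its axioms are restated
  here over an arbitrary ring.  The fields \<open>mult\<close> and \<open>one\<close> of the record type of modules
  play no role for a structure that is used only as a module.
\<close>

locale left_module = R?: ring R + M?: abelian_group M
  for R :: "('a, 'c) ring_scheme" (structure) and M :: "('a, 'b, 'd) module_scheme" (structure) +
  assumes lsmult_closed:
      "\<lbrakk>a \<in> carrier R; x \<in> carrier M\<rbrakk> \<Longrightarrow> a \<odot>\<^bsub>M\<^esub> x \<in> carrier M"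
    and lsmult_l_distr:
      "\<lbrakk>a \<in> carrier R; b \<in> carrier R; x \<in> carrier M\<rbrakk> \<Longrightarrow>
        (a \<oplus>\<^bsub>R\<^esub> b) \<odot>\<^bsub>M\<^esub> x = a \<odot>\<^bsub>M\<^esub> x \<oplus>\<^bsub>M\<^esub> b \<odot>\<^bsub>M\<^esub> x"
    and lsmult_r_distr:
      "\<lbrakk>a \<in> carrier R; x \<in> carrier M; y \<in> carrier M\<rbrakk> \<Longrightarrow>
        a \<odot>\<^bsub>M\<^esub> (x \<oplus>\<^bsub>M\<^esub> y) = a \<odot>\<^bsub>M\<^esub> x \<oplus>\<^bsub>M\<^esub> a \<odot>\<^bsub>M\<^esub> y"
    and lsmult_assoc:
      "\<lbrakk>a \<in> carrier R; b \<in> carrier R; x \<in> carrier M\<rbrakk> \<Longrightarrow>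
        (a \<otimes>\<^bsub>R\<^esub> b) \<odot>\<^bsub>M\<^esub> x = a \<odot>\<^bsub>M\<^esub> (b \<odot>\<^bsub>M\<^esub> x)"
    and lsmult_one:
      "x \<in> carrier M \<Longrightarrow> \<one>\<^bsub>R\<^esub> \<odot>\<^bsub>M\<^esub> x = x"

definition fg_module :: "('a, 'c) ring_scheme \<Rightarrow> ('a, 'b, 'd) module_scheme \<Rightarrow> bool" where
  "fg_module R M \<longleftrightarrow> left_module R M \<and>
     (\<exists>A. finite A \<and> A \<subseteq> carrier M \<and>
        (\<forall>N. Module.submodule N R M \<and> A \<subseteq> N \<longrightarrow> N = carrier M))"

definition noetherian_module :: "('a, 'c) ring_scheme \<Rightarrow> ('a, 'b, 'd) module_scheme \<Rightarrow> bool" where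
  "noetherian_module R M \<longleftrightarrow> left_module R M \<and>
     (\<forall>N. Module.submodule N R M \<longrightarrow> fg_module R (M\<lparr>carrier := N\<rparr>))"

definition module_iso ::
  "('a, 'c) ring_scheme \<Rightarrow> ('a, 'b, 'd) module_scheme \<Rightarrow> ('a, 'e, 'f) module_scheme \<Rightarrow> bool" where
  "module_iso R M N \<longleftrightarrow>
     (\<exists>f \<in> LinearCombinations.module_hom R M N. bij_betw f (carrier M) (carrier N))"

definition short_exact ::
  "('a, 'c) ring_scheme \<Rightarrow> ('a, 'b1) module \<Rightarrow> ('a, 'b2) module \<Rightarrow> ('a, 'b3) module \<Rightarrow> bool" where
  "short_exact R M' M M'' \<longleftrightarrow>
     (\<exists>f \<in> LinearCombinations.module_hom R M' M. \<exists>g \<in> LinearCombinations.module_hom R M M''.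
        inj_on f (carrier M') \<and> f ` carrier M' = a_kernel M M'' g \<and>
        g ` carrier M = carrier M'')"

definition free_module :: "('a, 'c) ring_scheme \<Rightarrow> 'i set \<Rightarrow> ('a, 'i \<Rightarrow> 'a) module" where
  "free_module R I =
     \<lparr>carrier = {f. (\<forall>i. f i \<in> carrier R) \<and> finite {i. f i \<noteq> \<zero>\<^bsub>R\<^esub>} \<and> {i. f i \<noteq> \<zero>\<^bsub>R\<^esub>} \<subseteq> I},
      monoid.mult = (\<lambda>f g i. \<zero>\<^bsub>R\<^esub>), monoid.one = (\<lambda>i. \<zero>\<^bsub>R\<^esub>),
      ring.zero = (\<lambda>i. \<zero>\<^bsub>R\<^esub>), ring.add = (\<lambda>f g i. f i \<oplus>\<^bsub>R\<^esub> g i),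
      smult = (\<lambda>a f i. a \<otimes>\<^bsub>R\<^esub> f i)\<rparr>"

definition free_basis :: "('a, 'c) ring_scheme \<Rightarrow> 'i \<Rightarrow> ('i \<Rightarrow> 'a)" where
  "free_basis R i = (\<lambda>j. if j = i then \<one>\<^bsub>R\<^esub> else \<zero>\<^bsub>R\<^esub>)"

text \<open>
  Projective means isomorphic to a direct summand of a free module.  The types of the index set
  and of the complement are no restriction: if \<open>P\<close> is projective, then the canonical epimorphism
  onto \<open>P\<close> from the free module on the set \<open>carrier P\<close> splits, and its kernel is a complement.
\<close>

definition projective_module ::
  "('a, 'c) ring_scheme \<Rightarrow> ('a, 'p, 'd) module_scheme \<Rightarrow> bool" where
  "projective_module R P \<longleftrightarrow> left_module R P \<and>
     (\<exists>(I :: 'p set) (Q :: ('a, 'p \<Rightarrow> 'a) module).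
        left_module R Q \<and> module_iso R (direct_sum P Q) (free_module R I))"

text \<open>The elements of the quotient of \<open>M\<close> by a submodule \<open>N\<close> are the additive cosets of \<open>N\<close>.\<close>

definition quotient_module :: "('a, 'b, 'd) module_scheme \<Rightarrow> 'b set \<Rightarrow> ('a, 'b set) module" where
  "quotient_module M N =
     \<lparr>carrier = a_rcosets\<^bsub>M\<^esub> N, monoid.mult = (\<lambda>X Y. N), monoid.one = N, ring.zero = N,
      ring.add = (\<lambda>X Y. X <+>\<^bsub>M\<^esub> Y),
      smult = (\<lambda>a X. \<Union>x\<in>X. N +>\<^bsub>M\<^esub> (a \<odot>\<^bsub>M\<^esub> x))\<rparr>"

definition with_action :: "('b, 'd) ring_scheme \<Rightarrow> ('a \<Rightarrow> 'b \<Rightarrow> 'b) \<Rightarrow> ('a, 'b) module" where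
  "with_action M act =
     \<lparr>carrier = carrier M, monoid.mult = monoid.mult M, monoid.one = \<one>\<^bsub>M\<^esub>, ring.zero = \<zero>\<^bsub>M\<^esub>,
      ring.add = ring.add M, smult = act\<rparr>"

section \<open>Algebras over a field and tensor products\<close>

definition k_algebra :: "('k, 'c) ring_scheme \<Rightarrow> ('k, 'a, 'd) module_scheme \<Rightarrow> bool" where
  "k_algebra K A \<longleftrightarrow> vectorspace K A \<and> ring A \<and>
     (\<forall>c \<in> carrier K. \<forall>x \<in> carrier A. \<forall>y \<in> carrier A.
        (c \<odot>\<^bsub>A\<^esub> x) \<otimes>\<^bsub>A\<^esub> y = c \<odot>\<^bsub>A\<^esub> (x \<otimes>\<^bsub>A\<^esub> y) \<and>
        x \<otimes>\<^bsub>A\<^esub> (c \<odot>\<^bsub>A\<^esub> y) = c \<odot>\<^bsub>A\<^esub> (x \<otimes>\<^bsub>A\<^esub> y))"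

text \<open>The vector space underlying a left module over an algebra \<open>A\<close>.\<close>

definition scalar_restriction ::
  "('k, 'a, 'd) module_scheme \<Rightarrow> ('a, 'm, 'e) module_scheme \<Rightarrow> ('k, 'm) module" where
  "scalar_restriction A M = with_action M (\<lambda>c m. (c \<odot>\<^bsub>A\<^esub> \<one>\<^bsub>A\<^esub>) \<odot>\<^bsub>M\<^esub> m)"

text \<open>
  The tensor product of two vector spaces is the free vector space on the pairs of vectors modulo
  the subspace spanned by the bilinearity relations.
\<close>

abbreviation tensor_free ::
  "('k, 'c) ring_scheme \<Rightarrow> ('k, 'v, 'd) module_scheme \<Rightarrow> ('k, 'w, 'e) module_scheme \<Rightarrow>
     ('k, 'v \<times> 'w \<Rightarrow> 'k) module" where
  "tensor_free K V W \<equiv> free_module K (carrier V \<times> carrier W)"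

definition tensor_relators ::
  "('k, 'c) ring_scheme \<Rightarrow> ('k, 'v, 'd) module_scheme \<Rightarrow> ('k, 'w, 'e) module_scheme \<Rightarrow>
     ('v \<times> 'w \<Rightarrow> 'k) set" where
  "tensor_relators K V W =
     (let F = tensor_free K V W; e = free_basis K in
       {e (v \<oplus>\<^bsub>V\<^esub> v', w) \<ominus>\<^bsub>F\<^esub> (e (v, w) \<oplus>\<^bsub>F\<^esub> e (v', w)) | v v' w.
          v \<in> carrier V \<and> v' \<in> carrier V \<and> w \<in> carrier W}
     \<union> {e (v, w \<oplus>\<^bsub>W\<^esub> w') \<ominus>\<^bsub>F\<^esub> (e (v, w) \<oplus>\<^bsub>F\<^esub> e (v, w')) | v w w'.
          v \<in> carrier V \<and> w \<in> carrier W \<and> w' \<in> carrier W}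
     \<union> {e (c \<odot>\<^bsub>V\<^esub> v, w) \<ominus>\<^bsub>F\<^esub> (c \<odot>\<^bsub>F\<^esub> e (v, w)) | c v w.
          c \<in> carrier K \<and> v \<in> carrier V \<and> w \<in> carrier W}
     \<union> {e (v, c \<odot>\<^bsub>W\<^esub> w) \<ominus>\<^bsub>F\<^esub> (c \<odot>\<^bsub>F\<^esub> e (v, w)) | c v w.
          c \<in> carrier K \<and> v \<in> carrier V \<and> w \<in> carrier W})"

definition tensor_null ::
  "('k, 'c) ring_scheme \<Rightarrow> ('k, 'v, 'd) module_scheme \<Rightarrow> ('k, 'w, 'e) module_scheme \<Rightarrow>
     ('v \<times> 'w \<Rightarrow> 'k) set" where
  "tensor_null K V W = LinearCombinations.module.span K (tensor_free K V W) (tensor_relators K V W)"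

definition tensor ::
  "('k, 'c) ring_scheme \<Rightarrow> ('k, 'v, 'd) module_scheme \<Rightarrow> ('k, 'w, 'e) module_scheme \<Rightarrow>
     ('k, ('v \<times> 'w \<Rightarrow> 'k) set) module" where
  "tensor K V W = quotient_module (tensor_free K V W) (tensor_null K V W)"

definition pure_tensor ::
  "('k, 'c) ring_scheme \<Rightarrow> ('k, 'v, 'd) module_scheme \<Rightarrow> ('k, 'w, 'e) module_scheme \<Rightarrow>
     'v \<Rightarrow> 'w \<Rightarrow> ('v \<times> 'w \<Rightarrow> 'k) set" where
  "pure_tensor K V W v w = tensor_null K V W +>\<^bsub>tensor_free K V W\<^esub> free_basis K (v, w)"

text \<open>
  For a bilinear map \<open>f\<close> into \<open>U\<close>, the function \<open>tensor_lift K U f\<close> is the induced linear map on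
  the tensor product: it sends the sum of \<open>v\<^sub>i \<otimes> w\<^sub>i\<close> to the sum of \<open>f v\<^sub>i w\<^sub>i\<close>.  By bilinearity, the
  chosen representative \<open>p\<close> of the coset \<open>t\<close> does not matter.
\<close>

definition tensor_lift ::
  "('k, 'c) ring_scheme \<Rightarrow> ('k, 'u, 'd) module_scheme \<Rightarrow> ('v \<Rightarrow> 'w \<Rightarrow> 'u) \<Rightarrow>
     ('v \<times> 'w \<Rightarrow> 'k) set \<Rightarrow> 'u" where
  "tensor_lift K U f t =
     (let p = (SOME p. p \<in> t) in
       \<Oplus>\<^bsub>U\<^esub>x \<in> {x. p x \<noteq> \<zero>\<^bsub>K\<^esub>}. p x \<odot>\<^bsub>U\<^esub> f (fst x) (snd x))"

definition tensor_algebra ::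
  "('k, 'c) ring_scheme \<Rightarrow> ('k, 'a, 'd) module_scheme \<Rightarrow> ('k, 'b, 'e) module_scheme \<Rightarrow>
     ('k, ('a \<times> 'b \<Rightarrow> 'k) set) module" where
  "tensor_algebra K A B =
     (tensor K A B)
       \<lparr>monoid.mult := (\<lambda>s t.
          tensor_lift K (tensor K A B) (\<lambda>a b.
            tensor_lift K (tensor K A B) (\<lambda>a' b'.
              pure_tensor K A B (a \<otimes>\<^bsub>A\<^esub> a') (b \<otimes>\<^bsub>B\<^esub> b')) t) s),
        monoid.one := pure_tensor K A B \<one>\<^bsub>A\<^esub> \<one>\<^bsub>B\<^esub>\<rparr>"

section \<open>Hopf algebras, module algebras and smash products\<close>

record ('k, 'h) hopf = "('k, 'h) module" +
  comult :: "'h \<Rightarrow> ('h \<times> 'h \<Rightarrow> 'k) set"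
  counit :: "'h \<Rightarrow> 'k"
  antipode :: "'h \<Rightarrow> 'h"

text \<open>\<open>sweedler K H U f h\<close> is the sum of \<open>f h\<^sub>1 h\<^sub>2\<close> in Sweedler notation, with values in \<open>U\<close>.\<close>

definition sweedler ::
  "('k, 'c) ring_scheme \<Rightarrow> ('k, 'h, 'd) hopf_scheme \<Rightarrow> ('k, 'u, 'e) module_scheme \<Rightarrow>
     ('h \<Rightarrow> 'h \<Rightarrow> 'u) \<Rightarrow> 'h \<Rightarrow> 'u" where
  "sweedler K H U f h = tensor_lift K U f (comult H h)"

text \<open>
  Coassociativity compares the two iterated comultiplications in \<open>H \<otimes> (H \<otimes> H)\<close>; the
  canonical isomorphism from \<open>(H \<otimes> H) \<otimes> H\<close> is built into its left-hand side.
\<close>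

definition hopf_algebra :: "('k, 'c) ring_scheme \<Rightarrow> ('k, 'h, 'd) hopf_scheme \<Rightarrow> bool" where
  "hopf_algebra K H \<longleftrightarrow>
     k_algebra K H \<and>
     comult H \<in> LinearCombinations.module_hom K H (tensor K H H) \<and>
     comult H \<in> ring_hom H (tensor_algebra K H H) \<and>
     counit H \<in> ring_hom H K \<and>
     (\<forall>c \<in> carrier K. \<forall>h \<in> carrier H. counit H (c \<odot>\<^bsub>H\<^esub> h) = c \<otimes>\<^bsub>K\<^esub> counit H h) \<and>
     antipode H \<in> LinearCombinations.module_hom K H H \<and>
     (\<forall>h \<in> carrier H.
        sweedler K H (tensor K H (tensor K H H)) (\<lambda>h\<^sub>1 h\<^sub>2.
          sweedler K H (tensor K H (tensor K H H)) (\<lambda>h\<^sub>1\<^sub>1 h\<^sub>1\<^sub>2.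
            pure_tensor K H (tensor K H H) h\<^sub>1\<^sub>1 (pure_tensor K H H h\<^sub>1\<^sub>2 h\<^sub>2)) h\<^sub>1) h
        = sweedler K H (tensor K H (tensor K H H)) (\<lambda>h\<^sub>1 h\<^sub>2.
            pure_tensor K H (tensor K H H) h\<^sub>1 (comult H h\<^sub>2)) h) \<and>
     (\<forall>h \<in> carrier H.
        sweedler K H H (\<lambda>h\<^sub>1 h\<^sub>2. counit H h\<^sub>1 \<odot>\<^bsub>H\<^esub> h\<^sub>2) h = h \<and>
        sweedler K H H (\<lambda>h\<^sub>1 h\<^sub>2. counit H h\<^sub>2 \<odot>\<^bsub>H\<^esub> h\<^sub>1) h = h) \<and>
     (\<forall>h \<in> carrier H.
        sweedler K H H (\<lambda>h\<^sub>1 h\<^sub>2. antipode H h\<^sub>1 \<otimes>\<^bsub>H\<^esub> h\<^sub>2) h = counit H h \<odot>\<^bsub>H\<^esub> \<one>\<^bsub>H\<^esub> \<and>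
        sweedler K H H (\<lambda>h\<^sub>1 h\<^sub>2. h\<^sub>1 \<otimes>\<^bsub>H\<^esub> antipode H h\<^sub>2) h = counit H h \<odot>\<^bsub>H\<^esub> \<one>\<^bsub>H\<^esub>)"

definition left_integral :: "('k, 'h, 'd) hopf_scheme \<Rightarrow> 'h \<Rightarrow> bool" where
  "left_integral H \<Lambda> \<longleftrightarrow> \<Lambda> \<in> carrier H \<and>
     (\<forall>h \<in> carrier H. h \<otimes>\<^bsub>H\<^esub> \<Lambda> = counit H h \<odot>\<^bsub>H\<^esub> \<Lambda>)"

text \<open>
  The third conjunct says that the vector space structure which \<open>R\<close> carries as an \<open>H\<close>-module
  is the one it has as an algebra.
\<close>

definition module_algebra ::
  "('k, 'c) ring_scheme \<Rightarrow> ('k, 'h, 'd) hopf_scheme \<Rightarrow> ('k, 'r, 'e) module_scheme \<Rightarrow>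
     ('h \<Rightarrow> 'r \<Rightarrow> 'r) \<Rightarrow> bool" where
  "module_algebra K H R act \<longleftrightarrow>
     k_algebra K R \<and>
     left_module H (with_action R act) \<and>
     (\<forall>c \<in> carrier K. \<forall>h \<in> carrier H. \<forall>r \<in> carrier R. act (c \<odot>\<^bsub>H\<^esub> h) r = c \<odot>\<^bsub>R\<^esub> act h r) \<and>
     (\<forall>h \<in> carrier H. \<forall>r \<in> carrier R. \<forall>r' \<in> carrier R.
        act h (r \<otimes>\<^bsub>R\<^esub> r') = sweedler K H R (\<lambda>h\<^sub>1 h\<^sub>2. act h\<^sub>1 r \<otimes>\<^bsub>R\<^esub> act h\<^sub>2 r') h) \<and>
     (\<forall>h \<in> carrier H. act h \<one>\<^bsub>R\<^esub> = counit H h \<odot>\<^bsub>R\<^esub> \<one>\<^bsub>R\<^esub>)"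

definition invariants ::
  "('k, 'h, 'd) hopf_scheme \<Rightarrow> ('k, 'r, 'e) module_scheme \<Rightarrow> ('h \<Rightarrow> 'r \<Rightarrow> 'r) \<Rightarrow> 'r set" where
  "invariants H R act = {r \<in> carrier R. \<forall>h \<in> carrier H. act h r = counit H h \<odot>\<^bsub>R\<^esub> r}"

definition smash_product ::
  "('k, 'c) ring_scheme \<Rightarrow> ('k, 'h, 'd) hopf_scheme \<Rightarrow> ('k, 'r, 'e) module_scheme \<Rightarrow>
     ('h \<Rightarrow> 'r \<Rightarrow> 'r) \<Rightarrow> ('k, ('r \<times> 'h \<Rightarrow> 'k) set) module" where
  "smash_product K H R act =
     (tensor K R H)
       \<lparr>monoid.mult := (\<lambda>s t.
          tensor_lift K (tensor K R H) (\<lambda>r h.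
            tensor_lift K (tensor K R H) (\<lambda>r' h'.
              sweedler K H (tensor K R H) (\<lambda>h\<^sub>1 h\<^sub>2.
                pure_tensor K R H (r \<otimes>\<^bsub>R\<^esub> act h\<^sub>1 r') (h\<^sub>2 \<otimes>\<^bsub>H\<^esub> h')) h) t) s),
        monoid.one := pure_tensor K R H \<one>\<^bsub>R\<^esub> \<one>\<^bsub>H\<^esub>\<rparr>"

section \<open>The Grothendieck group of finitely generated modules\<close>

text \<open>
  Every finitely generated left \<open>R\<close>-module is isomorphic to a quotient of \<open>R\<^sup>n\<close> for some \<open>n\<close>,
  hence to a module whose elements are sets of functions \<open>nat \<Rightarrow> 'a\<close>, where \<open>'a\<close> is the type of
  the elements of \<open>R\<close>.  The modules with elements in this type thus represent all finitely
  generated modules, and all short exact sequences of such, up to isomorphism.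
\<close>

definition fg_modules :: "('a, 'c) ring_scheme \<Rightarrow> ('a, (nat \<Rightarrow> 'a) set) module set" where
  "fg_modules R = {M. fg_module R M}"

definition proj_dim_gcd :: "('k, 'c) ring_scheme \<Rightarrow> ('k, 'h, 'd) module_scheme \<Rightarrow> nat" where
  "proj_dim_gcd K H =
     Gcd {vectorspace.dim K (scalar_restriction H P) | P.
            P \<in> fg_modules H \<and> projective_module H P}"

definition G0_relations ::
  "('a, 'c) ring_scheme \<Rightarrow> (('a, (nat \<Rightarrow> 'a) set) module \<Rightarrow>\<^sub>0 int) set" where
  "G0_relations R =
     generate (free_Abelian_group (fg_modules R))
       {frag_of M - (frag_of M' + frag_of M'') | M' M M''.
          M' \<in> fg_modules R \<and> M \<in> fg_modules R \<and> M'' \<in> fg_modules R \<and> short_exact R M' M M''}"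

definition G0 ::
  "('a, 'c) ring_scheme \<Rightarrow> (('a, (nat \<Rightarrow> 'a) set) module \<Rightarrow>\<^sub>0 int) set monoid" where
  "G0 R = free_Abelian_group (fg_modules R) Mod G0_relations R"

text \<open>
  The order \<open>group.ord\<close> of an element of infinite order is 0, and every natural number divides 0,
  which agrees with the convention that every integer divides infinity.
\<close>

text \<open>
  The class of a finitely generated module with elements of an arbitrary type is the class of an
  isomorphic member of \<open>fg_modules R\<close>; isomorphic modules have equal classes in \<open>G0 R\<close>.
\<close>

definition G0_class ::
  "('a, 'c) ring_scheme \<Rightarrow> ('a, 'm, 'd) module_scheme \<Rightarrow>
     (('a, (nat \<Rightarrow> 'a) set) module \<Rightarrow>\<^sub>0 int) set" where
  "G0_class R M =
     G0_relations R #>\<^bsub>free_Abelian_group (fg_modules R)\<^esub>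
       frag_of (SOME N. N \<in> fg_modules R \<and> module_iso R M N)"

end

theory Submission imports Defs begin

text \<open>
  Let \<open>\<delta>\<close> be the greatest common divisor of the dimensions of the finitely generated projective
  \<open>H\<close>-modules.  The proof attaches to every finitely generated \<open>T\<close>-module \<open>V\<close> an integer \<open>n(V)\<close>
  which is additive modulo \<open>\<delta>\<close> on short exact sequences and satisfies \<open>n(V) \<equiv> - dim V\<close> modulo \<open>\<delta>\<close>
  whenever \<open>V\<close> is finite-dimensional.  Then \<open>n\<close> is a homomorphism from \<open>G\<^sub>0(T)\<close> to the integers
  modulo \<open>\<delta>\<close>, so \<open>k [M] = 0\<close> forces \<open>\<delta>\<close> to divide \<open>k dim M\<close>, that is, \<open>\<delta> / (\<delta>, dim M)\<close> to divide
  \<open>k\<close>.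

  The number \<open>n(V)\<close> is obtained by restriction to \<open>H\<close>.  Although \<open>V\<close> is in general
  infinite-dimensional, it turns out to be the image of a projective \<open>H\<close>-module \<open>X\<close> under a map
  with finite-dimensional kernel (\<open>finite_kernel_cover\<close>), and \<open>n(V)\<close> is the dimension of that
  kernel.  A form of Schanuel's lemma shows that this dimension is unique modulo \<open>\<delta>\<close>
  (\<open>ker_dim_unique\<close>): any two such covers map to each other over \<open>V\<close>, and on the kernels the
  composites differ from the identities by maps which factor through free modules of finite rank,
  because a finite-dimensional submodule of a projective module meets only finitely many
  coordinates.  Additivity is the horseshoe lemma (\<open>ker_dim_extension\<close>).  A finite-dimensional \<open>V\<close>
  is covered by a free module of finite rank, whence \<open>n(V) \<equiv> - dim V\<close> (\<open>ker_dim_finite\<close>).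

  The existence of the covers is the main point.  Let \<open>J\<close> be the radical of \<open>H\<close>, let \<open>X\<^sub>0 \<rightarrow> V\<close> be
  a surjection from a free module, and let \<open>L\<close> be its kernel.  As in the construction of
  projective covers, a direct summand of \<open>X\<^sub>0\<close> that is contained in \<open>L\<close> can be split off so that
  the rest of \<open>L\<close> lies in \<open>J X\<^sub>0\<close>.  Since \<open>J\<close> is nilpotent, Nakayama's lemma then reduces the
  claim to the finiteness of \<open>(L \<inter> J X\<^sub>0) / J L\<close>, the group \<open>Tor\<^sub>1(H / J, V)\<close>
  (\<open>fin_kernel_cover_exists\<close>).  The invariants \<open>S = R\<^sup>H\<close> act on \<open>V\<close> by \<open>H\<close>-linear maps, hence on
  this group.  As \<open>V\<close> is a sum of finitely many images of \<open>R\<close>, it is noetherian over \<open>S\<close>, and so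
  the group is finitely generated over \<open>S\<close>.  It is annihilated by the ideal \<open>\<Lambda>R\<close>, because
  multiplication by an element of \<open>\<Lambda>R\<close> on \<open>V\<close> lifts to an \<open>H\<close>-linear map \<open>V \<rightarrow> X\<^sub>0\<close>.  So it is a
  finitely generated module over the finite-dimensional algebra \<open>S / \<Lambda>R\<close>, and it is
  finite-dimensional (\<open>tor_finite\<close>).

  The lift comes from the integral.  For a linear map \<open>f\<close> between \<open>H\<close>-modules, the map
  \<open>x \<mapsto> \<Sum> \<Lambda>\<^sub>1 f(S(\<Lambda>\<^sub>2) x)\<close> is \<open>H\<close>-linear (\<open>trace_hom\<close>), and multiplication by \<open>\<Lambda>r\<close> on a \<open>T\<close>-module
  is the map obtained in this way from multiplication by \<open>r\<close> (\<open>trace_mul\<close>).  It is therefore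
  enough to compose the latter with a linear section of \<open>X\<^sub>0 \<rightarrow> V\<close> before taking the trace.
\<close>

section \<open>Left modules and their homomorphisms\<close>

text \<open>
  Module homomorphisms make sense over any ring, although the theory that defines them is about
  commutative rings.
\<close>

abbreviation "Hom \<equiv> LinearCombinations.module_hom"

lemma left_moduleI:
  assumes "ring R" "abelian_group M"
    "\<And>a x. \<lbrakk>a \<in> carrier R; x \<in> carrier M\<rbrakk> \<Longrightarrow> a \<odot>\<^bsub>M\<^esub> x \<in> carrier M"
    "\<And>a b x. \<lbrakk>a \<in> carrier R; b \<in> carrier R; x \<in> carrier M\<rbrakk> \<Longrightarrow>
        (a \<oplus>\<^bsub>R\<^esub> b) \<odot>\<^bsub>M\<^esub> x = a \<odot>\<^bsub>M\<^esub> x \<oplus>\<^bsub>M\<^esub> b \<odot>\<^bsub>M\<^esub> x"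
    "\<And>a x y. \<lbrakk>a \<in> carrier R; x \<in> carrier M; y \<in> carrier M\<rbrakk> \<Longrightarrow>
        a \<odot>\<^bsub>M\<^esub> (x \<oplus>\<^bsub>M\<^esub> y) = a \<odot>\<^bsub>M\<^esub> x \<oplus>\<^bsub>M\<^esub> a \<odot>\<^bsub>M\<^esub> y"
    "\<And>a b x. \<lbrakk>a \<in> carrier R; b \<in> carrier R; x \<in> carrier M\<rbrakk> \<Longrightarrow>
        (a \<otimes>\<^bsub>R\<^esub> b) \<odot>\<^bsub>M\<^esub> x = a \<odot>\<^bsub>M\<^esub> (b \<odot>\<^bsub>M\<^esub> x)"
    "\<And>x. x \<in> carrier M \<Longrightarrow> \<one>\<^bsub>R\<^esub> \<odot>\<^bsub>M\<^esub> x = x"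
  shows "left_module R M"
  using assms by (intro left_module.intro left_module_axioms.intro) auto

lemma submodule_iff:
  "Module.submodule N R M \<longleftrightarrow> subgroup N (add_monoid M) \<and> (\<forall>a\<in>carrier R. \<forall>x\<in>N. a \<odot>\<^bsub>M\<^esub> x \<in> N)"
  unfolding Module.submodule_def Module.submodule_axioms_def by auto

context left_module
begin

declare lsmult_closed [simp, intro] lsmult_one [simp]

lemma lsmult_l_null [simp]:
  assumes "x \<in> carrier M" shows "\<zero>\<^bsub>R\<^esub> \<odot>\<^bsub>M\<^esub> x = \<zero>\<^bsub>M\<^esub>"
proof -
  have "\<zero>\<^bsub>R\<^esub> \<odot>\<^bsub>M\<^esub> x \<oplus>\<^bsub>M\<^esub> \<zero>\<^bsub>R\<^esub> \<odot>\<^bsub>M\<^esub> x = \<zero>\<^bsub>R\<^esub> \<odot>\<^bsub>M\<^esub> x"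
    using lsmult_l_distr[of "\<zero>\<^bsub>R\<^esub>" "\<zero>\<^bsub>R\<^esub>" x] assms by simp
  then show ?thesis using assms by (metis M.add.r_cancel_one' lsmult_closed R.zero_closed)
qed

lemma lsmult_r_null [simp]:
  assumes "a \<in> carrier R" shows "a \<odot>\<^bsub>M\<^esub> \<zero>\<^bsub>M\<^esub> = \<zero>\<^bsub>M\<^esub>"
proof -
  have "a \<odot>\<^bsub>M\<^esub> \<zero>\<^bsub>M\<^esub> \<oplus>\<^bsub>M\<^esub> a \<odot>\<^bsub>M\<^esub> \<zero>\<^bsub>M\<^esub> = a \<odot>\<^bsub>M\<^esub> \<zero>\<^bsub>M\<^esub>"
    using lsmult_r_distr[of a "\<zero>\<^bsub>M\<^esub>" "\<zero>\<^bsub>M\<^esub>"] assms by simp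
  then show ?thesis using assms by (metis M.add.r_cancel_one' lsmult_closed M.zero_closed)
qed

lemma lsmult_l_minus:
  assumes "a \<in> carrier R" "x \<in> carrier M" shows "(\<ominus>\<^bsub>R\<^esub> a) \<odot>\<^bsub>M\<^esub> x = \<ominus>\<^bsub>M\<^esub> (a \<odot>\<^bsub>M\<^esub> x)"
proof -
  have "(\<ominus>\<^bsub>R\<^esub> a) \<odot>\<^bsub>M\<^esub> x \<oplus>\<^bsub>M\<^esub> a \<odot>\<^bsub>M\<^esub> x = \<zero>\<^bsub>M\<^esub>"
    using lsmult_l_distr[of "\<ominus>\<^bsub>R\<^esub> a" a x] assms by (simp add: R.l_neg)
  then show ?thesis using assms by (metis M.minus_equality lsmult_closed R.a_inv_closed)
qed

lemma lsmult_r_minus: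
  assumes "a \<in> carrier R" "x \<in> carrier M" shows "a \<odot>\<^bsub>M\<^esub> (\<ominus>\<^bsub>M\<^esub> x) = \<ominus>\<^bsub>M\<^esub> (a \<odot>\<^bsub>M\<^esub> x)"
proof -
  have "a \<odot>\<^bsub>M\<^esub> (\<ominus>\<^bsub>M\<^esub> x) \<oplus>\<^bsub>M\<^esub> a \<odot>\<^bsub>M\<^esub> x = \<zero>\<^bsub>M\<^esub>"
    using lsmult_r_distr[of a "\<ominus>\<^bsub>M\<^esub> x" x] assms by (simp add: M.l_neg)
  then show ?thesis using assms by (metis M.minus_equality lsmult_closed M.a_inv_closed)
qed

lemma lsmult_minus_distr:
  assumes "a \<in> carrier R" "x \<in> carrier M" "y \<in> carrier M"
  shows "a \<odot>\<^bsub>M\<^esub> (x \<ominus>\<^bsub>M\<^esub> y) = a \<odot>\<^bsub>M\<^esub> x \<ominus>\<^bsub>M\<^esub> a \<odot>\<^bsub>M\<^esub> y"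
  using assms by (simp add: a_minus_def lsmult_r_distr lsmult_r_minus)

lemma finsum_lsmult:
  "\<lbrakk>a \<in> carrier R; f \<in> A \<rightarrow> carrier M\<rbrakk> \<Longrightarrow>
     a \<odot>\<^bsub>M\<^esub> (\<Oplus>\<^bsub>M\<^esub>i\<in>A. f i) = (\<Oplus>\<^bsub>M\<^esub>i\<in>A. a \<odot>\<^bsub>M\<^esub> f i)"
proof (induct A rule: infinite_finite_induct)
  case (insert x F) then show ?case by (simp add: Pi_def lsmult_r_distr)
qed auto

lemma neg_submodule:
  assumes "\<And>a x. \<lbrakk>a \<in> carrier R; x \<in> N\<rbrakk> \<Longrightarrow> a \<odot>\<^bsub>M\<^esub> x \<in> N" "N \<subseteq> carrier M" "x \<in> N"
  shows "\<ominus>\<^bsub>M\<^esub> x \<in> N"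
  using assms lsmult_l_minus[of "\<one>\<^bsub>R\<^esub>" x]
  by (metis R.a_inv_closed R.one_closed lsmult_one subsetD)

lemma submoduleI:
  assumes sub: "N \<subseteq> carrier M" and "\<zero>\<^bsub>M\<^esub> \<in> N"
    and "\<And>x y. \<lbrakk>x \<in> N; y \<in> N\<rbrakk> \<Longrightarrow> x \<oplus>\<^bsub>M\<^esub> y \<in> N"
    and sm: "\<And>a x. \<lbrakk>a \<in> carrier R; x \<in> N\<rbrakk> \<Longrightarrow> a \<odot>\<^bsub>M\<^esub> x \<in> N"
  shows "Module.submodule N R M"
  unfolding submodule_iff
proof (intro conjI ballI subgroup.intro)
  fix x assume "x \<in> N"
  then show "inv\<^bsub>add_monoid M\<^esub> x \<in> N" using neg_submodule[OF sm sub] by (simp add: a_inv_def)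
qed (use assms in auto)

lemma submoduleD:
  assumes "Module.submodule N R M"
  shows "N \<subseteq> carrier M" "\<zero>\<^bsub>M\<^esub> \<in> N" "\<And>x y. \<lbrakk>x \<in> N; y \<in> N\<rbrakk> \<Longrightarrow> x \<oplus>\<^bsub>M\<^esub> y \<in> N"
    "\<And>a x. \<lbrakk>a \<in> carrier R; x \<in> N\<rbrakk> \<Longrightarrow> a \<odot>\<^bsub>M\<^esub> x \<in> N" "\<And>x. x \<in> N \<Longrightarrow> \<ominus>\<^bsub>M\<^esub> x \<in> N"
    "\<And>x y. \<lbrakk>x \<in> N; y \<in> N\<rbrakk> \<Longrightarrow> x \<ominus>\<^bsub>M\<^esub> y \<in> N" "\<And>x. x \<in> N \<Longrightarrow> x \<in> carrier M"
proof -
  show *: "N \<subseteq> carrier M" "\<zero>\<^bsub>M\<^esub> \<in> N" "\<And>x y. \<lbrakk>x \<in> N; y \<in> N\<rbrakk> \<Longrightarrow> x \<oplus>\<^bsub>M\<^esub> y \<in> N"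
    "\<And>a x. \<lbrakk>a \<in> carrier R; x \<in> N\<rbrakk> \<Longrightarrow> a \<odot>\<^bsub>M\<^esub> x \<in> N"
    using assms subgroup.subset[of N "add_monoid M"] subgroup.one_closed[of N "add_monoid M"]
      subgroup.m_closed[of N "add_monoid M"] unfolding submodule_iff by auto
  show **: "\<And>x. x \<in> N \<Longrightarrow> \<ominus>\<^bsub>M\<^esub> x \<in> N" using neg_submodule * by blast
  then show "\<And>x y. \<lbrakk>x \<in> N; y \<in> N\<rbrakk> \<Longrightarrow> x \<ominus>\<^bsub>M\<^esub> y \<in> N" unfolding a_minus_def using * by blast
  show "\<And>x. x \<in> N \<Longrightarrow> x \<in> carrier M" using * by blast
qed

lemma submodule_finsum:
  assumes "Module.submodule N R M" "f \<in> A \<rightarrow> N"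
  shows "(\<Oplus>\<^bsub>M\<^esub>i\<in>A. f i) \<in> N"
  using assms(2)
proof (induct A rule: infinite_finite_induct)
  case (insert x F)
  then show ?case using submoduleD[OF assms(1)] by (subst M.finsum_insert) auto
qed (use submoduleD[OF assms(1)] in auto)

lemma submodule_left_module:
  assumes N: "Module.submodule N R M"
  shows "left_module R (M\<lparr>carrier := N\<rparr>)"
proof (rule left_moduleI)
  note D = submoduleD[OF N]
  show "abelian_group (M\<lparr>carrier := N\<rparr>)"
  proof (rule abelian_groupI)
    fix x assume "x \<in> carrier (M\<lparr>carrier := N\<rparr>)"
    then show "\<exists>y\<in>carrier (M\<lparr>carrier := N\<rparr>). y \<oplus>\<^bsub>M\<lparr>carrier := N\<rparr>\<^esub> x = \<zero>\<^bsub>M\<lparr>carrier := N\<rparr>\<^esub>"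
      using D by (auto intro!: bexI[of _ "\<ominus>\<^bsub>M\<^esub> x"] M.l_neg)
  qed (use D(2,3) in \<open>auto simp: M.a_ac D(7)\<close>)
qed (use submoduleD(4)[OF N] in \<open>auto simp: lsmult_l_distr lsmult_r_distr lsmult_assoc R.ring_axioms submoduleD(7)[OF N]\<close>)

lemma carrier_submodule: "Module.submodule (carrier M) R M"
  by (rule submoduleI) auto

lemma zero_submodule: "Module.submodule {\<zero>\<^bsub>M\<^esub>} R M"
  by (rule submoduleI) auto

lemma submodule_Int:
  assumes "Module.submodule N R M" "Module.submodule N' R M"
  shows "Module.submodule (N \<inter> N') R M"
  using submoduleD[OF assms(1)] submoduleD[OF assms(2)] by (intro submoduleI) auto

lemma submodule_Inter:
  assumes "\<And>N. N \<in> \<N> \<Longrightarrow> Module.submodule N R M" "\<N> \<noteq> {}"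
  shows "Module.submodule (\<Inter>\<N>) R M"
proof (rule submoduleI)
  show "\<Inter>\<N> \<subseteq> carrier M" using assms(2) submoduleD(1)[OF assms(1)] by blast
qed (use submoduleD(2-4)[OF assms(1)] in auto)

lemma submodule_Union_chain:
  assumes "\<And>N. N \<in> \<N> \<Longrightarrow> Module.submodule N R M" "\<N> \<noteq> {}"
    "\<And>N N'. \<lbrakk>N \<in> \<N>; N' \<in> \<N>\<rbrakk> \<Longrightarrow> N \<subseteq> N' \<or> N' \<subseteq> N"
  shows "Module.submodule (\<Union>\<N>) R M"
proof (rule submoduleI)
  fix x y assume "x \<in> \<Union>\<N>" "y \<in> \<Union>\<N>"
  then obtain N N' where N: "N \<in> \<N>" "N' \<in> \<N>" "x \<in> N" "y \<in> N'" by blast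
  then have "(x \<in> N' \<and> y \<in> N') \<or> (x \<in> N \<and> y \<in> N)" using assms(3)[OF N(1,2)] by blast
  then show "x \<oplus>\<^bsub>M\<^esub> y \<in> \<Union>\<N>" using submoduleD(3)[OF assms(1)] N by blast
next
  show "\<zero>\<^bsub>M\<^esub> \<in> \<Union>\<N>" using assms(2) submoduleD(2)[OF assms(1)] by blast
next
  show "\<Union>\<N> \<subseteq> carrier M" using submoduleD(1)[OF assms(1)] by blast
next
  fix a x assume "a \<in> carrier R" "x \<in> \<Union>\<N>"
  then show "a \<odot>\<^bsub>M\<^esub> x \<in> \<Union>\<N>" using submoduleD(4)[OF assms(1)] by blast
qed

end

definition submodule_plus :: "('a, 'b, 'd) module_scheme \<Rightarrow> 'b set \<Rightarrow> 'b set \<Rightarrow> 'b set" where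
  "submodule_plus M N N' = {x \<oplus>\<^bsub>M\<^esub> y | x y. x \<in> N \<and> y \<in> N'}"

definition submodule_hull :: "('a, 'c) ring_scheme \<Rightarrow> ('a, 'b, 'd) module_scheme \<Rightarrow> 'b set \<Rightarrow> 'b set" where
  "submodule_hull R M A = \<Inter>{N. Module.submodule N R M \<and> A \<subseteq> N}"

context left_module
begin

lemma submodule_plus:
  assumes N: "Module.submodule N R M" and N': "Module.submodule N' R M"
  shows "Module.submodule (submodule_plus M N N') R M"
proof (rule submoduleI)
  note D = submoduleD[OF N] submoduleD[OF N']
  show "submodule_plus M N N' \<subseteq> carrier M" unfolding submodule_plus_def using D(1,8) by auto
  show "\<zero>\<^bsub>M\<^esub> \<in> submodule_plus M N N'" unfolding submodule_plus_def
    using D(2,9) by (intro CollectI exI[of _ "\<zero>\<^bsub>M\<^esub>"]) auto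
  show "u \<oplus>\<^bsub>M\<^esub> v \<in> submodule_plus M N N'"
    if uv: "u \<in> submodule_plus M N N'" "v \<in> submodule_plus M N N'" for u v
  proof -
    obtain x y x' y' where *: "x \<in> N" "y \<in> N'" "x' \<in> N" "y' \<in> N'" "u = x \<oplus>\<^bsub>M\<^esub> y" "v = x' \<oplus>\<^bsub>M\<^esub> y'"
      using uv unfolding submodule_plus_def by blast
    then have "u \<oplus>\<^bsub>M\<^esub> v = (x \<oplus>\<^bsub>M\<^esub> x') \<oplus>\<^bsub>M\<^esub> (y \<oplus>\<^bsub>M\<^esub> y')" using D(7,14) by (simp add: M.a_ac)
    then show ?thesis unfolding submodule_plus_def using * D(3,10) by blast
  qed
  show "a \<odot>\<^bsub>M\<^esub> u \<in> submodule_plus M N N'" if a: "a \<in> carrier R" "u \<in> submodule_plus M N N'" for a u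
  proof -
    obtain x y where *: "x \<in> N" "y \<in> N'" "u = x \<oplus>\<^bsub>M\<^esub> y"
      using a unfolding submodule_plus_def by auto
    then have "a \<odot>\<^bsub>M\<^esub> u = a \<odot>\<^bsub>M\<^esub> x \<oplus>\<^bsub>M\<^esub> a \<odot>\<^bsub>M\<^esub> y" using D(7,14) a by (simp add: lsmult_r_distr)
    then show ?thesis unfolding submodule_plus_def using * D(4,11) a by blast
  qed
qed

lemma submodule_plus_upper:
  assumes N: "Module.submodule N R M" and N': "Module.submodule N' R M"
  shows "N \<subseteq> submodule_plus M N N'" "N' \<subseteq> submodule_plus M N N'"
proof -
  show "N \<subseteq> submodule_plus M N N'"
  proof
    fix x assume "x \<in> N"
    then have "x = x \<oplus>\<^bsub>M\<^esub> \<zero>\<^bsub>M\<^esub>" using submoduleD(7)[OF N] by simp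
    then show "x \<in> submodule_plus M N N'"
      unfolding submodule_plus_def using \<open>x \<in> N\<close> submoduleD(2)[OF N'] by blast
  qed
  show "N' \<subseteq> submodule_plus M N N'"
  proof
    fix x assume "x \<in> N'"
    then have "x = \<zero>\<^bsub>M\<^esub> \<oplus>\<^bsub>M\<^esub> x" using submoduleD(7)[OF N'] by simp
    then show "x \<in> submodule_plus M N N'"
      unfolding submodule_plus_def using \<open>x \<in> N'\<close> submoduleD(2)[OF N] by blast
  qed
qed

lemma submodule_plus_least:
  assumes "Module.submodule L R M" "N \<subseteq> L" "N' \<subseteq> L"
  shows "submodule_plus M N N' \<subseteq> L"
  unfolding submodule_plus_def using submoduleD(3)[OF assms(1)] assms(2,3) by blast

lemma hull_submodule:
  assumes "A \<subseteq> carrier M" shows "Module.submodule (submodule_hull R M A) R M"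
  unfolding submodule_hull_def by (rule submodule_Inter) (use assms carrier_submodule in auto)

lemma hull_superset: "A \<subseteq> submodule_hull R M A"
  unfolding submodule_hull_def by auto

lemma hull_least: "\<lbrakk>Module.submodule N R M; A \<subseteq> N\<rbrakk> \<Longrightarrow> submodule_hull R M A \<subseteq> N"
  unfolding submodule_hull_def by auto

end

locale left_module_hom = M: left_module R M + N: left_module R N
  for R :: "('a, 'c) ring_scheme" and M :: "('a, 'b, 'd) module_scheme"
    and N :: "('a, 'e, 'f) module_scheme" +
  fixes f
  assumes hom: "f \<in> Hom R M N"
begin

lemma closed [simp, intro]: "x \<in> carrier M \<Longrightarrow> f x \<in> carrier N"
  using hom by (auto simp: LinearCombinations.module_hom_def)

lemma add [simp]: "\<lbrakk>x \<in> carrier M; y \<in> carrier M\<rbrakk> \<Longrightarrow> f (x \<oplus>\<^bsub>M\<^esub> y) = f x \<oplus>\<^bsub>N\<^esub> f y"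
  using hom by (auto simp: LinearCombinations.module_hom_def)

lemma smult [simp]: "\<lbrakk>a \<in> carrier R; x \<in> carrier M\<rbrakk> \<Longrightarrow> f (a \<odot>\<^bsub>M\<^esub> x) = a \<odot>\<^bsub>N\<^esub> f x"
  using hom by (auto simp: LinearCombinations.module_hom_def)

lemma zero [simp]: "f \<zero>\<^bsub>M\<^esub> = \<zero>\<^bsub>N\<^esub>"
  using smult[of "\<zero>\<^bsub>R\<^esub>" "\<zero>\<^bsub>M\<^esub>"] by (simp del: smult)

lemma neg [simp]: "x \<in> carrier M \<Longrightarrow> f (\<ominus>\<^bsub>M\<^esub> x) = \<ominus>\<^bsub>N\<^esub> f x"
  using smult[of "\<ominus>\<^bsub>R\<^esub> \<one>\<^bsub>R\<^esub>" x] by (simp add: M.lsmult_l_minus N.lsmult_l_minus del: smult)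

lemma minus [simp]: "\<lbrakk>x \<in> carrier M; y \<in> carrier M\<rbrakk> \<Longrightarrow> f (x \<ominus>\<^bsub>M\<^esub> y) = f x \<ominus>\<^bsub>N\<^esub> f y"
  by (simp add: a_minus_def)

lemma finsum [simp]: "g \<in> A \<rightarrow> carrier M \<Longrightarrow> f (\<Oplus>\<^bsub>M\<^esub>i\<in>A. g i) = (\<Oplus>\<^bsub>N\<^esub>i\<in>A. f (g i))"
proof (induct A rule: infinite_finite_induct)
  case (insert x F) then show ?case by (simp add: Pi_def)
qed auto

lemma vimage_submodule:
  assumes "Module.submodule L R N" shows "Module.submodule {x \<in> carrier M. f x \<in> L} R M"
  using N.submoduleD[OF assms] by (intro M.submoduleI) auto

lemma ker_submodule: "Module.submodule {x \<in> carrier M. f x = \<zero>\<^bsub>N\<^esub>} R M"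
  by (intro M.submoduleI) auto

lemma image_submodule:
  assumes "Module.submodule L R M" shows "Module.submodule (f ` L) R N"
proof (rule N.submoduleI)
  note D = M.submoduleD[OF assms]
  show "f ` L \<subseteq> carrier N" using D by auto
  show "\<zero>\<^bsub>N\<^esub> \<in> f ` L" using D(2) zero by (metis imageI)
  show "x \<oplus>\<^bsub>N\<^esub> y \<in> f ` L" if xy: "x \<in> f ` L" "y \<in> f ` L" for x y
  proof -
    obtain u v where "u \<in> L" "v \<in> L" "x = f u" "y = f v" using xy by blast
    then show ?thesis using D(3,7) by (intro image_eqI[of _ _ "u \<oplus>\<^bsub>M\<^esub> v"]) auto
  qed
  show "a \<odot>\<^bsub>N\<^esub> x \<in> f ` L" if ax: "a \<in> carrier R" "x \<in> f ` L" for a x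
  proof -
    obtain u where "u \<in> L" "x = f u" using ax by blast
    then show ?thesis using D(4,7) ax by (intro image_eqI[of _ _ "a \<odot>\<^bsub>M\<^esub> u"]) auto
  qed
qed

lemma inj_on_iff: "inj_on f (carrier M) \<longleftrightarrow> (\<forall>x\<in>carrier M. f x = \<zero>\<^bsub>N\<^esub> \<longrightarrow> x = \<zero>\<^bsub>M\<^esub>)"
proof
  assume "inj_on f (carrier M)"
  then show "\<forall>x\<in>carrier M. f x = \<zero>\<^bsub>N\<^esub> \<longrightarrow> x = \<zero>\<^bsub>M\<^esub>" by (metis M.zero_closed inj_onD zero)
next
  assume *: "\<forall>x\<in>carrier M. f x = \<zero>\<^bsub>N\<^esub> \<longrightarrow> x = \<zero>\<^bsub>M\<^esub>"
  show "inj_on f (carrier M)"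
  proof
    fix x y assume xy: "x \<in> carrier M" "y \<in> carrier M" "f x = f y"
    then have "f (x \<ominus>\<^bsub>M\<^esub> y) = \<zero>\<^bsub>N\<^esub>" by simp
    then have "x \<ominus>\<^bsub>M\<^esub> y = \<zero>\<^bsub>M\<^esub>" using * xy by simp
    then show "x = y" using xy by simp
  qed
qed

end

lemma HomI:
  assumes "\<And>x. x \<in> carrier M \<Longrightarrow> f x \<in> carrier N"
    "\<And>x y. \<lbrakk>x \<in> carrier M; y \<in> carrier M\<rbrakk> \<Longrightarrow> f (x \<oplus>\<^bsub>M\<^esub> y) = f x \<oplus>\<^bsub>N\<^esub> f y"
    "\<And>a x. \<lbrakk>a \<in> carrier R; x \<in> carrier M\<rbrakk> \<Longrightarrow> f (a \<odot>\<^bsub>M\<^esub> x) = a \<odot>\<^bsub>N\<^esub> f x"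
  shows "f \<in> Hom R M N"
  using assms by (auto simp: LinearCombinations.module_hom_def)

lemma HomD:
  assumes "f \<in> Hom R M N"
  shows "\<And>x. x \<in> carrier M \<Longrightarrow> f x \<in> carrier N"
    "\<And>x y. \<lbrakk>x \<in> carrier M; y \<in> carrier M\<rbrakk> \<Longrightarrow> f (x \<oplus>\<^bsub>M\<^esub> y) = f x \<oplus>\<^bsub>N\<^esub> f y"
    "\<And>a x. \<lbrakk>a \<in> carrier R; x \<in> carrier M\<rbrakk> \<Longrightarrow> f (a \<odot>\<^bsub>M\<^esub> x) = a \<odot>\<^bsub>N\<^esub> f x"
  using assms by (auto simp: LinearCombinations.module_hom_def)

lemma left_module_homI:
  "\<lbrakk>left_module R M; left_module R N; f \<in> Hom R M N\<rbrakk> \<Longrightarrow> left_module_hom R M N f"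
  by (simp add: left_module_hom_def left_module_hom_axioms_def)

lemma Hom_comp: "\<lbrakk>f \<in> Hom R M N; g \<in> Hom R N L\<rbrakk> \<Longrightarrow> (\<lambda>x. g (f x)) \<in> Hom R M L"
  by (auto simp: LinearCombinations.module_hom_def Pi_def)

lemma Hom_id: "(\<lambda>x. x) \<in> Hom R M M"
  by (auto simp: LinearCombinations.module_hom_def)

lemma Hom_restrict: "\<lbrakk>f \<in> Hom R M N; L \<subseteq> carrier M\<rbrakk> \<Longrightarrow> f \<in> Hom R (M\<lparr>carrier := L\<rparr>) N"
  by (auto simp: LinearCombinations.module_hom_def subset_iff)

lemma Hom_cod_restrict:
  "\<lbrakk>f \<in> Hom R M N; \<And>x. x \<in> carrier M \<Longrightarrow> f x \<in> L\<rbrakk> \<Longrightarrow> f \<in> Hom R M (N\<lparr>carrier := L\<rparr>)"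
  by (auto simp: LinearCombinations.module_hom_def)

lemma Hom_cod_extend: "\<lbrakk>f \<in> Hom R M (N\<lparr>carrier := L\<rparr>); L \<subseteq> carrier N\<rbrakk> \<Longrightarrow> f \<in> Hom R M N"
  by (auto simp: LinearCombinations.module_hom_def)

lemma Hom_add:
  assumes "left_module R N" "f \<in> Hom R M N" "g \<in> Hom R M N"
  shows "(\<lambda>x. f x \<oplus>\<^bsub>N\<^esub> g x) \<in> Hom R M N"
proof -
  interpret N: left_module R N by fact
  show ?thesis using assms(2,3) by (intro HomI) (auto simp: HomD N.M.a_ac N.lsmult_r_distr)
qed

lemma Hom_neg:
  assumes "left_module R N" "f \<in> Hom R M N"
  shows "(\<lambda>x. \<ominus>\<^bsub>N\<^esub> f x) \<in> Hom R M N"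
proof -
  interpret N: left_module R N by fact
  show ?thesis using assms(2) by (intro HomI) (auto simp: HomD N.M.minus_add N.lsmult_r_minus N.M.a_comm)
qed

lemma Hom_minus:
  assumes "left_module R N" "f \<in> Hom R M N" "g \<in> Hom R M N"
  shows "(\<lambda>x. f x \<ominus>\<^bsub>N\<^esub> g x) \<in> Hom R M N"
  unfolding a_minus_def by (intro Hom_add Hom_neg assms)

lemma bij_hom_inverse:
  assumes M: "left_module R M" and f: "f \<in> Hom R M N" "bij_betw f (carrier M) (carrier N)"
  obtains g where "g \<in> Hom R N M" "bij_betw g (carrier N) (carrier M)"
    "\<And>y. y \<in> carrier N \<Longrightarrow> f (g y) = y"
proof
  interpret M: left_module R M by (rule M)
  note D = HomD[OF f(1)]
  let ?g = "the_inv_into (carrier M) f"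
  show g: "bij_betw ?g (carrier N) (carrier M)" using f(2) by (rule bij_betw_the_inv_into)
  have gf: "\<And>x. x \<in> carrier M \<Longrightarrow> ?g (f x) = x" using f(2) the_inv_into_f_f bij_betw_def by metis
  show fg: "\<And>y. y \<in> carrier N \<Longrightarrow> f (?g y) = y" using f(2) f_the_inv_into_f_bij_betw by metis
  have gc: "\<And>y. y \<in> carrier N \<Longrightarrow> ?g y \<in> carrier M" using g bij_betwE by blast
  show "?g \<in> Hom R N M"
  proof (rule HomI)
    fix x y assume "x \<in> carrier N" "y \<in> carrier N"
    then show "?g (x \<oplus>\<^bsub>N\<^esub> y) = ?g x \<oplus>\<^bsub>M\<^esub> ?g y"
      using gf[of "?g x \<oplus>\<^bsub>M\<^esub> ?g y"] by (simp add: fg gc D)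
  next
    fix a y assume "a \<in> carrier R" "y \<in> carrier N"
    then show "?g (a \<odot>\<^bsub>N\<^esub> y) = a \<odot>\<^bsub>M\<^esub> ?g y" using gf[of "a \<odot>\<^bsub>M\<^esub> ?g y"] by (simp add: fg gc D M.lsmult_closed)
  qed (use gc in auto)
qed

lemma module_iso_sym:
  assumes "left_module R M" "module_iso R M N" shows "module_iso R N M"
  using assms(2) bij_hom_inverse[OF assms(1)] unfolding module_iso_def by metis

section \<open>Linear combinations and projective modules\<close>

text \<open>
  The sum extends over the support of the coefficients, so that it is meaningful for an infinite
  index set: \<open>finsum\<close> over an infinite set would be \<open>\<zero>\<close>.
\<close>

definition lin_comb ::
  "('a, 'c) ring_scheme \<Rightarrow> ('a, 'b, 'd) module_scheme \<Rightarrow> 'i set \<Rightarrow> ('i \<Rightarrow> 'a) \<Rightarrow> ('i \<Rightarrow> 'b) \<Rightarrow> 'b" where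
  "lin_comb R M I c m = (\<Oplus>\<^bsub>M\<^esub>i\<in>{i \<in> I. c i \<noteq> \<zero>\<^bsub>R\<^esub>}. c i \<odot>\<^bsub>M\<^esub> m i)"

abbreviation (input) fin_supp :: "('a, 'c) ring_scheme \<Rightarrow> 'i set \<Rightarrow> ('i \<Rightarrow> 'a) \<Rightarrow> bool" where
  "fin_supp R I c \<equiv> finite {i \<in> I. c i \<noteq> \<zero>\<^bsub>R\<^esub>}"

context left_module
begin

lemma lin_comb_eq:
  assumes "finite F" "F \<subseteq> I" "{i \<in> I. c i \<noteq> \<zero>\<^bsub>R\<^esub>} \<subseteq> F" "c \<in> I \<rightarrow> carrier R" "m \<in> I \<rightarrow> carrier M"
  shows "lin_comb R M I c m = (\<Oplus>\<^bsub>M\<^esub>i\<in>F. c i \<odot>\<^bsub>M\<^esub> m i)"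
  unfolding lin_comb_def
proof (rule M.add.finprod_mono_neutral_cong_left)
  fix i assume "i \<in> F - {i \<in> I. c i \<noteq> \<zero>\<^bsub>R\<^esub>}"
  then show "c i \<odot>\<^bsub>M\<^esub> m i = \<zero>\<^bsub>M\<^esub>" using assms(2,5) by (auto simp: Pi_iff)
qed (use assms in \<open>auto simp: Pi_iff subset_iff\<close>)

lemma lin_comb_closed [intro]:
  assumes "c \<in> I \<rightarrow> carrier R" "m \<in> I \<rightarrow> carrier M"
  shows "lin_comb R M I c m \<in> carrier M"
  unfolding lin_comb_def using assms by (intro M.finsum_closed) (auto simp: Pi_iff)

lemma lin_comb_add:
  assumes c: "c \<in> I \<rightarrow> carrier R" "d \<in> I \<rightarrow> carrier R" and m: "m \<in> I \<rightarrow> carrier M"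
    and f: "fin_supp R I c" "fin_supp R I d"
  shows "lin_comb R M I (\<lambda>i. c i \<oplus>\<^bsub>R\<^esub> d i) m = lin_comb R M I c m \<oplus>\<^bsub>M\<^esub> lin_comb R M I d m"
proof -
  let ?F = "{i \<in> I. c i \<noteq> \<zero>\<^bsub>R\<^esub>} \<union> {i \<in> I. d i \<noteq> \<zero>\<^bsub>R\<^esub>}"
  have F: "finite ?F" "?F \<subseteq> I" using f by auto
  have "lin_comb R M I (\<lambda>i. c i \<oplus>\<^bsub>R\<^esub> d i) m = (\<Oplus>\<^bsub>M\<^esub>i\<in>?F. (c i \<oplus>\<^bsub>R\<^esub> d i) \<odot>\<^bsub>M\<^esub> m i)"
    using c m by (intro lin_comb_eq F) auto
  also have "\<dots> = (\<Oplus>\<^bsub>M\<^esub>i\<in>?F. c i \<odot>\<^bsub>M\<^esub> m i \<oplus>\<^bsub>M\<^esub> d i \<odot>\<^bsub>M\<^esub> m i)"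
    using c m by (intro M.finsum_cong') (auto simp: Pi_iff lsmult_l_distr)
  also have "\<dots> = (\<Oplus>\<^bsub>M\<^esub>i\<in>?F. c i \<odot>\<^bsub>M\<^esub> m i) \<oplus>\<^bsub>M\<^esub> (\<Oplus>\<^bsub>M\<^esub>i\<in>?F. d i \<odot>\<^bsub>M\<^esub> m i)"
    using c m by (intro M.finsum_addf) (auto simp: Pi_iff)
  also have "\<dots> = lin_comb R M I c m \<oplus>\<^bsub>M\<^esub> lin_comb R M I d m"
    using c m by (simp add: lin_comb_eq[OF F] subset_iff)
  finally show ?thesis .
qed

lemma lin_comb_smult:
  assumes a: "a \<in> carrier R" and c: "c \<in> I \<rightarrow> carrier R" and m: "m \<in> I \<rightarrow> carrier M" and f: "fin_supp R I c"
  shows "lin_comb R M I (\<lambda>i. a \<otimes>\<^bsub>R\<^esub> c i) m = a \<odot>\<^bsub>M\<^esub> lin_comb R M I c m"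
proof -
  let ?F = "{i \<in> I. c i \<noteq> \<zero>\<^bsub>R\<^esub>}"
  have F: "finite ?F" "?F \<subseteq> I" using f by auto
  have "lin_comb R M I (\<lambda>i. a \<otimes>\<^bsub>R\<^esub> c i) m = (\<Oplus>\<^bsub>M\<^esub>i\<in>?F. (a \<otimes>\<^bsub>R\<^esub> c i) \<odot>\<^bsub>M\<^esub> m i)"
    using c m a by (intro lin_comb_eq F) auto
  also have "\<dots> = (\<Oplus>\<^bsub>M\<^esub>i\<in>?F. a \<odot>\<^bsub>M\<^esub> (c i \<odot>\<^bsub>M\<^esub> m i))"
    using c m a by (intro M.finsum_cong') (auto simp: Pi_iff lsmult_assoc)
  also have "\<dots> = a \<odot>\<^bsub>M\<^esub> (\<Oplus>\<^bsub>M\<^esub>i\<in>?F. c i \<odot>\<^bsub>M\<^esub> m i)"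
    using c m a by (intro finsum_lsmult[symmetric]) (auto simp: Pi_iff)
  also have "\<dots> = a \<odot>\<^bsub>M\<^esub> lin_comb R M I c m" by (simp add: lin_comb_def)
  finally show ?thesis .
qed

lemma lin_comb_add_right:
  assumes c: "c \<in> I \<rightarrow> carrier R" and m: "m \<in> I \<rightarrow> carrier M" "m' \<in> I \<rightarrow> carrier M"
  shows "lin_comb R M I c (\<lambda>i. m i \<oplus>\<^bsub>M\<^esub> m' i) = lin_comb R M I c m \<oplus>\<^bsub>M\<^esub> lin_comb R M I c m'"
proof -
  let ?F = "{i \<in> I. c i \<noteq> \<zero>\<^bsub>R\<^esub>}"
  have "lin_comb R M I c (\<lambda>i. m i \<oplus>\<^bsub>M\<^esub> m' i) = (\<Oplus>\<^bsub>M\<^esub>i\<in>?F. c i \<odot>\<^bsub>M\<^esub> m i \<oplus>\<^bsub>M\<^esub> c i \<odot>\<^bsub>M\<^esub> m' i)"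
    unfolding lin_comb_def using c m by (intro M.finsum_cong') (auto simp: Pi_iff lsmult_r_distr)
  also have "\<dots> = lin_comb R M I c m \<oplus>\<^bsub>M\<^esub> lin_comb R M I c m'"
    unfolding lin_comb_def using c m by (intro M.finsum_addf) (auto simp: Pi_iff)
  finally show ?thesis .
qed

lemma lin_comb_cong:
  assumes "c \<in> I \<rightarrow> carrier R" "m \<in> I \<rightarrow> carrier M"
    "\<And>i. i \<in> I \<Longrightarrow> c i = c' i" "\<And>i. i \<in> I \<Longrightarrow> c i \<noteq> \<zero>\<^bsub>R\<^esub> \<Longrightarrow> m i = m' i"
  shows "lin_comb R M I c m = lin_comb R M I c' m'"
proof -
  have "{i \<in> I. c i \<noteq> \<zero>\<^bsub>R\<^esub>} = {i \<in> I. c' i \<noteq> \<zero>\<^bsub>R\<^esub>}" using assms(3) by auto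
  then show ?thesis unfolding lin_comb_def using assms
    by (intro M.finsum_cong') (auto simp: Pi_iff)
qed

lemma lin_comb_delta:
  assumes "j \<in> I" "m \<in> I \<rightarrow> carrier M"
  shows "lin_comb R M I (\<lambda>i. if i = j then \<one>\<^bsub>R\<^esub> else \<zero>\<^bsub>R\<^esub>) m = m j"
proof -
  have "lin_comb R M I (\<lambda>i. if i = j then \<one>\<^bsub>R\<^esub> else \<zero>\<^bsub>R\<^esub>) m
      = (\<Oplus>\<^bsub>M\<^esub>i\<in>{j}. (if i = j then \<one>\<^bsub>R\<^esub> else \<zero>\<^bsub>R\<^esub>) \<odot>\<^bsub>M\<^esub> m i)"
    using assms by (intro lin_comb_eq) auto
  also have "\<dots> = m j" using assms by (auto simp: Pi_iff)
  finally show ?thesis .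
qed

lemma lin_comb_submodule:
  assumes "Module.submodule N R M" "c \<in> I \<rightarrow> carrier R" "m \<in> I \<rightarrow> N"
  shows "lin_comb R M I c m \<in> N"
  unfolding lin_comb_def using assms submoduleD(4)[OF assms(1)]
  by (intro submodule_finsum) auto

end

lemma (in left_module_hom) lin_comb:
  assumes "c \<in> I \<rightarrow> carrier R" "m \<in> I \<rightarrow> carrier M"
  shows "f (lin_comb R M I c m) = lin_comb R N I c (\<lambda>i. f (m i))"
proof -
  have "(\<lambda>i. c i \<odot>\<^bsub>M\<^esub> m i) \<in> {i \<in> I. c i \<noteq> \<zero>\<^bsub>R\<^esub>} \<rightarrow> carrier M" using assms by auto
  then show ?thesis unfolding lin_comb_def using assms
    by (subst finsum) (auto simp: Pi_iff intro!: N.M.finsum_cong')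
qed

abbreviation regular :: "('a, 'c) ring_scheme \<Rightarrow> ('a, 'a) module" where
  "regular R \<equiv> with_action R (monoid.mult R)"

lemma with_action_simps [simp]:
  "carrier (with_action M act) = carrier M" "\<zero>\<^bsub>with_action M act\<^esub> = \<zero>\<^bsub>M\<^esub>"
  "x \<oplus>\<^bsub>with_action M act\<^esub> y = x \<oplus>\<^bsub>M\<^esub> y" "a \<odot>\<^bsub>with_action M act\<^esub> x = act a x"
  by (simp_all add: with_action_def)

lemma abelian_group_record_cong:
  assumes "abelian_group M" "carrier N = carrier M" "\<zero>\<^bsub>N\<^esub> = \<zero>\<^bsub>M\<^esub>" "ring.add N = ring.add M"
  shows "abelian_group N"
proof -
  interpret abelian_group M by fact
  show ?thesis
  proof (rule abelian_groupI)
    fix x assume "x \<in> carrier N"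
    then show "\<exists>y\<in>carrier N. y \<oplus>\<^bsub>N\<^esub> x = \<zero>\<^bsub>N\<^esub>"
      using assms(2-4) by (intro bexI[of _ "\<ominus>\<^bsub>M\<^esub> x"]) (auto simp: l_neg)
  qed (use assms(2-4) in \<open>auto simp: a_ac\<close>)
qed

lemma regular_left_module: "ring R \<Longrightarrow> left_module R (regular R)"
proof -
  assume "ring R"
  then interpret ring R .
  have "abelian_group (regular R)"
    by (rule abelian_group_record_cong[OF abelian_group_axioms]) (simp_all add: with_action_def)
  then show ?thesis by (intro left_moduleI) (auto simp: ring_axioms l_distr r_distr m_assoc)
qed

lemma free_module_simps [simp]:
  "\<zero>\<^bsub>free_module R I\<^esub> = (\<lambda>i. \<zero>\<^bsub>R\<^esub>)" "x \<oplus>\<^bsub>free_module R I\<^esub> y = (\<lambda>i. x i \<oplus>\<^bsub>R\<^esub> y i)"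
  "a \<odot>\<^bsub>free_module R I\<^esub> x = (\<lambda>i. a \<otimes>\<^bsub>R\<^esub> x i)"
  by (simp_all add: free_module_def)

lemma free_module_carrier:
  "x \<in> carrier (free_module R I) \<longleftrightarrow>
     (\<forall>i. x i \<in> carrier R) \<and> (\<forall>i. i \<notin> I \<longrightarrow> x i = \<zero>\<^bsub>R\<^esub>) \<and> fin_supp R I x"
proof -
  have *: "{i. x i \<noteq> \<zero>\<^bsub>R\<^esub>} = {i \<in> I. x i \<noteq> \<zero>\<^bsub>R\<^esub>}" if "\<forall>i. i \<notin> I \<longrightarrow> x i = \<zero>\<^bsub>R\<^esub>" using that by blast
  have "{i. x i \<noteq> \<zero>\<^bsub>R\<^esub>} \<subseteq> I \<longleftrightarrow> (\<forall>i. i \<notin> I \<longrightarrow> x i = \<zero>\<^bsub>R\<^esub>)" by blast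
  then show ?thesis unfolding free_module_def using * by auto
qed

lemma free_module_left_module:
  assumes "ring R" shows "left_module R (free_module R I)"
proof (rule left_moduleI)
  interpret ring R by fact
  have fin_add: "fin_supp R I (\<lambda>i. x i \<oplus>\<^bsub>R\<^esub> y i)" if "fin_supp R I x" "fin_supp R I y" for x y
    by (rule finite_subset[of _ "{i \<in> I. x i \<noteq> \<zero>\<^bsub>R\<^esub>} \<union> {i \<in> I. y i \<noteq> \<zero>\<^bsub>R\<^esub>}"]) (use that in auto)
  have fin_smult: "fin_supp R I (\<lambda>i. a \<otimes>\<^bsub>R\<^esub> x i)" if "fin_supp R I x" "a \<in> carrier R" for a x
    by (rule finite_subset[OF _ that(1)]) (use that in auto)
  show "ring R" by fact
  show "abelian_group (free_module R I)"
  proof (rule abelian_groupI)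
    fix x assume x: "x \<in> carrier (free_module R I)"
    have "fin_supp R I (\<lambda>i. \<ominus>\<^bsub>R\<^esub> x i)"
      by (rule finite_subset[of _ "{i \<in> I. x i \<noteq> \<zero>\<^bsub>R\<^esub>}"]) (use x in \<open>auto simp: free_module_carrier\<close>)
    with x show "\<exists>y\<in>carrier (free_module R I). y \<oplus>\<^bsub>free_module R I\<^esub> x = \<zero>\<^bsub>free_module R I\<^esub>"
      by (intro bexI[of _ "\<lambda>i. \<ominus>\<^bsub>R\<^esub> x i"]) (auto simp: free_module_carrier fun_eq_iff l_neg)
  qed (auto simp: free_module_carrier fun_eq_iff a_ac intro: fin_add)
  show "a \<odot>\<^bsub>free_module R I\<^esub> x \<in> carrier (free_module R I)"
    if "a \<in> carrier R" "x \<in> carrier (free_module R I)" for a x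
    using that by (auto simp: free_module_carrier intro: fin_smult)
qed (auto simp: free_module_carrier fun_eq_iff ring.ring_simprules[OF assms])

lemma free_basis_carrier [simp]:
  assumes "ring R" "i \<in> I" shows "free_basis R i \<in> carrier (free_module R I)"
proof -
  interpret ring R by fact
  have "fin_supp R I (free_basis R i)"
    by (rule finite_subset[of _ "{i}"]) (auto simp: free_basis_def)
  then show ?thesis using assms by (auto simp: free_module_carrier free_basis_def)
qed

lemma free_module_eval_hom: "ring R \<Longrightarrow> (\<lambda>x. x i) \<in> Hom R (free_module R I) (regular R)"
  by (rule HomI) (auto simp: free_module_carrier)

text \<open>
  By the dual basis lemma, projectivity amounts to the existence of coordinates with respect to a
  generating family that need not be a basis.  This form leaves the type of the index set free and
  passes to direct summands at once.
\<close>

definition dual_basis ::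
  "('a, 'c) ring_scheme \<Rightarrow> ('a, 'b, 'd) module_scheme \<Rightarrow> 'i set \<Rightarrow> ('i \<Rightarrow> 'b) \<Rightarrow> ('i \<Rightarrow> 'b \<Rightarrow> 'a) \<Rightarrow> bool" where
  "dual_basis R X I b f \<longleftrightarrow> left_module R X \<and> b \<in> I \<rightarrow> carrier X \<and>
     (\<forall>i\<in>I. f i \<in> Hom R X (regular R)) \<and>
     (\<forall>x\<in>carrier X. fin_supp R I (\<lambda>i. f i x) \<and> x = lin_comb R X I (\<lambda>i. f i x) b)"

lemma dual_basisD:
  assumes "dual_basis R X I b f"
  shows "left_module R X" "b \<in> I \<rightarrow> carrier X" "\<And>i. i \<in> I \<Longrightarrow> b i \<in> carrier X"
    "\<And>i. i \<in> I \<Longrightarrow> f i \<in> Hom R X (regular R)"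
    "\<And>i x. \<lbrakk>i \<in> I; x \<in> carrier X\<rbrakk> \<Longrightarrow> f i x \<in> carrier R"
    "\<And>i x y. \<lbrakk>i \<in> I; x \<in> carrier X; y \<in> carrier X\<rbrakk> \<Longrightarrow> f i (x \<oplus>\<^bsub>X\<^esub> y) = f i x \<oplus>\<^bsub>R\<^esub> f i y"
    "\<And>i a x. \<lbrakk>i \<in> I; a \<in> carrier R; x \<in> carrier X\<rbrakk> \<Longrightarrow> f i (a \<odot>\<^bsub>X\<^esub> x) = a \<otimes>\<^bsub>R\<^esub> f i x"
    "\<And>x. x \<in> carrier X \<Longrightarrow> fin_supp R I (\<lambda>i. f i x)"
    "\<And>x. x \<in> carrier X \<Longrightarrow> lin_comb R X I (\<lambda>i. f i x) b = x"
proof -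
  show *: "left_module R X" "b \<in> I \<rightarrow> carrier X" "\<And>i. i \<in> I \<Longrightarrow> b i \<in> carrier X"
    "\<And>i. i \<in> I \<Longrightarrow> f i \<in> Hom R X (regular R)" "\<And>x. x \<in> carrier X \<Longrightarrow> fin_supp R I (\<lambda>i. f i x)"
    "\<And>x. x \<in> carrier X \<Longrightarrow> lin_comb R X I (\<lambda>i. f i x) b = x"
    using assms unfolding dual_basis_def by auto
  show "\<And>i x. \<lbrakk>i \<in> I; x \<in> carrier X\<rbrakk> \<Longrightarrow> f i x \<in> carrier R"
    "\<And>i x y. \<lbrakk>i \<in> I; x \<in> carrier X; y \<in> carrier X\<rbrakk> \<Longrightarrow> f i (x \<oplus>\<^bsub>X\<^esub> y) = f i x \<oplus>\<^bsub>R\<^esub> f i y"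
    "\<And>i a x. \<lbrakk>i \<in> I; a \<in> carrier R; x \<in> carrier X\<rbrakk> \<Longrightarrow> f i (a \<odot>\<^bsub>X\<^esub> x) = a \<otimes>\<^bsub>R\<^esub> f i x"
    using HomD[OF *(4)] by auto
qed

lemma free_module_dual_basis:
  assumes "ring R" shows "dual_basis R (free_module R I) I (free_basis R) (\<lambda>i x. x i)"
  unfolding dual_basis_def
proof (intro conjI ballI)
  interpret F: left_module R "free_module R I" using free_module_left_module[OF assms] .
  interpret G: left_module R "regular R" using regular_left_module[OF assms] .
  show "left_module R (free_module R I)" by (rule F.left_module_axioms)
  show b: "free_basis R \<in> I \<rightarrow> carrier (free_module R I)" using assms by simp
  show "\<And>i. (\<lambda>x. x i) \<in> Hom R (free_module R I) (regular R)" using free_module_eval_hom[OF assms] .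
  fix x assume x: "x \<in> carrier (free_module R I)"
  then show "fin_supp R I x" by (simp add: free_module_carrier)
  show "x = lin_comb R (free_module R I) I x (free_basis R)"
  proof
    fix j
    interpret E: left_module_hom R "free_module R I" "regular R" "\<lambda>x. x j"
      using free_module_eval_hom[OF assms] by (intro left_module_homI) (fact | rule F.left_module_axioms G.left_module_axioms)+
    let ?y = "lin_comb R (free_module R I) I x (free_basis R)"
    have "?y j = lin_comb R (regular R) I x (\<lambda>i. free_basis R i j)"
      using E.lin_comb[of x I "free_basis R"] b x by (auto simp: free_module_carrier)
    also have "\<dots> = x j"
    proof (cases "j \<in> I")
      case True
      let ?F = "{i \<in> I. x i \<noteq> \<zero>\<^bsub>R\<^esub>} \<union> {j}"
      have "lin_comb R (regular R) I x (\<lambda>i. free_basis R i j)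
          = (\<Oplus>\<^bsub>regular R\<^esub>i\<in>?F. x i \<odot>\<^bsub>regular R\<^esub> free_basis R i j)"
        using x True by (intro G.lin_comb_eq) (auto simp: free_module_carrier free_basis_def)
      also have "\<dots> = (\<Oplus>\<^bsub>regular R\<^esub>i\<in>?F. if j = i then x i else \<zero>\<^bsub>regular R\<^esub>)"
        using x by (intro G.M.finsum_cong') (auto simp: free_module_carrier free_basis_def)
      also have "\<dots> = x j"
        using x by (subst G.M.finsum_singleton) (auto simp: free_module_carrier)
      finally show ?thesis .
    next
      case False
      have "lin_comb R (regular R) I x (\<lambda>i. free_basis R i j) = \<zero>\<^bsub>regular R\<^esub>"
        unfolding lin_comb_def
        using x False by (intro G.M.add.finprod_one_eqI) (auto simp: free_module_carrier free_basis_def)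
      then show ?thesis using x False by (simp add: free_module_carrier)
    qed
    finally show "x j = ?y j" by simp
  qed
qed

lemma lin_comb_hom:
  assumes X: "dual_basis R X I b f" and M: "left_module R M" and m: "m \<in> I \<rightarrow> carrier M"
  shows "(\<lambda>x. lin_comb R M I (\<lambda>i. f i x) m) \<in> Hom R X M"
proof -
  interpret M: left_module R M by fact
  interpret X: left_module R X using dual_basisD(1)[OF X] .
  note D = dual_basisD(4-8)[OF X]
  have c: "\<And>x. x \<in> carrier X \<Longrightarrow> (\<lambda>i. f i x) \<in> I \<rightarrow> carrier R" using D(2) by auto
  show ?thesis
  proof (rule HomI)
    fix x y assume xy: "x \<in> carrier X" "y \<in> carrier X"
    have "lin_comb R M I (\<lambda>i. f i (x \<oplus>\<^bsub>X\<^esub> y)) m = lin_comb R M I (\<lambda>i. f i x \<oplus>\<^bsub>R\<^esub> f i y) m"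
      using xy m c D(3) by (intro M.lin_comb_cong) auto
    also have "\<dots> = lin_comb R M I (\<lambda>i. f i x) m \<oplus>\<^bsub>M\<^esub> lin_comb R M I (\<lambda>i. f i y) m"
      using xy m c D(5) by (intro M.lin_comb_add) auto
    finally show "lin_comb R M I (\<lambda>i. f i (x \<oplus>\<^bsub>X\<^esub> y)) m =
      lin_comb R M I (\<lambda>i. f i x) m \<oplus>\<^bsub>M\<^esub> lin_comb R M I (\<lambda>i. f i y) m" .
  next
    fix a x assume ax: "a \<in> carrier R" "x \<in> carrier X"
    have "lin_comb R M I (\<lambda>i. f i (a \<odot>\<^bsub>X\<^esub> x)) m = lin_comb R M I (\<lambda>i. a \<otimes>\<^bsub>R\<^esub> f i x) m"
      using ax m c D(4) by (intro M.lin_comb_cong) auto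
    also have "\<dots> = a \<odot>\<^bsub>M\<^esub> lin_comb R M I (\<lambda>i. f i x) m"
      using ax m c D(5) by (intro M.lin_comb_smult) auto
    finally show "lin_comb R M I (\<lambda>i. f i (a \<odot>\<^bsub>X\<^esub> x)) m = a \<odot>\<^bsub>M\<^esub> lin_comb R M I (\<lambda>i. f i x) m" .
  qed (use m c in \<open>auto intro: M.lin_comb_closed\<close>)
qed

text \<open>Lift the images of the family \<open>b\<close> one by one; the coordinates do the rest.\<close>

lemma dual_basis_lift:
  assumes X: "dual_basis R X I b f" and M: "left_module R M" "left_module R N" and g: "g \<in> Hom R M N"
    and surj: "carrier N \<subseteq> g ` carrier M" and h: "h \<in> Hom R X N"
  shows "\<exists>k \<in> Hom R X M. \<forall>x\<in>carrier X. g (k x) = h x"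
proof -
  interpret g: left_module_hom R M N g by (rule left_module_homI[OF M g])
  interpret h: left_module_hom R X N h by (rule left_module_homI[OF dual_basisD(1)[OF X] M(2) h])
  have "\<exists>m. m \<in> carrier M \<and> g m = h (b i)" if i: "i \<in> I" for i
  proof -
    have "h (b i) \<in> g ` carrier M" using h.closed[OF dual_basisD(3)[OF X i]] surj by blast
    then show ?thesis by (auto simp: image_iff)
  qed
  then obtain m where m: "\<And>i. i \<in> I \<Longrightarrow> m i \<in> carrier M \<and> g (m i) = h (b i)" by metis
  show ?thesis
  proof (intro bexI ballI)
    show "(\<lambda>x. lin_comb R M I (\<lambda>i. f i x) m) \<in> Hom R X M" using m by (intro lin_comb_hom[OF X M(1)]) auto
    fix x assume x: "x \<in> carrier X"
    have c: "(\<lambda>i. f i x) \<in> I \<rightarrow> carrier R" using dual_basisD(5)[OF X] x by auto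
    have "g (lin_comb R M I (\<lambda>i. f i x) m) = lin_comb R N I (\<lambda>i. f i x) (\<lambda>i. g (m i))"
      using c m by (intro g.lin_comb) auto
    also have "\<dots> = lin_comb R N I (\<lambda>i. f i x) (\<lambda>i. h (b i))"
      using c m by (intro g.N.lin_comb_cong) auto
    also have "\<dots> = h (lin_comb R X I (\<lambda>i. f i x) b)"
      by (rule h.lin_comb[OF c dual_basisD(2)[OF X], symmetric])
    also have "\<dots> = h x" using dual_basisD(9)[OF X x] by simp
    finally show "g (lin_comb R M I (\<lambda>i. f i x) m) = h x" .
  qed
qed

lemma dual_basis_retract:
  assumes X: "dual_basis R X I b f" and Y: "left_module R Y" and p: "p \<in> Hom R X Y" and s: "s \<in> Hom R Y X"
    and ps: "\<And>y. y \<in> carrier Y \<Longrightarrow> p (s y) = y"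
  shows "dual_basis R Y I (\<lambda>i. p (b i)) (\<lambda>i y. f i (s y))"
proof -
  note D = dual_basisD[OF X]
  interpret p: left_module_hom R X Y p by (rule left_module_homI[OF D(1) Y p])
  interpret s: left_module_hom R Y X s by (rule left_module_homI[OF Y D(1) s])
  show ?thesis unfolding dual_basis_def
  proof (intro conjI ballI)
    fix y assume y: "y \<in> carrier Y"
    show "fin_supp R I (\<lambda>i. f i (s y))" using D(8) y by blast
    have "y = p (lin_comb R X I (\<lambda>i. f i (s y)) b)" using D(9)[of "s y"] y ps by simp
    also have "\<dots> = lin_comb R Y I (\<lambda>i. f i (s y)) (\<lambda>i. p (b i))"
      using D(2,5) y by (intro p.lin_comb) auto
    finally show "y = lin_comb R Y I (\<lambda>i. f i (s y)) (\<lambda>i. p (b i))" .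
  next
    fix i assume "i \<in> I"
    then show "(\<lambda>y. f i (s y)) \<in> Hom R Y (regular R)" using Hom_comp[OF s D(4)] by blast
  qed (use D(3) Y in auto)
qed

lemma direct_sum_simps [simp]:
  "carrier (direct_sum M N) = carrier M \<times> carrier N" "\<zero>\<^bsub>direct_sum M N\<^esub> = (\<zero>\<^bsub>M\<^esub>, \<zero>\<^bsub>N\<^esub>)"
  "x \<oplus>\<^bsub>direct_sum M N\<^esub> y = (fst x \<oplus>\<^bsub>M\<^esub> fst y, snd x \<oplus>\<^bsub>N\<^esub> snd y)"
  "a \<odot>\<^bsub>direct_sum M N\<^esub> x = (a \<odot>\<^bsub>M\<^esub> fst x, a \<odot>\<^bsub>N\<^esub> snd x)"
  by (simp_all add: direct_sum_def)

lemma direct_sum_left_module: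
  assumes "left_module R M" "left_module R N" shows "left_module R (direct_sum M N)"
proof -
  interpret M: left_module R M by fact
  interpret N: left_module R N by fact
  have "abelian_group (direct_sum M N)"
  proof (rule abelian_groupI)
    fix x assume "x \<in> carrier (direct_sum M N)"
    then show "\<exists>y\<in>carrier (direct_sum M N). y \<oplus>\<^bsub>direct_sum M N\<^esub> x = \<zero>\<^bsub>direct_sum M N\<^esub>"
      by (intro bexI[of _ "(\<ominus>\<^bsub>M\<^esub> fst x, \<ominus>\<^bsub>N\<^esub> snd x)"]) (auto simp: M.M.l_neg N.M.l_neg)
  qed (auto simp: M.M.a_ac N.M.a_ac)
  then show ?thesis by (intro left_moduleI)
    (auto simp: M.R.ring_axioms M.lsmult_l_distr N.lsmult_l_distr M.lsmult_r_distr N.lsmult_r_distr M.lsmult_assoc N.lsmult_assoc)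
qed

lemma direct_sum_inj_hom:
  assumes "left_module R M" "left_module R N"
  shows "(\<lambda>x. (x, \<zero>\<^bsub>N\<^esub>)) \<in> Hom R M (direct_sum M N)" "(\<lambda>y. (\<zero>\<^bsub>M\<^esub>, y)) \<in> Hom R N (direct_sum M N)"
proof -
  interpret M: left_module R M by fact
  interpret N: left_module R N by fact
  show "(\<lambda>x. (x, \<zero>\<^bsub>N\<^esub>)) \<in> Hom R M (direct_sum M N)" "(\<lambda>y. (\<zero>\<^bsub>M\<^esub>, y)) \<in> Hom R N (direct_sum M N)"
    by (auto intro!: HomI)
qed

lemma direct_sum_proj_hom: "fst \<in> Hom R (direct_sum M N) M" "snd \<in> Hom R (direct_sum M N) N"
  by (auto intro!: HomI)

lemma direct_sum_dual_basis:
  assumes X: "dual_basis R X I b f" and Y: "dual_basis R Y J c g"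
  shows "dual_basis R (direct_sum X Y) (I <+> J)
    (case_sum (\<lambda>i. (b i, \<zero>\<^bsub>Y\<^esub>)) (\<lambda>j. (\<zero>\<^bsub>X\<^esub>, c j))) (case_sum (\<lambda>i z. f i (fst z)) (\<lambda>j z. g j (snd z)))"
proof -
  note D = dual_basisD[OF X]
  note E = dual_basisD[OF Y]
  interpret X: left_module R X by (rule D(1))
  interpret Y: left_module R Y by (rule E(1))
  let ?Z = "direct_sum X Y"
  interpret Z: left_module R ?Z by (rule direct_sum_left_module[OF D(1) E(1)])
  let ?b = "case_sum (\<lambda>i. (b i, \<zero>\<^bsub>Y\<^esub>)) (\<lambda>j. (\<zero>\<^bsub>X\<^esub>, c j))"
  let ?f = "case_sum (\<lambda>i z. f i (fst z)) (\<lambda>j z. g j (snd z))"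
  interpret i1: left_module_hom R X ?Z "\<lambda>x. (x, \<zero>\<^bsub>Y\<^esub>)"
    by (intro left_module_homI D(1) Z.left_module_axioms direct_sum_inj_hom E(1))
  interpret i2: left_module_hom R Y ?Z "\<lambda>y. (\<zero>\<^bsub>X\<^esub>, y)"
    by (intro left_module_homI D(1) Z.left_module_axioms direct_sum_inj_hom E(1))
  show ?thesis unfolding dual_basis_def
  proof (intro conjI ballI)
    show "left_module R ?Z" by (rule Z.left_module_axioms)
    show "?b \<in> (I <+> J) \<rightarrow> carrier ?Z" using D(3) E(3) by auto
  next
    fix k assume "k \<in> I <+> J"
    then show "?f k \<in> Hom R ?Z (regular R)"
      using Hom_comp[OF direct_sum_proj_hom(1) D(4)] Hom_comp[OF direct_sum_proj_hom(2) E(4)] by auto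
  next
    fix z assume z: "z \<in> carrier ?Z"
    let ?S = "{i \<in> I. f i (fst z) \<noteq> \<zero>\<^bsub>R\<^esub>}" and ?S' = "{j \<in> J. g j (snd z) \<noteq> \<zero>\<^bsub>R\<^esub>}"
    have S: "{k \<in> I <+> J. ?f k z \<noteq> \<zero>\<^bsub>R\<^esub>} = Inl ` ?S \<union> Inr ` ?S'" by auto
    have fin: "finite ?S" "finite ?S'" using D(8)[of "fst z"] E(8)[of "snd z"] z by auto
    then show "fin_supp R (I <+> J) (\<lambda>k. ?f k z)" unfolding S by simp
    have m: "(\<lambda>k. ?f k z \<odot>\<^bsub>?Z\<^esub> ?b k) \<in> Inl ` ?S \<union> Inr ` ?S' \<rightarrow> carrier ?Z"
      using z D(3,5) E(3,5) by auto
    have "lin_comb R ?Z (I <+> J) (\<lambda>k. ?f k z) ?b =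
      (\<Oplus>\<^bsub>?Z\<^esub>k\<in>Inl ` ?S. ?f k z \<odot>\<^bsub>?Z\<^esub> ?b k) \<oplus>\<^bsub>?Z\<^esub> (\<Oplus>\<^bsub>?Z\<^esub>k\<in>Inr ` ?S'. ?f k z \<odot>\<^bsub>?Z\<^esub> ?b k)"
      unfolding lin_comb_def S using fin m by (intro Z.M.finsum_Un_disjoint) auto
    also have "(\<Oplus>\<^bsub>?Z\<^esub>k\<in>Inl ` ?S. ?f k z \<odot>\<^bsub>?Z\<^esub> ?b k) = (\<Oplus>\<^bsub>?Z\<^esub>i\<in>?S. ?f (Inl i) z \<odot>\<^bsub>?Z\<^esub> ?b (Inl i))"
      using m by (intro Z.M.finsum_reindex) auto
    also have "\<dots> = (\<Oplus>\<^bsub>?Z\<^esub>i\<in>?S. (f i (fst z) \<odot>\<^bsub>X\<^esub> b i, \<zero>\<^bsub>Y\<^esub>))"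
      using z D(3,5) by (intro Z.M.finsum_cong') auto
    also have "\<dots> = (\<Oplus>\<^bsub>X\<^esub>i\<in>?S. f i (fst z) \<odot>\<^bsub>X\<^esub> b i, \<zero>\<^bsub>Y\<^esub>)"
      using z D(3,5) by (intro i1.finsum[symmetric]) auto
    also have "\<dots> = (fst z, \<zero>\<^bsub>Y\<^esub>)" using D(9)[of "fst z"] z by (auto simp: lin_comb_def)
    also have "(\<Oplus>\<^bsub>?Z\<^esub>k\<in>Inr ` ?S'. ?f k z \<odot>\<^bsub>?Z\<^esub> ?b k) = (\<Oplus>\<^bsub>?Z\<^esub>j\<in>?S'. ?f (Inr j) z \<odot>\<^bsub>?Z\<^esub> ?b (Inr j))"
      using m by (intro Z.M.finsum_reindex) auto
    also have "\<dots> = (\<Oplus>\<^bsub>?Z\<^esub>j\<in>?S'. (\<zero>\<^bsub>X\<^esub>, g j (snd z) \<odot>\<^bsub>Y\<^esub> c j))"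
      using z E(3,5) by (intro Z.M.finsum_cong') auto
    also have "\<dots> = (\<zero>\<^bsub>X\<^esub>, \<Oplus>\<^bsub>Y\<^esub>j\<in>?S'. g j (snd z) \<odot>\<^bsub>Y\<^esub> c j)"
      using z E(3,5) by (intro i2.finsum[symmetric]) auto
    also have "\<dots> = (\<zero>\<^bsub>X\<^esub>, snd z)" using E(9)[of "snd z"] z by (auto simp: lin_comb_def)
    finally show "z = lin_comb R ?Z (I <+> J) (\<lambda>k. ?f k z) ?b" using z by auto
  qed
qed

lemma quotient_module_simps [simp]:
  "\<zero>\<^bsub>quotient_module M N\<^esub> = N" "X \<oplus>\<^bsub>quotient_module M N\<^esub> Y = X <+>\<^bsub>M\<^esub> Y"
  "carrier (quotient_module M N) = a_rcosets\<^bsub>M\<^esub> N"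
  by (simp_all add: quotient_module_def)

context left_module
begin

lemma coset_eq_iff:
  assumes N: "Module.submodule N R M" and "x \<in> carrier M" "y \<in> carrier M"
  shows "N +>\<^bsub>M\<^esub> x = N +>\<^bsub>M\<^esub> y \<longleftrightarrow> x \<ominus>\<^bsub>M\<^esub> y \<in> N"
proof -
  have s: "subgroup N (add_monoid M)" using N unfolding submodule_iff by auto
  have "N \<subseteq> carrier M" using submoduleD(1)[OF N] .
  then show ?thesis
    by (metis M.a_coset_add_inv1 M.a_coset_add_inv2 M.a_coset_join1 M.a_coset_join2 M.minus_closed a_minus_def assms(2,3) s)
qed

lemma coset_self:
  assumes N: "Module.submodule N R M" and "x \<in> carrier M" shows "x \<in> N +>\<^bsub>M\<^esub> x"
  using M.a_rcosI[of "\<zero>\<^bsub>M\<^esub>" N x] assms(2) submoduleD[OF N] by simp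

lemma coset_sub:
  assumes N: "Module.submodule N R M" and "x \<in> carrier M" "y \<in> N +>\<^bsub>M\<^esub> x"
  shows "y \<in> carrier M" "N +>\<^bsub>M\<^esub> y = N +>\<^bsub>M\<^esub> x"
proof -
  have s: "subgroup N (add_monoid M)" using N unfolding submodule_iff by auto
  show "y \<in> carrier M" using assms(2,3) M.a_r_coset_subset_G[OF submoduleD(1)[OF N]] by blast
  show "N +>\<^bsub>M\<^esub> y = N +>\<^bsub>M\<^esub> x" using M.a_repr_independence[OF assms(3,2) s] by simp
qed

lemma quotient_module_carrier: "X \<in> carrier (quotient_module M N) \<longleftrightarrow> (\<exists>x\<in>carrier M. X = N +>\<^bsub>M\<^esub> x)"
  by (auto simp: A_RCOSETS_def')

lemma quotient_add:
  assumes N: "Module.submodule N R M" and "x \<in> carrier M" "y \<in> carrier M"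
  shows "(N +>\<^bsub>M\<^esub> x) <+>\<^bsub>M\<^esub> (N +>\<^bsub>M\<^esub> y) = N +>\<^bsub>M\<^esub> (x \<oplus>\<^bsub>M\<^esub> y)"
proof -
  interpret abelian_subgroup N M
    using N unfolding submodule_iff by (intro abelian_subgroupI3) (auto simp: additive_subgroup_def M.abelian_group_axioms)
  show ?thesis using a_rcos_sum assms by auto
qed

lemma quotient_smult:
  assumes N: "Module.submodule N R M" and a: "a \<in> carrier R" and x: "x \<in> carrier M"
  shows "a \<odot>\<^bsub>quotient_module M N\<^esub> (N +>\<^bsub>M\<^esub> x) = N +>\<^bsub>M\<^esub> (a \<odot>\<^bsub>M\<^esub> x)"
proof -
  have "N +>\<^bsub>M\<^esub> (a \<odot>\<^bsub>M\<^esub> y) = N +>\<^bsub>M\<^esub> (a \<odot>\<^bsub>M\<^esub> x)" if y: "y \<in> N +>\<^bsub>M\<^esub> x" for y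
  proof -
    have "y \<in> carrier M" "y \<ominus>\<^bsub>M\<^esub> x \<in> N" using coset_sub[OF N x y] coset_eq_iff[OF N] x by auto
    then show ?thesis using submoduleD(4)[OF N a] a x by (subst coset_eq_iff[OF N]) (auto simp: lsmult_minus_distr[symmetric])
  qed
  moreover have "a \<odot>\<^bsub>quotient_module M N\<^esub> (N +>\<^bsub>M\<^esub> x) = (\<Union>y\<in>N +>\<^bsub>M\<^esub> x. N +>\<^bsub>M\<^esub> (a \<odot>\<^bsub>M\<^esub> y))"
    by (simp add: quotient_module_def)
  ultimately show ?thesis using coset_self[OF N x] by blast
qed

lemma quotient_left_module:
  assumes N: "Module.submodule N R M" shows "left_module R (quotient_module M N)"
proof (rule left_moduleI)
  let ?Q = "quotient_module M N"
  have N0: "N = N +>\<^bsub>M\<^esub> \<zero>\<^bsub>M\<^esub>" using submoduleD(1)[OF N] by simp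
  have ex: "\<exists>x\<in>carrier M. X = N +>\<^bsub>M\<^esub> x" if "X \<in> carrier ?Q" for X
    using that quotient_module_carrier by blast
  have cl: "N +>\<^bsub>M\<^esub> x \<in> carrier ?Q" if "x \<in> carrier M" for x
    using that quotient_module_carrier by blast
  note qa = quotient_add[OF N] quotient_smult[OF N]
  show "abelian_group ?Q"
  proof (rule abelian_groupI)
    fix X Y assume "X \<in> carrier ?Q" "Y \<in> carrier ?Q"
    then obtain x y where "x \<in> carrier M" "X = N +>\<^bsub>M\<^esub> x" "y \<in> carrier M" "Y = N +>\<^bsub>M\<^esub> y" using ex by metis
    then show "X \<oplus>\<^bsub>?Q\<^esub> Y \<in> carrier ?Q" "X \<oplus>\<^bsub>?Q\<^esub> Y = Y \<oplus>\<^bsub>?Q\<^esub> X" using cl by (auto simp: qa M.a_comm)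
  next
    fix X Y Z assume "X \<in> carrier ?Q" "Y \<in> carrier ?Q" "Z \<in> carrier ?Q"
    then obtain x y z where "x \<in> carrier M" "X = N +>\<^bsub>M\<^esub> x" "y \<in> carrier M" "Y = N +>\<^bsub>M\<^esub> y"
      "z \<in> carrier M" "Z = N +>\<^bsub>M\<^esub> z" using ex by metis
    then show "X \<oplus>\<^bsub>?Q\<^esub> Y \<oplus>\<^bsub>?Q\<^esub> Z = X \<oplus>\<^bsub>?Q\<^esub> (Y \<oplus>\<^bsub>?Q\<^esub> Z)" by (simp add: qa M.a_assoc)
  next
    show "\<zero>\<^bsub>?Q\<^esub> \<in> carrier ?Q" using cl[of "\<zero>\<^bsub>M\<^esub>"] N0 by simp
  next
    fix X assume "X \<in> carrier ?Q"
    then obtain x where x: "x \<in> carrier M" "X = N +>\<^bsub>M\<^esub> x" using ex by metis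
    then show "\<zero>\<^bsub>?Q\<^esub> \<oplus>\<^bsub>?Q\<^esub> X = X" using qa(1)[of "\<zero>\<^bsub>M\<^esub>" x] N0 by simp
    show "\<exists>Y\<in>carrier ?Q. Y \<oplus>\<^bsub>?Q\<^esub> X = \<zero>\<^bsub>?Q\<^esub>"
      using x N0 cl[of "\<ominus>\<^bsub>M\<^esub> x"] by (intro bexI[of _ "N +>\<^bsub>M\<^esub> (\<ominus>\<^bsub>M\<^esub> x)"]) (auto simp: qa M.l_neg)
  qed
  fix a X assume a: "a \<in> carrier R" and "X \<in> carrier ?Q"
  then obtain x where x: "x \<in> carrier M" "X = N +>\<^bsub>M\<^esub> x" using ex by metis
  then show "a \<odot>\<^bsub>?Q\<^esub> X \<in> carrier ?Q" using a cl by (simp add: qa)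
  { fix Y assume "Y \<in> carrier ?Q"
    then obtain y where "y \<in> carrier M" "Y = N +>\<^bsub>M\<^esub> y" using ex by metis
    then show "a \<odot>\<^bsub>?Q\<^esub> (X \<oplus>\<^bsub>?Q\<^esub> Y) = a \<odot>\<^bsub>?Q\<^esub> X \<oplus>\<^bsub>?Q\<^esub> a \<odot>\<^bsub>?Q\<^esub> Y"
      using a x by (simp add: qa lsmult_r_distr) }
  { fix b assume b: "b \<in> carrier R"
    show "(a \<oplus>\<^bsub>R\<^esub> b) \<odot>\<^bsub>?Q\<^esub> X = a \<odot>\<^bsub>?Q\<^esub> X \<oplus>\<^bsub>?Q\<^esub> b \<odot>\<^bsub>?Q\<^esub> X" using a b x by (simp add: qa lsmult_l_distr)
    show "(a \<otimes>\<^bsub>R\<^esub> b) \<odot>\<^bsub>?Q\<^esub> X = a \<odot>\<^bsub>?Q\<^esub> (b \<odot>\<^bsub>?Q\<^esub> X)" using a b x by (simp add: qa lsmult_assoc) }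
next
  fix X assume "X \<in> carrier (quotient_module M N)"
  then obtain x where x: "x \<in> carrier M" "X = N +>\<^bsub>M\<^esub> x" using quotient_module_carrier by metis
  then show "\<one>\<^bsub>R\<^esub> \<odot>\<^bsub>quotient_module M N\<^esub> X = X" by (simp add: quotient_smult[OF N])
qed (rule R.ring_axioms)

lemma quotient_hom:
  assumes N: "Module.submodule N R M" shows "(\<lambda>x. N +>\<^bsub>M\<^esub> x) \<in> Hom R M (quotient_module M N)"
  by (rule HomI) (auto simp: quotient_add[OF N] quotient_smult[OF N] quotient_module_carrier simp del: quotient_module_simps(3))

end

section \<open>Finitely generated modules\<close>

lemma fg_moduleE:
  assumes "fg_module R M"
  obtains A where "finite A" "A \<subseteq> carrier M" "\<And>N. \<lbrakk>Module.submodule N R M; A \<subseteq> N\<rbrakk> \<Longrightarrow> N = carrier M"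
proof -
  from assms have "\<exists>A. finite A \<and> A \<subseteq> carrier M \<and> (\<forall>N. Module.submodule N R M \<and> A \<subseteq> N \<longrightarrow> N = carrier M)"
    unfolding fg_module_def by (rule conjunct2)
  then show ?thesis by (elim exE conjE) (rule that, assumption+, iprover)
qed

lemma fg_module_iff:
  "fg_module R M \<longleftrightarrow> left_module R M \<and> (\<exists>A. finite A \<and> A \<subseteq> carrier M \<and> submodule_hull R M A = carrier M)"
proof (cases "left_module R M")
  case True
  then interpret left_module R M .
  have "(\<forall>N. Module.submodule N R M \<and> A \<subseteq> N \<longrightarrow> N = carrier M) \<longleftrightarrow> submodule_hull R M A = carrier M"
    if "A \<subseteq> carrier M" for A
    using hull_least hull_superset hull_submodule[OF that] submoduleD(1) by blast
  then show ?thesis unfolding fg_module_def using True by auto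
qed (auto simp: fg_module_def)

lemma fg_module_image:
  assumes "left_module R M" "left_module R N" "f \<in> Hom R M N" "f ` carrier M = carrier N" "fg_module R M"
  shows "fg_module R N"
proof -
  interpret left_module_hom R M N f using assms by (intro left_module_homI)
  obtain A where A: "finite A" "A \<subseteq> carrier M" "\<And>L. \<lbrakk>Module.submodule L R M; A \<subseteq> L\<rbrakk> \<Longrightarrow> L = carrier M"
    using assms(5) unfolding fg_module_def by blast
  show ?thesis unfolding fg_module_def
  proof (intro conjI exI allI impI)
    fix L assume L: "Module.submodule L R N \<and> f ` A \<subseteq> L"
    then have "{x \<in> carrier M. f x \<in> L} = carrier M" using A(2) vimage_submodule[of L] by (intro A(3)) auto
    then have "carrier N \<subseteq> L" unfolding assms(4)[symmetric] by blast
    moreover have "L \<subseteq> carrier N" using L N.submoduleD(1)[of L] by simp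
    ultimately show "L = carrier N" by simp
  qed (use A assms in auto)
qed

lemma iso_quotient:
  assumes "left_module R M" "left_module R N" "f \<in> Hom R M N" "f ` carrier M = carrier N"
  shows "module_iso R (quotient_module M {x \<in> carrier M. f x = \<zero>\<^bsub>N\<^esub>}) N"
proof -
  interpret left_module_hom R M N f using assms by (intro left_module_homI)
  define L where "L = {x \<in> carrier M. f x = \<zero>\<^bsub>N\<^esub>}"
  have L: "Module.submodule L R M" unfolding L_def by (rule ker_submodule)
  let ?Q = "quotient_module M L"
  let ?g = "\<lambda>X. f (SOME x. x \<in> X)"
  have g: "?g (L +>\<^bsub>M\<^esub> x) = f x" if x: "x \<in> carrier M" for x
  proof -
    have "(SOME y. y \<in> L +>\<^bsub>M\<^esub> x) \<in> L +>\<^bsub>M\<^esub> x" using M.coset_self[OF L x] by (rule someI)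
    then obtain y where y: "y = (SOME y. y \<in> L +>\<^bsub>M\<^esub> x)" "y \<in> L +>\<^bsub>M\<^esub> x" by blast
    then have "y \<in> carrier M" "y \<ominus>\<^bsub>M\<^esub> x \<in> L" using M.coset_sub[OF L x y(2)] M.coset_eq_iff[OF L] x by auto
    then have "f y = f x" using x by (simp add: L_def)
    then show ?thesis using y by simp
  qed
  have ex: "\<exists>x\<in>carrier M. X = L +>\<^bsub>M\<^esub> x" if "X \<in> carrier ?Q" for X
    using that M.quotient_module_carrier by blast
  have "?g \<in> Hom R ?Q N"
  proof (rule HomI)
    fix X assume "X \<in> carrier ?Q"
    then show "?g X \<in> carrier N" using ex[of X] g by auto
  next
    fix X Y assume "X \<in> carrier ?Q" "Y \<in> carrier ?Q"
    then obtain x y where "x \<in> carrier M" "X = L +>\<^bsub>M\<^esub> x" "y \<in> carrier M" "Y = L +>\<^bsub>M\<^esub> y" using ex by metis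
    then show "?g (X \<oplus>\<^bsub>?Q\<^esub> Y) = ?g X \<oplus>\<^bsub>N\<^esub> ?g Y" by (simp add: M.quotient_add[OF L] g)
  next
    fix a X assume "a \<in> carrier R" "X \<in> carrier ?Q"
    moreover obtain x where "x \<in> carrier M" "X = L +>\<^bsub>M\<^esub> x" using ex calculation by metis
    ultimately show "?g (a \<odot>\<^bsub>?Q\<^esub> X) = a \<odot>\<^bsub>N\<^esub> ?g X" by (simp add: M.quotient_smult[OF L] g)
  qed
  moreover have "bij_betw ?g (carrier ?Q) (carrier N)"
  proof (rule bij_betw_imageI)
    show "inj_on ?g (carrier ?Q)"
    proof
      fix X Y assume XY: "X \<in> carrier ?Q" "Y \<in> carrier ?Q" "?g X = ?g Y"
      then obtain x y where *: "x \<in> carrier M" "X = L +>\<^bsub>M\<^esub> x" "y \<in> carrier M" "Y = L +>\<^bsub>M\<^esub> y" using ex by metis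
      then show "X = Y" using XY(3) by (auto simp: g M.coset_eq_iff[OF L]) (simp add: L_def)
    qed
    show "?g ` carrier ?Q = carrier N"
    proof
      show "?g ` carrier ?Q \<subseteq> carrier N"
      proof (rule image_subsetI)
        fix X assume "X \<in> carrier ?Q"
        then obtain x where "x \<in> carrier M" "X = L +>\<^bsub>M\<^esub> x" using ex by metis
        then show "?g X \<in> carrier N" using g by simp
      qed
      show "carrier N \<subseteq> ?g ` carrier ?Q"
      proof
        fix y assume "y \<in> carrier N"
        then obtain x where x: "x \<in> carrier M" "y = f x" using assms(4) by blast
        then have "L +>\<^bsub>M\<^esub> x \<in> carrier ?Q" using M.quotient_module_carrier by blast
        then show "y \<in> ?g ` carrier ?Q" using x g by (intro image_eqI[of _ _ "L +>\<^bsub>M\<^esub> x"]) auto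
      qed
    qed
  qed
  ultimately show ?thesis unfolding module_iso_def L_def by blast
qed

lemma fg_module_cover:
  assumes "fg_module R M"
  shows "\<exists>m f. f \<in> Hom R (free_module R {..<m::nat}) M \<and> f ` carrier (free_module R {..<m}) = carrier M"
proof -
  obtain A where A: "finite A" "A \<subseteq> carrier M" "submodule_hull R M A = carrier M" and M: "left_module R M"
    using assms unfolding fg_module_iff by blast
  interpret left_module R M by (rule M)
  obtain e and m :: nat where e: "A = e ` {..<m}" using finite_imp_nat_seg_image_inj_on[OF A(1)]
    by (metis lessThan_def)
  let ?F = "free_module R {..<m}"
  note D = free_module_dual_basis[OF R.ring_axioms, of "{..<m}"]
  let ?f = "\<lambda>x. lin_comb R M {..<m} x e"
  have f: "?f \<in> Hom R ?F M" using lin_comb_hom[OF D M, of e] A(2) e by auto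
  interpret f: left_module_hom R ?F M ?f by (intro left_module_homI M f dual_basisD(1)[OF D])
  have "A \<subseteq> ?f ` carrier ?F"
  proof
    fix a assume "a \<in> A"
    then obtain i where i: "i < m" "a = e i" using e by auto
    then have "?f (free_basis R i) = a"
      using lin_comb_delta[of i "{..<m}" e] A(2) e by (auto simp: free_basis_def)
    then show "a \<in> ?f ` carrier ?F" using i R.ring_axioms by (metis free_basis_carrier imageI lessThan_iff)
  qed
  then have "carrier M \<subseteq> ?f ` carrier ?F"
    using hull_least[OF f.image_submodule[OF f.M.carrier_submodule]] A(3) by blast
  then show ?thesis using f f.closed by blast
qed

lemma fg_module_representative:
  assumes "fg_module R M" shows "\<exists>N \<in> fg_modules R. module_iso R M N"
proof -
  obtain m f where f: "f \<in> Hom R (free_module R {..<m::nat}) M" "f ` carrier (free_module R {..<m}) = carrier M"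
    using fg_module_cover[OF assms] by blast
  have M: "left_module R M" using assms fg_module_def by blast
  then interpret M: left_module R M .
  let ?F = "free_module R {..<m}" and ?L = "{x \<in> carrier (free_module R {..<m}). f x = \<zero>\<^bsub>M\<^esub>}"
  interpret f: left_module_hom R ?F M f
    using f M free_module_left_module[OF M.R.ring_axioms] by (intro left_module_homI)
  let ?N = "quotient_module ?F ?L"
  have N: "left_module R ?N" by (rule f.M.quotient_left_module[OF f.ker_submodule])
  have iso: "module_iso R M ?N" using iso_quotient[OF f.M.left_module_axioms M f] module_iso_sym N by blast
  then obtain g where "g \<in> Hom R M ?N" "bij_betw g (carrier M) (carrier ?N)" unfolding module_iso_def by blast
  then have "fg_module R ?N" using fg_module_image[OF M N _ _ assms] bij_betw_imp_surj_on by blast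
  then show ?thesis using iso unfolding fg_modules_def by blast
qed

section \<open>Finite-dimensional vector spaces\<close>

lemma module_iff_left_module: "cring K \<Longrightarrow> Module.module K V \<longleftrightarrow> left_module K V"
  unfolding Module.module_def Module.module_axioms_def left_module_def left_module_axioms_def
  using cring.axioms(1) by auto

lemma field_cring: "field K \<Longrightarrow> cring K"
  by (simp add: field_def domain_def)

lemma vectorspace_iff: "field K \<Longrightarrow> vectorspace K V \<longleftrightarrow> left_module K V"
  unfolding vectorspace_def using module_iff_left_module field_cring by blast

lemma submodule_conv:
  assumes "Module.module K V"
  shows "LinearCombinations.submodule K N V \<longleftrightarrow> Module.submodule N K V"
proof -
  interpret Module.module K V by fact
  interpret L: left_module K V using assms module_iff_left_module is_cring by blast
  show ?thesis
    using L.submoduleD[of N] L.submoduleI[of N] assms unfolding LinearCombinations.submodule_def by blast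
qed

lemma subspace_conv:
  assumes "vectorspace K V" shows "VectorSpace.subspace K N V \<longleftrightarrow> Module.submodule N K V"
  using submodule_conv[of K V N] assms unfolding VectorSpace.subspace_def vectorspace_def by blast

lemma span_eq_hull:
  assumes "Module.module K V" "A \<subseteq> carrier V"
  shows "LinearCombinations.module.span K V A = submodule_hull K V A"
proof -
  interpret Module.module K V by fact
  interpret L: left_module K V using assms module_iff_left_module is_cring by blast
  note c = submodule_conv[OF assms(1)]
  show ?thesis
  proof
    show "span A \<subseteq> submodule_hull K V A"
      using span_is_subset[OF L.hull_superset] L.hull_submodule[OF assms(2)] c by blast
    show "submodule_hull K V A \<subseteq> span A"
      using L.hull_least in_own_span[OF assms(2)] span_is_submodule[OF assms(2)] c by blast
  qed
qed

lemma fin_dim_iff: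
  assumes "field K" "left_module K V"
  shows "vectorspace.fin_dim K V \<longleftrightarrow> fg_module K V"
proof -
  have V: "vectorspace K V" using assms vectorspace_iff by blast
  then have m: "Module.module K V" unfolding vectorspace_def by blast
  show ?thesis unfolding vectorspace.fin_dim_def[OF V] fg_module_iff
    using assms(2) by (simp add: span_eq_hull[OF m] cong: conj_cong)
qed

lemma dim_surj:
  assumes K: "field K" and V: "left_module K V" and W: "left_module K W" and fd: "fg_module K V"
    and f: "f \<in> Hom K V W" "f ` carrier V = carrier W"
  shows "vectorspace.dim K V = vectorspace.dim K W + vectorspace.dim K (V\<lparr>carrier := {x \<in> carrier V. f x = \<zero>\<^bsub>W\<^esub>}\<rparr>)"
proof -
  have VW: "vectorspace K V" "vectorspace K W" using assms vectorspace_iff by blast+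
  interpret linear_map K V W f using VW f(1)
    unfolding linear_map_def mod_hom_def mod_hom_axioms_def vectorspace_def by blast
  have "vectorspace.dim K (W\<lparr>carrier := im\<rparr>) + vectorspace.dim K (V\<lparr>carrier := ker\<rparr>) = vectorspace.dim K V"
    using rank_nullity fin_dim_iff K V fd by blast
  moreover have "im = carrier W" using f(2) by (simp add: im_def)
  ultimately show ?thesis by (simp add: ker_def)
qed

lemma dim_bij:
  assumes K: "field K" and V: "left_module K V" and W: "left_module K W" and fd: "fg_module K V"
    and f: "f \<in> Hom K V W" "bij_betw f (carrier V) (carrier W)"
  shows "vectorspace.dim K V = vectorspace.dim K W"
proof -
  have VW: "vectorspace K V" "vectorspace K W" using assms vectorspace_iff by blast+
  interpret linear_map K V W f using VW f(1)
    unfolding linear_map_def mod_hom_def mod_hom_axioms_def vectorspace_def by blast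
  show ?thesis using dim_eq fin_dim_iff[OF K V] fd f(2) unfolding bij_betw_def by blast
qed

lemma fg_subspace:
  assumes K: "field K" and V: "left_module K V" and fd: "fg_module K V" and N: "Module.submodule N K V"
  shows "fg_module K (V\<lparr>carrier := N\<rparr>)"
proof -
  interpret vectorspace K V using assms vectorspace_iff by blast
  have fin: "fin_dim" using fd fin_dim_iff[OF K V] by blast
  have s: "VectorSpace.subspace K N V" using subspace_conv N vectorspace_axioms by blast
  interpret N: vectorspace K "vs N" by (rule subspace_is_vs[OF s])
  have sub: "N \<subseteq> carrier V" using s unfolding VectorSpace.subspace_def LinearCombinations.submodule_def by blast
  have li: "lin_indpt A" if "A \<subseteq> N" "N.lin_indpt A" for A
    using span_li_not_depend(2)[of A N] that is_module[OF s] by simp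
  have "\<exists>A. finite A \<and> maximal A (\<lambda>S. S \<subseteq> carrier (vs N) \<and> N.lin_indpt S)"
  proof (rule maximal_exists[where N = dim and B = "{}"])
    show "finite A \<and> card A \<le> dim" if "A \<subseteq> carrier (vs N) \<and> N.lin_indpt A" for A
      using li_le_dim[OF fin _ li[of A]] subset_trans[OF _ sub, of A] that by simp
    show "{} \<subseteq> carrier (vs N) \<and> N.lin_indpt {}" by (auto simp: N.lin_dep_def)
  qed
  then obtain A where "finite A" "N.basis A" using N.max_li_is_basis by blast
  then have "N.fin_dim" unfolding N.fin_dim_def N.basis_def by blast
  then show ?thesis using fin_dim_iff[OF K] vectorspace_iff[OF K] N.vectorspace_axioms by blast
qed

lemma dim_strict:
  assumes K: "field K" and V: "left_module K V" and fd: "fg_module K V" and N: "Module.submodule N K V"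
    and neq: "N \<noteq> carrier V"
  shows "vectorspace.dim K (V\<lparr>carrier := N\<rparr>) < vectorspace.dim K V"
proof -
  interpret vectorspace K V using assms vectorspace_iff by blast
  have fin: "fin_dim" using fd fin_dim_iff[OF K V] by blast
  have s: "VectorSpace.subspace K N V" using subspace_conv N vectorspace_axioms by blast
  interpret N: vectorspace K "vs N" by (rule subspace_is_vs[OF s])
  have Nl: "left_module K (vs N)" using N.vectorspace_axioms vectorspace_iff[OF K] by blast
  have Nfin: "N.fin_dim" using fg_subspace[OF K V fd N] fin_dim_iff[OF K Nl] by blast
  then obtain B where B: "finite B" "N.basis B" using N.finite_basis_exists by blast
  have sub: "N \<subseteq> carrier V" using s unfolding VectorSpace.subspace_def LinearCombinations.submodule_def by blast
  have BN: "B \<subseteq> N" "N.lin_indpt B" "N.span B = N" using B(2) unfolding N.basis_def by auto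
  have li: "lin_indpt B" using span_li_not_depend(2)[of B N] BN is_module[OF s] by simp
  have card: "N.dim = card B" using N.dim_basis B by blast
  have "card B \<le> dim" using li_le_dim(2)[OF fin _ li] BN sub by auto
  moreover have "card B \<noteq> dim"
  proof
    assume "card B = dim"
    then have "basis B" using dim_li_is_basis[OF fin B(1) _ li] BN sub by auto
    then have "span B = carrier V" unfolding basis_def by blast
    moreover have "span B = N" using span_li_not_depend(1)[of B N] BN is_module[OF s] by simp
    ultimately show False using neq by simp
  qed
  ultimately show ?thesis using card by simp
qed

text \<open>
  Generators of the kernel and preimages of generators of the image generate together.
\<close>

lemma fg_module_extension:
  assumes V: "left_module R V" and W: "left_module R W" and f: "f \<in> Hom R V W" "f ` carrier V = carrier W"
    and ker: "fg_module R (V\<lparr>carrier := {x \<in> carrier V. f x = \<zero>\<^bsub>W\<^esub>}\<rparr>)" and im: "fg_module R W"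
  shows "fg_module R V"
proof -
  interpret left_module_hom R V W f by (rule left_module_homI[OF V W f(1)])
  let ?L = "{x \<in> carrier V. f x = \<zero>\<^bsub>W\<^esub>}"
  obtain A where A: "finite A" "A \<subseteq> ?L" "\<And>N. Module.submodule N R (V\<lparr>carrier := ?L\<rparr>) \<Longrightarrow> A \<subseteq> N \<Longrightarrow> N = ?L"
    using ker unfolding fg_module_def by auto
  obtain B where B: "finite B" "B \<subseteq> carrier W" "\<And>N. Module.submodule N R W \<Longrightarrow> B \<subseteq> N \<Longrightarrow> N = carrier W"
    using im unfolding fg_module_def by auto
  obtain C where C: "finite C" "C \<subseteq> carrier V" "B = f ` C"
    using B(1,2) f(2) by (metis finite_subset_image)
  show ?thesis unfolding fg_module_def
  proof (intro conjI exI allI impI)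
    fix N assume N: "Module.submodule N R V \<and> A \<union> C \<subseteq> N"
    then have N': "Module.submodule N R V" by blast
    note D = M.submoduleD[OF N']
    have "Module.submodule (N \<inter> ?L) R (V\<lparr>carrier := ?L\<rparr>)"
    proof (rule left_module.submoduleI[OF M.submodule_left_module[OF ker_submodule]])
      show "x \<oplus>\<^bsub>V\<lparr>carrier := ?L\<rparr>\<^esub> y \<in> N \<inter> ?L" if "x \<in> N \<inter> ?L" "y \<in> N \<inter> ?L" for x y
        using that D(3)[of x y] D(7) by simp
      show "a \<odot>\<^bsub>V\<lparr>carrier := ?L\<rparr>\<^esub> x \<in> N \<inter> ?L" if "a \<in> carrier R" "x \<in> N \<inter> ?L" for a x
        using that D(4)[of a x] D(7) by simp
    qed (use D(2) in auto)
    then have "N \<inter> ?L = ?L" using A(2,3) N by blast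
    then have L: "?L \<subseteq> N" by blast
    have im: "f ` N = carrier W" using B(3)[OF image_submodule[OF N']] C N by blast
    show "N = carrier V"
    proof
      show "carrier V \<subseteq> N"
      proof
        fix x assume x: "x \<in> carrier V"
        then have "f x \<in> f ` N" using im closed by blast
        then obtain y where y: "y \<in> N" "f x = f y" by blast
        then have "x \<ominus>\<^bsub>V\<^esub> y \<in> ?L" using x D(7) by simp
        then have "x \<ominus>\<^bsub>V\<^esub> y \<in> N" using L by blast
        then have "(x \<ominus>\<^bsub>V\<^esub> y) \<oplus>\<^bsub>V\<^esub> y \<in> N" using D(3) y by blast
        then show "x \<in> N" using x y D(7) by (simp add: a_minus_def M.M.a_assoc M.M.l_neg)
      qed
    qed (use D in auto)
  qed (use A C V in auto)
qed

section \<open>Modules over a finite-dimensional algebra\<close>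

text \<open>
  The canonical map from the free module on \<open>carrier P\<close> onto \<open>P\<close> has a section, and its kernel is
  a complement of the image of the section.
\<close>

lemma projective_module_if_dual_basis:
  assumes P: "dual_basis R P I b f"
  shows "projective_module R P"
proof -
  note PM = dual_basisD(1)[OF P]
  interpret P: left_module R P by (rule PM)
  let ?F = "free_module R (carrier P)"
  note D = free_module_dual_basis[OF P.R.ring_axioms, of "carrier P"]
  note FM = dual_basisD(1)[OF D]
  define \<rho> where "\<rho> = (\<lambda>x. lin_comb R P (carrier P) x (\<lambda>p. p))"
  have \<rho>: "\<rho> \<in> Hom R ?F P" unfolding \<rho>_def using lin_comb_hom[OF D PM, of "\<lambda>p. p"] by simp
  interpret \<rho>: left_module_hom R ?F P \<rho> by (rule left_module_homI[OF FM PM \<rho>])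
  have "carrier P \<subseteq> \<rho> ` carrier ?F"
  proof
    fix p assume p: "p \<in> carrier P"
    then have "\<rho> (free_basis R p) = p" unfolding \<rho>_def
      using P.lin_comb_delta[of p "carrier P" "\<lambda>p. p"] by (auto simp: free_basis_def)
    then show "p \<in> \<rho> ` carrier ?F" using free_basis_carrier[OF P.R.ring_axioms p] by (metis imageI)
  qed
  from dual_basis_lift[OF P FM PM \<rho> this Hom_id] obtain s
    where s: "s \<in> Hom R P ?F" and \<rho>s: "\<And>x. x \<in> carrier P \<Longrightarrow> \<rho> (s x) = x" by blast
  interpret s: left_module_hom R P ?F s by (rule left_module_homI[OF PM FM s])
  define Q where "Q = ?F\<lparr>carrier := {x \<in> carrier ?F. \<rho> x = \<zero>\<^bsub>P\<^esub>}\<rparr>"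
  have Qc: "carrier Q = {x \<in> carrier ?F. \<rho> x = \<zero>\<^bsub>P\<^esub>}" "\<zero>\<^bsub>Q\<^esub> = \<zero>\<^bsub>?F\<^esub>"
    "\<And>x y. x \<oplus>\<^bsub>Q\<^esub> y = x \<oplus>\<^bsub>?F\<^esub> y" "\<And>a x. a \<odot>\<^bsub>Q\<^esub> x = a \<odot>\<^bsub>?F\<^esub> x" by (simp_all add: Q_def)
  have Q: "left_module R Q" unfolding Q_def by (rule \<rho>.M.submodule_left_module[OF \<rho>.ker_submodule])
  let ?h = "\<lambda>z. s (fst z) \<oplus>\<^bsub>?F\<^esub> snd z"
  have "?h \<in> Hom R (direct_sum P Q) ?F"
  proof (rule HomI)
    fix x y assume "x \<in> carrier (direct_sum P Q)" "y \<in> carrier (direct_sum P Q)"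
    then show "?h (x \<oplus>\<^bsub>direct_sum P Q\<^esub> y) = ?h x \<oplus>\<^bsub>?F\<^esub> ?h y"
      using s.closed by (auto simp: Qc \<rho>.M.M.a_ac simp del: free_module_simps)
  next
    fix a x assume "a \<in> carrier R" "x \<in> carrier (direct_sum P Q)"
    then show "?h (a \<odot>\<^bsub>direct_sum P Q\<^esub> x) = a \<odot>\<^bsub>?F\<^esub> ?h x"
      using s.closed by (auto simp: Qc \<rho>.M.lsmult_r_distr simp del: free_module_simps)
  qed (use s.closed in \<open>auto simp: Qc simp del: free_module_simps\<close>)
  moreover have "bij_betw ?h (carrier (direct_sum P Q)) (carrier ?F)"
  proof (rule bij_betwI[where g = "\<lambda>x. (\<rho> x, x \<ominus>\<^bsub>?F\<^esub> s (\<rho> x))"])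
    show "?h \<in> carrier (direct_sum P Q) \<rightarrow> carrier ?F"
      using s.closed by (auto simp: Qc simp del: free_module_simps)
    show "(\<lambda>x. (\<rho> x, x \<ominus>\<^bsub>?F\<^esub> s (\<rho> x))) \<in> carrier ?F \<rightarrow> carrier (direct_sum P Q)"
      using s.closed \<rho>s by (auto simp: Qc)
    fix x assume "x \<in> carrier (direct_sum P Q)"
    then obtain u v where x: "x = (u, v)" "u \<in> carrier P" "v \<in> carrier ?F" "\<rho> v = \<zero>\<^bsub>P\<^esub>" by (auto simp: Qc)
    then have "\<rho> (?h x) = u" using \<rho>s s.closed by (simp del: free_module_simps)
    moreover have "(s u \<oplus>\<^bsub>?F\<^esub> v) \<ominus>\<^bsub>?F\<^esub> s u = v" using x s.closed[OF x(2)]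
      by (simp add: a_minus_def \<rho>.M.M.a_ac \<rho>.M.M.r_neg1 \<rho>.M.M.r_neg \<rho>.M.M.a_comm del: free_module_simps)
    ultimately show "(\<rho> (?h x), ?h x \<ominus>\<^bsub>?F\<^esub> s (\<rho> (?h x))) = x" using x by simp
  next
    fix y assume y: "y \<in> carrier ?F"
    then have "s (\<rho> y) \<in> carrier ?F" by (intro s.closed \<rho>.closed)
    then show "?h (\<rho> y, y \<ominus>\<^bsub>?F\<^esub> s (\<rho> y)) = y" using y
      by (simp add: a_minus_def \<rho>.M.M.a_lcomm \<rho>.M.M.r_neg del: free_module_simps)
  qed
  ultimately have "module_iso R (direct_sum P Q) ?F" unfolding module_iso_def by blast
  then show ?thesis unfolding projective_module_def using Q PM by blast
qed

text \<open>
  A finitely generated module over \<open>H\<close> is the same as one that is finite-dimensional over \<open>K\<close>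
  (\<open>fg_sr_iff\<close>), and finite dimension is expressed as finite generation throughout.
\<close>

locale fd_algebra =
  fixes K :: "('k, 'c) ring_scheme" and H :: "('k, 'h, 'd) module_scheme"
  assumes field: "field K" and algebra: "k_algebra K H" and fg: "fg_module K H"
begin

sublocale K: field K by (rule field)
sublocale H: ring H using algebra unfolding k_algebra_def by blast

lemma H_left_module: "left_module K H"
  using algebra vectorspace_iff[OF field] unfolding k_algebra_def by blast

sublocale HK: left_module K H by (rule H_left_module)

lemma smult_mult:
  assumes "c \<in> carrier K" "x \<in> carrier H" "y \<in> carrier H"
  shows "(c \<odot>\<^bsub>H\<^esub> x) \<otimes>\<^bsub>H\<^esub> y = c \<odot>\<^bsub>H\<^esub> (x \<otimes>\<^bsub>H\<^esub> y)" "x \<otimes>\<^bsub>H\<^esub> (c \<odot>\<^bsub>H\<^esub> y) = c \<odot>\<^bsub>H\<^esub> (x \<otimes>\<^bsub>H\<^esub> y)"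
  using assms algebra unfolding k_algebra_def by blast+

abbreviation sr :: "('h, 'w, 'e) module_scheme \<Rightarrow> ('k, 'w) module" where
  "sr \<equiv> scalar_restriction H"

abbreviation sdim :: "('h, 'w, 'e) module_scheme \<Rightarrow> nat" where
  "sdim W \<equiv> vectorspace.dim K (sr W)"

lemma sr_simps [simp]:
  "carrier (sr W) = carrier W" "\<zero>\<^bsub>sr W\<^esub> = \<zero>\<^bsub>W\<^esub>" "x \<oplus>\<^bsub>sr W\<^esub> y = x \<oplus>\<^bsub>W\<^esub> y"
  "c \<odot>\<^bsub>sr W\<^esub> x = (c \<odot>\<^bsub>H\<^esub> \<one>\<^bsub>H\<^esub>) \<odot>\<^bsub>W\<^esub> x"
  by (simp_all add: scalar_restriction_def)

lemma sr_sub: "sr (W\<lparr>carrier := N\<rparr>) = (sr W)\<lparr>carrier := N\<rparr>"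
  by (simp add: scalar_restriction_def with_action_def)

lemma sr_left_module:
  assumes "left_module H W" shows "left_module K (sr W)"
proof -
  interpret W: left_module H W by fact
  have "abelian_group (sr W)"
    by (rule abelian_group_record_cong[OF W.M.abelian_group_axioms]) (simp_all add: scalar_restriction_def with_action_def)
  then show ?thesis
  proof (rule left_moduleI[rotated])
    fix a b x assume a: "a \<in> carrier K" "b \<in> carrier K" and x: "x \<in> carrier (sr W)"
    show "(a \<oplus>\<^bsub>K\<^esub> b) \<odot>\<^bsub>sr W\<^esub> x = a \<odot>\<^bsub>sr W\<^esub> x \<oplus>\<^bsub>sr W\<^esub> b \<odot>\<^bsub>sr W\<^esub> x"
      using a x by (simp add: HK.lsmult_l_distr W.lsmult_l_distr)
    have "(a \<otimes>\<^bsub>K\<^esub> b) \<odot>\<^bsub>H\<^esub> \<one>\<^bsub>H\<^esub> = (a \<odot>\<^bsub>H\<^esub> \<one>\<^bsub>H\<^esub>) \<otimes>\<^bsub>H\<^esub> (b \<odot>\<^bsub>H\<^esub> \<one>\<^bsub>H\<^esub>)"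
      using a smult_mult(1)[of a "\<one>\<^bsub>H\<^esub>" "b \<odot>\<^bsub>H\<^esub> \<one>\<^bsub>H\<^esub>"] by (simp add: HK.lsmult_assoc)
    then show "(a \<otimes>\<^bsub>K\<^esub> b) \<odot>\<^bsub>sr W\<^esub> x = a \<odot>\<^bsub>sr W\<^esub> (b \<odot>\<^bsub>sr W\<^esub> x)"
      using a x by (simp add: W.lsmult_assoc)
  qed (use K.ring_axioms in \<open>auto simp: W.lsmult_r_distr\<close>)
qed

lemma sr_Hom: "f \<in> Hom H V W \<Longrightarrow> f \<in> Hom K (sr V) (sr W)"
  by (rule HomI) (auto simp: HomD[of f H V W])

lemma sr_submodule:
  assumes "left_module H W" "Module.submodule N H W" shows "Module.submodule N K (sr W)"
  using left_module.submoduleD[OF assms] HK.lsmult_closed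
  by (intro left_module.submoduleI[OF sr_left_module[OF assms(1)]]) auto

lemma smult_sr:
  assumes "left_module H W" "c \<in> carrier K" "h \<in> carrier H" "x \<in> carrier W"
  shows "(c \<odot>\<^bsub>H\<^esub> h) \<odot>\<^bsub>W\<^esub> x = c \<odot>\<^bsub>sr W\<^esub> (h \<odot>\<^bsub>W\<^esub> x)"
    "h \<odot>\<^bsub>W\<^esub> (c \<odot>\<^bsub>sr W\<^esub> x) = c \<odot>\<^bsub>sr W\<^esub> (h \<odot>\<^bsub>W\<^esub> x)"
proof -
  interpret W: left_module H W by fact
  show "(c \<odot>\<^bsub>H\<^esub> h) \<odot>\<^bsub>W\<^esub> x = c \<odot>\<^bsub>sr W\<^esub> (h \<odot>\<^bsub>W\<^esub> x)"
    using W.lsmult_assoc[of "c \<odot>\<^bsub>H\<^esub> \<one>\<^bsub>H\<^esub>" h x] assms by (simp add: smult_mult)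
  show "h \<odot>\<^bsub>W\<^esub> (c \<odot>\<^bsub>sr W\<^esub> x) = c \<odot>\<^bsub>sr W\<^esub> (h \<odot>\<^bsub>W\<^esub> x)"
    using W.lsmult_assoc[of "c \<odot>\<^bsub>H\<^esub> \<one>\<^bsub>H\<^esub>" h x] W.lsmult_assoc[of h "c \<odot>\<^bsub>H\<^esub> \<one>\<^bsub>H\<^esub>" x] assms by (simp add: smult_mult)
qed

lemma fg_sr_iff:
  assumes "left_module H W" shows "fg_module K (sr W) \<longleftrightarrow> fg_module H W"
proof
  assume "fg_module K (sr W)"
  then obtain A where A: "finite A" "A \<subseteq> carrier W" "\<And>N. Module.submodule N K (sr W) \<Longrightarrow> A \<subseteq> N \<Longrightarrow> N = carrier W"
    unfolding fg_module_def by auto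
  show "fg_module H W" unfolding fg_module_def
    using A sr_submodule[OF assms] assms by (intro conjI exI[of _ A]) auto
next
  interpret W: left_module H W by fact
  interpret WK: left_module K "sr W" by (rule sr_left_module[OF assms])
  assume "fg_module H W"
  then obtain A where A: "finite A" "A \<subseteq> carrier W" "\<And>N. Module.submodule N H W \<Longrightarrow> A \<subseteq> N \<Longrightarrow> N = carrier W"
    unfolding fg_module_def by blast
  obtain B where B: "finite B" "B \<subseteq> carrier H" "\<And>N. Module.submodule N K H \<Longrightarrow> B \<subseteq> N \<Longrightarrow> N = carrier H"
    using fg unfolding fg_module_def by blast
  let ?C = "(\<lambda>(b, a). b \<odot>\<^bsub>W\<^esub> a) ` (B \<times> A)"
  let ?N = "submodule_hull K (sr W) ?C"
  have C: "?C \<subseteq> carrier (sr W)" using A(2) B(2) by auto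
  note N = WK.submoduleD[OF WK.hull_submodule[OF C]]
  have 1: "h \<odot>\<^bsub>W\<^esub> a \<in> ?N" if h: "h \<in> carrier H" and a: "a \<in> A" for h a
  proof -
    have "Module.submodule {h \<in> carrier H. h \<odot>\<^bsub>W\<^esub> a \<in> ?N} K H"
    proof (rule HK.submoduleI)
      show "c \<odot>\<^bsub>H\<^esub> h \<in> {h \<in> carrier H. h \<odot>\<^bsub>W\<^esub> a \<in> ?N}" if "c \<in> carrier K" "h \<in> {h \<in> carrier H. h \<odot>\<^bsub>W\<^esub> a \<in> ?N}" for c h
        using that N(4)[of c "h \<odot>\<^bsub>W\<^esub> a"] smult_sr(1)[OF assms, of c h a] A(2) a by auto
      show "g \<oplus>\<^bsub>H\<^esub> h \<in> {h \<in> carrier H. h \<odot>\<^bsub>W\<^esub> a \<in> ?N}"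
        if "g \<in> {h \<in> carrier H. h \<odot>\<^bsub>W\<^esub> a \<in> ?N}" "h \<in> {h \<in> carrier H. h \<odot>\<^bsub>W\<^esub> a \<in> ?N}" for g h
        using that N(3) A(2) a by (auto simp: W.lsmult_l_distr)
    qed (use N(2) A(2) a in auto)
    moreover have "B \<subseteq> {h \<in> carrier H. h \<odot>\<^bsub>W\<^esub> a \<in> ?N}" using B(2) a WK.hull_superset[of ?C] by auto
    ultimately show ?thesis using B(3) h by blast
  qed
  have 2: "h \<odot>\<^bsub>W\<^esub> x \<in> ?N" if h: "h \<in> carrier H" and x: "x \<in> ?N" for h x
  proof -
    have "Module.submodule {x \<in> ?N. h \<odot>\<^bsub>W\<^esub> x \<in> ?N} K (sr W)"
    proof (rule WK.submoduleI)
      show "x \<oplus>\<^bsub>sr W\<^esub> y \<in> {x \<in> ?N. h \<odot>\<^bsub>W\<^esub> x \<in> ?N}"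
        if "x \<in> {x \<in> ?N. h \<odot>\<^bsub>W\<^esub> x \<in> ?N}" "y \<in> {x \<in> ?N. h \<odot>\<^bsub>W\<^esub> x \<in> ?N}" for x y
        using that N(3)[of x y] N(3)[of "h \<odot>\<^bsub>W\<^esub> x" "h \<odot>\<^bsub>W\<^esub> y"] N(7)[of x] N(7)[of y] h by (auto simp: W.lsmult_r_distr)
      show "c \<odot>\<^bsub>sr W\<^esub> x \<in> {x \<in> ?N. h \<odot>\<^bsub>W\<^esub> x \<in> ?N}"
        if "c \<in> carrier K" "x \<in> {x \<in> ?N. h \<odot>\<^bsub>W\<^esub> x \<in> ?N}" for c x
        using that N(4)[of c x] N(4)[of c "h \<odot>\<^bsub>W\<^esub> x"] smult_sr(2)[OF assms, of c h x] N(7)[of x] h by auto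
    qed (use N(1,2) h in auto)
    moreover have "?C \<subseteq> {x \<in> ?N. h \<odot>\<^bsub>W\<^esub> x \<in> ?N}"
    proof
      fix y assume "y \<in> ?C"
      then obtain b a where ba: "b \<in> B" "a \<in> A" "y = b \<odot>\<^bsub>W\<^esub> a" by auto
      then have "h \<odot>\<^bsub>W\<^esub> y = (h \<otimes>\<^bsub>H\<^esub> b) \<odot>\<^bsub>W\<^esub> a" using h A(2) B(2) by (subst W.lsmult_assoc) auto
      then show "y \<in> {x \<in> ?N. h \<odot>\<^bsub>W\<^esub> x \<in> ?N}" using 1[of "h \<otimes>\<^bsub>H\<^esub> b" a] 1[of b a] ba h B(2) by auto
    qed
    ultimately have "?N \<subseteq> {x \<in> ?N. h \<odot>\<^bsub>W\<^esub> x \<in> ?N}" by (intro WK.hull_least)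
    then show ?thesis using x by blast
  qed
  have "Module.submodule ?N H W" using N(1-3) 2 by (intro W.submoduleI) auto
  moreover have "A \<subseteq> ?N"
  proof
    fix a assume "a \<in> A"
    then show "a \<in> ?N" using 1[OF H.one_closed, of a] A(2) W.lsmult_one[of a] by auto
  qed
  ultimately have "?N = carrier W" using A(3) by blast
  then show "fg_module K (sr W)" unfolding fg_module_iff using WK.left_module_axioms A(1) B(1) C
    by (intro conjI exI[of _ ?C]) auto
qed

lemma fg_submodule:
  assumes "left_module H W" "fg_module H W" "Module.submodule N H W"
  shows "fg_module H (W\<lparr>carrier := N\<rparr>)"
proof -
  interpret W: left_module H W by fact
  show ?thesis
    using fg_subspace[OF field sr_left_module[OF assms(1)] _ sr_submodule[OF assms(1,3)]] assms fg_sr_iff[OF assms(1)]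
      fg_sr_iff[OF W.submodule_left_module[OF assms(3)]] by (simp add: sr_sub)
qed

lemma sdim_surj:
  assumes V: "left_module H V" and W: "left_module H W" and fd: "fg_module H V"
    and f: "f \<in> Hom H V W" "f ` carrier V = carrier W"
  shows "sdim V = sdim W + sdim (V\<lparr>carrier := {x \<in> carrier V. f x = \<zero>\<^bsub>W\<^esub>}\<rparr>)"
  using dim_surj[OF field sr_left_module[OF V] sr_left_module[OF W] _ sr_Hom[OF f(1)]] f(2) fd fg_sr_iff[OF V]
  by (simp add: sr_sub)

lemma sdim_bij:
  assumes V: "left_module H V" and W: "left_module H W" and fd: "fg_module H V"
    and f: "f \<in> Hom H V W" "bij_betw f (carrier V) (carrier W)"
  shows "sdim V = sdim W"
  using dim_bij[OF field sr_left_module[OF V] sr_left_module[OF W] _ sr_Hom[OF f(1)]] f(2) fd fg_sr_iff[OF V]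
  by simp

lemma fg_direct_sum:
  assumes V: "left_module H V" "fg_module H V" and W: "left_module H W" "fg_module H W"
  shows "fg_module H (direct_sum V W)" "sdim (direct_sum V W) = sdim V + sdim W"
proof -
  interpret V: left_module H V by fact
  interpret W: left_module H W by fact
  let ?S = "direct_sum V W"
  have S: "left_module H ?S" by (rule direct_sum_left_module[OF V(1) W(1)])
  let ?L = "?S\<lparr>carrier := {x \<in> carrier ?S. snd x = \<zero>\<^bsub>W\<^esub>}\<rparr>"
  interpret p: left_module_hom H ?S W snd by (rule left_module_homI[OF S W(1) direct_sum_proj_hom(2)])
  have L: "left_module H ?L" by (rule p.M.submodule_left_module[OF p.ker_submodule])
  have i: "(\<lambda>x. (x, \<zero>\<^bsub>W\<^esub>)) \<in> Hom H V ?L"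
    by (rule Hom_cod_restrict[OF direct_sum_inj_hom(1)[OF V(1) W(1)]]) auto
  have b: "bij_betw (\<lambda>x. (x, \<zero>\<^bsub>W\<^esub>)) (carrier V) (carrier ?L)"
    by (rule bij_betwI[where g = fst]) auto
  have fgL: "fg_module H ?L" using fg_module_image[OF V(1) L i _ V(2)] b unfolding bij_betw_def by blast
  have sur: "snd ` carrier ?S = carrier W" by (auto intro: image_eqI[of _ _ "(\<zero>\<^bsub>V\<^esub>, _)"])
  show fgS: "fg_module H ?S" by (rule fg_module_extension[OF S W(1) direct_sum_proj_hom(2) sur fgL W(2)])
  show "sdim ?S = sdim V + sdim W"
    using sdim_surj[OF S W(1) fgS direct_sum_proj_hom(2) sur] sdim_bij[OF V(1) L V(2) i b] by simp
qed

text \<open>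
  The number \<open>proj_dim_gcd\<close> only refers to the modules in \<open>fg_modules H\<close>; by transport along an
  isomorphism it divides the dimension of finitely generated projective modules over every type.
\<close>

lemma finite_dual_basis_dim:
  assumes W: "dual_basis H W I b f" and I: "finite I"
  shows "fg_module H W" "proj_dim_gcd K H dvd sdim W"
proof -
  note WM = dual_basisD(1)[OF W]
  interpret W: left_module H W by (rule WM)
  show fgW: "fg_module H W" unfolding fg_module_def
  proof (intro conjI exI allI impI)
    show "b ` I \<subseteq> carrier W" using dual_basisD(2)[OF W] by auto
    fix N assume N: "Module.submodule N H W \<and> b ` I \<subseteq> N"
    have "x \<in> N" if x: "x \<in> carrier W" for x
    proof -
      have "lin_comb H W I (\<lambda>i. f i x) b \<in> N"
        using N dual_basisD(5)[OF W] x by (intro W.lin_comb_submodule) auto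
      then show ?thesis using dual_basisD(9)[OF W x] by simp
    qed
    then show "N = carrier W" using W.submoduleD(1)[of N] N by auto
  qed (use WM I in auto)
  obtain N where N: "N \<in> fg_modules H" "module_iso H W N" using fg_module_representative[OF fgW] by blast
  then have NM: "left_module H N" "fg_module H N" unfolding fg_modules_def fg_module_def by auto
  obtain p where p: "p \<in> Hom H W N" "bij_betw p (carrier W) (carrier N)" using N(2) unfolding module_iso_def by blast
  obtain s where s: "s \<in> Hom H N W" "\<And>y. y \<in> carrier N \<Longrightarrow> p (s y) = y"
    using bij_hom_inverse[OF WM p] by metis
  from dual_basis_retract[OF W NM(1) p(1) s]
  have "projective_module H N" by (rule projective_module_if_dual_basis)
  then have "proj_dim_gcd K H dvd sdim N" unfolding proj_dim_gcd_def using N(1) by (intro Gcd_dvd) blast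
  then show "proj_dim_gcd K H dvd sdim W" using sdim_bij[OF WM NM(1) fgW p] by simp
qed

end

section \<open>Projective modules over a module with finite-dimensional kernel\<close>

context fd_algebra
begin

text \<open>
  The hypotheses say that \<open>W\<close> and \<open>W'\<close> are isomorphic up to maps that factor through the free
  modules \<open>Q\<close> and \<open>Q'\<close> of finite rank on \<open>I\<close> and \<open>I'\<close>: with \<open>p\<close> for the coordinate map and \<open>q\<close> for
  the map given by the family \<open>w\<close>, they read \<open>b a = 1 + q p\<close> and \<open>a b = 1 + q' p'\<close>.  The map
  \<open>(b, - q)\<close> from \<open>W' \<oplus> Q\<close> to \<open>W\<close> is split by \<open>(a, p)\<close>.  Its kernel \<open>Y\<close> is a direct summand of
  \<open>Q' \<oplus> Q\<close>: for \<open>(u, h)\<close> in \<open>Y\<close>, \<open>b u = q h\<close> gives \<open>u = a q h - q' p' u\<close>, so that \<open>(u, h)\<close> can be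
  recovered from \<open>(p' u, h)\<close>.  Hence \<open>dim W + dim Y = dim W' + dim Q\<close>, where \<open>dim Y\<close> and \<open>dim Q\<close>
  are divisible by \<open>\<delta>\<close>.
\<close>

lemma stable_iso_sdim:
  assumes W: "left_module H W" "fg_module H W" and W': "left_module H W'" "fg_module H W'"
    and a: "a \<in> Hom H W W'" and b: "b \<in> Hom H W' W"
    and I: "finite I" and f: "\<And>i. i \<in> I \<Longrightarrow> f i \<in> Hom H W (regular H)" and w: "w \<in> I \<rightarrow> carrier W"
    and ba: "\<And>x. x \<in> carrier W \<Longrightarrow> b (a x) = x \<oplus>\<^bsub>W\<^esub> lin_comb H W I (\<lambda>i. f i x) w"
    and I': "finite I'" and f': "\<And>i. i \<in> I' \<Longrightarrow> f' i \<in> Hom H W' (regular H)" and w': "w' \<in> I' \<rightarrow> carrier W'"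
    and ab: "\<And>x. x \<in> carrier W' \<Longrightarrow> a (b x) = x \<oplus>\<^bsub>W'\<^esub> lin_comb H W' I' (\<lambda>i. f' i x) w'"
  shows "sdim W mod proj_dim_gcd K H = sdim W' mod proj_dim_gcd K H"
proof -
  interpret a: left_module_hom H W W' a by (rule left_module_homI[OF W(1) W'(1) a])
  interpret b: left_module_hom H W' W b by (rule left_module_homI[OF W'(1) W(1) b])
  let ?Q = "free_module H I" and ?Q' = "free_module H I'"
  note DQ = free_module_dual_basis[OF H.ring_axioms, of I] and DQ' = free_module_dual_basis[OF H.ring_axioms, of I']
  note Q = dual_basisD(1)[OF DQ] and Q' = dual_basisD(1)[OF DQ']
  interpret Q: left_module H ?Q by (rule Q)
  have tuple: "(\<lambda>x i. if i \<in> J then g i x else \<zero>\<^bsub>H\<^esub>) \<in> Hom H V (free_module H J)"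
    if J: "finite J" and g: "\<And>i. i \<in> J \<Longrightarrow> g i \<in> Hom H V (regular H)" for J :: "'x set" and g and V :: "('h, 'y, 'z) module_scheme"
    using HomD[OF g] J by (intro HomI) (auto simp: free_module_carrier fun_eq_iff)
  define p where "p = (\<lambda>x i. if i \<in> I then f i x else \<zero>\<^bsub>H\<^esub>)"
  define p' where "p' = (\<lambda>x i. if i \<in> I' then f' i x else \<zero>\<^bsub>H\<^esub>)"
  have p: "p \<in> Hom H W ?Q" unfolding p_def by (rule tuple[OF I f])
  have p': "p' \<in> Hom H W' ?Q'" unfolding p'_def by (rule tuple[OF I' f'])
  interpret p: left_module_hom H W ?Q p by (rule left_module_homI[OF W(1) Q p])
  interpret p': left_module_hom H W' ?Q' p' by (rule left_module_homI[OF W'(1) Q' p'])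
  define q where "q = (\<lambda>x. lin_comb H W I x w)"
  define q' where "q' = (\<lambda>x. lin_comb H W' I' x w')"
  have q: "q \<in> Hom H ?Q W" unfolding q_def by (rule lin_comb_hom[OF DQ W(1) w])
  have q': "q' \<in> Hom H ?Q' W'" unfolding q'_def by (rule lin_comb_hom[OF DQ' W'(1) w'])
  interpret q: left_module_hom H ?Q W q by (rule left_module_homI[OF Q W(1) q])
  interpret q': left_module_hom H ?Q' W' q' by (rule left_module_homI[OF Q' W'(1) q'])
  have qp: "b (a x) = x \<oplus>\<^bsub>W\<^esub> q (p x)" if x: "x \<in> carrier W" for x
  proof -
    have "lin_comb H W I (p x) w = lin_comb H W I (\<lambda>i. f i x) w"
      using HomD(1)[OF f] x w by (intro a.M.lin_comb_cong) (auto simp: p_def)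
    then show ?thesis using ba[OF x] by (simp add: q_def)
  qed
  have qp': "a (b x) = x \<oplus>\<^bsub>W'\<^esub> q' (p' x)" if x: "x \<in> carrier W'" for x
  proof -
    have "lin_comb H W' I' (p' x) w' = lin_comb H W' I' (\<lambda>i. f' i x) w'"
      using HomD(1)[OF f'] x w' by (intro a.N.lin_comb_cong) (auto simp: p'_def)
    then show ?thesis using ab[OF x] by (simp add: q'_def)
  qed
  let ?S = "direct_sum W' ?Q"
  have S: "left_module H ?S" by (rule direct_sum_left_module[OF W'(1) Q])
  let ?\<phi> = "\<lambda>z. b (fst z) \<ominus>\<^bsub>W\<^esub> q (snd z)"
  have \<phi>: "?\<phi> \<in> Hom H ?S W"
    by (intro Hom_minus W(1) Hom_comp[OF direct_sum_proj_hom(1) b] Hom_comp[OF direct_sum_proj_hom(2) q])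
  interpret \<phi>: left_module_hom H ?S W ?\<phi> by (rule left_module_homI[OF S W(1) \<phi>])
  let ?\<psi> = "\<lambda>x. (a x, p x)"
  have \<psi>: "?\<psi> \<in> Hom H W ?S" by (rule HomI) (auto simp del: free_module_simps)
  interpret \<psi>: left_module_hom H W ?S ?\<psi> by (rule left_module_homI[OF W(1) S \<psi>])
  have \<phi>\<psi>: "?\<phi> (?\<psi> x) = x" if x: "x \<in> carrier W" for x
    using qp[OF x] x by (simp add: a_minus_def a.M.M.a_assoc a.M.M.r_neg)
  have sur: "?\<phi> ` carrier ?S = carrier W"
  proof
    show "?\<phi> ` carrier ?S \<subseteq> carrier W" using \<phi>.closed by blast
    show "carrier W \<subseteq> ?\<phi> ` carrier ?S"
    proof
      fix x assume x: "x \<in> carrier W"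
      show "x \<in> ?\<phi> ` carrier ?S" using \<psi>.closed[OF x] by (rule rev_image_eqI) (rule \<phi>\<psi>[OF x, symmetric])
    qed
  qed
  define Y where "Y = ?S\<lparr>carrier := {z \<in> carrier ?S. ?\<phi> z = \<zero>\<^bsub>W\<^esub>}\<rparr>"
  have Y: "left_module H Y" unfolding Y_def by (rule \<phi>.M.submodule_left_module[OF \<phi>.ker_submodule])
  have Ysub: "carrier Y \<subseteq> carrier ?S" by (auto simp: Y_def)
  \<comment> \<open>the projection onto \<open>Y\<close> that belongs to the splitting\<close>
  define e where "e = (\<lambda>z. z \<ominus>\<^bsub>?S\<^esub> ?\<psi> (?\<phi> z))"
  have e: "e \<in> Hom H ?S Y" unfolding Y_def
  proof (rule Hom_cod_restrict)
    show "e \<in> Hom H ?S ?S" unfolding e_def by (rule Hom_minus[OF S Hom_id Hom_comp[OF \<phi> \<psi>]])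
    fix z assume z: "z \<in> carrier ?S"
    have c: "?\<phi> z \<in> carrier W" by (rule \<phi>.closed[OF z])
    have c2: "?\<psi> (?\<phi> z) \<in> carrier ?S" by (rule \<psi>.closed[OF c])
    have "?\<phi> (e z) = ?\<phi> z \<ominus>\<^bsub>W\<^esub> ?\<phi> (?\<psi> (?\<phi> z))" unfolding e_def by (rule \<phi>.minus[OF z c2])
    also have "\<dots> = \<zero>\<^bsub>W\<^esub>" unfolding \<phi>\<psi>[OF c] using c by (simp add: a.M.M.r_neg a_minus_def)
    finally show "e z \<in> {z \<in> carrier ?S. ?\<phi> z = \<zero>\<^bsub>W\<^esub>}" using \<phi>.M.M.minus_closed[OF z c2] unfolding e_def by blast
  qed
  have eY: "e z = z" if z: "z \<in> carrier Y" for z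
  proof -
    have "?\<phi> z = \<zero>\<^bsub>W\<^esub>" "z \<in> carrier ?S" using z by (auto simp: Y_def)
    moreover have "?\<psi> \<zero>\<^bsub>W\<^esub> = \<zero>\<^bsub>?S\<^esub>" by (rule \<psi>.zero)
    moreover have "z \<ominus>\<^bsub>?S\<^esub> \<zero>\<^bsub>?S\<^esub> = z"
      using \<open>z \<in> carrier ?S\<close> \<phi>.M.M.r_zero \<phi>.M.M.a_inv_closed \<phi>.M.M.add.inv_one unfolding a_minus_def a_inv_def by simp
    ultimately show ?thesis by (simp add: e_def)
  qed
  let ?G = "direct_sum ?Q' ?Q"
  note DG = direct_sum_dual_basis[OF DQ' DQ]
  define r where "r = (\<lambda>z. (a (q (snd z)) \<ominus>\<^bsub>W'\<^esub> q' (fst z), snd z))"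
  have r1: "(\<lambda>z. a (q (snd z)) \<ominus>\<^bsub>W'\<^esub> q' (fst z)) \<in> Hom H ?G W'"
    by (intro Hom_minus W'(1) Hom_comp[OF Hom_comp[OF direct_sum_proj_hom(2) q] a] Hom_comp[OF direct_sum_proj_hom(1) q'])
  have r: "r \<in> Hom H ?G ?S"
    using HomD[OF r1] unfolding r_def by (intro HomI) (auto simp del: free_module_simps)
  have s: "(\<lambda>y. (p' (fst y), snd y)) \<in> Hom H Y ?G"
    by (rule HomI) (auto simp: Y_def simp del: free_module_simps)
  have rs: "e (r (p' (fst y), snd y)) = y" if y: "y \<in> carrier Y" for y
  proof -
    obtain u h where yu: "y = (u, h)" "u \<in> carrier W'" "h \<in> carrier ?Q" and "b u \<ominus>\<^bsub>W\<^esub> q h = \<zero>\<^bsub>W\<^esub>"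
      using y by (cases y) (auto simp: Y_def)
    then have "q h = b u" by simp
    then have "a (q h) \<ominus>\<^bsub>W'\<^esub> q' (p' u) = u"
      using qp'[OF yu(2)] yu by (simp add: a_minus_def a.N.M.a_assoc a.N.M.r_neg)
    then have "r (p' (fst y), snd y) = y" using yu by (simp add: r_def)
    then show ?thesis using eY[OF y] by simp
  qed
  have fin: "finite (I' <+> I)" using I I' by simp
  have dvdY: "proj_dim_gcd K H dvd sdim Y"
    by (rule finite_dual_basis_dim(2)[OF dual_basis_retract[OF DG Y Hom_comp[OF r e] s rs] fin])
  have dvdQ: "proj_dim_gcd K H dvd sdim ?Q" and fgQ: "fg_module H ?Q" using finite_dual_basis_dim[OF DQ I] by auto
  have "sdim ?S = sdim W + sdim Y"
    using sdim_surj[OF S W(1) fg_direct_sum(1)[OF W' Q fgQ] \<phi> sur] by (simp add: Y_def)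
  then have "sdim W + sdim Y = sdim W' + sdim ?Q" using fg_direct_sum(2)[OF W' Q fgQ] by simp
  moreover obtain k l where "sdim Y = proj_dim_gcd K H * k" "sdim ?Q = proj_dim_gcd K H * l"
    using dvdY dvdQ by (auto elim!: dvdE)
  ultimately show ?thesis by (metis mod_mult_self2)
qed

text \<open>
  The source \<open>X\<close> will always be projective, but this is expressed by a separate \<open>dual_basis\<close>.
\<close>

definition fin_kernel_cover ::
  "('h, 'x, 'e) module_scheme \<Rightarrow> ('x \<Rightarrow> 'v) \<Rightarrow> ('h, 'v, 'f) module_scheme \<Rightarrow> bool" where
  "fin_kernel_cover X \<pi> V \<longleftrightarrow> left_module H V \<and> \<pi> \<in> Hom H X V \<and> \<pi> ` carrier X = carrier V \<and>
     fg_module H (X\<lparr>carrier := {x \<in> carrier X. \<pi> x = \<zero>\<^bsub>V\<^esub>}\<rparr>)"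

abbreviation ker_dim ::
  "('h, 'x, 'e) module_scheme \<Rightarrow> ('x \<Rightarrow> 'v) \<Rightarrow> ('h, 'v, 'f) module_scheme \<Rightarrow> nat" where
  "ker_dim X \<pi> V \<equiv> sdim (X\<lparr>carrier := {x \<in> carrier X. \<pi> x = \<zero>\<^bsub>V\<^esub>}\<rparr>)"

text \<open>
  Lift the identity of \<open>V\<close> to \<open>s : X \<rightarrow> X'\<close> and \<open>t : X' \<rightarrow> X\<close>.  Then \<open>c = t s - 1\<close> maps \<open>X\<close> to the
  kernel \<open>L\<close> of \<open>\<pi>\<close>.  Since \<open>L\<close> is finitely generated, all but finitely many of the coordinate
  functions of \<open>X\<close> vanish on \<open>L\<close>, and therefore the restriction of \<open>c\<close> to \<open>L\<close> is a finite sum of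
  terms \<open>f\<^sub>i(x) c(b\<^sub>i)\<close>.  This and the same for \<open>s t - 1\<close> is the situation of \<open>stable_iso_sdim\<close>.
\<close>

lemma ker_dim_unique:
  assumes X: "dual_basis H X I b f" and X': "dual_basis H X' I' b' f'"
    and \<pi>: "fin_kernel_cover X \<pi> V" and \<pi>': "fin_kernel_cover X' \<pi>' V"
  shows "ker_dim X \<pi> V mod proj_dim_gcd K H = ker_dim X' \<pi>' V mod proj_dim_gcd K H"
proof -
  have V: "left_module H V" using \<pi> unfolding fin_kernel_cover_def by blast
  have h: "\<pi> \<in> Hom H X V" "\<pi> ` carrier X = carrier V" "\<pi>' \<in> Hom H X' V" "\<pi>' ` carrier X' = carrier V"
    using \<pi> \<pi>' unfolding fin_kernel_cover_def by auto
  note XM = dual_basisD(1)[OF X] and XM' = dual_basisD(1)[OF X']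
  obtain s where s: "s \<in> Hom H X X'" "\<And>x. x \<in> carrier X \<Longrightarrow> \<pi>' (s x) = \<pi> x"
    using dual_basis_lift[OF X XM' V h(3) _ h(1)] h(4) by auto
  obtain t where t: "t \<in> Hom H X' X" "\<And>x. x \<in> carrier X' \<Longrightarrow> \<pi> (t x) = \<pi>' x"
    using dual_basis_lift[OF X' XM V h(1) _ h(3)] h(2) by auto
  define L where "L = X\<lparr>carrier := {x \<in> carrier X. \<pi> x = \<zero>\<^bsub>V\<^esub>}\<rparr>"
  define L' where "L' = X'\<lparr>carrier := {x \<in> carrier X'. \<pi>' x = \<zero>\<^bsub>V\<^esub>}\<rparr>"
  have fgL: "fg_module H L" "fg_module H L'" using \<pi> \<pi>' unfolding fin_kernel_cover_def L_def L'_def by auto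
  \<comment> \<open>stated for arbitrary covers, to be used once for each of the two composites\<close>
  have factor: "\<exists>J w. finite J \<and> J \<subseteq> I \<and> w \<in> J \<rightarrow> carrier (X\<lparr>carrier := {x \<in> carrier X. \<pi> x = \<zero>\<^bsub>V\<^esub>}\<rparr>) \<and>
    (\<forall>x\<in>carrier X. \<pi> x = \<zero>\<^bsub>V\<^esub> \<longrightarrow> t (s x) = x \<oplus>\<^bsub>X\<^esub> lin_comb H (X\<lparr>carrier := {x \<in> carrier X. \<pi> x = \<zero>\<^bsub>V\<^esub>}\<rparr>) J (\<lambda>i. f i x) w)"
    if X: "dual_basis H X I b f" and h: "\<pi> \<in> Hom H X V" "\<pi>' \<in> Hom H X' V" and X': "left_module H X'"
      and s: "s \<in> Hom H X X'" "\<And>x. x \<in> carrier X \<Longrightarrow> \<pi>' (s x) = \<pi> x"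
      and t: "t \<in> Hom H X' X" "\<And>x. x \<in> carrier X' \<Longrightarrow> \<pi> (t x) = \<pi>' x"
      and fgL: "fg_module H (X\<lparr>carrier := {x \<in> carrier X. \<pi> x = \<zero>\<^bsub>V\<^esub>}\<rparr>)"
    for X :: "('h, 'xx, 'ee) module_scheme" and I :: "'ii set" and b f and \<pi> s \<pi>' t and X' :: "('h, 'yy, 'ff) module_scheme"
  proof -
    note D = dual_basisD[OF X]
    define L where "L = X\<lparr>carrier := {x \<in> carrier X. \<pi> x = \<zero>\<^bsub>V\<^esub>}\<rparr>"
    interpret \<pi>: left_module_hom H X V \<pi> by (rule left_module_homI[OF D(1) V h(1)])
    have L: "left_module H L" unfolding L_def by (rule \<pi>.M.submodule_left_module[OF \<pi>.ker_submodule])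
    interpret L: left_module H L by (rule L)
    define c where "c = (\<lambda>x. t (s x) \<ominus>\<^bsub>X\<^esub> x)"
    have c: "c \<in> Hom H X L" unfolding L_def
    proof (rule Hom_cod_restrict)
      show cX: "c \<in> Hom H X X" unfolding c_def by (rule Hom_minus[OF D(1) Hom_comp[OF s(1) t(1)] Hom_id])
      fix x assume x: "x \<in> carrier X"
      have tx: "t (s x) \<in> carrier X" "s x \<in> carrier X'" using HomD(1)[OF t(1)] HomD(1)[OF s(1)] x by auto
      then have "\<pi> (c x) = \<zero>\<^bsub>V\<^esub>" unfolding c_def using x s(2) t(2) by (simp add: a_minus_def \<pi>.N.M.r_neg)
      then show "c x \<in> {x \<in> carrier X. \<pi> x = \<zero>\<^bsub>V\<^esub>}" using HomD(1)[OF cX x] by blast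
    qed
    interpret c: left_module_hom H X L c by (rule left_module_homI[OF D(1) L c])
    have Lc: "carrier L = {x \<in> carrier X. \<pi> x = \<zero>\<^bsub>V\<^esub>}" by (simp add: L_def)
    have "fg_module H L" using fgL unfolding L_def .
    then obtain A where A: "finite A" "A \<subseteq> carrier L" "\<And>N. Module.submodule N H L \<Longrightarrow> A \<subseteq> N \<Longrightarrow> N = carrier L"
      unfolding fg_module_def by blast
    define J where "J = (\<Union>x\<in>A. {i \<in> I. f i x \<noteq> \<zero>\<^bsub>H\<^esub>})"
    have "finite {i \<in> I. f i x \<noteq> \<zero>\<^bsub>H\<^esub>}" if "x \<in> A" for x using D(8) A(2) Lc that by blast
    then have J: "finite J" "J \<subseteq> I" unfolding J_def using A(1) by auto
    have f0: "f i x = \<zero>\<^bsub>H\<^esub>" if i: "i \<in> I - J" and x: "x \<in> carrier L" for i x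
    proof -
      have fi: "f i \<in> Hom H L (regular H)" using Hom_restrict[OF D(4)] i unfolding L_def by auto
      interpret fi: left_module_hom H L "regular H" "f i"
        by (rule left_module_homI[OF L regular_left_module[OF H.ring_axioms] fi])
      have "A \<subseteq> {x \<in> carrier L. f i x = \<zero>\<^bsub>regular H\<^esub>}" using i A(2) unfolding J_def by auto
      then have "{x \<in> carrier L. f i x = \<zero>\<^bsub>regular H\<^esub>} = carrier L" using A(3) fi.ker_submodule by blast
      then show ?thesis using x by auto
    qed
    show ?thesis unfolding L_def[symmetric]
    proof (intro exI conjI ballI impI)
      show "finite J" "J \<subseteq> I" by (fact J)+
      show "(\<lambda>i. c (b i)) \<in> J \<rightarrow> carrier L" using D(3) J(2) by auto
      fix x assume x: "x \<in> carrier X" and "\<pi> x = \<zero>\<^bsub>V\<^esub>"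
      then have xL: "x \<in> carrier L" by (simp add: Lc)
      have fx: "(\<lambda>i. f i x) \<in> I \<rightarrow> carrier H" using D(5) x by auto
      have "c x = c (lin_comb H X I (\<lambda>i. f i x) b)" using D(9)[OF x] by simp
      also have "\<dots> = lin_comb H L I (\<lambda>i. f i x) (\<lambda>i. c (b i))" by (rule c.lin_comb[OF fx D(2)])
      also have "\<dots> = lin_comb H L J (\<lambda>i. f i x) (\<lambda>i. c (b i))"
      proof -
        have "{i \<in> I. f i x \<noteq> \<zero>\<^bsub>H\<^esub>} = {i \<in> J. f i x \<noteq> \<zero>\<^bsub>H\<^esub>}" using f0 xL J(2) by blast
        then show ?thesis unfolding lin_comb_def by simp
      qed
      finally have "c x = lin_comb H L J (\<lambda>i. f i x) (\<lambda>i. c (b i))" .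
      moreover have "t (s x) = x \<oplus>\<^bsub>X\<^esub> c x"
      proof -
        have tx: "t (s x) \<in> carrier X" using HomD(1)[OF t(1) HomD(1)[OF s(1) x]] .
        then show ?thesis unfolding c_def using x by (metis \<pi>.M.M.a_lcomm \<pi>.M.M.a_inv_closed \<pi>.M.M.r_neg \<pi>.M.M.r_zero a_minus_def)
      qed
      ultimately show "t (s x) = x \<oplus>\<^bsub>X\<^esub> lin_comb H L J (\<lambda>i. f i x) (\<lambda>i. c (b i))" by simp
    qed
  qed
  obtain J w where J: "finite J" "J \<subseteq> I" and w: "w \<in> J \<rightarrow> carrier L"
    and ba: "\<And>x. x \<in> carrier L \<Longrightarrow> t (s x) = x \<oplus>\<^bsub>L\<^esub> lin_comb H L J (\<lambda>i. f i x) w"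
    using factor[OF X h(1,3) XM' s t fgL(1)[unfolded L_def]] unfolding L_def by auto
  obtain J' w' where J': "finite J'" "J' \<subseteq> I'" and w': "w' \<in> J' \<rightarrow> carrier L'"
    and ab: "\<And>x. x \<in> carrier L' \<Longrightarrow> s (t x) = x \<oplus>\<^bsub>L'\<^esub> lin_comb H L' J' (\<lambda>i. f' i x) w'"
    using factor[OF X' h(3,1) XM t s fgL(2)[unfolded L'_def]] unfolding L'_def by auto
  have sL: "s \<in> Hom H L L'" unfolding L_def L'_def
    using Hom_restrict[OF s(1), of "{x \<in> carrier X. \<pi> x = \<zero>\<^bsub>V\<^esub>}"] HomD(1)[OF s(1)] s(2)
    by (intro Hom_cod_restrict) auto
  have tL: "t \<in> Hom H L' L" unfolding L_def L'_def
    using Hom_restrict[OF t(1), of "{x \<in> carrier X'. \<pi>' x = \<zero>\<^bsub>V\<^esub>}"] HomD(1)[OF t(1)] t(2)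
    by (intro Hom_cod_restrict) auto
  have fL: "f i \<in> Hom H L (regular H)" if "i \<in> J" for i
    unfolding L_def using Hom_restrict[OF dual_basisD(4)[OF X]] that J(2) by auto
  have fL': "f' i \<in> Hom H L' (regular H)" if "i \<in> J'" for i
    unfolding L'_def using Hom_restrict[OF dual_basisD(4)[OF X']] that J'(2) by auto
  have LM: "left_module H L" "left_module H L'" using fgL unfolding fg_module_def by auto
  show ?thesis unfolding L_def[symmetric] L'_def[symmetric]
    by (rule stable_iso_sdim[OF LM(1) fgL(1) LM(2) fgL(2) sL tL J(1) fL w ba J'(1) fL' w' ab])
qed

text \<open>
  The horseshoe lemma: with a lift \<open>l : X' \<rightarrow> W\<close> of \<open>\<pi>'\<close>, the map \<open>(x, y) \<mapsto> i(\<pi> x) + l y\<close> is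
  surjective, and its kernel is an extension of the kernel of \<open>\<pi>'\<close> by the kernel of \<open>\<pi>\<close>.
\<close>

lemma ker_dim_extension:
  assumes X: "dual_basis H X I b f" and X': "dual_basis H X' I' b' f'"
    and \<pi>: "fin_kernel_cover X \<pi> V" and \<pi>': "fin_kernel_cover X' \<pi>' V''" and W: "left_module H W"
    and i: "i \<in> Hom H V W" "inj_on i (carrier V)" and g: "g \<in> Hom H W V''" "g ` carrier W = carrier V''"
    and exact: "i ` carrier V = {x \<in> carrier W. g x = \<zero>\<^bsub>V''\<^esub>}"
  shows "\<exists>\<rho>. fin_kernel_cover (direct_sum X X') \<rho> W \<and>
     ker_dim (direct_sum X X') \<rho> W = ker_dim X \<pi> V + ker_dim X' \<pi>' V''"
proof -
  have V: "left_module H V" "left_module H V''" using \<pi> \<pi>' unfolding fin_kernel_cover_def by auto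
  have h: "\<pi> \<in> Hom H X V" "\<pi> ` carrier X = carrier V" "\<pi>' \<in> Hom H X' V''" "\<pi>' ` carrier X' = carrier V''"
    using \<pi> \<pi>' unfolding fin_kernel_cover_def by auto
  note XM = dual_basisD(1)[OF X] and XM' = dual_basisD(1)[OF X']
  obtain l where l: "l \<in> Hom H X' W" and gl: "\<And>x. x \<in> carrier X' \<Longrightarrow> g (l x) = \<pi>' x"
    using dual_basis_lift[OF X' W V(2) g(1) _ h(3)] g(2) by auto
  interpret \<pi>: left_module_hom H X V \<pi> by (rule left_module_homI[OF XM V(1) h(1)])
  interpret \<pi>': left_module_hom H X' V'' \<pi>' by (rule left_module_homI[OF XM' V(2) h(3)])
  interpret i: left_module_hom H V W i by (rule left_module_homI[OF V(1) W i(1)])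
  interpret g: left_module_hom H W V'' g by (rule left_module_homI[OF W V(2) g(1)])
  interpret l: left_module_hom H X' W l by (rule left_module_homI[OF XM' W l])
  let ?S = "direct_sum X X'"
  let ?\<rho> = "\<lambda>z. i (\<pi> (fst z)) \<oplus>\<^bsub>W\<^esub> l (snd z)"
  have S: "left_module H ?S" by (rule direct_sum_left_module[OF XM XM'])
  have \<rho>: "?\<rho> \<in> Hom H ?S W"
    by (intro Hom_add W Hom_comp[OF Hom_comp[OF direct_sum_proj_hom(1) h(1)] i(1)] Hom_comp[OF direct_sum_proj_hom(2) l])
  interpret \<rho>: left_module_hom H ?S W ?\<rho> by (rule left_module_homI[OF S W \<rho>])
  have gi: "g (i v) = \<zero>\<^bsub>V''\<^esub>" if "v \<in> carrier V" for v using exact that by blast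
  have lift: "\<exists>x\<in>carrier X. i (\<pi> x) = w" if w: "w \<in> carrier W" "g w = \<zero>\<^bsub>V''\<^esub>" for w
  proof -
    have "w \<in> i ` (\<pi> ` carrier X)" using w unfolding exact h(2) by blast
    then show ?thesis by blast
  qed
  have sur: "?\<rho> ` carrier ?S = carrier W"
  proof
    show "carrier W \<subseteq> ?\<rho> ` carrier ?S"
    proof
      fix w assume w: "w \<in> carrier W"
      then have "g w \<in> \<pi>' ` carrier X'" using h(4) g.closed by blast
      then obtain y where y: "y \<in> carrier X'" "\<pi>' y = g w" by force
      then have "g (w \<ominus>\<^bsub>W\<^esub> l y) = \<zero>\<^bsub>V''\<^esub>" using w gl by (simp add: a_minus_def \<pi>'.N.M.r_neg)
      then obtain x where x: "x \<in> carrier X" "i (\<pi> x) = w \<ominus>\<^bsub>W\<^esub> l y" using lift[of "w \<ominus>\<^bsub>W\<^esub> l y"] w y by auto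
      have "w = ?\<rho> (x, y)" using x y w by (simp add: a_minus_def i.N.M.a_assoc i.N.M.l_neg)
      then show "w \<in> ?\<rho> ` carrier ?S" using x y by (intro image_eqI[of _ _ "(x, y)"]) auto
    qed
  qed (use \<rho>.closed in blast)
  define Z where "Z = ?S\<lparr>carrier := {z \<in> carrier ?S. ?\<rho> z = \<zero>\<^bsub>W\<^esub>}\<rparr>"
  define L where "L = X\<lparr>carrier := {x \<in> carrier X. \<pi> x = \<zero>\<^bsub>V\<^esub>}\<rparr>"
  define L' where "L' = X'\<lparr>carrier := {x \<in> carrier X'. \<pi>' x = \<zero>\<^bsub>V''\<^esub>}\<rparr>"
  have fgL: "fg_module H L" "fg_module H L'" using \<pi> \<pi>' unfolding fin_kernel_cover_def L_def L'_def by auto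
  have ZM: "left_module H Z" "left_module H L" "left_module H L'"
    unfolding Z_def L_def L'_def
    by (intro \<rho>.M.submodule_left_module \<rho>.ker_submodule \<pi>.M.submodule_left_module \<pi>.ker_submodule
        \<pi>'.M.submodule_left_module \<pi>'.ker_submodule)+
  have Zc: "z \<in> carrier Z \<longleftrightarrow> fst z \<in> carrier X \<and> snd z \<in> carrier X' \<and> ?\<rho> z = \<zero>\<^bsub>W\<^esub>" for z
    by (cases z) (auto simp: Z_def)
  have snd: "snd \<in> Hom H Z L'" unfolding Z_def L'_def
  proof (intro Hom_cod_restrict Hom_restrict)
    show "snd \<in> Hom H ?S X'" by (rule direct_sum_proj_hom(2))
    fix z assume "z \<in> carrier (?S\<lparr>carrier := {z \<in> carrier ?S. ?\<rho> z = \<zero>\<^bsub>W\<^esub>}\<rparr>)"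
    then have z: "fst z \<in> carrier X" "snd z \<in> carrier X'" "?\<rho> z = \<zero>\<^bsub>W\<^esub>" by auto
    have "g (?\<rho> z) = \<pi>' (snd z)" using z(1,2) gi gl by simp
    then show "snd z \<in> {x \<in> carrier X'. \<pi>' x = \<zero>\<^bsub>V''\<^esub>}" using z by simp
  qed auto
  have snd_sur: "snd ` carrier Z = carrier L'"
  proof
    show "snd ` carrier Z \<subseteq> carrier L'" using HomD(1)[OF snd] by blast
    show "carrier L' \<subseteq> snd ` carrier Z"
    proof
      fix y assume "y \<in> carrier L'"
      then have y: "y \<in> carrier X'" "\<pi>' y = \<zero>\<^bsub>V''\<^esub>" by (auto simp: L'_def)
      then obtain x where x: "x \<in> carrier X" "i (\<pi> x) = \<ominus>\<^bsub>W\<^esub> l y" using lift[of "\<ominus>\<^bsub>W\<^esub> l y"] gl by auto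
      then have "(x, y) \<in> carrier Z" using y by (simp add: Zc i.N.M.l_neg)
      then show "y \<in> snd ` carrier Z" by force
    qed
  qed
  define N where "N = Z\<lparr>carrier := {z \<in> carrier Z. snd z = \<zero>\<^bsub>L'\<^esub>}\<rparr>"
  interpret sn: left_module_hom H Z L' snd by (rule left_module_homI[OF ZM(1,3) snd])
  have N: "left_module H N" unfolding N_def by (rule sn.M.submodule_left_module[OF sn.ker_submodule])
  have i0: "i v = \<zero>\<^bsub>W\<^esub> \<longleftrightarrow> v = \<zero>\<^bsub>V\<^esub>" if "v \<in> carrier V" for v using i(2) that i.inj_on_iff by auto
  have Nc: "z \<in> carrier N \<longleftrightarrow> fst z \<in> carrier L \<and> snd z = \<zero>\<^bsub>X'\<^esub>" for z
    using i0[OF \<pi>.closed, of "fst z"] by (auto simp: N_def Zc L_def L'_def)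
  have inj: "(\<lambda>x. (x, \<zero>\<^bsub>X'\<^esub>)) \<in> Hom H L N"
    by (rule HomI) (auto simp: Nc, auto simp: N_def Z_def L_def)
  have bij: "bij_betw (\<lambda>x. (x, \<zero>\<^bsub>X'\<^esub>)) (carrier L) (carrier N)"
    by (rule bij_betwI[where g = fst]) (auto simp: Nc prod_eq_iff)
  have fgN: "fg_module H N" using fg_module_image[OF ZM(2) N inj _ fgL(1)] bij unfolding bij_betw_def by blast
  have fgZ: "fg_module H Z"
    using fg_module_extension[OF ZM(1,3) snd snd_sur _ fgL(2)] fgN unfolding N_def by blast
  have "sdim Z = sdim L' + sdim N" using sdim_surj[OF ZM(1,3) fgZ snd snd_sur] by (simp add: N_def)
  also have "sdim N = sdim L" using sdim_bij[OF ZM(2) N fgL(1) inj bij] by simp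
  finally show ?thesis using fgZ \<rho> sur W unfolding fin_kernel_cover_def Z_def L_def L'_def
    by (intro exI[of _ ?\<rho>]) simp
qed

lemma ker_dim_finite:
  assumes V: "left_module H V" "fg_module H V"
  shows "\<exists>(X :: ('h, nat \<Rightarrow> 'h) module) (I :: nat set) b f \<pi>. dual_basis H X I b f \<and> fin_kernel_cover X \<pi> V \<and>
    proj_dim_gcd K H dvd ker_dim X \<pi> V + sdim V"
proof -
  obtain m \<pi> where \<pi>: "\<pi> \<in> Hom H (free_module H {..<m::nat}) V" "\<pi> ` carrier (free_module H {..<m}) = carrier V"
    using fg_module_cover[OF V(2)] by blast
  let ?X = "free_module H {..<m}"
  note D = free_module_dual_basis[OF H.ring_axioms, of "{..<m}"]
  note DM = dual_basisD(1)[OF D]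
  interpret \<pi>: left_module_hom H ?X V \<pi> by (rule left_module_homI[OF DM V(1) \<pi>(1)])
  note X = finite_dual_basis_dim[OF D finite_lessThan]
  have "fin_kernel_cover ?X \<pi> V" unfolding fin_kernel_cover_def
    using V(1) \<pi> fg_submodule[OF DM X(1) \<pi>.ker_submodule] by blast
  moreover have "proj_dim_gcd K H dvd ker_dim ?X \<pi> V + sdim V"
    using sdim_surj[OF DM V(1) X(1) \<pi>] X(2) by (simp add: add.commute)
  ultimately show ?thesis using D by blast
qed

text \<open>
  The free module of rank one has positive dimension.
\<close>

lemma proj_dim_gcd_pos:
  assumes "\<one>\<^bsub>H\<^esub> \<noteq> \<zero>\<^bsub>H\<^esub>" shows "proj_dim_gcd K H \<noteq> 0"
proof -
  let ?F = "free_module H {0::nat}"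
  note D = free_module_dual_basis[OF H.ring_axioms, of "{0::nat}"]
  note X = finite_dual_basis_dim[OF D, simplified]
  interpret F: left_module H ?F by (rule dual_basisD(1)[OF D])
  interpret FK: left_module K "sr ?F" by (rule sr_left_module[OF F.left_module_axioms])
  have "free_basis H 0 \<in> carrier ?F" using H.ring_axioms by simp
  moreover have "free_basis H (0::nat) \<noteq> \<zero>\<^bsub>?F\<^esub>" using assms by (auto simp: free_basis_def dest: fun_cong[of _ _ 0])
  ultimately have "{\<zero>\<^bsub>sr ?F\<^esub>} \<noteq> carrier (sr ?F)" by auto
  then have "sdim ?F > 0"
    using dim_strict[OF field FK.left_module_axioms _ FK.zero_submodule] X(1) fg_sr_iff[OF F.left_module_axioms]
    by linarith
  then show ?thesis using X(2) by auto
qed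

end

section \<open>Complements of submodules\<close>

lemma (in abelian_group) add_eq_minus:
  assumes "u \<oplus> v = w" "u \<in> carrier G" "v \<in> carrier G" shows "w \<ominus> u = v" "w \<ominus> v = u"
  using assms by (auto simp: a_minus_def a_assoc r_neg) (metis a_comm a_inv_closed r_neg1 r_neg2)

context left_module
begin

lemma submodule_of_submodule:
  assumes "Module.submodule N R M"
  shows "Module.submodule L R (M\<lparr>carrier := N\<rparr>) \<longleftrightarrow> Module.submodule L R M \<and> L \<subseteq> N"
proof -
  interpret N: left_module R "M\<lparr>carrier := N\<rparr>" by (rule submodule_left_module[OF assms])
  show ?thesis
  proof
    assume L: "Module.submodule L R (M\<lparr>carrier := N\<rparr>)"
    note D = N.submoduleD[OF L]
    have "L \<subseteq> N" using D(1) by simp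
    moreover have "Module.submodule L R M"
    proof (rule submoduleI)
      show "L \<subseteq> carrier M" using \<open>L \<subseteq> N\<close> submoduleD(1)[OF assms] by blast
    qed (use D(2-4) in auto)
    ultimately show "Module.submodule L R M \<and> L \<subseteq> N" by blast
  next
    assume L: "Module.submodule L R M \<and> L \<subseteq> N"
    then show "Module.submodule L R (M\<lparr>carrier := N\<rparr>)"
      using submoduleD(2-4)[of L] by (intro N.submoduleI) auto
  qed
qed

lemma cyclic_submodule:
  assumes m: "m \<in> carrier M"
  shows "Module.submodule {a \<odot>\<^bsub>M\<^esub> m | a. a \<in> carrier R} R M" (is "Module.submodule ?C R M")
    and "m \<in> {a \<odot>\<^bsub>M\<^esub> m | a. a \<in> carrier R}"
proof -
  show "Module.submodule ?C R M"
  proof (rule submoduleI)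
    show "\<zero>\<^bsub>M\<^esub> \<in> ?C" using m by (intro CollectI exI[of _ "\<zero>\<^bsub>R\<^esub>"]) simp
    show "x \<oplus>\<^bsub>M\<^esub> y \<in> ?C" if xy: "x \<in> ?C" "y \<in> ?C" for x y
    proof -
      obtain a b where "a \<in> carrier R" "b \<in> carrier R" "x = a \<odot>\<^bsub>M\<^esub> m" "y = b \<odot>\<^bsub>M\<^esub> m" using xy by blast
      then show ?thesis using m by (intro CollectI exI[of _ "a \<oplus>\<^bsub>R\<^esub> b"]) (simp add: lsmult_l_distr)
    qed
    show "c \<odot>\<^bsub>M\<^esub> x \<in> ?C" if cx: "c \<in> carrier R" "x \<in> ?C" for c x
    proof -
      obtain a where "a \<in> carrier R" "x = a \<odot>\<^bsub>M\<^esub> m" using cx by blast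
      then show ?thesis using m cx(1) by (intro CollectI exI[of _ "c \<otimes>\<^bsub>R\<^esub> a"]) (simp add: lsmult_assoc)
    qed
  qed (use m in auto)
  show "m \<in> ?C" using m by (intro CollectI exI[of _ "\<one>\<^bsub>R\<^esub>"]) simp
qed

lemma direct_projection:
  assumes A: "Module.submodule A R M" and B: "Module.submodule B R M" and AB: "A \<inter> B \<subseteq> {\<zero>\<^bsub>M\<^esub>}"
    and sum: "submodule_plus M A B = carrier M"
  shows "\<exists>p \<in> Hom R M (M\<lparr>carrier := B\<rparr>). (\<forall>x\<in>B. p x = x) \<and> (\<forall>x\<in>carrier M. x \<ominus>\<^bsub>M\<^esub> p x \<in> A)"
proof -
  note DA = submoduleD[OF A] and DB = submoduleD[OF B]
  have ex: "\<exists>b\<in>B. x \<ominus>\<^bsub>M\<^esub> b \<in> A" if x: "x \<in> carrier M" for x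
  proof -
    have "x \<in> submodule_plus M A B" using x sum by simp
    then obtain a b where ab: "a \<in> A" "b \<in> B" "x = a \<oplus>\<^bsub>M\<^esub> b" unfolding submodule_plus_def by blast
    then have "x \<ominus>\<^bsub>M\<^esub> b = a" using DA(7) DB(7) by (simp add: a_minus_def M.a_assoc M.r_neg)
    then show ?thesis using ab by blast
  qed
  have uniq: "b = b'" if "b \<in> B" "b' \<in> B" "x \<ominus>\<^bsub>M\<^esub> b \<in> A" "x \<ominus>\<^bsub>M\<^esub> b' \<in> A" "x \<in> carrier M" for x b b'
  proof -
    have c: "b \<in> carrier M" "b' \<in> carrier M" using that DB(7) by auto
    have "(x \<ominus>\<^bsub>M\<^esub> b') \<ominus>\<^bsub>M\<^esub> (x \<ominus>\<^bsub>M\<^esub> b) = b \<ominus>\<^bsub>M\<^esub> b'"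
    proof (rule M.add_eq_minus(1))
      show "(x \<ominus>\<^bsub>M\<^esub> b) \<oplus>\<^bsub>M\<^esub> (b \<ominus>\<^bsub>M\<^esub> b') = x \<ominus>\<^bsub>M\<^esub> b'"
        using c that(5) by (simp add: a_minus_def M.a_assoc M.r_neg1)
    qed (use c that(5) in auto)
    then have "b \<ominus>\<^bsub>M\<^esub> b' \<in> A \<inter> B" using DA(6)[OF that(4,3)] DB(6)[OF that(1,2)] by simp
    then have "b \<ominus>\<^bsub>M\<^esub> b' = \<zero>\<^bsub>M\<^esub>" using AB by blast
    then show ?thesis using c by simp
  qed
  define p where "p = (\<lambda>x. SOME b. b \<in> B \<and> x \<ominus>\<^bsub>M\<^esub> b \<in> A)"
  have p: "p x \<in> B" "x \<ominus>\<^bsub>M\<^esub> p x \<in> A" if "x \<in> carrier M" for x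
    using someI_ex[of "\<lambda>b. b \<in> B \<and> x \<ominus>\<^bsub>M\<^esub> b \<in> A"] ex[OF that] unfolding p_def by blast+
  have p_eq: "p x = b" if "x \<in> carrier M" "b \<in> B" "x \<ominus>\<^bsub>M\<^esub> b \<in> A" for x b
    using uniq[OF p(1) that(2) p(2) that(3)] that(1) by blast
  have "p \<in> Hom R M (M\<lparr>carrier := B\<rparr>)"
  proof (rule HomI)
    fix x y assume xy: "x \<in> carrier M" "y \<in> carrier M"
    have c: "p x \<in> carrier M" "p y \<in> carrier M" using p(1) DB(7) xy by auto
    have "(x \<oplus>\<^bsub>M\<^esub> y) \<ominus>\<^bsub>M\<^esub> (p x \<oplus>\<^bsub>M\<^esub> p y) = (x \<ominus>\<^bsub>M\<^esub> p x) \<oplus>\<^bsub>M\<^esub> (y \<ominus>\<^bsub>M\<^esub> p y)"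
      using c xy by (simp add: a_minus_def M.minus_add M.a_ac)
    then show "p (x \<oplus>\<^bsub>M\<^esub> y) = p x \<oplus>\<^bsub>M\<lparr>carrier := B\<rparr>\<^esub> p y"
      using p_eq[of "x \<oplus>\<^bsub>M\<^esub> y" "p x \<oplus>\<^bsub>M\<^esub> p y"] xy p DA(3) DB(3) by simp
  next
    fix a x assume ax: "a \<in> carrier R" "x \<in> carrier M"
    have c: "p x \<in> carrier M" using p(1) DB(7) ax by auto
    have "a \<odot>\<^bsub>M\<^esub> x \<ominus>\<^bsub>M\<^esub> a \<odot>\<^bsub>M\<^esub> p x \<in> A"
      using DA(4)[OF ax(1) p(2)[OF ax(2)]] c ax by (simp add: lsmult_minus_distr)
    then show "p (a \<odot>\<^bsub>M\<^esub> x) = a \<odot>\<^bsub>M\<lparr>carrier := B\<rparr>\<^esub> p x"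
      using p_eq[of "a \<odot>\<^bsub>M\<^esub> x" "a \<odot>\<^bsub>M\<^esub> p x"] ax p DB(4) by simp
  qed (use p in auto)
  moreover have "p x = x" if "x \<in> B" for x
    using p_eq[of x x] that DB(7) DA(2) by (simp add: a_minus_def M.r_neg)
  ultimately show ?thesis using p(2) by blast
qed

text \<open>
  The hypothesis \<open>idem\<close> holds for \<open>J = rad\<close> over a finite-dimensional algebra, where it says that
  \<open>H / J\<close> is semisimple, and for \<open>J = {\<zero>}\<close> over a field.  Choose \<open>N'\<close> maximal with \<open>B \<subseteq> N'\<close> and
  \<open>N \<inter> N' \<subseteq> B\<close>.  If \<open>m\<close> is not in \<open>N + N'\<close>, let \<open>e\<close> generate modulo \<open>J\<close> the left ideal of the \<open>a\<close>
  with \<open>a m\<close> in \<open>N + N'\<close>, and put \<open>m' = m - e m\<close>.  If \<open>a m'\<close> is in \<open>N + N'\<close> then so is \<open>a m\<close>,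
  hence \<open>a - a e\<close> is in \<open>J\<close> and \<open>a m' = (a - a e) m\<close> is in \<open>B\<close>.  So \<open>N'\<close> can be enlarged by the
  multiples of \<open>m'\<close>.
\<close>

lemma relative_complement:
  assumes N: "Module.submodule N R M" and B: "Module.submodule B R M"
    and J: "\<And>j x. \<lbrakk>j \<in> J; x \<in> carrier M\<rbrakk> \<Longrightarrow> j \<odot>\<^bsub>M\<^esub> x \<in> B"
    and idem: "\<And>L. Module.submodule L R (regular R) \<Longrightarrow> \<exists>e\<in>L. \<forall>x\<in>L. x \<ominus>\<^bsub>R\<^esub> x \<otimes>\<^bsub>R\<^esub> e \<in> J"
  shows "\<exists>N'. Module.submodule N' R M \<and> B \<subseteq> N' \<and> N \<inter> N' \<subseteq> B \<and> submodule_plus M N N' = carrier M"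
proof -
  let ?A = "{N'. Module.submodule N' R M \<and> B \<subseteq> N' \<and> N \<inter> N' \<subseteq> B}"
  have "\<exists>N'\<in>?A. \<forall>X\<in>?A. N' \<subseteq> X \<longrightarrow> X = N'"
  proof (rule subset_Zorn_nonempty)
    show "?A \<noteq> {}" using B by blast
    fix C assume C: "C \<noteq> {}" "subset.chain ?A C"
    then have sub: "\<And>X. X \<in> C \<Longrightarrow> X \<in> ?A" and ch: "\<And>X Y. \<lbrakk>X \<in> C; Y \<in> C\<rbrakk> \<Longrightarrow> X \<subseteq> Y \<or> Y \<subseteq> X"
      unfolding subset_chain_def by blast+
    have "Module.submodule (\<Union>C) R M" by (rule submodule_Union_chain) (use sub ch C in auto)
    then show "\<Union>C \<in> ?A" using sub C(1) by blast
  qed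
  then obtain N' where "N' \<in> ?A" and mx: "\<forall>X\<in>?A. N' \<subseteq> X \<longrightarrow> X = N'" by (elim bexE)
  then have N': "Module.submodule N' R M" "B \<subseteq> N'" "N \<inter> N' \<subseteq> B" by simp_all
  have max: "X = N'" if "Module.submodule X R M" "B \<subseteq> X" "N \<inter> X \<subseteq> B" "N' \<subseteq> X" for X
    using mx that by simp
  let ?P = "submodule_plus M N N'"
  have P: "Module.submodule ?P R M" by (rule submodule_plus[OF N N'(1)])
  note DP = submoduleD[OF P] and DN = submoduleD[OF N] and DN' = submoduleD[OF N'(1)]
  have up: "N \<subseteq> ?P" "N' \<subseteq> ?P" using submodule_plus_upper[OF N N'(1)] by auto
  have "m \<in> ?P" if m: "m \<in> carrier M" for m
  proof (rule ccontr)
    assume mP: "m \<notin> ?P"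
    interpret G: left_module R "regular R" by (rule regular_left_module[OF R.ring_axioms])
    let ?L = "{a \<in> carrier R. a \<odot>\<^bsub>M\<^esub> m \<in> ?P}"
    have L: "Module.submodule ?L R (regular R)"
      by (rule G.submoduleI) (use m DP(2-4) in \<open>auto simp: lsmult_l_distr lsmult_assoc\<close>)
    obtain e where e: "e \<in> ?L" "\<And>x. x \<in> ?L \<Longrightarrow> x \<ominus>\<^bsub>R\<^esub> x \<otimes>\<^bsub>R\<^esub> e \<in> J" using idem[OF L] by blast
    then have ec: "e \<in> carrier R" "e \<odot>\<^bsub>M\<^esub> m \<in> ?P" by auto
    define m' where "m' = m \<ominus>\<^bsub>M\<^esub> e \<odot>\<^bsub>M\<^esub> m"
    have m'c: "m' \<in> carrier M" unfolding m'_def using m ec by simp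
    have m'P: "m' \<notin> ?P"
    proof
      assume "m' \<in> ?P"
      then have "m' \<oplus>\<^bsub>M\<^esub> e \<odot>\<^bsub>M\<^esub> m \<in> ?P" using DP(3) ec by blast
      then show False using mP m ec by (simp add: m'_def a_minus_def M.a_assoc M.l_neg)
    qed
    let ?C = "{a \<odot>\<^bsub>M\<^esub> m' | a. a \<in> carrier R}"
    note C = cyclic_submodule(1)[OF m'c]
    let ?X = "submodule_plus M N' ?C"
    note X = submodule_plus[OF N'(1) C] and upX = submodule_plus_upper[OF N'(1) C]
    have "N \<inter> ?X \<subseteq> B"
    proof
      fix n assume n: "n \<in> N \<inter> ?X"
      then obtain n' a where na: "n' \<in> N'" "a \<in> carrier R" "n = n' \<oplus>\<^bsub>M\<^esub> a \<odot>\<^bsub>M\<^esub> m'"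
        unfolding submodule_plus_def by blast
      have nc: "n \<in> carrier M" "n' \<in> carrier M" using n na DN(7) DN'(7) by auto
      have "n \<ominus>\<^bsub>M\<^esub> n' = a \<odot>\<^bsub>M\<^esub> m'" using na nc m'c by (intro M.add_eq_minus) auto
      moreover have "n \<ominus>\<^bsub>M\<^esub> n' \<in> ?P" using DP(6) n na(1) up by blast
      ultimately have am': "a \<odot>\<^bsub>M\<^esub> m' \<in> ?P" by simp
      have eq: "a \<odot>\<^bsub>M\<^esub> m' = a \<odot>\<^bsub>M\<^esub> m \<ominus>\<^bsub>M\<^esub> a \<odot>\<^bsub>M\<^esub> (e \<odot>\<^bsub>M\<^esub> m)"
        unfolding m'_def using m ec na by (simp add: lsmult_minus_distr)
      have "a \<odot>\<^bsub>M\<^esub> m = a \<odot>\<^bsub>M\<^esub> m' \<oplus>\<^bsub>M\<^esub> a \<odot>\<^bsub>M\<^esub> (e \<odot>\<^bsub>M\<^esub> m)"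
        unfolding eq using m ec na by (simp add: a_minus_def M.a_assoc M.l_neg)
      also have "\<dots> \<in> ?P" using am' DP(3) DP(4)[OF na(2) ec(2)] by blast
      finally have "a \<ominus>\<^bsub>R\<^esub> a \<otimes>\<^bsub>R\<^esub> e \<in> J" using e(2) na(2) by blast
      then have "(a \<ominus>\<^bsub>R\<^esub> a \<otimes>\<^bsub>R\<^esub> e) \<odot>\<^bsub>M\<^esub> m \<in> B" using J m by blast
      also have "(a \<ominus>\<^bsub>R\<^esub> a \<otimes>\<^bsub>R\<^esub> e) \<odot>\<^bsub>M\<^esub> m = a \<odot>\<^bsub>M\<^esub> m'"
        unfolding eq using m ec na by (simp add: a_minus_def lsmult_l_distr lsmult_l_minus lsmult_assoc)
      finally have "a \<odot>\<^bsub>M\<^esub> m' \<in> N'" using N'(2) by blast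
      then have "n \<in> N'" using na DN'(3) by blast
      then show "n \<in> B" using n N'(3) by blast
    qed
    then have "?X = N'" using max[OF X] upX(1) N'(2) by blast
    moreover have "m' \<in> ?C" by (rule cyclic_submodule(2)[OF m'c])
    ultimately have "m' \<in> N'" using upX(2) by blast
    then show False using m'P up by blast
  qed
  then have "?P = carrier M" using DP(1) by blast
  then show ?thesis using N' by blast
qed

text \<open>
  Fitting's decomposition for commuting \<open>e\<close> and \<open>g\<close> with \<open>e + g = 1\<close>.  Both statements reflect
  that \<open>e\<^sup>i\<close> and \<open>g\<^sup>j\<close> generate the unit ideal of the commutative ring generated by \<open>e\<close>; the
  induction on \<open>i + j\<close> expands \<open>x = e x + g x\<close>.
\<close>

lemma fitting_sum:
  assumes e: "e \<in> Hom R M M" and g: "g \<in> Hom R M M" and eg: "\<And>x. x \<in> carrier M \<Longrightarrow> x = e x \<oplus>\<^bsub>M\<^esub> g x"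
    and comm: "\<And>x. x \<in> carrier M \<Longrightarrow> e (g x) = g (e x)" and x: "x \<in> carrier M"
  shows "\<exists>a\<in>carrier M. \<exists>b\<in>carrier M. x = (e ^^ i) a \<oplus>\<^bsub>M\<^esub> (g ^^ j) b"
  using x
proof (induction "i + j" arbitrary: i j x)
  case 0
  then show ?case by (intro bexI[of _ x] bexI[of _ "\<zero>\<^bsub>M\<^esub>"]) auto
next
  case (Suc n)
  interpret e: left_module_hom R M M e by (rule left_module_homI[OF left_module_axioms left_module_axioms e])
  interpret g: left_module_hom R M M g by (rule left_module_homI[OF left_module_axioms left_module_axioms g])
  have pc: "(e ^^ k) x \<in> carrier M" "(g ^^ k) x \<in> carrier M" if "x \<in> carrier M" for k x
    using that by (induction k) auto
  have p0: "(e ^^ k) \<zero>\<^bsub>M\<^esub> = \<zero>\<^bsub>M\<^esub>" "(g ^^ k) \<zero>\<^bsub>M\<^esub> = \<zero>\<^bsub>M\<^esub>" for k by (induction k) auto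
  have padd: "(e ^^ k) (x \<oplus>\<^bsub>M\<^esub> y) = (e ^^ k) x \<oplus>\<^bsub>M\<^esub> (e ^^ k) y" "(g ^^ k) (x \<oplus>\<^bsub>M\<^esub> y) = (g ^^ k) x \<oplus>\<^bsub>M\<^esub> (g ^^ k) y"
    if "x \<in> carrier M" "y \<in> carrier M" for k x y
    using that pc by (induction k) auto
  have swap1: "e ((g ^^ k) x) = (g ^^ k) (e x)" if "x \<in> carrier M" for k x
    using that pc comm by (induction k) auto
  have swap2: "g ((e ^^ k) x) = (e ^^ k) (g x)" if "x \<in> carrier M" for k x
    using that pc comm[symmetric] by (induction k) auto
  show ?case
  proof (cases "i = 0 \<or> j = 0")
    case True
    then show ?thesis
    proof
      assume "i = 0"
      then show ?thesis using Suc.prems p0 by (intro bexI[of _ x] bexI[of _ "\<zero>\<^bsub>M\<^esub>"]) auto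
    next
      assume "j = 0"
      then show ?thesis using Suc.prems p0 by (intro bexI[of _ "\<zero>\<^bsub>M\<^esub>"] bexI[of _ x]) auto
    qed
  next
    case False
    then obtain i' j' where ij: "i = Suc i'" "j = Suc j'" by (metis not0_implies_Suc)
    obtain a b where ab: "a \<in> carrier M" "b \<in> carrier M" "x = (e ^^ i') a \<oplus>\<^bsub>M\<^esub> (g ^^ j) b"
      using Suc.hyps(1)[of i' j x] Suc.hyps(2) Suc.prems ij by auto
    obtain a' b' where ab': "a' \<in> carrier M" "b' \<in> carrier M" "x = (e ^^ i) a' \<oplus>\<^bsub>M\<^esub> (g ^^ j') b'"
      using Suc.hyps(1)[of i j' x] Suc.hyps(2) Suc.prems ij by auto
    have "e x = e ((e ^^ i') a) \<oplus>\<^bsub>M\<^esub> e ((g ^^ j) b)" using ab(1,2) pc by (subst ab(3)) simp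
    then have "e x = (e ^^ i) a \<oplus>\<^bsub>M\<^esub> (g ^^ j) (e b)" using swap1[OF ab(2)] by (simp add: ij(1))
    moreover have "g x = g ((e ^^ i) a') \<oplus>\<^bsub>M\<^esub> g ((g ^^ j') b')" using ab'(1,2) pc by (subst ab'(3)) simp
    then have "g x = (e ^^ i) (g a') \<oplus>\<^bsub>M\<^esub> (g ^^ j) b'" using swap2[OF ab'(1)] by (simp add: ij(2))
    ultimately have "x = ((e ^^ i) a \<oplus>\<^bsub>M\<^esub> (g ^^ j) (e b)) \<oplus>\<^bsub>M\<^esub> ((e ^^ i) (g a') \<oplus>\<^bsub>M\<^esub> (g ^^ j) b')"
      using eg[OF Suc.prems] by simp
    also have "\<dots> = (e ^^ i) (a \<oplus>\<^bsub>M\<^esub> g a') \<oplus>\<^bsub>M\<^esub> (g ^^ j) (e b \<oplus>\<^bsub>M\<^esub> b')"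
      using ab ab' pc by (simp add: padd M.a_ac)
    finally show ?thesis using ab ab' by (intro bexI[of _ "a \<oplus>\<^bsub>M\<^esub> g a'"] bexI[of _ "e b \<oplus>\<^bsub>M\<^esub> b'"]) auto
  qed
qed

lemma fitting_inter:
  assumes e: "e \<in> Hom R M M" and g: "g \<in> Hom R M M" and eg: "\<And>x. x \<in> carrier M \<Longrightarrow> x = e x \<oplus>\<^bsub>M\<^esub> g x"
    and comm: "\<And>x. x \<in> carrier M \<Longrightarrow> e (g x) = g (e x)" and x: "x \<in> carrier M"
    and "(e ^^ i) x = \<zero>\<^bsub>M\<^esub>" "(g ^^ j) x = \<zero>\<^bsub>M\<^esub>"
  shows "x = \<zero>\<^bsub>M\<^esub>"
  using x assms(6,7)
proof (induction "i + j" arbitrary: i j x)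
  case 0
  then show ?case by simp
next
  case (Suc n)
  interpret e: left_module_hom R M M e by (rule left_module_homI[OF left_module_axioms left_module_axioms e])
  interpret g: left_module_hom R M M g by (rule left_module_homI[OF left_module_axioms left_module_axioms g])
  have pc: "(e ^^ k) x \<in> carrier M" "(g ^^ k) x \<in> carrier M" if "x \<in> carrier M" for k x
    using that by (induction k) auto
  have swap1: "(g ^^ k) (e x) = e ((g ^^ k) x)" if "x \<in> carrier M" for k x
    using that pc comm by (induction k) auto
  have swap2: "(e ^^ k) (g x) = g ((e ^^ k) x)" if "x \<in> carrier M" for k x
    using that pc comm by (induction k) auto
  show ?case
  proof (cases "i = 0 \<or> j = 0")
    case True
    then show ?thesis using Suc.prems by auto
  next
    case False
    then obtain i' j' where ij: "i = Suc i'" "j = Suc j'" by (metis not0_implies_Suc)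
    have "(e ^^ i') (e x) = \<zero>\<^bsub>M\<^esub>" using Suc.prems(2) unfolding ij by (simp add: funpow_swap1)
    moreover have "(g ^^ j) (e x) = \<zero>\<^bsub>M\<^esub>" using swap1[OF Suc.prems(1)] Suc.prems(3) by simp
    ultimately have "e x = \<zero>\<^bsub>M\<^esub>" using Suc.hyps(1)[of i' j "e x"] Suc.hyps(2) Suc.prems(1) ij by simp
    moreover have "(g ^^ j') (g x) = \<zero>\<^bsub>M\<^esub>" using Suc.prems(3) unfolding ij by (simp add: funpow_swap1)
    moreover have "(e ^^ i) (g x) = \<zero>\<^bsub>M\<^esub>" using swap2[OF Suc.prems(1)] Suc.prems(2) by simp
    moreover have "g x = \<zero>\<^bsub>M\<^esub>" using Suc.hyps(1)[of i j' "g x"] Suc.hyps(2) Suc.prems(1) ij calculation(2,3) by simp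
    ultimately show ?thesis using eg[OF Suc.prems(1)] by simp
  qed
qed

end

section \<open>The radical of a finite-dimensional algebra\<close>

context fd_algebra
begin

abbreviation left_ideal :: "'h set \<Rightarrow> bool" where
  "left_ideal L \<equiv> Module.submodule L H (regular H)"

sublocale G: left_module H "regular H" by (rule regular_left_module[OF H.ring_axioms])

text \<open>
  Maximality is encoded by its consequence that every \<open>h\<close> outside \<open>m\<close> has a left inverse modulo
  \<open>m\<close>, which is the form in which it is verified and used.
\<close>

definition maximal_left_ideal :: "'h set \<Rightarrow> bool" where
  "maximal_left_ideal m \<longleftrightarrow> left_ideal m \<and> \<one>\<^bsub>H\<^esub> \<notin> m \<and>
     (\<forall>h\<in>carrier H - m. \<exists>h'\<in>carrier H. \<one>\<^bsub>H\<^esub> \<ominus>\<^bsub>H\<^esub> h' \<otimes>\<^bsub>H\<^esub> h \<in> m)"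

definition rad :: "'h set" where
  "rad = carrier H \<inter> \<Inter>{m. maximal_left_ideal m}"

lemma left_idealD:
  assumes "left_ideal L"
  shows "L \<subseteq> carrier H" "\<zero>\<^bsub>H\<^esub> \<in> L" "\<And>x y. \<lbrakk>x \<in> L; y \<in> L\<rbrakk> \<Longrightarrow> x \<oplus>\<^bsub>H\<^esub> y \<in> L"
    "\<And>a x. \<lbrakk>a \<in> carrier H; x \<in> L\<rbrakk> \<Longrightarrow> a \<otimes>\<^bsub>H\<^esub> x \<in> L" "\<And>x. x \<in> L \<Longrightarrow> x \<in> carrier H"
    "\<And>x. x \<in> L \<Longrightarrow> \<ominus>\<^bsub>H\<^esub> x \<in> L" "\<And>x y. \<lbrakk>x \<in> L; y \<in> L\<rbrakk> \<Longrightarrow> x \<ominus>\<^bsub>H\<^esub> y \<in> L"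
proof -
  note D = G.submoduleD[OF assms]
  show *: "L \<subseteq> carrier H" "\<zero>\<^bsub>H\<^esub> \<in> L" "\<And>x y. \<lbrakk>x \<in> L; y \<in> L\<rbrakk> \<Longrightarrow> x \<oplus>\<^bsub>H\<^esub> y \<in> L"
    "\<And>a x. \<lbrakk>a \<in> carrier H; x \<in> L\<rbrakk> \<Longrightarrow> a \<otimes>\<^bsub>H\<^esub> x \<in> L" "\<And>x. x \<in> L \<Longrightarrow> x \<in> carrier H"
    using D(1-4,7) by auto
  show **: "\<ominus>\<^bsub>H\<^esub> x \<in> L" if "x \<in> L" for x
    using *(4)[of "\<ominus>\<^bsub>H\<^esub> \<one>\<^bsub>H\<^esub>" x] *(5)[OF that] that by (simp add: H.l_minus)
  show "x \<ominus>\<^bsub>H\<^esub> y \<in> L" if "x \<in> L" "y \<in> L" for x y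
    using *(3)[OF that(1) **[OF that(2)]] by (simp add: a_minus_def)
qed

lemma left_idealI:
  assumes "L \<subseteq> carrier H" "\<zero>\<^bsub>H\<^esub> \<in> L" "\<And>x y. \<lbrakk>x \<in> L; y \<in> L\<rbrakk> \<Longrightarrow> x \<oplus>\<^bsub>H\<^esub> y \<in> L"
    "\<And>a x. \<lbrakk>a \<in> carrier H; x \<in> L\<rbrakk> \<Longrightarrow> a \<otimes>\<^bsub>H\<^esub> x \<in> L"
  shows "left_ideal L"
  using assms by (intro G.submoduleI) auto

lemma rad_left_ideal: "left_ideal rad"
proof (rule left_idealI)
  have m: "left_ideal m" if "maximal_left_ideal m" for m
    using that unfolding maximal_left_ideal_def by simp
  note D = left_idealD[OF m]
  show "\<zero>\<^bsub>H\<^esub> \<in> rad" "\<And>x y. \<lbrakk>x \<in> rad; y \<in> rad\<rbrakk> \<Longrightarrow> x \<oplus>\<^bsub>H\<^esub> y \<in> rad"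
    "\<And>a x. \<lbrakk>a \<in> carrier H; x \<in> rad\<rbrakk> \<Longrightarrow> a \<otimes>\<^bsub>H\<^esub> x \<in> rad"
    unfolding rad_def using D(2-4) by auto
qed (auto simp: rad_def)

text \<open>
  If \<open>m\<close> is a maximal left ideal that does not contain \<open>h\<close>, then so is the set of all \<open>x\<close> with
  \<open>x h\<close> in \<open>m\<close>.
\<close>

lemma rad_right_ideal:
  assumes j: "j \<in> rad" and h: "h \<in> carrier H" shows "j \<otimes>\<^bsub>H\<^esub> h \<in> rad"
proof -
  have jc: "j \<in> carrier H" using j rad_def by blast
  have "j \<otimes>\<^bsub>H\<^esub> h \<in> m" if m: "maximal_left_ideal m" for m
  proof (cases "h \<in> m")
    case True
    then show ?thesis using m jc left_idealD(4) unfolding maximal_left_ideal_def by blast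
  next
    case False
    have mL: "left_ideal m" using m unfolding maximal_left_ideal_def by blast
    note D = left_idealD[OF mL]
    let ?m = "{x \<in> carrier H. x \<otimes>\<^bsub>H\<^esub> h \<in> m}"
    have L: "left_ideal ?m" using h D(2-4) by (intro left_idealI) (auto simp: H.l_distr H.m_assoc)
    have "maximal_left_ideal ?m" unfolding maximal_left_ideal_def
    proof (intro conjI ballI L)
      show "\<one>\<^bsub>H\<^esub> \<notin> ?m" using False h by simp
      fix x assume "x \<in> carrier H - ?m"
      then have x: "x \<in> carrier H" "x \<otimes>\<^bsub>H\<^esub> h \<in> carrier H - m" using h by auto
      then obtain h' where h': "h' \<in> carrier H" "\<one>\<^bsub>H\<^esub> \<ominus>\<^bsub>H\<^esub> h' \<otimes>\<^bsub>H\<^esub> (x \<otimes>\<^bsub>H\<^esub> h) \<in> m"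
        using m unfolding maximal_left_ideal_def by blast
      have "h \<otimes>\<^bsub>H\<^esub> (\<one>\<^bsub>H\<^esub> \<ominus>\<^bsub>H\<^esub> h' \<otimes>\<^bsub>H\<^esub> (x \<otimes>\<^bsub>H\<^esub> h)) \<in> m" using D(4) h h' by blast
      also have "h \<otimes>\<^bsub>H\<^esub> (\<one>\<^bsub>H\<^esub> \<ominus>\<^bsub>H\<^esub> h' \<otimes>\<^bsub>H\<^esub> (x \<otimes>\<^bsub>H\<^esub> h)) = (\<one>\<^bsub>H\<^esub> \<ominus>\<^bsub>H\<^esub> (h \<otimes>\<^bsub>H\<^esub> h') \<otimes>\<^bsub>H\<^esub> x) \<otimes>\<^bsub>H\<^esub> h"
        using h h' x by (simp add: a_minus_def H.l_distr H.r_distr H.m_assoc H.l_minus H.r_minus)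
      finally show "\<exists>h'\<in>carrier H. \<one>\<^bsub>H\<^esub> \<ominus>\<^bsub>H\<^esub> h' \<otimes>\<^bsub>H\<^esub> x \<in> ?m"
        using h h' x by (intro bexI[of _ "h \<otimes>\<^bsub>H\<^esub> h'"]) auto
    qed
    then show ?thesis using j unfolding rad_def by blast
  qed
  then show ?thesis using jc h unfolding rad_def by blast
qed

lemma sdim_less:
  assumes W: "left_module H W" "fg_module H W" and N: "Module.submodule N H W" "Module.submodule N' H W" "N \<subset> N'"
  shows "sdim (W\<lparr>carrier := N\<rparr>) < sdim (W\<lparr>carrier := N'\<rparr>)"
proof -
  interpret W: left_module H W by (rule W(1))
  let ?W = "W\<lparr>carrier := N'\<rparr>"
  have M: "left_module H ?W" by (rule W.submodule_left_module[OF N(2)])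
  have "Module.submodule N H ?W" using W.submodule_of_submodule[OF N(2)] N by blast
  then have "Module.submodule N K (sr ?W)" using sr_submodule M by blast
  moreover have "fg_module K (sr ?W)" using fg_submodule[OF W N(2)] fg_sr_iff[OF M] by blast
  ultimately show ?thesis using dim_strict[OF field sr_left_module[OF M]] N(3) by (auto simp: sr_sub)
qed

lemma fg_regular: "fg_module H (regular H)"
proof -
  have "N = carrier H" if "left_ideal N" "\<one>\<^bsub>H\<^esub> \<in> N" for N
  proof
    show "carrier H \<subseteq> N" using left_idealD(4)[OF that(1) _ that(2)] by auto
  qed (use left_idealD(1) that in auto)
  then show ?thesis unfolding fg_module_def by (intro conjI exI[of _ "{\<one>\<^bsub>H\<^esub>}"]) (auto simp: G.left_module_axioms)
qed

text \<open>
  Let \<open>L'\<close> be of minimal dimension with \<open>L + L' = H\<close>.  If a maximal left ideal \<open>m\<close> did not contain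
  \<open>L \<inter> L'\<close>, then \<open>L' \<inter> m\<close> would be a smaller such left ideal.  So \<open>L \<inter> L'\<close> is contained in the
  radical.  Write \<open>1 = e + e'\<close> with \<open>e\<close> in \<open>L\<close> and \<open>e'\<close> in \<open>L'\<close>.  For \<open>x\<close> in \<open>L\<close>, the element
  \<open>x - x e = x e'\<close> is in \<open>L \<inter> L'\<close>.
\<close>

lemma idempotent_modulo_rad:
  assumes L: "left_ideal L" shows "\<exists>e\<in>L. \<forall>x\<in>L. x \<ominus>\<^bsub>H\<^esub> x \<otimes>\<^bsub>H\<^esub> e \<in> rad"
proof -
  let ?P = "\<lambda>L'. left_ideal L' \<and> submodule_plus (regular H) L L' = carrier H"
  have "submodule_plus (regular H) L (carrier H) = carrier H"
    using G.submodule_plus_upper(2)[OF L G.carrier_submodule] G.submoduleD(1)[OF G.submodule_plus[OF L G.carrier_submodule]] by simp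
  then have "?P (carrier H)" using G.carrier_submodule by simp
  then obtain L' where L': "?P L'" and min: "\<And>L''. ?P L'' \<Longrightarrow> sdim ((regular H)\<lparr>carrier := L'\<rparr>) \<le> sdim ((regular H)\<lparr>carrier := L''\<rparr>)"
    using ex_has_least_nat[of ?P "carrier H" "\<lambda>L. sdim ((regular H)\<lparr>carrier := L\<rparr>)"] by blast
  then have L'i: "left_ideal L'" by blast
  note DL = left_idealD[OF L] and DL' = left_idealD[OF L'i]
  have sub: "x \<in> m" if x: "x \<in> L" "x \<in> L'" and m: "maximal_left_ideal m" for x m
  proof (rule ccontr)
    assume xm: "x \<notin> m"
    have mL: "left_ideal m" using m unfolding maximal_left_ideal_def by blast
    note D = left_idealD[OF mL]
    obtain h' where h': "h' \<in> carrier H" "\<one>\<^bsub>H\<^esub> \<ominus>\<^bsub>H\<^esub> h' \<otimes>\<^bsub>H\<^esub> x \<in> m"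
      using m xm x DL(5) unfolding maximal_left_ideal_def by blast
    let ?L = "L' \<inter> m"
    have Li: "left_ideal ?L" by (rule G.submodule_Int[OF L'i mL])
    note PL = G.submodule_plus[OF L Li] and up = G.submodule_plus_upper[OF L Li]
    have "L' \<subseteq> submodule_plus (regular H) L ?L"
    proof
      fix y assume y: "y \<in> L'"
      let ?a = "y \<otimes>\<^bsub>H\<^esub> (h' \<otimes>\<^bsub>H\<^esub> x)"
      have yc: "y \<in> carrier H" "x \<in> carrier H" using y x DL' by auto
      have a: "?a \<in> L" "?a \<in> L'" using DL(4) DL'(4) x h' yc by auto
      have "y \<ominus>\<^bsub>H\<^esub> ?a = y \<otimes>\<^bsub>H\<^esub> (\<one>\<^bsub>H\<^esub> \<ominus>\<^bsub>H\<^esub> h' \<otimes>\<^bsub>H\<^esub> x)"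
        using yc h' by (simp add: a_minus_def H.r_distr H.r_minus)
      then have "y \<ominus>\<^bsub>H\<^esub> ?a \<in> m" using D(4) h' yc by simp
      then have "y \<ominus>\<^bsub>H\<^esub> ?a \<in> ?L" using a y DL'(7) by blast
      moreover have "y = ?a \<oplus>\<^bsub>H\<^esub> (y \<ominus>\<^bsub>H\<^esub> ?a)" using yc h' by (simp add: a_minus_def H.a_lcomm H.r_neg)
      ultimately show "y \<in> submodule_plus (regular H) L ?L" using a unfolding submodule_plus_def by auto
    qed
    then have "submodule_plus (regular H) L L' \<subseteq> submodule_plus (regular H) L ?L"
      using G.submodule_plus_least[OF PL up(1)] by blast
    then have "?P ?L" using L' Li G.submoduleD(1)[OF PL] by auto
    then have "sdim ((regular H)\<lparr>carrier := L'\<rparr>) \<le> sdim ((regular H)\<lparr>carrier := ?L\<rparr>)" by (rule min)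
    moreover have "?L \<subset> L'" using x xm by blast
    ultimately show False using sdim_less[OF G.left_module_axioms fg_regular Li L'i] by simp
  qed
  have "\<one>\<^bsub>H\<^esub> \<in> submodule_plus (regular H) L L'" using L' by simp
  then obtain e e' where e: "e \<in> L" "e' \<in> L'" "\<one>\<^bsub>H\<^esub> = e \<oplus>\<^bsub>H\<^esub> e'" unfolding submodule_plus_def by auto
  have "x \<ominus>\<^bsub>H\<^esub> x \<otimes>\<^bsub>H\<^esub> e \<in> rad" if x: "x \<in> L" for x
  proof -
    have c: "x \<in> carrier H" "e \<in> carrier H" "e' \<in> carrier H" using x e DL DL' by auto
    have "x = x \<otimes>\<^bsub>H\<^esub> (e \<oplus>\<^bsub>H\<^esub> e')" unfolding e(3)[symmetric] using c by simp
    then have "x = x \<otimes>\<^bsub>H\<^esub> e \<oplus>\<^bsub>H\<^esub> x \<otimes>\<^bsub>H\<^esub> e'" using c by (simp add: H.r_distr)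
    then have "x \<ominus>\<^bsub>H\<^esub> x \<otimes>\<^bsub>H\<^esub> e = x \<otimes>\<^bsub>H\<^esub> e'"
      using c by (intro H.add_eq_minus(1)) auto
    moreover have "x \<ominus>\<^bsub>H\<^esub> x \<otimes>\<^bsub>H\<^esub> e \<in> L" using DL(7) x DL(4) c e by blast
    moreover have "x \<otimes>\<^bsub>H\<^esub> e' \<in> L'" using DL'(4) c e by blast
    ultimately have "x \<otimes>\<^bsub>H\<^esub> e' \<in> m" if "maximal_left_ideal m" for m
      using sub[OF _ _ that, of "x \<otimes>\<^bsub>H\<^esub> e'"] by simp
    then have "x \<otimes>\<^bsub>H\<^esub> e' \<in> rad" unfolding rad_def using c by simp
    then show ?thesis using \<open>x \<ominus>\<^bsub>H\<^esub> x \<otimes>\<^bsub>H\<^esub> e = x \<otimes>\<^bsub>H\<^esub> e'\<close> by simp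
  qed
  then show ?thesis using e by blast
qed

lemma maximal_submodule_exists:
  assumes W: "left_module H W" "fg_module H W" and ne: "carrier W \<noteq> {\<zero>\<^bsub>W\<^esub>}"
  shows "\<exists>A. Module.submodule A H W \<and> A \<noteq> carrier W \<and> (\<forall>B. Module.submodule B H W \<and> A \<subset> B \<longrightarrow> B = carrier W)"
proof -
  interpret W: left_module H W by (rule W(1))
  let ?P = "\<lambda>A. Module.submodule A H W \<and> A \<noteq> carrier W"
  have 1: "?P {\<zero>\<^bsub>W\<^esub>}" using ne W.zero_submodule by auto
  have 2: "\<forall>A. ?P A \<longrightarrow> sdim (W\<lparr>carrier := A\<rparr>) < Suc (sdim W)"
  proof (intro allI impI)
    fix A assume A: "?P A"
    then have "A \<subset> carrier W" using W.submoduleD(1) by blast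
    then show "sdim (W\<lparr>carrier := A\<rparr>) < Suc (sdim W)"
      using sdim_less[OF W _ W.carrier_submodule, of A] A by simp
  qed
  obtain A where A: "?P A" and max: "\<And>B. ?P B \<Longrightarrow> sdim (W\<lparr>carrier := B\<rparr>) \<le> sdim (W\<lparr>carrier := A\<rparr>)"
    using ex_has_greatest_nat[OF 1 2] by blast
  have "B = carrier W" if B: "Module.submodule B H W" "A \<subset> B" for B
  proof (rule ccontr)
    assume "B \<noteq> carrier W"
    then show False using max[of B] sdim_less[OF W _ B(1,2)] A B by simp
  qed
  then show ?thesis using A by blast
qed

text \<open>
  The quotient \<open>W / A\<close> is simple, so the annihilator of a nonzero element of it is a maximal left
  ideal.
\<close>

lemma rad_maximal_submodule:
  assumes W: "left_module H W" and A: "Module.submodule A H W"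
    and max: "\<And>B. \<lbrakk>Module.submodule B H W; A \<subset> B\<rbrakk> \<Longrightarrow> B = carrier W"
    and j: "j \<in> rad" and a: "a \<in> carrier W"
  shows "j \<odot>\<^bsub>W\<^esub> a \<in> A"
proof -
  interpret W: left_module H W by (rule W)
  note D = W.submoduleD[OF A]
  have jc: "j \<in> carrier H" using j rad_def by blast
  show ?thesis
  proof (cases "a \<in> A")
    case True then show ?thesis using D(4) jc by blast
  next
    case False
    let ?m = "{h \<in> carrier H. h \<odot>\<^bsub>W\<^esub> a \<in> A}"
    have "maximal_left_ideal ?m" unfolding maximal_left_ideal_def
    proof (intro conjI ballI)
      show "left_ideal ?m" using D(2-4) a by (intro left_idealI) (auto simp: W.lsmult_l_distr W.lsmult_assoc)
      show "\<one>\<^bsub>H\<^esub> \<notin> ?m" using False a by simp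
      fix h assume "h \<in> carrier H - ?m"
      then have h: "h \<in> carrier H" "h \<odot>\<^bsub>W\<^esub> a \<notin> A" by auto
      let ?C = "{g \<odot>\<^bsub>W\<^esub> (h \<odot>\<^bsub>W\<^esub> a) | g. g \<in> carrier H}"
      have ha: "h \<odot>\<^bsub>W\<^esub> a \<in> carrier W" using h a by simp
      note C = W.cyclic_submodule(1)[OF ha]
      let ?P = "submodule_plus W A ?C"
      note P = W.submodule_plus[OF A C] and up = W.submodule_plus_upper[OF A C]
      have "h \<odot>\<^bsub>W\<^esub> a \<in> ?C" by (rule W.cyclic_submodule(2)[OF ha])
      then have "A \<subset> ?P" using up h by blast
      then have "a \<in> ?P" using max[OF P] a by blast
      then obtain x h' where xh: "x \<in> A" "h' \<in> carrier H" "a = x \<oplus>\<^bsub>W\<^esub> h' \<odot>\<^bsub>W\<^esub> (h \<odot>\<^bsub>W\<^esub> a)"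
        by (auto simp: submodule_plus_def)
      have "(\<one>\<^bsub>H\<^esub> \<ominus>\<^bsub>H\<^esub> h' \<otimes>\<^bsub>H\<^esub> h) \<odot>\<^bsub>W\<^esub> a = a \<ominus>\<^bsub>W\<^esub> h' \<odot>\<^bsub>W\<^esub> (h \<odot>\<^bsub>W\<^esub> a)"
        using xh(2) h a by (simp add: a_minus_def W.lsmult_l_distr W.lsmult_l_minus W.lsmult_assoc)
      also have "\<dots> = x" using xh(1,2) D(7) h a by (subst xh(3)) (simp add: a_minus_def W.M.a_assoc W.M.r_neg)
      finally show "\<exists>h'\<in>carrier H. \<one>\<^bsub>H\<^esub> \<ominus>\<^bsub>H\<^esub> h' \<otimes>\<^bsub>H\<^esub> h \<in> ?m" using xh h by (intro bexI[of _ h']) auto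
    qed
    then show ?thesis using j unfolding rad_def by blast
  qed
qed

text \<open>
  The submodule \<open>J N\<close>, where \<open>J\<close> is the radical.
\<close>

definition rmul :: "('h, 'w, 'e) module_scheme \<Rightarrow> 'w set \<Rightarrow> 'w set" where
  "rmul W N = submodule_hull H W {j \<odot>\<^bsub>W\<^esub> x | j x. j \<in> rad \<and> x \<in> N}"

lemma rad_carrier: "j \<in> rad \<Longrightarrow> j \<in> carrier H"
  by (simp add: rad_def)

lemma rmul_submodule:
  assumes "left_module H W" "N \<subseteq> carrier W" shows "Module.submodule (rmul W N) H W"
proof -
  interpret W: left_module H W by fact
  show ?thesis unfolding rmul_def using assms(2) rad_carrier by (intro W.hull_submodule) auto
qed

lemma rmul_mem: "\<lbrakk>left_module H W; j \<in> rad; x \<in> N\<rbrakk> \<Longrightarrow> j \<odot>\<^bsub>W\<^esub> x \<in> rmul W N"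
  unfolding rmul_def using left_module.hull_superset[of H W "{j \<odot>\<^bsub>W\<^esub> x | j x. j \<in> rad \<and> x \<in> N}"] by blast

lemma rmul_least:
  assumes "left_module H W" "Module.submodule L H W" "\<And>j x. \<lbrakk>j \<in> rad; x \<in> N\<rbrakk> \<Longrightarrow> j \<odot>\<^bsub>W\<^esub> x \<in> L"
  shows "rmul W N \<subseteq> L"
  unfolding rmul_def using assms by (intro left_module.hull_least) auto

lemma rmul_mono:
  assumes "left_module H W" "N \<subseteq> N'" "N' \<subseteq> carrier W" shows "rmul W N \<subseteq> rmul W N'"
  using assms rmul_mem[OF assms(1)] by (intro rmul_least rmul_submodule) auto

lemma rmul_sub:
  assumes "left_module H W" "Module.submodule N H W" shows "rmul W N \<subseteq> N"
  using assms left_module.submoduleD(4)[OF assms] rad_carrier by (intro rmul_least) auto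

lemma rmul_hom:
  assumes f: "left_module_hom H V W f" and N: "N \<subseteq> carrier V" and L: "L \<subseteq> carrier W" and fN: "f ` N \<subseteq> L"
  shows "f ` rmul V N \<subseteq> rmul W L"
proof -
  interpret left_module_hom H V W f by (rule f)
  have "rmul V N \<subseteq> {x \<in> carrier V. f x \<in> rmul W L}"
  proof (rule rmul_least)
    show "Module.submodule {x \<in> carrier V. f x \<in> rmul W L} H V"
      by (rule vimage_submodule[OF rmul_submodule[OF N.left_module_axioms L]])
    fix j x assume jx: "j \<in> rad" "x \<in> N"
    then have "f x \<in> L" "x \<in> carrier V" using fN assms(2) by auto
    then show "j \<odot>\<^bsub>V\<^esub> x \<in> {x \<in> carrier V. f x \<in> rmul W L}"
      using rmul_mem[OF N.left_module_axioms jx(1), of "f x" L] jx rad_carrier by auto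
  qed (rule M.left_module_axioms)
  then show ?thesis by blast
qed

lemma rmul_plus:
  assumes W: "left_module H W" and N: "Module.submodule N H W" and N': "Module.submodule N' H W"
  shows "rmul W (submodule_plus W N N') \<subseteq> submodule_plus W (rmul W N) (rmul W N')"
proof -
  interpret W: left_module H W by (rule W)
  note D = W.submoduleD[OF N] W.submoduleD[OF N']
  show ?thesis
  proof (rule rmul_least[OF W])
    show "Module.submodule (submodule_plus W (rmul W N) (rmul W N')) H W"
      using D(1,8) by (intro W.submodule_plus rmul_submodule W)
    fix j x assume j: "j \<in> rad" and "x \<in> submodule_plus W N N'"
    then obtain u v where uv: "u \<in> N" "v \<in> N'" "x = u \<oplus>\<^bsub>W\<^esub> v" unfolding submodule_plus_def by blast
    then have "j \<odot>\<^bsub>W\<^esub> x = j \<odot>\<^bsub>W\<^esub> u \<oplus>\<^bsub>W\<^esub> j \<odot>\<^bsub>W\<^esub> v" using D(7,14) rad_carrier[OF j] by (simp add: W.lsmult_r_distr)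
    then show "j \<odot>\<^bsub>W\<^esub> x \<in> submodule_plus W (rmul W N) (rmul W N')"
      unfolding submodule_plus_def using rmul_mem[OF W j] uv by blast
  qed
qed

lemma rmul_funpow_submodule:
  assumes "left_module H W" "Module.submodule N H W" shows "Module.submodule ((rmul W ^^ n) N) H W"
proof (induction n)
  case (Suc n)
  then show ?case using rmul_submodule[OF assms(1)] left_module.submoduleD(1)[OF assms(1)] by simp
qed (use assms in auto)

text \<open>
  The chain of the powers of \<open>J\<close> becomes stationary, say at \<open>A = J\<^sup>n\<close>.  If \<open>A\<close> were nonzero, then
  it would have a maximal submodule, which contains \<open>J A = A\<close> by \<open>rad_maximal_submodule\<close>.  The
  exponent works for all modules simultaneously, as \<open>J\<^sup>n W\<close> is generated by the products of \<open>J\<^sup>n\<close>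
  with \<open>W\<close>.
\<close>

lemma rad_nilpotent:
  "\<exists>n. \<forall>W :: ('h, 'w, 'e) module_scheme. left_module H W \<longrightarrow> (rmul W ^^ n) (carrier W) = {\<zero>\<^bsub>W\<^esub>}"
proof -
  define A where "A = (\<lambda>n. (rmul (regular H) ^^ n) (carrier H))"
  have Ai: "left_ideal (A n)" for n
    unfolding A_def using rmul_funpow_submodule[OF G.left_module_axioms G.carrier_submodule] by simp
  have AS: "A (Suc n) = rmul (regular H) (A n)" for n by (simp add: A_def)
  obtain n where min: "\<And>m. sdim ((regular H)\<lparr>carrier := A n\<rparr>) \<le> sdim ((regular H)\<lparr>carrier := A m\<rparr>)"
    using ex_has_least_nat[of "\<lambda>_. True" 0 "\<lambda>n. sdim ((regular H)\<lparr>carrier := A n\<rparr>)"] by blast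
  have "A (Suc n) \<subseteq> A n" unfolding AS by (rule rmul_sub[OF G.left_module_axioms Ai])
  then have AA: "A (Suc n) = A n"
    using min[of "Suc n"] sdim_less[OF G.left_module_axioms fg_regular Ai Ai, of "Suc n" n] by fastforce
  have A0: "A n = {\<zero>\<^bsub>H\<^esub>}"
  proof (rule ccontr)
    assume ne: "A n \<noteq> {\<zero>\<^bsub>H\<^esub>}"
    let ?W = "(regular H)\<lparr>carrier := A n\<rparr>"
    have W: "left_module H ?W" "fg_module H ?W"
      using G.submodule_left_module[OF Ai] fg_submodule[OF G.left_module_axioms fg_regular Ai] by auto
    obtain B where B: "Module.submodule B H ?W" "B \<noteq> A n"
      and max: "\<And>C. \<lbrakk>Module.submodule C H ?W; B \<subset> C\<rbrakk> \<Longrightarrow> C = carrier ?W"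
      using maximal_submodule_exists[OF W] ne by auto
    have Bi: "left_ideal B" "B \<subseteq> A n" using B(1) G.submodule_of_submodule[OF Ai] by auto
    have "rmul (regular H) (A n) \<subseteq> B"
    proof (rule rmul_least[OF G.left_module_axioms Bi(1)])
      fix j x assume "j \<in> rad" "x \<in> A n"
      then show "j \<odot>\<^bsub>regular H\<^esub> x \<in> B" using rad_maximal_submodule[OF W(1) B(1) max, of j x] by simp
    qed
    then show False using AA AS Bi(2) B(2) by auto
  qed
  have "(rmul W ^^ n) (carrier W) = {\<zero>\<^bsub>W\<^esub>}" if WM: "left_module H W" for W :: "('h, 'w, 'e) module_scheme"
  proof -
    interpret W: left_module H W by (rule WM)
    let ?S = "\<lambda>k. submodule_hull H W {a \<odot>\<^bsub>W\<^esub> x | a x. a \<in> A k \<and> x \<in> carrier W}"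
    have Sc: "{a \<odot>\<^bsub>W\<^esub> x | a x. a \<in> A k \<and> x \<in> carrier W} \<subseteq> carrier W" for k
      using left_idealD(5)[OF Ai] by auto
    have S: "Module.submodule (?S k) H W" for k by (rule W.hull_submodule[OF Sc])
    have "(rmul W ^^ k) (carrier W) \<subseteq> ?S k" for k
    proof (induction k)
      case 0
      have "x \<in> ?S 0" if "x \<in> carrier W" for x
      proof -
        have "\<one>\<^bsub>H\<^esub> \<odot>\<^bsub>W\<^esub> x \<in> {a \<odot>\<^bsub>W\<^esub> x | a x. a \<in> A 0 \<and> x \<in> carrier W}" using that by (auto simp: A_def simp del: W.lsmult_one)
        then show ?thesis using W.hull_superset that by (metis (no_types, lifting) W.lsmult_one subsetD)
      qed
      then show ?case by auto
    next
      case (Suc k)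
      let ?T = "{y \<in> carrier W. \<forall>j\<in>rad. j \<odot>\<^bsub>W\<^esub> y \<in> ?S (Suc k)}"
      note D = W.submoduleD[OF S[of "Suc k"]]
      have T: "Module.submodule ?T H W"
      proof (rule W.submoduleI)
        show "\<zero>\<^bsub>W\<^esub> \<in> ?T" using D(2) rad_carrier by auto
        show "x \<oplus>\<^bsub>W\<^esub> y \<in> ?T" if "x \<in> ?T" "y \<in> ?T" for x y
          using that D(3) rad_carrier by (auto simp: W.lsmult_r_distr)
        show "a \<odot>\<^bsub>W\<^esub> x \<in> ?T" if ax: "a \<in> carrier H" "x \<in> ?T" for a x
        proof -
          have "j \<odot>\<^bsub>W\<^esub> (a \<odot>\<^bsub>W\<^esub> x) = (j \<otimes>\<^bsub>H\<^esub> a) \<odot>\<^bsub>W\<^esub> x" if "j \<in> rad" for j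
            using that ax rad_carrier by (simp add: W.lsmult_assoc)
          then show ?thesis using ax rad_right_ideal by auto
        qed
      qed auto
      have "?S k \<subseteq> ?T"
      proof (rule W.hull_least[OF T], clarify, intro conjI ballI)
        fix a x assume a: "a \<in> A k" and x: "x \<in> carrier W"
        then have ac: "a \<in> carrier H" using left_idealD(5)[OF Ai] by blast
        show "a \<odot>\<^bsub>W\<^esub> x \<in> carrier W" using ac x by simp
        fix j assume j: "j \<in> rad"
        have "j \<otimes>\<^bsub>H\<^esub> a \<in> A (Suc k)" using rmul_mem[OF G.left_module_axioms j a] unfolding AS by simp
        then have "(j \<otimes>\<^bsub>H\<^esub> a) \<odot>\<^bsub>W\<^esub> x \<in> ?S (Suc k)" using x W.hull_superset[of "{a \<odot>\<^bsub>W\<^esub> x | a x. a \<in> A (Suc k) \<and> x \<in> carrier W}"] by blast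
        then show "j \<odot>\<^bsub>W\<^esub> (a \<odot>\<^bsub>W\<^esub> x) \<in> ?S (Suc k)" using rad_carrier[OF j] ac x by (simp add: W.lsmult_assoc)
      qed
      then have "rmul W (?S k) \<subseteq> ?S (Suc k)" by (intro rmul_least[OF WM S]) blast
      then show ?case using rmul_mono[OF WM Suc.IH] W.submoduleD(1)[OF S] by auto
    qed
    from this[of n] have "(rmul W ^^ n) (carrier W) \<subseteq> {\<zero>\<^bsub>W\<^esub>}"
    proof (rule subset_trans)
      show "?S n \<subseteq> {\<zero>\<^bsub>W\<^esub>}" unfolding A0 by (rule W.hull_least[OF W.zero_submodule]) auto
    qed
    then show ?thesis using W.submoduleD(2)[OF rmul_funpow_submodule[OF WM W.carrier_submodule]] by blast
  qed
  then show ?thesis by blast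
qed

text \<open>
  Iteration of the hypothesis gives \<open>N \<subseteq> U + J\<^sup>k N\<close> for all \<open>k\<close>, and \<open>J\<^sup>k N\<close> vanishes for large
  \<open>k\<close>.
\<close>

lemma nakayama:
  assumes W: "left_module H W" and N: "Module.submodule N H W" and U: "Module.submodule U H W"
    and sub: "N \<subseteq> submodule_plus W U (rmul W N)"
  shows "N \<subseteq> U"
proof -
  interpret W: left_module H W by (rule W)
  note DN = W.submoduleD[OF N] and DU = W.submoduleD[OF U]
  obtain n where n: "(rmul W ^^ n) (carrier W) = {\<zero>\<^bsub>W\<^esub>}"
    using rad_nilpotent W by blast
  note S = rmul_funpow_submodule[OF W N]
  have 1: "N \<subseteq> submodule_plus W U ((rmul W ^^ k) N)" for k
  proof (induction k)
    case 0 then show ?case using W.submodule_plus_upper(2)[OF U N] by simp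
  next
    case (Suc k)
    let ?T = "submodule_plus W U ((rmul W ^^ Suc k) N)"
    note T = W.submodule_plus[OF U S] and up = W.submodule_plus_upper[OF U S]
    have "rmul W N \<subseteq> rmul W (submodule_plus W U ((rmul W ^^ k) N))"
      by (rule rmul_mono[OF W Suc.IH]) (rule W.submoduleD(1)[OF T])
    also have "\<dots> \<subseteq> submodule_plus W (rmul W U) (rmul W ((rmul W ^^ k) N))" by (rule rmul_plus[OF W U S])
    also have "\<dots> \<subseteq> ?T" using rmul_sub[OF W U] up[of "Suc k"] by (intro W.submodule_plus_least[OF T]) auto
    finally have "submodule_plus W U (rmul W N) \<subseteq> ?T" using up[of "Suc k"] by (intro W.submodule_plus_least[OF T]) auto
    then show ?case using sub by blast
  qed
  have 2: "(rmul W ^^ k) N \<subseteq> (rmul W ^^ k) (carrier W)" for k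
  proof (induction k)
    case (Suc k)
    then show ?case
      using rmul_mono[OF W Suc.IH] W.submoduleD(1)[OF rmul_funpow_submodule[OF W W.carrier_submodule]] by simp
  qed (use DN in auto)
  have "(rmul W ^^ n) N \<subseteq> U" using 2[of n] n DU(2) by auto
  then show ?thesis using 1[of n] W.submodule_plus_least[OF U, of U "(rmul W ^^ n) N"] by blast
qed

end

section \<open>Noetherian modules\<close>

text \<open>
  The carrier is varied instead of the module, so that sums of submodules can be formed inside
  \<open>W\<close>.
\<close>

definition noetherian_submodule ::
  "('a, 'c) ring_scheme \<Rightarrow> ('a, 'b, 'd) module_scheme \<Rightarrow> 'b set \<Rightarrow> bool" where
  "noetherian_submodule S W A \<longleftrightarrow> Module.submodule A S W \<and>
     (\<forall>N. Module.submodule N S W \<and> N \<subseteq> A \<longrightarrow> fg_module S (W\<lparr>carrier := N\<rparr>))"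

context left_module
begin

lemma fg_submodule_iff:
  assumes N: "Module.submodule N R M"
  shows "fg_module R (M\<lparr>carrier := N\<rparr>) \<longleftrightarrow> (\<exists>A. finite A \<and> A \<subseteq> N \<and> submodule_hull R M A = N)"
proof -
  have sub: "N \<subseteq> carrier M" using submoduleD(1)[OF N] .
  have "(\<forall>L. Module.submodule L R (M\<lparr>carrier := N\<rparr>) \<and> A \<subseteq> L \<longrightarrow> L = N) \<longleftrightarrow> submodule_hull R M A = N"
    if A: "A \<subseteq> N" for A
  proof
    have h: "Module.submodule (submodule_hull R M A) R M" by (rule hull_submodule) (use A sub in blast)
    have hN: "submodule_hull R M A \<subseteq> N" by (rule hull_least[OF N A])
    assume "\<forall>L. Module.submodule L R (M\<lparr>carrier := N\<rparr>) \<and> A \<subseteq> L \<longrightarrow> L = N"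
    then show "submodule_hull R M A = N" using h hN hull_superset submodule_of_submodule[OF N] by blast
  next
    assume e: "submodule_hull R M A = N"
    show "\<forall>L. Module.submodule L R (M\<lparr>carrier := N\<rparr>) \<and> A \<subseteq> L \<longrightarrow> L = N"
    proof (intro allI impI)
      fix L assume L: "Module.submodule L R (M\<lparr>carrier := N\<rparr>) \<and> A \<subseteq> L"
      then have "Module.submodule L R M" "L \<subseteq> N" using submodule_of_submodule[OF N] by blast+
      then show "L = N" using hull_least[of L A] L e by blast
    qed
  qed
  then show ?thesis unfolding fg_module_def using submodule_left_module[OF N] by auto
qed

lemma noetherian_submodule_zero: "noetherian_submodule R M {\<zero>\<^bsub>M\<^esub>}"
  unfolding noetherian_submodule_def
proof (intro conjI allI impI zero_submodule)
  fix N assume N: "Module.submodule N R M \<and> N \<subseteq> {\<zero>\<^bsub>M\<^esub>}"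
  then have N': "Module.submodule N R M" by blast
  then have "N = {\<zero>\<^bsub>M\<^esub>}" using N submoduleD(2)[OF N'] by blast
  then show "fg_module R (M\<lparr>carrier := N\<rparr>)"
    unfolding fg_submodule_iff[OF N'] using hull_superset[of N] hull_least[OF N', of N]
    by (intro exI[of _ N]) auto
qed

text \<open>
  As in the proof of Hilbert's basis theorem, a submodule \<open>N\<close> of \<open>A + \<phi>(P)\<close> is determined by the
  finitely generated submodules \<open>N \<inter> A\<close> and \<open>lead N\<close>, the set of all \<open>p\<close> that occur as second
  component of an element of \<open>N\<close>.
\<close>

lemma noetherian_submodule_plus_image:
  assumes A: "noetherian_submodule R M A" and P: "noetherian_module R P" and \<phi>: "\<phi> \<in> Hom R P M"
  shows "noetherian_submodule R M (submodule_plus M A (\<phi> ` carrier P))"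
  unfolding noetherian_submodule_def
proof (intro conjI allI impI)
  have PM: "left_module R P" using P unfolding noetherian_module_def by blast
  interpret \<phi>: left_module_hom R P M \<phi> by (rule left_module_homI[OF PM left_module_axioms \<phi>])
  have As: "Module.submodule A R M" using A unfolding noetherian_submodule_def by blast
  note DA = submoduleD[OF As]
  show "Module.submodule (submodule_plus M A (\<phi> ` carrier P)) R M"
    by (rule submodule_plus[OF As \<phi>.image_submodule[OF \<phi>.M.carrier_submodule]])
  fix N assume N: "Module.submodule N R M \<and> N \<subseteq> submodule_plus M A (\<phi> ` carrier P)"
  then have Ns: "Module.submodule N R M" by blast
  note DN = submoduleD[OF Ns]
  define lead where "lead = (\<lambda>N. {p \<in> carrier P. \<exists>u\<in>A. u \<oplus>\<^bsub>M\<^esub> \<phi> p \<in> N})"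
  have lead: "Module.submodule (lead N) R P" if Ns: "Module.submodule N R M" for N
  proof (rule \<phi>.M.submoduleI)
    note DN = submoduleD[OF Ns]
    show "\<zero>\<^bsub>P\<^esub> \<in> lead N" unfolding lead_def using DA(2) DN(2) by (auto intro!: bexI[of _ "\<zero>\<^bsub>M\<^esub>"])
    show "x \<oplus>\<^bsub>P\<^esub> y \<in> lead N" if xy: "x \<in> lead N" "y \<in> lead N" for x y
    proof -
      obtain u v where uv: "u \<in> A" "v \<in> A" "u \<oplus>\<^bsub>M\<^esub> \<phi> x \<in> N" "v \<oplus>\<^bsub>M\<^esub> \<phi> y \<in> N" "x \<in> carrier P" "y \<in> carrier P"
        using xy unfolding lead_def by blast
      have "(u \<oplus>\<^bsub>M\<^esub> v) \<oplus>\<^bsub>M\<^esub> \<phi> (x \<oplus>\<^bsub>P\<^esub> y) = (u \<oplus>\<^bsub>M\<^esub> \<phi> x) \<oplus>\<^bsub>M\<^esub> (v \<oplus>\<^bsub>M\<^esub> \<phi> y)"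
        using uv DA(7) by (simp add: M.a_ac)
      also have "\<dots> \<in> N" using DN(3) uv by blast
      finally show ?thesis unfolding lead_def using uv DA(3) by blast
    qed
    show "a \<odot>\<^bsub>P\<^esub> x \<in> lead N" if ax: "a \<in> carrier R" "x \<in> lead N" for a x
    proof -
      obtain u where u: "u \<in> A" "u \<oplus>\<^bsub>M\<^esub> \<phi> x \<in> N" "x \<in> carrier P" using ax unfolding lead_def by blast
      have "a \<odot>\<^bsub>M\<^esub> u \<oplus>\<^bsub>M\<^esub> \<phi> (a \<odot>\<^bsub>P\<^esub> x) = a \<odot>\<^bsub>M\<^esub> (u \<oplus>\<^bsub>M\<^esub> \<phi> x)"
        using u DA(7) ax by (simp add: lsmult_r_distr)
      also have "\<dots> \<in> N" using DN(4) u ax by blast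
      finally show ?thesis unfolding lead_def using u ax DA(4) by blast
    qed
  qed (auto simp: lead_def)
  have "fg_module R (P\<lparr>carrier := lead N\<rparr>)" using P lead[OF Ns] unfolding noetherian_module_def by blast
  then obtain Q where Q: "finite Q" "Q \<subseteq> lead N" "submodule_hull R P Q = lead N"
    using \<phi>.M.fg_submodule_iff[OF lead[OF Ns]] by blast
  have "\<forall>p\<in>Q. \<exists>u. u \<in> A \<and> u \<oplus>\<^bsub>M\<^esub> \<phi> p \<in> N" using Q(2) unfolding lead_def by blast
  then obtain u where u: "\<And>p. p \<in> Q \<Longrightarrow> u p \<in> A" "\<And>p. p \<in> Q \<Longrightarrow> u p \<oplus>\<^bsub>M\<^esub> \<phi> p \<in> N" by metis
  have NA: "Module.submodule (N \<inter> A) R M" by (rule submodule_Int[OF Ns As])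
  have "fg_module R (M\<lparr>carrier := N \<inter> A\<rparr>)" using A NA unfolding noetherian_submodule_def by blast
  then obtain G where G: "finite G" "G \<subseteq> N \<inter> A" "submodule_hull R M G = N \<inter> A"
    using fg_submodule_iff[OF NA] by blast
  let ?G = "(\<lambda>p. u p \<oplus>\<^bsub>M\<^esub> \<phi> p) ` Q \<union> G"
  let ?N0 = "submodule_hull R M ?G"
  have GN: "?G \<subseteq> N" using u G by blast
  have N0: "Module.submodule ?N0 R M" by (rule hull_submodule) (use GN DN in blast)
  note D0 = submoduleD[OF N0]
  have N0N: "?N0 \<subseteq> N" by (rule hull_least[OF Ns GN])
  have "Q \<subseteq> lead ?N0"
  proof
    fix p assume p: "p \<in> Q"
    then have "u p \<oplus>\<^bsub>M\<^esub> \<phi> p \<in> ?N0" using hull_superset[of ?G] by blast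
    then show "p \<in> lead ?N0" using p u(1)[OF p] Q(2) unfolding lead_def by blast
  qed
  then have LL: "lead N \<subseteq> lead ?N0" using \<phi>.M.hull_least[OF lead[OF N0]] Q(3) by blast
  have NA0: "N \<inter> A \<subseteq> ?N0" using hull_least[OF N0, of G] G(3) hull_superset[of ?G] by blast
  have "N \<subseteq> ?N0"
  proof
    fix y assume y: "y \<in> N"
    then obtain v p where vp: "v \<in> A" "p \<in> carrier P" "y = v \<oplus>\<^bsub>M\<^esub> \<phi> p" using N unfolding submodule_plus_def by blast
    then have "p \<in> lead ?N0" using LL y unfolding lead_def by blast
    then obtain v' where v': "v' \<in> A" "v' \<oplus>\<^bsub>M\<^esub> \<phi> p \<in> ?N0" unfolding lead_def by blast
    have c: "v \<in> carrier M" "v' \<in> carrier M" "\<phi> p \<in> carrier M" using vp v' DA(7) by auto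
    have eq: "(v' \<oplus>\<^bsub>M\<^esub> \<phi> p) \<oplus>\<^bsub>M\<^esub> (v \<ominus>\<^bsub>M\<^esub> v') = y"
    proof -
      have "(v' \<oplus>\<^bsub>M\<^esub> \<phi> p) \<oplus>\<^bsub>M\<^esub> (v \<ominus>\<^bsub>M\<^esub> v') = (v' \<oplus>\<^bsub>M\<^esub> (\<ominus>\<^bsub>M\<^esub> v')) \<oplus>\<^bsub>M\<^esub> (v \<oplus>\<^bsub>M\<^esub> \<phi> p)"
        using c by (simp add: a_minus_def M.a_ac del: M.r_neg)
      then show ?thesis unfolding vp(3) using c by (simp add: M.r_neg)
    qed
    have "v \<ominus>\<^bsub>M\<^esub> v' = y \<ominus>\<^bsub>M\<^esub> (v' \<oplus>\<^bsub>M\<^esub> \<phi> p)"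
      using M.add_eq_minus(1)[OF eq] c by simp
    then have "v \<ominus>\<^bsub>M\<^esub> v' \<in> N \<inter> A" using DN(6)[OF y, of "v' \<oplus>\<^bsub>M\<^esub> \<phi> p"] v' N0N DA(6)[OF vp(1) v'(1)] by auto
    then have "v \<ominus>\<^bsub>M\<^esub> v' \<in> ?N0" using NA0 by blast
    then show "y \<in> ?N0" using D0(3)[OF v'(2)] eq by metis
  qed
  then have "?N0 = N" using N0N by blast
  then show "fg_module R (M\<lparr>carrier := N\<rparr>)"
    unfolding fg_submodule_iff[OF Ns] using Q(1) G(1) GN by (intro exI[of _ ?G]) auto
qed

lemma noetherian_if_finite_sum_of_images:
  assumes P: "noetherian_module R P" and \<Phi>: "finite \<Phi>" "\<Phi> \<subseteq> Hom R P M"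
    and gen: "\<And>N. \<lbrakk>Module.submodule N R M; \<And>\<phi>. \<phi> \<in> \<Phi> \<Longrightarrow> \<phi> ` carrier P \<subseteq> N\<rbrakk> \<Longrightarrow> N = carrier M"
  shows "noetherian_module R M"
proof -
  have "\<exists>A. noetherian_submodule R M A \<and> (\<forall>\<phi>\<in>\<Phi>. \<phi> ` carrier P \<subseteq> A)"
    using \<Phi>
  proof (induction \<Phi> rule: finite_induct)
    case empty then show ?case using noetherian_submodule_zero by blast
  next
    case (insert \<phi> \<Phi>)
    then obtain A where A: "noetherian_submodule R M A" "\<forall>\<phi>\<in>\<Phi>. \<phi> ` carrier P \<subseteq> A" by blast
    let ?B = "submodule_plus M A (\<phi> ` carrier P)"
    have PM: "left_module R P" using P unfolding noetherian_module_def by blast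
    interpret \<phi>: left_module_hom R P M \<phi> using insert.prems by (intro left_module_homI PM left_module_axioms) auto
    have As: "Module.submodule A R M" using A unfolding noetherian_submodule_def by blast
    have "noetherian_submodule R M ?B"
      using insert.prems by (intro noetherian_submodule_plus_image[OF A(1) P]) auto
    moreover have "A \<subseteq> ?B" "\<phi> ` carrier P \<subseteq> ?B"
      using submodule_plus_upper[OF As \<phi>.image_submodule[OF \<phi>.M.carrier_submodule]] by auto
    moreover have "\<psi> ` carrier P \<subseteq> ?B" if "\<psi> \<in> insert \<phi> \<Phi>" for \<psi>
      using that A(2) calculation(2,3) subset_trans by (cases "\<psi> = \<phi>") auto
    ultimately show ?case by blast
  qed
  then obtain A where A: "noetherian_submodule R M A" "\<forall>\<phi>\<in>\<Phi>. \<phi> ` carrier P \<subseteq> A" by blast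
  then have "A = carrier M" using gen[of A] unfolding noetherian_submodule_def by blast
  then show ?thesis using A(1) submoduleD(1) left_module_axioms
    unfolding noetherian_submodule_def noetherian_module_def by auto
qed

end

text \<open>
  The power \<open>M\<^sup>I\<close>, with functions that vanish outside of \<open>I\<close> so that equality is equality on \<open>I\<close>.
\<close>

definition fun_module :: "('a, 'b, 'd) module_scheme \<Rightarrow> 'i set \<Rightarrow> ('a, 'i \<Rightarrow> 'b) module" where
  "fun_module M I =
     \<lparr>carrier = {f. (\<forall>i\<in>I. f i \<in> carrier M) \<and> (\<forall>i. i \<notin> I \<longrightarrow> f i = \<zero>\<^bsub>M\<^esub>)},
      monoid.mult = (\<lambda>f g. f), monoid.one = (\<lambda>i. \<zero>\<^bsub>M\<^esub>),
      ring.zero = (\<lambda>i. \<zero>\<^bsub>M\<^esub>), ring.add = (\<lambda>f g i. f i \<oplus>\<^bsub>M\<^esub> g i),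
      smult = (\<lambda>a f i. a \<odot>\<^bsub>M\<^esub> f i)\<rparr>"

lemma fun_module_simps [simp]:
  "x \<in> carrier (fun_module M I) \<longleftrightarrow> (\<forall>i\<in>I. x i \<in> carrier M) \<and> (\<forall>i. i \<notin> I \<longrightarrow> x i = \<zero>\<^bsub>M\<^esub>)"
  "\<zero>\<^bsub>fun_module M I\<^esub> = (\<lambda>i. \<zero>\<^bsub>M\<^esub>)" "x \<oplus>\<^bsub>fun_module M I\<^esub> y = (\<lambda>i. x i \<oplus>\<^bsub>M\<^esub> y i)"
  "a \<odot>\<^bsub>fun_module M I\<^esub> x = (\<lambda>i. a \<odot>\<^bsub>M\<^esub> x i)"
  by (simp_all add: fun_module_def)

context left_module
begin

lemma fun_module_left_module: "left_module R (fun_module M I)"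
proof -
  have c: "x i \<in> carrier M" if "x \<in> carrier (fun_module M I)" for x i
    using that by (cases "i \<in> I") auto
  show ?thesis
  proof (rule left_moduleI[OF R.ring_axioms])
    show "abelian_group (fun_module M I)"
    proof (rule abelian_groupI)
      fix x assume x: "x \<in> carrier (fun_module M I)"
      then show "\<exists>y\<in>carrier (fun_module M I). y \<oplus>\<^bsub>fun_module M I\<^esub> x = \<zero>\<^bsub>fun_module M I\<^esub>"
        using c[OF x] by (intro bexI[of _ "\<lambda>i. \<ominus>\<^bsub>M\<^esub> x i"]) (auto simp: M.l_neg)
      show "\<zero>\<^bsub>fun_module M I\<^esub> \<oplus>\<^bsub>fun_module M I\<^esub> x = x" using c[OF x] by auto
    next
      fix x y assume x: "x \<in> carrier (fun_module M I)" and y: "y \<in> carrier (fun_module M I)"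
      show "x \<oplus>\<^bsub>fun_module M I\<^esub> y = y \<oplus>\<^bsub>fun_module M I\<^esub> x" using c[OF x] c[OF y] by (auto simp: M.a_comm)
      fix z assume z: "z \<in> carrier (fun_module M I)"
      show "x \<oplus>\<^bsub>fun_module M I\<^esub> y \<oplus>\<^bsub>fun_module M I\<^esub> z = x \<oplus>\<^bsub>fun_module M I\<^esub> (y \<oplus>\<^bsub>fun_module M I\<^esub> z)"
        using c[OF x] c[OF y] c[OF z] by (auto simp: M.a_assoc)
    qed auto
  qed (use c in \<open>simp_all add: fun_eq_iff lsmult_l_distr lsmult_r_distr lsmult_assoc del: fun_module_simps(1),
        simp_all\<close>)
qed

lemma fun_module_single_hom:
  "i \<in> I \<Longrightarrow> (\<lambda>x j. if j = i then x else \<zero>\<^bsub>M\<^esub>) \<in> Hom R M (fun_module M I)"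
  by (rule HomI) auto

lemma fun_module_generated:
  assumes I: "finite I" and N: "Module.submodule N R (fun_module M I)"
    and sing: "\<And>i x. \<lbrakk>i \<in> I; x \<in> carrier M\<rbrakk> \<Longrightarrow> (\<lambda>j. if j = i then x else \<zero>\<^bsub>M\<^esub>) \<in> N"
  shows "N = carrier (fun_module M I)"
proof -
  interpret F: left_module R "fun_module M I" by (rule fun_module_left_module)
  note D = F.submoduleD[OF N]
  have "x \<in> N" if x: "x \<in> carrier (fun_module M I)" for x
  proof -
    have "(\<lambda>j. if j \<in> J then x j else \<zero>\<^bsub>M\<^esub>) \<in> N" if "finite J" "J \<subseteq> I" for J
      using that
    proof (induction J rule: finite_induct)
      case empty then show ?case using D(2) by simp
    next
      case (insert i J)
      have "(\<lambda>j. if j \<in> J then x j else \<zero>\<^bsub>M\<^esub>) \<oplus>\<^bsub>fun_module M I\<^esub> (\<lambda>j. if j = i then x i else \<zero>\<^bsub>M\<^esub>) \<in> N"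
        using insert x by (intro D(3) sing) auto
      also have "(\<lambda>j. if j \<in> J then x j else \<zero>\<^bsub>M\<^esub>) \<oplus>\<^bsub>fun_module M I\<^esub> (\<lambda>j. if j = i then x i else \<zero>\<^bsub>M\<^esub>)
          = (\<lambda>j. if j \<in> insert i J then x j else \<zero>\<^bsub>M\<^esub>)"
        using insert x by (auto simp: fun_eq_iff subset_iff)
      finally show ?case .
    qed
    from this[OF I subset_refl] have "(\<lambda>j. if j \<in> I then x j else \<zero>\<^bsub>M\<^esub>) \<in> N" .
    also have "(\<lambda>j. if j \<in> I then x j else \<zero>\<^bsub>M\<^esub>) = x" using x by auto
    finally show ?thesis .
  qed
  then show ?thesis using D(1) by blast
qed

lemma fun_module_noetherian:
  assumes P: "noetherian_module R P" and \<Psi>: "finite \<Psi>" "\<Psi> \<subseteq> Hom R P M"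
    and gen: "\<And>N. \<lbrakk>Module.submodule N R M; \<And>\<phi>. \<phi> \<in> \<Psi> \<Longrightarrow> \<phi> ` carrier P \<subseteq> N\<rbrakk> \<Longrightarrow> N = carrier M"
    and I: "finite I"
  shows "noetherian_module R (fun_module M I)"
proof -
  interpret F: left_module R "fun_module M I" by (rule fun_module_left_module)
  let ?s = "\<lambda>i x j. if j = i then x else \<zero>\<^bsub>M\<^esub>"
  let ?\<Phi> = "(\<lambda>(i, \<psi>) p. ?s i (\<psi> p)) ` (I \<times> \<Psi>)"
  show ?thesis
  proof (rule F.noetherian_if_finite_sum_of_images[OF P])
    show "finite ?\<Phi>" using I \<Psi> by simp
    show "?\<Phi> \<subseteq> Hom R P (fun_module M I)"
    proof
      fix \<phi> assume "\<phi> \<in> ?\<Phi>"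
      then obtain i \<psi> where *: "i \<in> I" "\<psi> \<in> \<Psi>" "\<phi> = (\<lambda>p. ?s i (\<psi> p))" by auto
      then have "\<psi> \<in> Hom R P M" using \<Psi>(2) by blast
      from Hom_comp[OF this fun_module_single_hom[OF *(1)]] show "\<phi> \<in> Hom R P (fun_module M I)"
        unfolding *(3) .
    qed
    fix N assume N: "Module.submodule N R (fun_module M I)" and im: "\<And>\<phi>. \<phi> \<in> ?\<Phi> \<Longrightarrow> \<phi> ` carrier P \<subseteq> N"
    show "N = carrier (fun_module M I)"
    proof (rule fun_module_generated[OF I N])
      fix i x assume i: "i \<in> I" and x: "x \<in> carrier M"
      interpret s: left_module_hom R M "fun_module M I" "?s i"
        by (rule left_module_homI[OF left_module_axioms F.left_module_axioms fun_module_single_hom[OF i]])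
      have "{x \<in> carrier M. ?s i x \<in> N} = carrier M"
      proof (rule gen[OF s.vimage_submodule[OF N]])
        fix \<psi> assume \<psi>: "\<psi> \<in> \<Psi>"
        have "(\<lambda>p. ?s i (\<psi> p)) \<in> ?\<Phi>" using i \<psi> by force
        from im[OF this] have "\<And>p. p \<in> carrier P \<Longrightarrow> ?s i (\<psi> p) \<in> N" by blast
        moreover have "\<psi> p \<in> carrier M" if "p \<in> carrier P" for p
          using HomD(1)[of \<psi> R P M] \<Psi>(2) \<psi> that by blast
        ultimately show "\<psi> ` carrier P \<subseteq> {x \<in> carrier M. ?s i x \<in> N}" by blast
      qed
      then show "?s i x \<in> N" using x by blast
    qed
  qed
qed

end

section \<open>Existence of covers with finite-dimensional kernel\<close>

context fd_algebra
begin

lemma left_ideal_subspace: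
  assumes "left_ideal L" shows "Module.submodule L K H"
proof (rule HK.submoduleI)
  fix c x assume cx: "c \<in> carrier K" "x \<in> L"
  then have x: "x \<in> carrier H" using left_idealD[OF assms] by blast
  have "(c \<odot>\<^bsub>H\<^esub> \<one>\<^bsub>H\<^esub>) \<otimes>\<^bsub>H\<^esub> x \<in> L" using left_idealD(4)[OF assms] cx by simp
  then show "c \<odot>\<^bsub>H\<^esub> x \<in> L" using cx x by (simp add: smult_mult)
qed (use left_idealD[OF assms] in auto)

text \<open>
  A finite set \<open>B\<close> that spans the radical over \<open>K\<close> suffices to write all elements of \<open>J N\<close>,
  uniformly in the module.  The sums \<open>P\<close> on the right-hand side are closed under multiplication by
  \<open>a\<close> in \<open>H\<close>, since \<open>a j\<close> is again a linear combination of \<open>B\<close>.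
\<close>

lemma rmul_representation:
  "\<exists>B. finite B \<and> B \<subseteq> rad \<and> (\<forall>(W :: ('h, 'w, 'e) module_scheme) N. left_module H W \<and> Module.submodule N H W \<longrightarrow>
     (\<forall>x\<in>rmul W N. \<exists>y. y \<in> B \<rightarrow> N \<and> x = (\<Oplus>\<^bsub>W\<^esub>j\<in>B. j \<odot>\<^bsub>W\<^esub> y j)))"
proof -
  have radK: "Module.submodule rad K H" by (rule left_ideal_subspace[OF rad_left_ideal])
  obtain B where B: "finite B" "B \<subseteq> rad" "submodule_hull K H B = rad"
    using fg_subspace[OF field H_left_module fg radK] HK.fg_submodule_iff[OF radK] by blast
  have "\<exists>y. y \<in> B \<rightarrow> N \<and> x = (\<Oplus>\<^bsub>W\<^esub>j\<in>B. j \<odot>\<^bsub>W\<^esub> y j)"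
    if WM: "left_module H W" and N: "Module.submodule N H W" and x: "x \<in> rmul W N"
    for W :: "('h, 'w, 'e) module_scheme" and N x
  proof -
    interpret W: left_module H W by (rule WM)
    note D = W.submoduleD[OF N]
    have Bc: "j \<in> carrier H" if "j \<in> B" for j using that B(2) rad_carrier by blast
    define P where "P = {\<Oplus>\<^bsub>W\<^esub>j\<in>B. j \<odot>\<^bsub>W\<^esub> y j | y. y \<in> B \<rightarrow> N}"
    have PI: "(\<Oplus>\<^bsub>W\<^esub>j\<in>B. j \<odot>\<^bsub>W\<^esub> y j) \<in> P" if "y \<in> B \<rightarrow> N" for y using that unfolding P_def by blast
    have Pc: "u \<in> carrier W" if "u \<in> P" for u
      using that unfolding P_def using D(7) Bc by (auto intro!: W.M.finsum_closed)
    have P0: "\<zero>\<^bsub>W\<^esub> \<in> P"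
    proof -
      have "(\<Oplus>\<^bsub>W\<^esub>j\<in>B. j \<odot>\<^bsub>W\<^esub> \<zero>\<^bsub>W\<^esub>) = \<zero>\<^bsub>W\<^esub>" using Bc by (intro W.M.add.finprod_one_eqI) auto
      then show ?thesis using PI[of "\<lambda>_. \<zero>\<^bsub>W\<^esub>"] D(2) by auto
    qed
    have Padd: "u \<oplus>\<^bsub>W\<^esub> v \<in> P" if "u \<in> P" "v \<in> P" for u v
    proof -
      obtain y z where y: "y \<in> B \<rightarrow> N" "u = (\<Oplus>\<^bsub>W\<^esub>j\<in>B. j \<odot>\<^bsub>W\<^esub> y j)" and z: "z \<in> B \<rightarrow> N" "v = (\<Oplus>\<^bsub>W\<^esub>j\<in>B. j \<odot>\<^bsub>W\<^esub> z j)"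
        using \<open>u \<in> P\<close> \<open>v \<in> P\<close> unfolding P_def by blast
      have yz: "\<And>j. j \<in> B \<Longrightarrow> y j \<in> carrier W" "\<And>j. j \<in> B \<Longrightarrow> z j \<in> carrier W" using y z D(7) by auto
      have "u \<oplus>\<^bsub>W\<^esub> v = (\<Oplus>\<^bsub>W\<^esub>j\<in>B. j \<odot>\<^bsub>W\<^esub> y j \<oplus>\<^bsub>W\<^esub> j \<odot>\<^bsub>W\<^esub> z j)"
        unfolding y z using yz Bc by (intro W.M.finsum_addf[symmetric]) auto
      also have "\<dots> = (\<Oplus>\<^bsub>W\<^esub>j\<in>B. j \<odot>\<^bsub>W\<^esub> (y j \<oplus>\<^bsub>W\<^esub> z j))"
        using yz Bc by (intro W.M.finsum_cong') (auto simp: W.lsmult_r_distr)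
      also have "\<dots> \<in> P" using y z D(3) by (intro PI) auto
      finally show ?thesis .
    qed
    have Pj: "j \<odot>\<^bsub>W\<^esub> v \<in> P" if j: "j \<in> rad" and v: "v \<in> N" for j v
    proof -
      have "Module.submodule {j \<in> carrier H. j \<odot>\<^bsub>W\<^esub> v \<in> P} K H"
      proof (rule HK.submoduleI)
        fix c h assume c: "c \<in> carrier K" and h: "h \<in> {j \<in> carrier H. j \<odot>\<^bsub>W\<^esub> v \<in> P}"
        then obtain y where y: "y \<in> B \<rightarrow> N" "h \<odot>\<^bsub>W\<^esub> v = (\<Oplus>\<^bsub>W\<^esub>j\<in>B. j \<odot>\<^bsub>W\<^esub> y j)" unfolding P_def by blast
        have yc: "\<And>j. j \<in> B \<Longrightarrow> y j \<in> carrier W" using y D(7) by auto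
        have "(c \<odot>\<^bsub>H\<^esub> h) \<odot>\<^bsub>W\<^esub> v = (c \<odot>\<^bsub>H\<^esub> \<one>\<^bsub>H\<^esub>) \<odot>\<^bsub>W\<^esub> (\<Oplus>\<^bsub>W\<^esub>j\<in>B. j \<odot>\<^bsub>W\<^esub> y j)"
          using smult_sr(1)[OF WM c] h v D(7) y by simp
        also have "\<dots> = (\<Oplus>\<^bsub>W\<^esub>j\<in>B. (c \<odot>\<^bsub>H\<^esub> \<one>\<^bsub>H\<^esub>) \<odot>\<^bsub>W\<^esub> (j \<odot>\<^bsub>W\<^esub> y j))"
          using c yc Bc by (intro W.finsum_lsmult) auto
        also have "\<dots> = (\<Oplus>\<^bsub>W\<^esub>j\<in>B. j \<odot>\<^bsub>W\<^esub> ((c \<odot>\<^bsub>H\<^esub> \<one>\<^bsub>H\<^esub>) \<odot>\<^bsub>W\<^esub> y j))"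
          using c yc Bc smult_sr(2)[OF WM c] by (intro W.M.finsum_cong') auto
        also have "\<dots> \<in> P" using y c by (intro PI funcsetI D(4)) auto
        finally show "c \<odot>\<^bsub>H\<^esub> h \<in> {j \<in> carrier H. j \<odot>\<^bsub>W\<^esub> v \<in> P}" using c h by simp
      qed (use P0 Padd v D(7) in \<open>auto simp: W.lsmult_l_distr\<close>)
      moreover have "B \<subseteq> {j \<in> carrier H. j \<odot>\<^bsub>W\<^esub> v \<in> P}"
      proof
        fix b assume b: "b \<in> B"
        have "(\<Oplus>\<^bsub>W\<^esub>j\<in>B. j \<odot>\<^bsub>W\<^esub> (if b = j then v else \<zero>\<^bsub>W\<^esub>)) = (\<Oplus>\<^bsub>W\<^esub>j\<in>B. if b = j then j \<odot>\<^bsub>W\<^esub> v else \<zero>\<^bsub>W\<^esub>)"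
          using v D(7) Bc by (intro W.M.finsum_cong') auto
        also have "\<dots> = b \<odot>\<^bsub>W\<^esub> v" using b B(1) v D(7) Bc by (intro W.M.finsum_singleton) auto
        finally have "b \<odot>\<^bsub>W\<^esub> v \<in> P" using PI[of "\<lambda>j. if b = j then v else \<zero>\<^bsub>W\<^esub>"] v D(2) by auto
        then show "b \<in> {j \<in> carrier H. j \<odot>\<^bsub>W\<^esub> v \<in> P}" using Bc[OF b] by simp
      qed
      ultimately have "rad \<subseteq> {j \<in> carrier H. j \<odot>\<^bsub>W\<^esub> v \<in> P}" using HK.hull_least B(3) by blast
      then show ?thesis using j by blast
    qed
    have PH: "Module.submodule P H W"
    proof (rule W.submoduleI)
      fix a u assume a: "a \<in> carrier H" and u: "u \<in> P"
      then obtain y where y: "y \<in> B \<rightarrow> N" "u = (\<Oplus>\<^bsub>W\<^esub>j\<in>B. j \<odot>\<^bsub>W\<^esub> y j)" unfolding P_def by blast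
      have yc: "\<And>j. j \<in> B \<Longrightarrow> y j \<in> carrier W" using y D(7) by auto
      have "a \<odot>\<^bsub>W\<^esub> u = (\<Oplus>\<^bsub>W\<^esub>j\<in>B. a \<odot>\<^bsub>W\<^esub> (j \<odot>\<^bsub>W\<^esub> y j))"
        unfolding y using a yc Bc by (intro W.finsum_lsmult) auto
      also have "\<dots> = (\<Oplus>\<^bsub>W\<^esub>j\<in>B. (a \<otimes>\<^bsub>H\<^esub> j) \<odot>\<^bsub>W\<^esub> y j)"
        using a yc Bc by (intro W.M.finsum_cong') (auto simp: W.lsmult_assoc)
      finally have eq: "a \<odot>\<^bsub>W\<^esub> u = (\<Oplus>\<^bsub>W\<^esub>j\<in>B. (a \<otimes>\<^bsub>H\<^esub> j) \<odot>\<^bsub>W\<^esub> y j)" .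
      have "(\<Oplus>\<^bsub>W\<^esub>j\<in>C. (a \<otimes>\<^bsub>H\<^esub> j) \<odot>\<^bsub>W\<^esub> y j) \<in> P" if "finite C" "C \<subseteq> B" for C
        using that
      proof (induction C rule: finite_induct)
        case (insert j C)
        have "a \<otimes>\<^bsub>H\<^esub> j \<in> rad" using left_idealD(4)[OF rad_left_ideal a] insert B(2) by blast
        then have "(a \<otimes>\<^bsub>H\<^esub> j) \<odot>\<^bsub>W\<^esub> y j \<in> P" using Pj y insert by auto
        moreover have "(\<lambda>j. (a \<otimes>\<^bsub>H\<^esub> j) \<odot>\<^bsub>W\<^esub> y j) \<in> C \<rightarrow> carrier W" using a yc Bc insert by auto
        ultimately show ?case using insert Padd Pc by (subst W.M.finsum_insert) auto
      qed (use P0 in simp)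
      then show "a \<odot>\<^bsub>W\<^esub> u \<in> P" using eq B(1) by simp
    qed (use P0 Padd Pc in auto)
    have "rmul W N \<subseteq> P" by (rule rmul_least[OF WM PH Pj])
    then show ?thesis using x unfolding P_def by blast
  qed
  then show ?thesis using B(1,2) by (intro exI[of _ B] conjI allI impI ballI) auto
qed

end

lemma (in abelian_group) minus_zero_right: "x \<in> carrier G \<Longrightarrow> x \<ominus> \<zero> = x"
  using add_eq_minus(1)[of \<zero> x x] by simp

context fd_algebra
begin

text \<open>
  Let \<open>L\<close> be the kernel of \<open>\<pi>\<close>.  If \<open>X\<close> is projective then \<open>(L \<inter> J X) / J L\<close> is \<open>Tor\<^sub>1(H / J, V)\<close>,
  and the conclusion is that finitely many elements \<open>U\<close> of \<open>L\<close> generate it over \<open>H\<close>.  The ring \<open>S\<close>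
  acts on \<open>V\<close> by \<open>H\<close>-linear maps \<open>t s\<close>, and \<open>V\<close> is noetherian over \<open>S\<close>, being a finite sum of
  images of \<open>P\<close>.

  The action of \<open>S\<close> on the quotient is described by syzygies on \<open>V\<close>, without lifting the maps
  \<open>t s\<close> to \<open>X\<close>.  For a finite set \<open>B\<close> that spans \<open>J\<close>, let \<open>Z\<close> be the \<open>S\<close>-module of all families
  \<open>z\<close> in \<open>V\<close> with \<open>\<Sum> j z\<^sub>j = 0\<close>.  Preimages \<open>\<xi>(z\<^sub>j)\<close> in \<open>X\<close> give an element \<open>\<theta>(z) = \<Sum> j \<xi>(z\<^sub>j)\<close> of
  \<open>L\<close>, whose class modulo \<open>J L\<close> does not depend on the choice (\<open>indep\<close>), and every element of
  \<open>L \<inter> J X\<close> arises in this way.  If \<open>i\<close> is in \<open>I\<close> and \<open>\<sigma> : V \<rightarrow> X\<close> lifts \<open>t i\<close>, then \<open>\<sigma>(z\<^sub>j)\<close> are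
  preimages of \<open>t i z\<^sub>j\<close> with \<open>\<Sum> j \<sigma>(z\<^sub>j) = \<sigma>(\<Sum> j z\<^sub>j) = 0\<close>, so the class of \<open>\<theta>(i z)\<close> vanishes.
  As \<open>S\<close> is spanned over \<open>K\<close> by \<open>I\<close> and the finite set \<open>E\<close>, the elements \<open>\<theta>(e z)\<close> for \<open>e\<close> in \<open>E\<close>
  and \<open>z\<close> in a finite set \<open>G\<close> of generators of \<open>Z\<close> suffice.
\<close>

lemma tor_finite:
  fixes X :: "('h, 'x, 'e) module_scheme" and V :: "('h, 'v, 'f) module_scheme"
    and S :: "('k, 's, 'g) module_scheme" and P :: "('s, 'p, 'q) module_scheme"
  assumes X: "left_module H X" and V: "left_module H V" and \<pi>: "\<pi> \<in> Hom H X V" "\<pi> ` carrier X = carrier V"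
    and SV: "left_module S (with_action V t)"
    and comm: "\<And>s h v. \<lbrakk>s \<in> carrier S; h \<in> carrier H; v \<in> carrier V\<rbrakk> \<Longrightarrow> t s (h \<odot>\<^bsub>V\<^esub> v) = h \<odot>\<^bsub>V\<^esub> t s v"
    and scal: "\<And>c s v. \<lbrakk>c \<in> carrier K; s \<in> carrier S; v \<in> carrier V\<rbrakk> \<Longrightarrow> t (c \<odot>\<^bsub>S\<^esub> s) v = c \<odot>\<^bsub>sr V\<^esub> t s v"
    and SK: "left_module K S"
    and P: "noetherian_module S P" and \<Psi>: "finite \<Psi>" "\<Psi> \<subseteq> Hom S P (with_action V t)"
    and gen: "\<And>N. \<lbrakk>Module.submodule N S (with_action V t); \<And>\<psi>. \<psi> \<in> \<Psi> \<Longrightarrow> \<psi> ` carrier P \<subseteq> N\<rbrakk> \<Longrightarrow> N = carrier V"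
    and E: "finite E" "E \<subseteq> carrier S" and I: "I \<subseteq> carrier S"
    and EI: "\<And>N. \<lbrakk>Module.submodule N K S; E \<subseteq> N; I \<subseteq> N\<rbrakk> \<Longrightarrow> N = carrier S"
    and lift: "\<And>i. i \<in> I \<Longrightarrow> \<exists>\<sigma>\<in>Hom H V X. \<forall>v\<in>carrier V. \<pi> (\<sigma> v) = t i v"
  shows "\<exists>U. finite U \<and> U \<subseteq> {x \<in> carrier X. \<pi> x = \<zero>\<^bsub>V\<^esub>} \<and>
    {x \<in> carrier X. \<pi> x = \<zero>\<^bsub>V\<^esub>} \<inter> rmul X (carrier X) \<subseteq>
      submodule_plus X (submodule_hull H X U) (rmul X {x \<in> carrier X. \<pi> x = \<zero>\<^bsub>V\<^esub>})"
proof -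
  interpret X: left_module H X by (rule X)
  interpret V: left_module H V by (rule V)
  interpret SV: left_module S "with_action V t" by (rule SV)
  interpret SK: left_module K S by (rule SK)
  interpret \<pi>: left_module_hom H X V \<pi> by (rule left_module_homI[OF X V \<pi>(1)])
  define L where "L = {x \<in> carrier X. \<pi> x = \<zero>\<^bsub>V\<^esub>}"
  have L: "Module.submodule L H X" unfolding L_def by (rule \<pi>.ker_submodule)
  obtain B where B: "finite B" "B \<subseteq> rad" and "\<forall>(W :: ('h, 'x, 'e) module_scheme) N.
     left_module H W \<and> Module.submodule N H W \<longrightarrow>
     (\<forall>x\<in>rmul W N. \<exists>y. y \<in> B \<rightarrow> N \<and> x = (\<Oplus>\<^bsub>W\<^esub>j\<in>B. j \<odot>\<^bsub>W\<^esub> y j))"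
    using rmul_representation by (elim exE conjE)
  then have rep: "\<exists>y. y \<in> B \<rightarrow> carrier X \<and> x = (\<Oplus>\<^bsub>X\<^esub>j\<in>B. j \<odot>\<^bsub>X\<^esub> y j)" if "x \<in> rmul X (carrier X)" for x
    using that X X.carrier_submodule by simp
  have Bc: "j \<in> carrier H" if "j \<in> B" for j using that B(2) rad_carrier by blast
  have tc [simp]: "t s v \<in> carrier V" if "s \<in> carrier S" "v \<in> carrier V" for s v
    using SV.lsmult_closed that by simp
  let ?F = "fun_module (with_action V t) B"
  interpret F: left_module S ?F by (rule SV.fun_module_left_module)
  define \<Sigma> where "\<Sigma> = (\<lambda>y. \<Oplus>\<^bsub>X\<^esub>j\<in>B. j \<odot>\<^bsub>X\<^esub> y j)"
  define \<tau> where "\<tau> = (\<lambda>z. \<Oplus>\<^bsub>V\<^esub>j\<in>B. j \<odot>\<^bsub>V\<^esub> z j)"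
  have \<Sigma>c: "\<Sigma> y \<in> carrier X" if "y \<in> B \<rightarrow> carrier X" for y
    unfolding \<Sigma>_def using that Bc by (intro X.M.finsum_closed) auto
  have \<Sigma>r: "\<Sigma> y \<in> rmul X N" if "y \<in> B \<rightarrow> N" "N \<subseteq> carrier X" for y N
    unfolding \<Sigma>_def using that B(2) by (intro X.submodule_finsum[OF rmul_submodule[OF X]] funcsetI rmul_mem[OF X]) auto
  have \<Sigma>add: "\<Sigma> (\<lambda>j. y j \<oplus>\<^bsub>X\<^esub> y' j) = \<Sigma> y \<oplus>\<^bsub>X\<^esub> \<Sigma> y'" if y: "y \<in> B \<rightarrow> carrier X" "y' \<in> B \<rightarrow> carrier X" for y y'
  proof -
    have "\<Sigma> (\<lambda>j. y j \<oplus>\<^bsub>X\<^esub> y' j) = (\<Oplus>\<^bsub>X\<^esub>j\<in>B. j \<odot>\<^bsub>X\<^esub> y j \<oplus>\<^bsub>X\<^esub> j \<odot>\<^bsub>X\<^esub> y' j)"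
      unfolding \<Sigma>_def using y Bc by (intro X.M.finsum_cong') (auto simp: Pi_iff X.lsmult_r_distr)
    also have "\<dots> = \<Sigma> y \<oplus>\<^bsub>X\<^esub> \<Sigma> y'"
      unfolding \<Sigma>_def using y Bc by (intro X.M.finsum_addf) (auto simp: Pi_iff)
    finally show ?thesis .
  qed
  have \<Sigma>hom: "(\<Oplus>\<^bsub>W\<^esub>j\<in>B. j \<odot>\<^bsub>W\<^esub> f (y j)) = f (\<Oplus>\<^bsub>Y\<^esub>j\<in>B. j \<odot>\<^bsub>Y\<^esub> y j)"
    if f: "left_module_hom H Y W f" and y: "y \<in> B \<rightarrow> carrier Y"
    for f and W :: "('h, 'y, 'z) module_scheme" and Y :: "('h, 'yy, 'zz) module_scheme" and y
  proof -
    interpret f: left_module_hom H Y W f by (rule f)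
    have "f (\<Oplus>\<^bsub>Y\<^esub>j\<in>B. j \<odot>\<^bsub>Y\<^esub> y j) = (\<Oplus>\<^bsub>W\<^esub>j\<in>B. f (j \<odot>\<^bsub>Y\<^esub> y j))"
      using y Bc by (intro f.finsum) auto
    also have "\<dots> = (\<Oplus>\<^bsub>W\<^esub>j\<in>B. j \<odot>\<^bsub>W\<^esub> f (y j))"
      using y Bc by (intro f.N.M.finsum_cong') (auto simp: Pi_iff)
    finally show ?thesis by simp
  qed
  have t_hom: "left_module_hom H V V (t s)" if s: "s \<in> carrier S" for s
    using SV.lsmult_r_distr[OF s] comm[OF s] s by (intro left_module_homI V HomI) auto
  have zc': "z j \<in> carrier V" if "z \<in> carrier ?F" for z j
    using that by (cases "j \<in> B") auto
  have zc: "z \<in> B \<rightarrow> carrier V" "\<And>j. z j \<in> carrier V" if "z \<in> carrier ?F" for z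
    using zc'[OF that] by auto
  define Z where "Z = {z \<in> carrier ?F. \<tau> z = \<zero>\<^bsub>V\<^esub>}"
  have \<tau>add: "\<tau> (\<lambda>j. z j \<oplus>\<^bsub>V\<^esub> z' j) = \<tau> z \<oplus>\<^bsub>V\<^esub> \<tau> z'" if z: "z \<in> carrier ?F" "z' \<in> carrier ?F" for z z'
  proof -
    have "\<tau> (\<lambda>j. z j \<oplus>\<^bsub>V\<^esub> z' j) = (\<Oplus>\<^bsub>V\<^esub>j\<in>B. j \<odot>\<^bsub>V\<^esub> z j \<oplus>\<^bsub>V\<^esub> j \<odot>\<^bsub>V\<^esub> z' j)"
      unfolding \<tau>_def using zc[OF z(1)] zc[OF z(2)] Bc by (intro V.M.finsum_cong') (auto simp: V.lsmult_r_distr)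
    also have "\<dots> = \<tau> z \<oplus>\<^bsub>V\<^esub> \<tau> z'"
      unfolding \<tau>_def using zc[OF z(1)] zc[OF z(2)] Bc by (intro V.M.finsum_addf) auto
    finally show ?thesis .
  qed
  have \<tau>t: "\<tau> (\<lambda>j. t s (z j)) = t s (\<tau> z)" if s: "s \<in> carrier S" and z: "z \<in> carrier ?F" for s z
    unfolding \<tau>_def by (rule \<Sigma>hom[OF t_hom[OF s] zc(1)[OF z]])
  have Z: "Module.submodule Z S ?F"
  proof (rule F.submoduleI)
    have "\<tau> (\<lambda>_. \<zero>\<^bsub>V\<^esub>) = \<zero>\<^bsub>V\<^esub>" unfolding \<tau>_def using Bc by (intro V.M.add.finprod_one_eqI) auto
    then show "\<zero>\<^bsub>?F\<^esub> \<in> Z" unfolding Z_def by simp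
    show "x \<oplus>\<^bsub>?F\<^esub> y \<in> Z" if xy: "x \<in> Z" "y \<in> Z" for x y
      using xy \<tau>add[of x y] F.M.a_closed[of x y] by (simp add: Z_def del: fun_module_simps(1))
    show "a \<odot>\<^bsub>?F\<^esub> x \<in> Z" if ax: "a \<in> carrier S" "x \<in> Z" for a x
      using ax \<tau>t[of a x] F.lsmult_closed[of a x] SV.lsmult_r_null[of a] by (simp add: Z_def del: fun_module_simps(1))
  qed (auto simp: Z_def)
  have "noetherian_module S ?F"
  proof (rule SV.fun_module_noetherian[OF P \<Psi> _ B(1)])
    fix N assume "Module.submodule N S (with_action V t)" "\<And>\<phi>. \<phi> \<in> \<Psi> \<Longrightarrow> \<phi> ` carrier P \<subseteq> N"
    from gen[OF this] show "N = carrier (with_action V t)" by simp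
  qed
  then have "fg_module S (?F\<lparr>carrier := Z\<rparr>)" using Z unfolding noetherian_module_def by blast
  then obtain G where G: "finite G" "G \<subseteq> Z" "submodule_hull S ?F G = Z" using F.fg_submodule_iff[OF Z] by blast
  have ZF: "z \<in> carrier ?F" if "z \<in> Z" for z using that unfolding Z_def by blast
  have "\<exists>x. x \<in> carrier X \<and> \<pi> x = v" if "v \<in> carrier V" for v using \<pi>(2) that by (metis imageE)
  then obtain \<xi> where \<xi>: "\<And>v. v \<in> carrier V \<Longrightarrow> \<xi> v \<in> carrier X \<and> \<pi> (\<xi> v) = v" by metis
  define \<theta> where "\<theta> = (\<lambda>z. \<Sigma> (\<lambda>j. \<xi> (z j)))"
  define U where "U = (\<lambda>(e, z). \<theta> (\<lambda>j. t e (z j))) ` (E \<times> G)"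
  have tz: "(\<lambda>j. t s (z j)) \<in> Z" if "s \<in> carrier S" "z \<in> Z" for s z
    using F.submoduleD(4)[OF Z that] by simp
  have \<theta>L: "\<theta> z \<in> L" if z: "z \<in> Z" for z
  proof -
    have c: "(\<lambda>j. \<xi> (z j)) \<in> B \<rightarrow> carrier X" using zc[OF ZF[OF z]] \<xi> by auto
    have "\<pi> (\<Sigma> (\<lambda>j. \<xi> (z j))) = (\<Oplus>\<^bsub>V\<^esub>j\<in>B. j \<odot>\<^bsub>V\<^esub> \<pi> (\<xi> (z j)))"
      unfolding \<Sigma>_def by (rule \<Sigma>hom[OF \<pi>.left_module_hom_axioms c, symmetric])
    also have "\<dots> = \<tau> z" unfolding \<tau>_def using zc[OF ZF[OF z]] \<xi> Bc by (intro V.M.finsum_cong') auto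
    also have "\<dots> = \<zero>\<^bsub>V\<^esub>" using z unfolding Z_def by blast
    finally show ?thesis unfolding L_def \<theta>_def using \<Sigma>c[OF c] by blast
  qed
  have U: "finite U" "U \<subseteq> L"
  proof -
    show "finite U" unfolding U_def using E(1) G(1) by simp
    show "U \<subseteq> L"
    proof
      fix u assume "u \<in> U"
      then obtain e z where ez: "e \<in> E" "z \<in> G" "u = \<theta> (\<lambda>j. t e (z j))" unfolding U_def by auto
      show "u \<in> L" unfolding ez(3) by (rule \<theta>L[OF tz[OF subsetD[OF E(2) ez(1)] subsetD[OF G(2) ez(2)]]])
    qed
  qed
  let ?P = "submodule_plus X (submodule_hull H X U) (rmul X L)"
  have Lc: "L \<subseteq> carrier X" using X.submoduleD(1)[OF L] .
  have hU: "Module.submodule (submodule_hull H X U) H X" by (rule X.hull_submodule) (use U Lc in blast)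
  note PS = X.submodule_plus[OF hU rmul_submodule[OF X Lc]]
    and up = X.submodule_plus_upper[OF hU rmul_submodule[OF X Lc]]
  note DP = X.submoduleD[OF PS]
  have indep: "\<Sigma> x \<in> ?P" if z: "z \<in> carrier ?F" and y: "y \<in> B \<rightarrow> carrier X" "\<And>j. j \<in> B \<Longrightarrow> \<pi> (y j) = z j" "\<Sigma> y \<in> ?P"
    and x: "x \<in> B \<rightarrow> carrier X" "\<And>j. j \<in> B \<Longrightarrow> \<pi> (x j) = z j" for x y z
  proof -
    have d: "(\<lambda>j. x j \<ominus>\<^bsub>X\<^esub> y j) \<in> B \<rightarrow> L"
      using x y zc[OF z] unfolding L_def by (auto simp: Pi_iff)
    then have "\<Sigma> (\<lambda>j. x j \<ominus>\<^bsub>X\<^esub> y j) \<in> ?P" using \<Sigma>r[OF d Lc] up by blast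
    then have "\<Sigma> (\<lambda>j. x j \<ominus>\<^bsub>X\<^esub> y j) \<oplus>\<^bsub>X\<^esub> \<Sigma> y \<in> ?P" using DP(3) y(3) by blast
    also have "\<Sigma> (\<lambda>j. x j \<ominus>\<^bsub>X\<^esub> y j) \<oplus>\<^bsub>X\<^esub> \<Sigma> y = \<Sigma> (\<lambda>j. (x j \<ominus>\<^bsub>X\<^esub> y j) \<oplus>\<^bsub>X\<^esub> y j)"
      using d Lc y(1) by (intro \<Sigma>add[symmetric]) auto
    also have "\<dots> = \<Sigma> x" unfolding \<Sigma>_def using x(1) y(1) Bc
      by (intro X.M.finsum_cong') (auto simp: Pi_iff a_minus_def X.M.a_assoc X.M.l_neg)
    finally show ?thesis .
  qed
  \<comment> \<open>the families whose class is in the span of the chosen elements; to be shown for all of \<open>Z\<close>\<close>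
  define good where "good = (\<lambda>z. \<theta> z \<in> ?P)"
  have goodI: "good z" if "z \<in> Z" "y \<in> B \<rightarrow> carrier X" "\<And>j. j \<in> B \<Longrightarrow> \<pi> (y j) = z j" "\<Sigma> y \<in> ?P" for y z
    unfolding good_def \<theta>_def
    by (rule indep[OF ZF[OF that(1)] that(2-4)]) (use \<xi> zc[OF ZF[OF that(1)]] in auto)
  have \<xi>z: "(\<lambda>j. \<xi> (z j)) \<in> B \<rightarrow> carrier X" if "z \<in> Z" for z using \<xi> zc[OF ZF[OF that]] by auto
  have good_zero: "good (\<lambda>j. \<zero>\<^bsub>V\<^esub>)"
  proof (rule goodI[of _ "\<lambda>j. \<zero>\<^bsub>X\<^esub>"])
    have "\<Sigma> (\<lambda>j. \<zero>\<^bsub>X\<^esub>) = \<zero>\<^bsub>X\<^esub>" unfolding \<Sigma>_def using Bc by (intro X.M.add.finprod_one_eqI) auto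
    then show "\<Sigma> (\<lambda>j. \<zero>\<^bsub>X\<^esub>) \<in> ?P" using DP(2) by simp
    show "(\<lambda>j. \<zero>\<^bsub>V\<^esub>) \<in> Z" using F.submoduleD(2)[OF Z] by simp
  qed auto
  have good_add: "good (\<lambda>j. z j \<oplus>\<^bsub>V\<^esub> z' j)" if z: "z \<in> Z" "z' \<in> Z" "good z" "good z'" for z z'
  proof (rule goodI)
    show "(\<lambda>j. z j \<oplus>\<^bsub>V\<^esub> z' j) \<in> Z" using F.submoduleD(3)[OF Z z(1,2)] by simp
    show "(\<lambda>j. \<xi> (z j) \<oplus>\<^bsub>X\<^esub> \<xi> (z' j)) \<in> B \<rightarrow> carrier X" using \<xi>z[OF z(1)] \<xi>z[OF z(2)] by auto
    show "\<pi> (\<xi> (z j) \<oplus>\<^bsub>X\<^esub> \<xi> (z' j)) = z j \<oplus>\<^bsub>V\<^esub> z' j" for j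
      using \<xi> zc(2)[OF ZF[OF z(1)], of j] zc(2)[OF ZF[OF z(2)], of j] by simp
    show "\<Sigma> (\<lambda>j. \<xi> (z j) \<oplus>\<^bsub>X\<^esub> \<xi> (z' j)) \<in> ?P"
      using \<Sigma>add[OF \<xi>z[OF z(1)] \<xi>z[OF z(2)]] z(3,4) DP(3) unfolding good_def \<theta>_def by simp
  qed
  have good_smult: "good (\<lambda>j. c \<odot>\<^bsub>sr V\<^esub> z j)" if c: "c \<in> carrier K" and z: "z \<in> Z" "good z"
    and cz: "(\<lambda>j. c \<odot>\<^bsub>sr V\<^esub> z j) \<in> Z" for c z
  proof (rule goodI[OF cz])
    let ?c = "c \<odot>\<^bsub>H\<^esub> \<one>\<^bsub>H\<^esub>"
    have cc: "?c \<in> carrier H" using c by simp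
    show "(\<lambda>j. ?c \<odot>\<^bsub>X\<^esub> \<xi> (z j)) \<in> B \<rightarrow> carrier X" using \<xi>z[OF z(1)] cc by auto
    show "\<pi> (?c \<odot>\<^bsub>X\<^esub> \<xi> (z j)) = c \<odot>\<^bsub>sr V\<^esub> z j" for j
      using \<xi> zc(2)[OF ZF[OF z(1)], of j] cc by simp
    have "\<Sigma> (\<lambda>j. ?c \<odot>\<^bsub>X\<^esub> \<xi> (z j)) = (\<Oplus>\<^bsub>X\<^esub>j\<in>B. ?c \<odot>\<^bsub>X\<^esub> (j \<odot>\<^bsub>X\<^esub> \<xi> (z j)))"
      unfolding \<Sigma>_def using \<xi>z[OF z(1)] Bc cc smult_sr(2)[OF X c]
      by (intro X.M.finsum_cong') (auto simp: Pi_iff)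
    also have "\<dots> = ?c \<odot>\<^bsub>X\<^esub> \<theta> z"
      unfolding \<theta>_def \<Sigma>_def using \<xi>z[OF z(1)] Bc cc by (intro X.finsum_lsmult[symmetric]) (auto simp: Pi_iff)
    finally show "\<Sigma> (\<lambda>j. ?c \<odot>\<^bsub>X\<^esub> \<xi> (z j)) \<in> ?P" using DP(4)[OF cc] z(2) unfolding good_def by simp
  qed
  have good_I: "good (\<lambda>j. t i (z j))" if i: "i \<in> I" and z: "z \<in> Z" for i z
  proof -
    obtain \<sigma> where \<sigma>: "\<sigma> \<in> Hom H V X" "\<And>v. v \<in> carrier V \<Longrightarrow> \<pi> (\<sigma> v) = t i v" using lift[OF i] by blast
    interpret \<sigma>: left_module_hom H V X \<sigma> by (rule left_module_homI[OF V X \<sigma>(1)])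
    note c = zc[OF ZF[OF z]]
    have "\<Sigma> (\<lambda>j. \<sigma> (z j)) = \<sigma> (\<tau> z)" unfolding \<Sigma>_def \<tau>_def by (rule \<Sigma>hom[OF \<sigma>.left_module_hom_axioms c(1)])
    also have "\<dots> = \<zero>\<^bsub>X\<^esub>" using z unfolding Z_def by simp
    finally have "\<Sigma> (\<lambda>j. \<sigma> (z j)) \<in> ?P" using DP(2) by simp
    then show ?thesis using tz[OF subsetD[OF I i] z] c \<sigma> by (intro goodI[of _ "\<lambda>j. \<sigma> (z j)"]) auto
  qed
  have good_G: "good (\<lambda>j. t s (z j))" if s: "s \<in> carrier S" and z: "z \<in> G" for s z
  proof -
    have zZ: "z \<in> Z" using z G(2) by blast
    note c = zc[OF ZF[OF zZ]]
    let ?N = "{s \<in> carrier S. good (\<lambda>j. t s (z j))}"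
    have "Module.submodule ?N K S"
    proof (rule SK.submoduleI)
      have "t \<zero>\<^bsub>S\<^esub> (z j) = \<zero>\<^bsub>V\<^esub>" for j using SV.lsmult_l_null[of "z j"] c(2) by simp
      then show "\<zero>\<^bsub>S\<^esub> \<in> ?N" using good_zero by simp
      show "s \<oplus>\<^bsub>S\<^esub> s' \<in> ?N" if ss: "s \<in> ?N" "s' \<in> ?N" for s s'
      proof -
        have sc: "s \<in> carrier S" "s' \<in> carrier S" using ss by auto
        have "t (s \<oplus>\<^bsub>S\<^esub> s') (z j) = t s (z j) \<oplus>\<^bsub>V\<^esub> t s' (z j)" for j
          using SV.lsmult_l_distr[OF sc, of "z j"] c(2) by simp
        then show ?thesis using good_add[OF tz[OF sc(1) zZ] tz[OF sc(2) zZ]] ss by simp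
      qed
      show "c \<odot>\<^bsub>S\<^esub> s \<in> ?N" if cs: "c \<in> carrier K" "s \<in> ?N" for c s
      proof -
        have sc: "s \<in> carrier S" "c \<odot>\<^bsub>S\<^esub> s \<in> carrier S" using cs by auto
        have "(\<lambda>j. t (c \<odot>\<^bsub>S\<^esub> s) (z j)) = (\<lambda>j. c \<odot>\<^bsub>sr V\<^esub> t s (z j))"
          using scal[OF cs(1) sc(1) c(2)] by (intro ext)
        then show ?thesis using good_smult[OF cs(1) tz[OF sc(1) zZ]] tz[OF sc(2) zZ] cs sc by simp
      qed
    qed auto
    moreover have "E \<subseteq> ?N"
    proof
      fix e assume e: "e \<in> E"
      have "\<theta> (\<lambda>j. t e (z j)) \<in> U" unfolding U_def using e z by force
      then have "\<theta> (\<lambda>j. t e (z j)) \<in> ?P" using X.hull_superset[of U] up(1) by blast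
      then show "e \<in> ?N" using e E(2) unfolding good_def by blast
    qed
    moreover have "I \<subseteq> ?N" using good_I zZ I by blast
    ultimately have "?N = carrier S" by (rule EI)
    then show ?thesis using s by blast
  qed
  let ?N = "{z \<in> Z. \<forall>s\<in>carrier S. good (\<lambda>j. t s (z j))}"
  have "Module.submodule ?N S ?F"
  proof (rule F.submoduleI)
    show "?N \<subseteq> carrier ?F" using F.submoduleD(1)[OF Z] by blast
    have "t s \<zero>\<^bsub>V\<^esub> = \<zero>\<^bsub>V\<^esub>" if "s \<in> carrier S" for s using SV.lsmult_r_null[OF that] by simp
    then show "\<zero>\<^bsub>?F\<^esub> \<in> ?N" using F.submoduleD(2)[OF Z] good_zero by simp
    show "x \<oplus>\<^bsub>?F\<^esub> y \<in> ?N" if xy: "x \<in> ?N" "y \<in> ?N" for x y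
    proof -
      have xyZ: "x \<in> Z" "y \<in> Z" using xy by auto
      have "good (\<lambda>j. t s (x j \<oplus>\<^bsub>V\<^esub> y j))" if s: "s \<in> carrier S" for s
      proof -
        have "(\<lambda>j. t s (x j \<oplus>\<^bsub>V\<^esub> y j)) = (\<lambda>j. t s (x j) \<oplus>\<^bsub>V\<^esub> t s (y j))"
          using SV.lsmult_r_distr[OF s] zc(2)[OF ZF[OF xyZ(1)]] zc(2)[OF ZF[OF xyZ(2)]] by (intro ext) simp
        then show ?thesis using good_add[OF tz[OF s xyZ(1)] tz[OF s xyZ(2)]] xy s by simp
      qed
      then show ?thesis using F.submoduleD(3)[OF Z xyZ] by simp
    qed
    show "a \<odot>\<^bsub>?F\<^esub> x \<in> ?N" if ax: "a \<in> carrier S" "x \<in> ?N" for a x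
    proof -
      have xZ: "x \<in> Z" using ax by auto
      have "good (\<lambda>j. t s (t a (x j)))" if s: "s \<in> carrier S" for s
      proof -
        have "(\<lambda>j. t s (t a (x j))) = (\<lambda>j. t (s \<otimes>\<^bsub>S\<^esub> a) (x j))"
          using SV.lsmult_assoc[OF s ax(1)] zc(2)[OF ZF[OF xZ]] by (intro ext) simp
        then show ?thesis using ax s SV.R.m_closed by simp
      qed
      then show ?thesis using F.submoduleD(4)[OF Z ax(1) xZ] by simp
    qed
  qed
  moreover have "G \<subseteq> ?N" using good_G G(2) by blast
  ultimately have ZN: "Z \<subseteq> ?N" using F.hull_least G(3) by blast
  have good_Z: "good z" if z: "z \<in> Z" for z
  proof -
    have "z \<in> ?N" using ZN z by (rule subsetD)
    then have "good (\<lambda>j. t \<one>\<^bsub>S\<^esub> (z j))" using SV.R.one_closed by simp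
    moreover have "(\<lambda>j. t \<one>\<^bsub>S\<^esub> (z j)) = z" using SV.lsmult_one zc(2)[OF ZF[OF z]] by (intro ext) simp
    ultimately show ?thesis by simp
  qed
  have "L \<inter> rmul X (carrier X) \<subseteq> ?P"
  proof
    fix x assume x: "x \<in> L \<inter> rmul X (carrier X)"
    then obtain y where y: "y \<in> B \<rightarrow> carrier X" "x = \<Sigma> y" using rep unfolding \<Sigma>_def by blast
    define z where "z = (\<lambda>j. if j \<in> B then \<pi> (y j) else \<zero>\<^bsub>V\<^esub>)"
    have zF: "z \<in> carrier ?F" using y(1) by (auto simp: z_def)
    have "\<tau> z = (\<Oplus>\<^bsub>V\<^esub>j\<in>B. j \<odot>\<^bsub>V\<^esub> \<pi> (y j))" unfolding \<tau>_def using y(1) Bc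
      by (intro V.M.finsum_cong') (auto simp: z_def Pi_iff)
    also have "\<dots> = \<pi> (\<Sigma> y)" unfolding \<Sigma>_def by (rule \<Sigma>hom[OF \<pi>.left_module_hom_axioms y(1)])
    also have "\<dots> = \<zero>\<^bsub>V\<^esub>" using x y(2) unfolding L_def by blast
    finally have zZ: "z \<in> Z" using zF unfolding Z_def by blast
    have g: "\<Sigma> (\<lambda>j. \<xi> (z j)) \<in> ?P" using good_Z[OF zZ] unfolding good_def \<theta>_def .
    show "x \<in> ?P" unfolding y(2)
    proof (rule indep[OF zF \<xi>z[OF zZ] _ g y(1)])
      show "\<pi> (\<xi> (z j)) = z j" for j using \<xi>[OF zc(2)[OF zF]] by simp
    qed (simp add: z_def)
  qed
  then show ?thesis using U unfolding L_def by blast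
qed

text \<open>
  The cover is a direct summand \<open>Y\<close> of \<open>X\<close>.  Let \<open>N\<close> be a complement of \<open>L\<close> modulo \<open>J X\<close>.
  Decomposing the family \<open>b\<close> along \<open>X = L + N\<close> gives an endomorphism \<open>e\<close> of \<open>X\<close> with values in \<open>L\<close>
  such that \<open>g = 1 - e\<close> has values in \<open>N\<close>.  Hence \<open>g\<close> maps \<open>L\<close> to \<open>L \<inter> N \<subseteq> J X\<close>, and \<open>e g\<close> maps
  \<open>X\<close> to \<open>J X\<close>; so \<open>e g\<close> is nilpotent.  By Fitting's decomposition, \<open>X\<close> is the direct sum of the
  images of \<open>e\<^sup>m\<close> and \<open>g\<^sup>m\<close> for large \<open>m\<close>.  The first of them is contained in \<open>L\<close> and may be
  removed: the second, \<open>Y\<close>, still maps onto \<open>V\<close>.  On \<open>Q = L \<inter> Y\<close> the map \<open>e\<close> is the identity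
  modulo \<open>J X\<close> and nilpotent, so \<open>Q \<subseteq> J X\<close>.  Thus the projection \<open>p\<close> to \<open>Y\<close> turns \<open>tor\<close> into
  \<open>Q \<subseteq> H p(U) + J Q\<close>, and Nakayama's lemma applies.
\<close>

lemma fin_kernel_cover_exists:
  fixes X :: "('h, 'x, 'e) module_scheme" and V :: "('h, 'v, 'f) module_scheme"
  assumes X: "dual_basis H X I b f" and V: "left_module H V" and \<pi>: "\<pi> \<in> Hom H X V" "\<pi> ` carrier X = carrier V"
    and U: "finite U" "U \<subseteq> {x \<in> carrier X. \<pi> x = \<zero>\<^bsub>V\<^esub>}"
    and tor: "{x \<in> carrier X. \<pi> x = \<zero>\<^bsub>V\<^esub>} \<inter> rmul X (carrier X) \<subseteq>
      submodule_plus X (submodule_hull H X U) (rmul X {x \<in> carrier X. \<pi> x = \<zero>\<^bsub>V\<^esub>})"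
  shows "\<exists>Y b' f'. dual_basis H (X\<lparr>carrier := Y\<rparr>) I b' f' \<and> fin_kernel_cover (X\<lparr>carrier := Y\<rparr>) \<pi> V"
proof -
  note D = dual_basisD[OF X]
  interpret X: left_module H X by (rule D(1))
  interpret \<pi>: left_module_hom H X V \<pi> by (rule left_module_homI[OF D(1) V \<pi>(1)])
  define L where "L = {x \<in> carrier X. \<pi> x = \<zero>\<^bsub>V\<^esub>}"
  have L: "Module.submodule L H X" unfolding L_def by (rule \<pi>.ker_submodule)
  note DL = X.submoduleD[OF L]
  let ?J = "rmul X (carrier X)"
  have J: "Module.submodule ?J H X" by (rule rmul_submodule[OF D(1)]) simp
  note DJ = X.submoduleD[OF J]
  obtain N where N: "Module.submodule N H X" "?J \<subseteq> N" "L \<inter> N \<subseteq> ?J" "submodule_plus X L N = carrier X"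
    using X.relative_complement[OF L J rmul_mem[OF D(1)] idempotent_modulo_rad] by blast
  note DN = X.submoduleD[OF N(1)]
  have "\<exists>k n. k \<in> L \<and> n \<in> N \<and> b i = k \<oplus>\<^bsub>X\<^esub> n" if "i \<in> I" for i
    using D(3)[OF that] N(4) unfolding submodule_plus_def by blast
  then obtain k n where kn: "\<And>i. i \<in> I \<Longrightarrow> k i \<in> L" "\<And>i. i \<in> I \<Longrightarrow> n i \<in> N" "\<And>i. i \<in> I \<Longrightarrow> b i = k i \<oplus>\<^bsub>X\<^esub> n i" by metis
  define e where "e = (\<lambda>x. lin_comb H X I (\<lambda>i. f i x) k)"
  have kX: "k \<in> I \<rightarrow> carrier X" "n \<in> I \<rightarrow> carrier X" using kn DL(7) DN(7) by auto
  have fx: "(\<lambda>i. f i x) \<in> I \<rightarrow> carrier H" if "x \<in> carrier X" for x using D(5) that by auto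
  have e: "e \<in> Hom H X X" unfolding e_def by (rule lin_comb_hom[OF X D(1) kX(1)])
  interpret e: left_module_hom H X X e by (rule left_module_homI[OF D(1) D(1) e])
  have eL: "e x \<in> L" if "x \<in> carrier X" for x
    unfolding e_def using fx[OF that] kn(1) by (intro X.lin_comb_submodule[OF L]) auto
  define g where "g = (\<lambda>x. x \<ominus>\<^bsub>X\<^esub> e x)"
  have g: "g \<in> Hom H X X" unfolding g_def by (rule Hom_minus[OF D(1) Hom_id e])
  interpret g: left_module_hom H X X g by (rule left_module_homI[OF D(1) D(1) g])
  have eg: "x = e x \<oplus>\<^bsub>X\<^esub> g x" if "x \<in> carrier X" for x
    unfolding g_def using that e.closed[OF that] by (metis X.M.a_inv_closed X.M.a_lcomm X.M.r_neg X.M.r_zero a_minus_def)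
  have gN: "g x \<in> N" if x: "x \<in> carrier X" for x
  proof -
    have "x = lin_comb H X I (\<lambda>i. f i x) b" using D(9)[OF x] by simp
    also have "\<dots> = lin_comb H X I (\<lambda>i. f i x) (\<lambda>i. k i \<oplus>\<^bsub>X\<^esub> n i)"
      using fx[OF x] D(2) kn(3) by (intro X.lin_comb_cong) auto
    also have "\<dots> = e x \<oplus>\<^bsub>X\<^esub> lin_comb H X I (\<lambda>i. f i x) n"
      unfolding e_def by (rule X.lin_comb_add_right[OF fx[OF x] kX])
    finally have "x = e x \<oplus>\<^bsub>X\<^esub> lin_comb H X I (\<lambda>i. f i x) n" .
    then have "g x = lin_comb H X I (\<lambda>i. f i x) n" unfolding g_def
      using X.M.add_eq_minus(1)[of "e x" "lin_comb H X I (\<lambda>i. f i x) n" x] x X.lin_comb_closed[OF fx[OF x] kX(2)] by simp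
    also have "\<dots> \<in> N" using fx[OF x] kn(2) by (intro X.lin_comb_submodule[OF N(1)]) auto
    finally show ?thesis .
  qed
  have gJ: "g x \<in> ?J" if x: "x \<in> L" for x
  proof -
    have "g x \<in> L" unfolding g_def using DL(6)[OF x eL[OF DL(7)[OF x]]] .
    then show ?thesis using gN[OF DL(7)[OF x]] N(3) by blast
  qed
  have comm: "e (g x) = g (e x)" if "x \<in> carrier X" for x
    unfolding g_def using that by simp
  have pc: "(e ^^ i) x \<in> carrier X" "(g ^^ i) x \<in> carrier X" if "x \<in> carrier X" for i x
    using that by (induction i) auto
  define d where "d = (\<lambda>x. e (g x))"
  have d: "d \<in> Hom H X X" unfolding d_def by (rule Hom_comp[OF g e])
  interpret d: left_module_hom H X X d by (rule left_module_homI[OF D(1) D(1) d])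
  have Jk: "Module.submodule ((rmul X ^^ i) (carrier X)) H X" for i
    by (rule rmul_funpow_submodule[OF D(1) X.carrier_submodule])
  note Jkc = X.submoduleD(1)[OF Jk]
  have dJ: "d ` ((rmul X ^^ i) (carrier X)) \<subseteq> (rmul X ^^ Suc i) (carrier X)" for i
  proof (induction i)
    case 0
    show ?case using comm gJ eL by (auto simp: d_def)
  next
    case (Suc i)
    show ?case using rmul_hom[OF d.left_module_hom_axioms Jkc Jkc Suc.IH] by simp
  qed
  have dk: "(d ^^ i) x \<in> (rmul X ^^ i) (carrier X)" if "x \<in> carrier X" for i x
  proof (induction i)
    case (Suc i) then show ?case using dJ[of i] by auto
  qed (use that in simp)
  have eg_swap: "e ((g ^^ i) x) = (g ^^ i) (e x)" if "x \<in> carrier X" for i x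
    using that pc comm by (induction i) auto
  have deg: "(d ^^ i) x = (g ^^ i) ((e ^^ i) x)" if "x \<in> carrier X" for i x
  proof (induction i)
    case (Suc i)
    have "(d ^^ Suc i) x = e (g ((g ^^ i) ((e ^^ i) x)))" using Suc.IH by (simp add: d_def)
    also have "\<dots> = e ((g ^^ Suc i) ((e ^^ i) x))" by simp
    also have "\<dots> = (g ^^ Suc i) (e ((e ^^ i) x))" by (rule eg_swap[OF pc(1)[OF that]])
    finally show ?case by simp
  qed simp
  obtain m0 where m0: "(rmul X ^^ m0) (carrier X) = {\<zero>\<^bsub>X\<^esub>}" using rad_nilpotent D(1) by blast
  \<comment> \<open>the successor ensures \<open>m > 0\<close>, which is needed for the image of \<open>e\<^sup>m\<close> to be in \<open>L\<close>\<close>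
  define m where "m = Suc m0"
  have "(rmul X ^^ m) (carrier X) \<subseteq> {\<zero>\<^bsub>X\<^esub>}"
    unfolding m_def using rmul_sub[OF D(1) X.zero_submodule] m0 by simp
  then have gem: "(g ^^ m) ((e ^^ m) x) = \<zero>\<^bsub>X\<^esub>" if "x \<in> carrier X" for x
    using dk[OF that, of m] deg[OF that, of m] by auto
  have eg_swap2: "(e ^^ j) ((g ^^ i) x) = (g ^^ i) ((e ^^ j) x)" if "x \<in> carrier X" for i j x
    using that pc eg_swap by (induction j) auto
  have powhom: "(e ^^ i) \<in> Hom H X X" "(g ^^ i) \<in> Hom H X X" for i
  proof -
    show "(e ^^ i) \<in> Hom H X X"
    proof (induction i)
      case (Suc i) then show ?case using Hom_comp[OF Suc e] by (simp add: comp_def)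
    qed (use Hom_id in \<open>simp add: id_def\<close>)
    show "(g ^^ i) \<in> Hom H X X"
    proof (induction i)
      case (Suc i) then show ?case using Hom_comp[OF Suc g] by (simp add: comp_def)
    qed (use Hom_id in \<open>simp add: id_def\<close>)
  qed
  define A where "A = (e ^^ m) ` carrier X"
  define Y where "Y = (g ^^ m) ` carrier X"
  have A: "Module.submodule A H X" and Y: "Module.submodule Y H X" unfolding A_def Y_def
    by (rule left_module_hom.image_submodule[OF left_module_homI[OF D(1) D(1)] X.carrier_submodule], rule powhom)+
  have AY: "A \<inter> Y \<subseteq> {\<zero>\<^bsub>X\<^esub>}"
  proof
    fix x assume "x \<in> A \<inter> Y"
    then obtain u v where uv: "u \<in> carrier X" "v \<in> carrier X" "x = (e ^^ m) u" "x = (g ^^ m) v" unfolding A_def Y_def by blast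
    have "(g ^^ m) x = \<zero>\<^bsub>X\<^esub>" using gem[OF uv(1)] uv(3) by simp
    moreover have "(e ^^ m) x = \<zero>\<^bsub>X\<^esub>" using gem[OF uv(2)] eg_swap2[OF uv(2), of m m] uv(4) by simp
    ultimately show "x \<in> {\<zero>\<^bsub>X\<^esub>}" using X.fitting_inter[OF e g eg comm, of x m m] pc[OF uv(1)] uv(3) by auto
  qed
  have AYsum: "submodule_plus X A Y = carrier X"
  proof
    show "carrier X \<subseteq> submodule_plus X A Y"
    proof
      fix x assume "x \<in> carrier X"
      from X.fitting_sum[OF e g eg comm this, of m m] show "x \<in> submodule_plus X A Y"
        unfolding submodule_plus_def A_def Y_def by blast
    qed
    show "submodule_plus X A Y \<subseteq> carrier X" by (rule X.submoduleD(1)[OF X.submodule_plus[OF A Y]])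
  qed
  obtain p where p: "p \<in> Hom H X (X\<lparr>carrier := Y\<rparr>)" "\<And>x. x \<in> Y \<Longrightarrow> p x = x" "\<And>x. x \<in> carrier X \<Longrightarrow> x \<ominus>\<^bsub>X\<^esub> p x \<in> A"
    using X.direct_projection[OF A Y AY AYsum] by blast
  let ?Y = "X\<lparr>carrier := Y\<rparr>"
  have YM: "left_module H ?Y" by (rule X.submodule_left_module[OF Y])
  have Yc: "Y \<subseteq> carrier X" using X.submoduleD(1)[OF Y] .
  have incl: "(\<lambda>x. x) \<in> Hom H ?Y X" by (rule Hom_restrict[OF Hom_id Yc])
  have DY: "dual_basis H ?Y I (\<lambda>i. p (b i)) (\<lambda>i y. f i y)"
    using dual_basis_retract[OF X YM p(1) incl] p(2) by simp
  have pX: "p \<in> Hom H X X" by (rule Hom_cod_extend[OF p(1) Yc])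
  interpret p: left_module_hom H X X p by (rule left_module_homI[OF D(1) D(1) pX])
  have AL: "A \<subseteq> L" unfolding A_def m_def using eL pc by auto
  have \<pi>p: "\<pi> (p x) = \<pi> x" if x: "x \<in> carrier X" for x
  proof -
    have "x \<ominus>\<^bsub>X\<^esub> p x \<in> L" using p(3)[OF x] AL by blast
    then show ?thesis using x by (simp add: L_def)
  qed
  have sur: "\<pi> ` Y = carrier V"
  proof
    show "carrier V \<subseteq> \<pi> ` Y"
    proof
      fix v assume "v \<in> carrier V"
      then obtain x where "x \<in> carrier X" "v = \<pi> x" using \<pi>(2) by blast
      then show "v \<in> \<pi> ` Y" using \<pi>p HomD(1)[OF p(1)] by (intro image_eqI[of _ _ "p x"]) auto
    qed
  qed (use Yc in auto)
  define Q where "Q = L \<inter> Y"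
  have Q: "Module.submodule Q H X" unfolding Q_def by (rule X.submodule_Int[OF L Y])
  note DQ = X.submoduleD[OF Q]
  have pQ: "p x \<in> Q" if x: "x \<in> L" for x
  proof -
    have xc: "x \<in> carrier X" using DL(7)[OF x] .
    have "\<pi> (p x) = \<zero>\<^bsub>V\<^esub>" using \<pi>p[OF xc] x by (simp add: L_def)
    then show ?thesis unfolding Q_def L_def using HomD(1)[OF p(1) xc] xc by simp
  qed
  have QJ: "x \<in> ?J" if x: "x \<in> Q" for x
  proof -
    have xL: "x \<in> L" "x \<in> Y" using x unfolding Q_def by auto
    have xc: "x \<in> carrier X" using DL(7)[OF xL(1)] .
    obtain v where v: "v \<in> carrier X" "x = (g ^^ m) v" using xL(2) unfolding Y_def by blast
    have e0: "(e ^^ m) x = \<zero>\<^bsub>X\<^esub>" using gem[OF v(1)] eg_swap2[OF v(1), of m m] v(2) by simp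
    have "x \<ominus>\<^bsub>X\<^esub> (e ^^ i) x \<in> ?J" for i
    proof (induction i)
      case 0 then show ?case using DJ(2) xc by (simp add: a_minus_def X.M.r_neg)
    next
      case (Suc i)
      have eiL: "(e ^^ i) x \<in> L" by (cases i) (use xL eL pc[OF xc] in auto)
      have c: "(e ^^ i) x \<in> carrier X" using pc xc by blast
      have "(x \<ominus>\<^bsub>X\<^esub> (e ^^ i) x) \<oplus>\<^bsub>X\<^esub> g ((e ^^ i) x) \<in> ?J" using DJ(3)[OF Suc.IH gJ[OF eiL]] .
      also have "(x \<ominus>\<^bsub>X\<^esub> (e ^^ i) x) \<oplus>\<^bsub>X\<^esub> g ((e ^^ i) x) = x \<ominus>\<^bsub>X\<^esub> e ((e ^^ i) x)"
        unfolding g_def using xc c by (simp add: a_minus_def X.M.a_assoc X.M.r_neg1)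
      finally show ?case by simp
    qed
    from this[of m] show ?thesis using xc by (simp add: e0 X.M.minus_zero_right)
  qed
  let ?pU = "p ` U"
  have UL: "U \<subseteq> L" using U(2) unfolding L_def .
  have pU: "?pU \<subseteq> Q" using pQ UL by blast
  have hU: "Module.submodule (submodule_hull H X ?pU) H X" by (rule X.hull_submodule) (use pU DQ(1) in blast)
  have hUQ: "submodule_hull H X ?pU \<subseteq> Q" by (rule X.hull_least[OF Q pU])
  have "Q \<subseteq> submodule_plus X (submodule_hull H X ?pU) (rmul X Q)"
  proof
    fix x assume x: "x \<in> Q"
    then have "x \<in> L \<inter> ?J" using QJ unfolding Q_def by blast
    then have "x \<in> submodule_plus X (submodule_hull H X U) (rmul X L)" using tor unfolding L_def by blast
    then obtain u w where uw: "u \<in> submodule_hull H X U" "w \<in> rmul X L" "x = u \<oplus>\<^bsub>X\<^esub> w" unfolding submodule_plus_def by blast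
    have hUs: "Module.submodule (submodule_hull H X U) H X" by (rule X.hull_submodule) (use UL DL(1) in blast)
    have uc: "u \<in> carrier X" using X.submoduleD(7)[OF hUs uw(1)] .
    have wc: "w \<in> carrier X" using X.submoduleD(7)[OF rmul_submodule[OF D(1) DL(1)] uw(2)] .
    have "submodule_hull H X U \<subseteq> {u \<in> carrier X. p u \<in> submodule_hull H X ?pU}"
      using X.hull_superset[of ?pU] UL DL(1) by (intro X.hull_least p.vimage_submodule hU) blast+
    then have pu: "p u \<in> submodule_hull H X ?pU" using uw(1) by blast
    have "p ` rmul X L \<subseteq> rmul X Q"
      by (rule rmul_hom[OF p.left_module_hom_axioms DL(1) DQ(1)]) (use pQ in blast)
    then have pw: "p w \<in> rmul X Q" using uw(2) by blast
    have "x = p x" using p(2) x unfolding Q_def by simp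
    also have "\<dots> = p u \<oplus>\<^bsub>X\<^esub> p w" using uc wc uw(3) by simp
    finally show "x \<in> submodule_plus X (submodule_hull H X ?pU) (rmul X Q)" unfolding submodule_plus_def using pu pw by blast
  qed
  from nakayama[OF D(1) Q hU this] have "submodule_hull H X ?pU = Q" using hUQ by blast
  then have "fg_module H (X\<lparr>carrier := Q\<rparr>)" using X.fg_submodule_iff[OF Q] U(1) pU by blast
  moreover have "Q = {x \<in> carrier ?Y. \<pi> x = \<zero>\<^bsub>V\<^esub>}" unfolding Q_def L_def using Yc by auto
  ultimately have "fin_kernel_cover ?Y \<pi> V" unfolding fin_kernel_cover_def
    using V Hom_restrict[OF \<pi>(1) Yc] sur by simp
  then show ?thesis using DY by blast
qed

end

section \<open>Tensor products\<close>

definition bilinear ::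
  "('k, 'c) ring_scheme \<Rightarrow> ('k, 'v, 'd) module_scheme \<Rightarrow> ('k, 'w, 'e) module_scheme \<Rightarrow>
     ('k, 'u, 'f) module_scheme \<Rightarrow> ('v \<Rightarrow> 'w \<Rightarrow> 'u) \<Rightarrow> bool" where
  "bilinear K V W U f \<longleftrightarrow> (\<forall>v\<in>carrier V. f v \<in> Hom K W U) \<and> (\<forall>w\<in>carrier W. (\<lambda>v. f v w) \<in> Hom K V U)"

lemma bilinearI:
  assumes "\<And>v. v \<in> carrier V \<Longrightarrow> f v \<in> Hom K W U" "\<And>w. w \<in> carrier W \<Longrightarrow> (\<lambda>v. f v w) \<in> Hom K V U"
  shows "bilinear K V W U f"
  using assms unfolding bilinear_def by blast

lemma bilinearD:
  assumes "bilinear K V W U f"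
  shows "\<And>v. v \<in> carrier V \<Longrightarrow> f v \<in> Hom K W U" "\<And>w. w \<in> carrier W \<Longrightarrow> (\<lambda>v. f v w) \<in> Hom K V U"
    "\<And>v w. \<lbrakk>v \<in> carrier V; w \<in> carrier W\<rbrakk> \<Longrightarrow> f v w \<in> carrier U"
    "\<And>v v' w. \<lbrakk>v \<in> carrier V; v' \<in> carrier V; w \<in> carrier W\<rbrakk> \<Longrightarrow> f (v \<oplus>\<^bsub>V\<^esub> v') w = f v w \<oplus>\<^bsub>U\<^esub> f v' w"
    "\<And>v w w'. \<lbrakk>v \<in> carrier V; w \<in> carrier W; w' \<in> carrier W\<rbrakk> \<Longrightarrow> f v (w \<oplus>\<^bsub>W\<^esub> w') = f v w \<oplus>\<^bsub>U\<^esub> f v w'"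
    "\<And>c v w. \<lbrakk>c \<in> carrier K; v \<in> carrier V; w \<in> carrier W\<rbrakk> \<Longrightarrow> f (c \<odot>\<^bsub>V\<^esub> v) w = c \<odot>\<^bsub>U\<^esub> f v w"
    "\<And>c v w. \<lbrakk>c \<in> carrier K; v \<in> carrier V; w \<in> carrier W\<rbrakk> \<Longrightarrow> f v (c \<odot>\<^bsub>W\<^esub> w) = c \<odot>\<^bsub>U\<^esub> f v w"
proof -
  show 1: "\<And>v. v \<in> carrier V \<Longrightarrow> f v \<in> Hom K W U" and 2: "\<And>w. w \<in> carrier W \<Longrightarrow> (\<lambda>v. f v w) \<in> Hom K V U"
    using assms unfolding bilinear_def by blast+
  show "\<And>v w. \<lbrakk>v \<in> carrier V; w \<in> carrier W\<rbrakk> \<Longrightarrow> f v w \<in> carrier U"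
    "\<And>v v' w. \<lbrakk>v \<in> carrier V; v' \<in> carrier V; w \<in> carrier W\<rbrakk> \<Longrightarrow> f (v \<oplus>\<^bsub>V\<^esub> v') w = f v w \<oplus>\<^bsub>U\<^esub> f v' w"
    "\<And>v w w'. \<lbrakk>v \<in> carrier V; w \<in> carrier W; w' \<in> carrier W\<rbrakk> \<Longrightarrow> f v (w \<oplus>\<^bsub>W\<^esub> w') = f v w \<oplus>\<^bsub>U\<^esub> f v w'"
    "\<And>c v w. \<lbrakk>c \<in> carrier K; v \<in> carrier V; w \<in> carrier W\<rbrakk> \<Longrightarrow> f (c \<odot>\<^bsub>V\<^esub> v) w = c \<odot>\<^bsub>U\<^esub> f v w"
    "\<And>c v w. \<lbrakk>c \<in> carrier K; v \<in> carrier V; w \<in> carrier W\<rbrakk> \<Longrightarrow> f v (c \<odot>\<^bsub>W\<^esub> w) = c \<odot>\<^bsub>U\<^esub> f v w"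
    using HomD[OF 1] HomD[OF 2] by blast+
qed

lemma bilinear_comp:
  assumes f: "bilinear K V W U f" and g: "g \<in> Hom K U U'"
  shows "bilinear K V W U' (\<lambda>v w. g (f v w))"
proof (rule bilinearI)
  show "(\<lambda>w. g (f v w)) \<in> Hom K W U'" if "v \<in> carrier V" for v
    by (rule Hom_comp[OF bilinearD(1)[OF f that] g])
  show "(\<lambda>v. g (f v w)) \<in> Hom K V U'" if "w \<in> carrier W" for w
    by (rule Hom_comp[OF bilinearD(2)[OF f that] g])
qed

lemma bilinear_comp_args:
  assumes f: "bilinear K V W U f" and g: "g \<in> Hom K V' V" and h: "h \<in> Hom K W' W"
  shows "bilinear K V' W' U (\<lambda>v w. f (g v) (h w))"
proof (rule bilinearI)
  show "(\<lambda>w. f (g v) (h w)) \<in> Hom K W' U" if "v \<in> carrier V'" for v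
    by (rule Hom_comp[OF h bilinearD(1)[OF f HomD(1)[OF g that]]])
  show "(\<lambda>v. f (g v) (h w)) \<in> Hom K V' U" if "w \<in> carrier W'" for w
    by (rule Hom_comp[OF g bilinearD(2)[OF f HomD(1)[OF h that]]])
qed

lemma bilinear_cong:
  assumes f: "bilinear K V W U f" and V: "left_module K V" and W: "left_module K W"
    and eq: "\<And>v w. \<lbrakk>v \<in> carrier V; w \<in> carrier W\<rbrakk> \<Longrightarrow> f v w = g v w"
  shows "bilinear K V W U g"
proof -
  interpret V: left_module K V by (rule V)
  interpret W: left_module K W by (rule W)
  note B = bilinearD[OF f]
  show ?thesis
  proof (rule bilinearI)
    show "g v \<in> Hom K W U" if v: "v \<in> carrier V" for v
      using B(3)[OF v] B(5)[OF v] B(7)[OF _ v] by (intro HomI) (simp_all add: eq[symmetric] v W.lsmult_closed)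
    show "(\<lambda>v. g v w) \<in> Hom K V U" if w: "w \<in> carrier W" for w
      using B(3)[OF _ w] B(4)[OF _ _ w] B(6)[OF _ _ w] by (intro HomI) (simp_all add: eq[symmetric] w V.lsmult_closed)
  qed
qed

locale tensor_product =
  fixes K :: "('k, 'c) ring_scheme" and V :: "('k, 'v, 'd) module_scheme" and W :: "('k, 'w, 'e) module_scheme"
  assumes K: "cring K" and V: "left_module K V" and W: "left_module K W"
begin

sublocale K: cring K by (rule K)
sublocale V: left_module K V by (rule V)
sublocale W: left_module K W by (rule W)

abbreviation "F \<equiv> tensor_free K V W"
abbreviation "N \<equiv> tensor_null K V W"
abbreviation pure (infixl "\<otimes>\<^sub>p" 75) where "v \<otimes>\<^sub>p w \<equiv> pure_tensor K V W v w"
abbreviation "T \<equiv> tensor K V W"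

lemma F_left_module: "left_module K F" by (rule free_module_left_module[OF K.ring_axioms])

sublocale F: left_module K F by (rule F_left_module)

lemma basis_closed: "\<lbrakk>v \<in> carrier V; w \<in> carrier W\<rbrakk> \<Longrightarrow> free_basis K (v, w) \<in> carrier F"
  by (simp add: K.ring_axioms)

lemma relators_closed: "tensor_relators K V W \<subseteq> carrier F"
  unfolding tensor_relators_def Let_def
  by (auto simp del: free_module_simps intro!: F.M.minus_closed F.M.a_closed F.lsmult_closed basis_closed)

lemma N_hull: "N = submodule_hull K F (tensor_relators K V W)"
  unfolding tensor_null_def using module_iff_left_module[OF K] F_left_module relators_closed
  by (intro span_eq_hull) auto

lemma N_submodule: "Module.submodule N K F"
  unfolding N_hull by (rule F.hull_submodule[OF relators_closed])

lemma T_left_module: "left_module K T"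
  unfolding tensor_def by (rule F.quotient_left_module[OF N_submodule])

sublocale T: left_module K T by (rule T_left_module)

lemma coset_closed: "x \<in> carrier F \<Longrightarrow> N +>\<^bsub>F\<^esub> x \<in> carrier T"
  unfolding tensor_def F.quotient_module_carrier by blast

lemma T_carrier: "t \<in> carrier T \<Longrightarrow> \<exists>x\<in>carrier F. t = N +>\<^bsub>F\<^esub> x"
  unfolding tensor_def F.quotient_module_carrier by blast

lemma coset_hom: "(\<lambda>x. N +>\<^bsub>F\<^esub> x) \<in> Hom K F T"
  unfolding tensor_def by (rule F.quotient_hom[OF N_submodule])

sublocale coset: left_module_hom K F T "\<lambda>x. N +>\<^bsub>F\<^esub> x"
  by (rule left_module_homI[OF F_left_module T_left_module coset_hom])

lemma pure_closed [simp, intro]: "\<lbrakk>v \<in> carrier V; w \<in> carrier W\<rbrakk> \<Longrightarrow> v \<otimes>\<^sub>p w \<in> carrier T"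
  unfolding pure_tensor_def using basis_closed coset_closed by blast

lemma relator_eq:
  assumes "x \<ominus>\<^bsub>F\<^esub> y \<in> tensor_relators K V W" "x \<in> carrier F" "y \<in> carrier F"
  shows "N +>\<^bsub>F\<^esub> x = N +>\<^bsub>F\<^esub> y"
  using F.coset_eq_iff[OF N_submodule assms(2,3)] assms(1) F.hull_superset unfolding N_hull by blast

lemma pure_bilinear: "bilinear K V W T (\<otimes>\<^sub>p)"
proof (rule bilinearI)
  fix v assume v: "v \<in> carrier V"
  show "(\<otimes>\<^sub>p) v \<in> Hom K W T"
  proof (rule HomI)
    fix w w' assume w: "w \<in> carrier W" "w' \<in> carrier W"
    have "v \<otimes>\<^sub>p (w \<oplus>\<^bsub>W\<^esub> w') = N +>\<^bsub>F\<^esub> (free_basis K (v, w) \<oplus>\<^bsub>F\<^esub> free_basis K (v, w'))"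
      unfolding pure_tensor_def
    proof (rule relator_eq)
      show "free_basis K (v, w \<oplus>\<^bsub>W\<^esub> w') \<ominus>\<^bsub>F\<^esub> (free_basis K (v, w) \<oplus>\<^bsub>F\<^esub> free_basis K (v, w')) \<in> tensor_relators K V W"
        unfolding tensor_relators_def Let_def using v w by blast
    qed (intro F.M.a_closed basis_closed v w W.M.a_closed)+
    then show "v \<otimes>\<^sub>p (w \<oplus>\<^bsub>W\<^esub> w') = v \<otimes>\<^sub>p w \<oplus>\<^bsub>T\<^esub> v \<otimes>\<^sub>p w'"
      unfolding pure_tensor_def using coset.add[OF basis_closed[OF v w(1)] basis_closed[OF v w(2)]] by simp
  next
    fix c w assume w: "c \<in> carrier K" "w \<in> carrier W"
    have "v \<otimes>\<^sub>p (c \<odot>\<^bsub>W\<^esub> w) = N +>\<^bsub>F\<^esub> (c \<odot>\<^bsub>F\<^esub> free_basis K (v, w))"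
      unfolding pure_tensor_def
    proof (rule relator_eq)
      show "free_basis K (v, c \<odot>\<^bsub>W\<^esub> w) \<ominus>\<^bsub>F\<^esub> (c \<odot>\<^bsub>F\<^esub> free_basis K (v, w)) \<in> tensor_relators K V W"
        unfolding tensor_relators_def Let_def using v w by blast
    qed (intro F.lsmult_closed basis_closed v w W.lsmult_closed)+
    then show "v \<otimes>\<^sub>p (c \<odot>\<^bsub>W\<^esub> w) = c \<odot>\<^bsub>T\<^esub> (v \<otimes>\<^sub>p w)"
      unfolding pure_tensor_def using coset.smult[OF w(1) basis_closed[OF v w(2)]] by simp
  qed (use v in auto)
next
  fix w assume w: "w \<in> carrier W"
  show "(\<lambda>v. v \<otimes>\<^sub>p w) \<in> Hom K V T"
  proof (rule HomI)
    fix v v' assume v: "v \<in> carrier V" "v' \<in> carrier V"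
    have "(v \<oplus>\<^bsub>V\<^esub> v') \<otimes>\<^sub>p w = N +>\<^bsub>F\<^esub> (free_basis K (v, w) \<oplus>\<^bsub>F\<^esub> free_basis K (v', w))"
      unfolding pure_tensor_def
    proof (rule relator_eq)
      show "free_basis K (v \<oplus>\<^bsub>V\<^esub> v', w) \<ominus>\<^bsub>F\<^esub> (free_basis K (v, w) \<oplus>\<^bsub>F\<^esub> free_basis K (v', w)) \<in> tensor_relators K V W"
        unfolding tensor_relators_def Let_def using v w by blast
    qed (intro F.M.a_closed basis_closed v w V.M.a_closed)+
    then show "(v \<oplus>\<^bsub>V\<^esub> v') \<otimes>\<^sub>p w = v \<otimes>\<^sub>p w \<oplus>\<^bsub>T\<^esub> v' \<otimes>\<^sub>p w"
      unfolding pure_tensor_def using coset.add[OF basis_closed[OF v(1) w] basis_closed[OF v(2) w]] by simp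
  next
    fix c v assume v: "c \<in> carrier K" "v \<in> carrier V"
    have "(c \<odot>\<^bsub>V\<^esub> v) \<otimes>\<^sub>p w = N +>\<^bsub>F\<^esub> (c \<odot>\<^bsub>F\<^esub> free_basis K (v, w))"
      unfolding pure_tensor_def
    proof (rule relator_eq)
      show "free_basis K (c \<odot>\<^bsub>V\<^esub> v, w) \<ominus>\<^bsub>F\<^esub> (c \<odot>\<^bsub>F\<^esub> free_basis K (v, w)) \<in> tensor_relators K V W"
        unfolding tensor_relators_def Let_def using v w by blast
    qed (intro F.lsmult_closed basis_closed v w V.lsmult_closed)+
    then show "(c \<odot>\<^bsub>V\<^esub> v) \<otimes>\<^sub>p w = c \<odot>\<^bsub>T\<^esub> (v \<otimes>\<^sub>p w)"
      unfolding pure_tensor_def using coset.smult[OF v(1) basis_closed[OF v(2) w]] by simp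
  qed (use w in auto)
qed

lemma T_generated:
  assumes L: "Module.submodule L K T" and pure: "\<And>v w. \<lbrakk>v \<in> carrier V; w \<in> carrier W\<rbrakk> \<Longrightarrow> v \<otimes>\<^sub>p w \<in> L"
  shows "L = carrier T"
proof -
  have "t \<in> L" if t: "t \<in> carrier T" for t
  proof -
    obtain x where x: "x \<in> carrier F" "t = N +>\<^bsub>F\<^esub> x" using T_carrier[OF t] by blast
    note D = free_module_dual_basis[OF K.ring_axioms, of "carrier V \<times> carrier W"]
    let ?L = "{x \<in> carrier F. N +>\<^bsub>F\<^esub> x \<in> L}"
    have "lin_comb K F (carrier V \<times> carrier W) x (free_basis K) \<in> ?L"
      using dual_basisD(5)[OF D _ x(1)] pure basis_closed
      by (intro F.lin_comb_submodule[OF coset.vimage_submodule[OF L]]) (auto simp: pure_tensor_def)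
    then show ?thesis using dual_basisD(9)[OF D x(1)] x(2) by simp
  qed
  then show ?thesis using T.submoduleD(1)[OF L] by blast
qed

lemma lift_hom:
  assumes U: "left_module K U" and f: "bilinear K V W U f"
  shows "tensor_lift K U f \<in> Hom K T U"
    "\<And>v w. \<lbrakk>v \<in> carrier V; w \<in> carrier W\<rbrakk> \<Longrightarrow> tensor_lift K U f (v \<otimes>\<^sub>p w) = f v w"
proof -
  interpret U: left_module K U by (rule U)
  note B = bilinearD[OF f]
  note D = free_module_dual_basis[OF K.ring_axioms, of "carrier V \<times> carrier W"]
  let ?m = "\<lambda>x. f (fst x) (snd x)"
  define \<Phi> where "\<Phi> = (\<lambda>p. lin_comb K U (carrier V \<times> carrier W) p ?m)"
  have m: "?m \<in> carrier V \<times> carrier W \<rightarrow> carrier U" using B(3) by auto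
  have \<Phi>: "\<Phi> \<in> Hom K F U" unfolding \<Phi>_def by (rule lin_comb_hom[OF D U m])
  interpret \<Phi>: left_module_hom K F U \<Phi> by (rule left_module_homI[OF F_left_module U \<Phi>])
  have b: "\<Phi> (free_basis K (v, w)) = f v w" if "v \<in> carrier V" "w \<in> carrier W" for v w
    unfolding \<Phi>_def free_basis_def using U.lin_comb_delta[of "(v, w)" "carrier V \<times> carrier W" ?m] that m by simp
  have "N \<subseteq> {x \<in> carrier F. \<Phi> x = \<zero>\<^bsub>U\<^esub>}" unfolding N_hull
  proof (rule F.hull_least[OF \<Phi>.ker_submodule])
    have *: "\<Phi> (x \<ominus>\<^bsub>F\<^esub> y) = \<zero>\<^bsub>U\<^esub>" if "x \<in> carrier F" "y \<in> carrier F" "\<Phi> x = \<Phi> y" for x y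
      using that by (simp add: a_minus_def U.M.r_neg del: free_module_simps)
    have **: "\<Phi> (free_basis K (v, w) \<oplus>\<^bsub>F\<^esub> free_basis K (v', w')) = f v w \<oplus>\<^bsub>U\<^esub> f v' w'"
      if "v \<in> carrier V" "w \<in> carrier W" "v' \<in> carrier V" "w' \<in> carrier W" for v w v' w'
      using \<Phi>.add[OF basis_closed basis_closed] b that by metis
    have ***: "\<Phi> (c \<odot>\<^bsub>F\<^esub> free_basis K (v, w)) = c \<odot>\<^bsub>U\<^esub> f v w"
      if "v \<in> carrier V" "w \<in> carrier W" "c \<in> carrier K" for v w c
      using \<Phi>.smult[OF _ basis_closed] b that by metis
    show "tensor_relators K V W \<subseteq> {x \<in> carrier F. \<Phi> x = \<zero>\<^bsub>U\<^esub>}"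
    proof
      fix r assume r: "r \<in> tensor_relators K V W"
      then have rF: "r \<in> carrier F" using relators_closed by blast
      have "\<Phi> r = \<zero>\<^bsub>U\<^esub>" using r unfolding tensor_relators_def Let_def
      proof (elim UnE CollectE exE conjE)
        fix v v' w assume h: "r = free_basis K (v \<oplus>\<^bsub>V\<^esub> v', w) \<ominus>\<^bsub>F\<^esub> (free_basis K (v, w) \<oplus>\<^bsub>F\<^esub> free_basis K (v', w))"
          "v \<in> carrier V" "v' \<in> carrier V" "w \<in> carrier W"
        show ?thesis unfolding h(1)
          by (rule *) (intro F.M.a_closed basis_closed V.M.a_closed h, intro F.M.a_closed basis_closed V.M.a_closed h,
            simp only: b[OF V.M.a_closed[OF h(2,3)] h(4)] **[OF h(2,4,3,4)] B(4)[OF h(2-4)])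
      next
        fix v w w' assume h: "r = free_basis K (v, w \<oplus>\<^bsub>W\<^esub> w') \<ominus>\<^bsub>F\<^esub> (free_basis K (v, w) \<oplus>\<^bsub>F\<^esub> free_basis K (v, w'))"
          "v \<in> carrier V" "w \<in> carrier W" "w' \<in> carrier W"
        show ?thesis unfolding h(1)
          by (rule *) (intro F.M.a_closed basis_closed W.M.a_closed h, intro F.M.a_closed basis_closed W.M.a_closed h,
            simp only: b[OF h(2) W.M.a_closed[OF h(3,4)]] **[OF h(2,3,2,4)] B(5)[OF h(2-4)])
      next
        fix c v w assume h: "r = free_basis K (c \<odot>\<^bsub>V\<^esub> v, w) \<ominus>\<^bsub>F\<^esub> (c \<odot>\<^bsub>F\<^esub> free_basis K (v, w))"
          "c \<in> carrier K" "v \<in> carrier V" "w \<in> carrier W"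
        show ?thesis unfolding h(1)
          by (rule *) (intro F.lsmult_closed basis_closed V.lsmult_closed h, intro F.lsmult_closed basis_closed V.lsmult_closed h,
            simp only: b[OF V.lsmult_closed[OF h(2,3)] h(4)] ***[OF h(3,4,2)] B(6)[OF h(2-4)])
      next
        fix c v w assume h: "r = free_basis K (v, c \<odot>\<^bsub>W\<^esub> w) \<ominus>\<^bsub>F\<^esub> (c \<odot>\<^bsub>F\<^esub> free_basis K (v, w))"
          "c \<in> carrier K" "v \<in> carrier V" "w \<in> carrier W"
        show ?thesis unfolding h(1)
          by (rule *) (intro F.lsmult_closed basis_closed W.lsmult_closed h, intro F.lsmult_closed basis_closed W.lsmult_closed h,
            simp only: b[OF h(3) W.lsmult_closed[OF h(2,4)]] ***[OF h(3,4,2)] B(7)[OF h(2-4)])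
      qed
      then show "r \<in> {x \<in> carrier F. \<Phi> x = \<zero>\<^bsub>U\<^esub>}" using rF by blast
    qed
  qed
  then have N0: "\<Phi> x = \<zero>\<^bsub>U\<^esub>" if "x \<in> N" for x using that by blast
  have lift: "tensor_lift K U f (N +>\<^bsub>F\<^esub> x) = \<Phi> x" if x: "x \<in> carrier F" for x
  proof -
    define p where "p = (SOME p. p \<in> N +>\<^bsub>F\<^esub> x)"
    have p: "p \<in> N +>\<^bsub>F\<^esub> x" unfolding p_def by (rule someI[of "\<lambda>p. p \<in> N +>\<^bsub>F\<^esub> x", OF F.coset_self[OF N_submodule x]])
    have pF: "p \<in> carrier F" using F.coset_sub[OF N_submodule x p] by blast
    have "p \<ominus>\<^bsub>F\<^esub> x \<in> N" using F.coset_sub[OF N_submodule x p] F.coset_eq_iff[OF N_submodule pF x] by blast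
    then have "\<Phi> p \<ominus>\<^bsub>U\<^esub> \<Phi> x = \<zero>\<^bsub>U\<^esub>" using N0 \<Phi>.minus[OF pF x] by metis
    then have "\<Phi> p = \<Phi> x" using \<Phi>.closed[OF pF] \<Phi>.closed[OF x] by simp
    moreover have "{x. p x \<noteq> \<zero>\<^bsub>K\<^esub>} = {x \<in> carrier V \<times> carrier W. p x \<noteq> \<zero>\<^bsub>K\<^esub>}"
      using pF unfolding free_module_carrier by blast
    then have "tensor_lift K U f (N +>\<^bsub>F\<^esub> x) = \<Phi> p"
      unfolding tensor_lift_def Let_def p_def[symmetric] \<Phi>_def lin_comb_def by simp
    ultimately show ?thesis by simp
  qed
  show "tensor_lift K U f (v \<otimes>\<^sub>p w) = f v w" if "v \<in> carrier V" "w \<in> carrier W" for v w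
    unfolding pure_tensor_def lift[OF basis_closed[OF that]] b[OF that] ..
  show "tensor_lift K U f \<in> Hom K T U"
  proof (rule HomI)
    fix s assume "s \<in> carrier T"
    then show "tensor_lift K U f s \<in> carrier U" using T_carrier lift \<Phi>.closed by metis
  next
    fix s t assume "s \<in> carrier T" "t \<in> carrier T"
    then obtain x y where xy: "x \<in> carrier F" "s = N +>\<^bsub>F\<^esub> x" "y \<in> carrier F" "t = N +>\<^bsub>F\<^esub> y" using T_carrier by metis
    then show "tensor_lift K U f (s \<oplus>\<^bsub>T\<^esub> t) = tensor_lift K U f s \<oplus>\<^bsub>U\<^esub> tensor_lift K U f t"
      using lift[OF F.M.a_closed[OF xy(1,3)]] coset.add[OF xy(1,3)] lift \<Phi>.add[OF xy(1,3)] by simp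
  next
    fix c t assume c: "c \<in> carrier K" and "t \<in> carrier T"
    then obtain y where y: "y \<in> carrier F" "t = N +>\<^bsub>F\<^esub> y" using T_carrier by metis
    then show "tensor_lift K U f (c \<odot>\<^bsub>T\<^esub> t) = c \<odot>\<^bsub>U\<^esub> tensor_lift K U f t"
      using lift[OF F.lsmult_closed[OF c y(1)]] coset.smult[OF c y(1)] lift \<Phi>.smult[OF c y(1)] by simp
  qed
qed

text \<open>
  The set where the two maps agree is a subspace that contains the pure tensors.
\<close>

lemma T_hom_ext:
  assumes U: "left_module K U" and f: "f \<in> Hom K T U" and g: "g \<in> Hom K T U" and t: "t \<in> carrier T"
    and eq: "\<And>v w. \<lbrakk>v \<in> carrier V; w \<in> carrier W\<rbrakk> \<Longrightarrow> f (v \<otimes>\<^sub>p w) = g (v \<otimes>\<^sub>p w)"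
  shows "f t = g t"
proof -
  interpret U: left_module K U by (rule U)
  have d: "(\<lambda>x. f x \<ominus>\<^bsub>U\<^esub> g x) \<in> Hom K T U" by (rule Hom_minus[OF U f g])
  interpret d: left_module_hom K T U "\<lambda>x. f x \<ominus>\<^bsub>U\<^esub> g x" by (rule left_module_homI[OF T_left_module U d])
  have "{x \<in> carrier T. f x \<ominus>\<^bsub>U\<^esub> g x = \<zero>\<^bsub>U\<^esub>} = carrier T"
  proof (rule T_generated[OF d.ker_submodule])
    fix v w assume vw: "v \<in> carrier V" "w \<in> carrier W"
    have "g (v \<otimes>\<^sub>p w) \<in> carrier U" using HomD(1)[OF g] vw by blast
    then show "v \<otimes>\<^sub>p w \<in> {x \<in> carrier T. f x \<ominus>\<^bsub>U\<^esub> g x = \<zero>\<^bsub>U\<^esub>}" using eq[OF vw] vw by simp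
  qed
  then have "f t \<ominus>\<^bsub>U\<^esub> g t = \<zero>\<^bsub>U\<^esub>" using t by blast
  then show ?thesis using HomD(1)[OF f t] HomD(1)[OF g t] by simp
qed

lemma lift_cong:
  assumes U: "left_module K U" and f: "bilinear K V W U f" and t: "t \<in> carrier T"
    and eq: "\<And>v w. \<lbrakk>v \<in> carrier V; w \<in> carrier W\<rbrakk> \<Longrightarrow> f v w = g v w"
  shows "tensor_lift K U f t = tensor_lift K U g t"
proof -
  note g = bilinear_cong[OF f V W eq]
  show ?thesis
  proof (rule T_hom_ext[OF U lift_hom(1)[OF U f] lift_hom(1)[OF U g] t])
    fix v w assume "v \<in> carrier V" "w \<in> carrier W"
    then show "tensor_lift K U f (v \<otimes>\<^sub>p w) = tensor_lift K U g (v \<otimes>\<^sub>p w)"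
      by (simp only: lift_hom(2)[OF U f] lift_hom(2)[OF U g] eq)
  qed
qed

lemma hom_lift:
  assumes U: "left_module K U" "left_module K U'" and f: "bilinear K V W U f" and g: "g \<in> Hom K U U'" and t: "t \<in> carrier T"
  shows "g (tensor_lift K U f t) = tensor_lift K U' (\<lambda>v w. g (f v w)) t"
proof (rule T_hom_ext[OF U(2) Hom_comp[OF lift_hom(1)[OF U(1) f] g] lift_hom(1)[OF U(2) bilinear_comp[OF f g]] t])
  fix v w assume "v \<in> carrier V" "w \<in> carrier W"
  then show "g (tensor_lift K U f (v \<otimes>\<^sub>p w)) = tensor_lift K U' (\<lambda>v w. g (f v w)) (v \<otimes>\<^sub>p w)"
    by (simp only: lift_hom(2)[OF U(1) f] lift_hom(2)[OF U(2) bilinear_comp[OF f g]])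
qed

text \<open>
  Linear dependence of the bilinear map on a parameter is inherited by the lift.  This makes
  iterated Sweedler sums multilinear.
\<close>

lemma lift_param_hom:
  assumes U: "left_module K U" and Y: "left_module K Y" and f: "\<And>y. y \<in> carrier Y \<Longrightarrow> bilinear K V W U (f y)"
    and lin: "\<And>v w. \<lbrakk>v \<in> carrier V; w \<in> carrier W\<rbrakk> \<Longrightarrow> (\<lambda>y. f y v w) \<in> Hom K Y U" and t: "t \<in> carrier T"
  shows "(\<lambda>y. tensor_lift K U (f y) t) \<in> Hom K Y U"
proof (rule HomI)
  interpret U: left_module K U by (rule U)
  interpret Y: left_module K Y by (rule Y)
  note L = lift_hom[OF U f]
  fix y y' assume y: "y \<in> carrier Y" "y' \<in> carrier Y"
  have "tensor_lift K U (f (y \<oplus>\<^bsub>Y\<^esub> y')) t = (\<lambda>t. tensor_lift K U (f y) t \<oplus>\<^bsub>U\<^esub> tensor_lift K U (f y') t) t"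
  proof (rule T_hom_ext[OF U _ _ t])
    show "(\<lambda>t. tensor_lift K U (f y) t \<oplus>\<^bsub>U\<^esub> tensor_lift K U (f y') t) \<in> Hom K T U"
      by (intro Hom_add U L y)
    fix v w assume "v \<in> carrier V" "w \<in> carrier W"
    then show "tensor_lift K U (f (y \<oplus>\<^bsub>Y\<^esub> y')) (v \<otimes>\<^sub>p w) = tensor_lift K U (f y) (v \<otimes>\<^sub>p w) \<oplus>\<^bsub>U\<^esub> tensor_lift K U (f y') (v \<otimes>\<^sub>p w)"
      using L(2) y HomD(2)[OF lin] by simp
  qed (intro L Y.M.a_closed y)
  then show "tensor_lift K U (f (y \<oplus>\<^bsub>Y\<^esub> y')) t = tensor_lift K U (f y) t \<oplus>\<^bsub>U\<^esub> tensor_lift K U (f y') t" .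
next
  interpret U: left_module K U by (rule U)
  interpret Y: left_module K Y by (rule Y)
  note L = lift_hom[OF U f]
  fix c y assume y: "c \<in> carrier K" "y \<in> carrier Y"
  have "tensor_lift K U (f (c \<odot>\<^bsub>Y\<^esub> y)) t = (\<lambda>t. tensor_lift K U (f y) (c \<odot>\<^bsub>T\<^esub> t)) t"
  proof (rule T_hom_ext[OF U _ _ t])
    have "(\<lambda>t. c \<odot>\<^bsub>T\<^esub> t) \<in> Hom K T T"
      using y(1) by (intro HomI) (auto simp: T.lsmult_r_distr T.lsmult_assoc[symmetric] K.m_comm)
    from Hom_comp[OF this L(1)[OF y(2)]] show "(\<lambda>t. tensor_lift K U (f y) (c \<odot>\<^bsub>T\<^esub> t)) \<in> Hom K T U" .
    fix v w assume "v \<in> carrier V" "w \<in> carrier W"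
    then show "tensor_lift K U (f (c \<odot>\<^bsub>Y\<^esub> y)) (v \<otimes>\<^sub>p w) = tensor_lift K U (f y) (c \<odot>\<^bsub>T\<^esub> (v \<otimes>\<^sub>p w))"
      using L(2) y HomD(3)[OF lin] HomD(3)[OF L(1)[OF y(2)] y(1)] by simp
  qed (intro L Y.lsmult_closed y)
  then show "tensor_lift K U (f (c \<odot>\<^bsub>Y\<^esub> y)) t = c \<odot>\<^bsub>U\<^esub> tensor_lift K U (f y) t"
    using HomD(3)[OF L(1)[OF y(2)] y(1) t] by simp
qed (rule HomD(1)[OF lift_hom(1)[OF U f] t])

end

section \<open>Sweedler calculus\<close>

definition trilinear ::
  "('k, 'c) ring_scheme \<Rightarrow> ('k, 'v, 'd) module_scheme \<Rightarrow> ('k, 'w, 'e) module_scheme \<Rightarrow>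
     ('k, 'x, 'g) module_scheme \<Rightarrow> ('k, 'u, 'f) module_scheme \<Rightarrow> ('v \<Rightarrow> 'w \<Rightarrow> 'x \<Rightarrow> 'u) \<Rightarrow> bool" where
  "trilinear K V W X U g \<longleftrightarrow> (\<forall>v\<in>carrier V. bilinear K W X U (g v)) \<and>
     (\<forall>w\<in>carrier W. \<forall>x\<in>carrier X. (\<lambda>v. g v w x) \<in> Hom K V U)"

lemma trilinearI:
  assumes "\<And>v w. \<lbrakk>v \<in> carrier V; w \<in> carrier W\<rbrakk> \<Longrightarrow> g v w \<in> Hom K X U"
    "\<And>v x. \<lbrakk>v \<in> carrier V; x \<in> carrier X\<rbrakk> \<Longrightarrow> (\<lambda>w. g v w x) \<in> Hom K W U"
    "\<And>w x. \<lbrakk>w \<in> carrier W; x \<in> carrier X\<rbrakk> \<Longrightarrow> (\<lambda>v. g v w x) \<in> Hom K V U"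
  shows "trilinear K V W X U g"
  using assms unfolding trilinear_def bilinear_def by blast

lemma trilinearD:
  assumes "trilinear K V W X U g"
  shows "\<And>v. v \<in> carrier V \<Longrightarrow> bilinear K W X U (g v)"
    "\<And>w. w \<in> carrier W \<Longrightarrow> bilinear K V X U (\<lambda>v. g v w)"
    "\<And>x. x \<in> carrier X \<Longrightarrow> bilinear K V W U (\<lambda>v w. g v w x)"
    "\<And>w x. \<lbrakk>w \<in> carrier W; x \<in> carrier X\<rbrakk> \<Longrightarrow> (\<lambda>v. g v w x) \<in> Hom K V U"
    "\<And>v x. \<lbrakk>v \<in> carrier V; x \<in> carrier X\<rbrakk> \<Longrightarrow> (\<lambda>w. g v w x) \<in> Hom K W U"
    "\<And>v w. \<lbrakk>v \<in> carrier V; w \<in> carrier W\<rbrakk> \<Longrightarrow> g v w \<in> Hom K X U"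
  using assms unfolding trilinear_def bilinear_def by blast+

context tensor_product
begin

lemma lift_bilinear:
  assumes U: "left_module K U" and X: "left_module K X" and Y: "left_module K Y"
    and f: "\<And>x y. \<lbrakk>x \<in> carrier X; y \<in> carrier Y\<rbrakk> \<Longrightarrow> bilinear K V W U (f x y)"
    and lin: "\<And>v w. \<lbrakk>v \<in> carrier V; w \<in> carrier W\<rbrakk> \<Longrightarrow> bilinear K X Y U (\<lambda>x y. f x y v w)" and t: "t \<in> carrier T"
  shows "bilinear K X Y U (\<lambda>x y. tensor_lift K U (f x y) t)"
proof (rule bilinearI)
  show "(\<lambda>y. tensor_lift K U (f x y) t) \<in> Hom K Y U" if "x \<in> carrier X" for x
    by (rule lift_param_hom[OF U Y f[OF that] bilinearD(1)[OF lin that] t])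
  show "(\<lambda>x. tensor_lift K U (f x y) t) \<in> Hom K X U" if "y \<in> carrier Y" for y
    by (rule lift_param_hom[OF U X f[OF _ that] bilinearD(2)[OF lin that] t])
qed

end

text \<open>
  Both sides are linear in \<open>t\<close> and agree on pure tensors.  For Sweedler sums, this is the
  interchange of independent summations.
\<close>

lemma lift_swap:
  assumes "tensor_product K V W" "tensor_product K V' W'" and U: "left_module K U"
    and f: "\<And>v w. \<lbrakk>v \<in> carrier V; w \<in> carrier W\<rbrakk> \<Longrightarrow> bilinear K V' W' U (f v w)"
    and f': "\<And>v' w'. \<lbrakk>v' \<in> carrier V'; w' \<in> carrier W'\<rbrakk> \<Longrightarrow> bilinear K V W U (\<lambda>v w. f v w v' w')"
    and t: "t \<in> carrier (tensor K V W)" and t': "t' \<in> carrier (tensor K V' W')"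
  shows "tensor_lift K U (\<lambda>v w. tensor_lift K U (f v w) t') t =
    tensor_lift K U (\<lambda>v' w'. tensor_lift K U (\<lambda>v w. f v w v' w') t) t'"
proof -
  interpret A: tensor_product K V W by fact
  interpret B: tensor_product K V' W' by fact
  have b: "bilinear K V W U (\<lambda>v w. tensor_lift K U (f v w) t')"
    by (rule B.lift_bilinear[OF U A.V A.W f f' t'])
  note A = A.lift_hom[OF U f']
  have c: "bilinear K V' W' U (\<lambda>v' w'. tensor_lift K U (\<lambda>v w. f v w v' w') t)" if "t \<in> carrier (tensor K V W)" for t
    by (rule A.lift_bilinear[OF U B.V B.W f' f that])
  show ?thesis
  proof (rule A.T_hom_ext[OF U A.lift_hom(1)[OF U b] B.lift_param_hom[OF U A.T_left_module c A(1) t'] t])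
    fix v w assume vw: "v \<in> carrier V" "w \<in> carrier W"
    show "tensor_lift K U (\<lambda>v w. tensor_lift K U (f v w) t') (pure_tensor K V W v w) =
      tensor_lift K U (\<lambda>v' w'. tensor_lift K U (\<lambda>v w. f v w v' w') (pure_tensor K V W v w)) t'"
      unfolding A.lift_hom(2)[OF U b vw]
      by (rule B.lift_cong[OF U f[OF vw] t']) (simp only: A(2)[OF _ _ vw])
  qed
qed

text \<open>
  The rules below express the usual manipulations of Sweedler sums.  A sum \<open>\<Sum> f h\<^sub>1 h\<^sub>2\<close> has a
  meaning only for bilinear \<open>f\<close>, so that each step comes with the multilinearity of the summand.
\<close>

locale fd_hopf_algebra = fd_algebra K H
  for K :: "('k, 'c) ring_scheme" and H :: "('k, 'h, 'd) hopf_scheme" +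
  assumes hopf: "hopf_algebra K H"
begin

sublocale HH: tensor_product K H H
  by unfold_locales

sublocale HHH: tensor_product K H "tensor K H H"
  by unfold_locales

abbreviation sw :: "('k, 'u, 'e) module_scheme \<Rightarrow> ('h \<Rightarrow> 'h \<Rightarrow> 'u) \<Rightarrow> 'h \<Rightarrow> 'u" where
  "sw \<equiv> sweedler K H"
abbreviation "\<epsilon> \<equiv> counit H"
abbreviation "\<S> \<equiv> antipode H"

lemma comult_hom: "comult H \<in> Hom K H (tensor K H H)"
  and comult_ring_hom: "comult H \<in> ring_hom H (tensor_algebra K H H)"
  and counit_ring_hom: "\<epsilon> \<in> ring_hom H K"
  and counit_smult: "\<lbrakk>c \<in> carrier K; h \<in> carrier H\<rbrakk> \<Longrightarrow> \<epsilon> (c \<odot>\<^bsub>H\<^esub> h) = c \<otimes>\<^bsub>K\<^esub> \<epsilon> h"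
  and antipode_hom: "\<S> \<in> Hom K H H"
  using hopf unfolding hopf_algebra_def by blast+

lemma comult_closed: "h \<in> carrier H \<Longrightarrow> comult H h \<in> carrier (tensor K H H)"
  using HomD(1)[OF comult_hom] .

lemma counit_closed [simp]: "h \<in> carrier H \<Longrightarrow> \<epsilon> h \<in> carrier K"
  and counit_add: "\<lbrakk>h \<in> carrier H; h' \<in> carrier H\<rbrakk> \<Longrightarrow> \<epsilon> (h \<oplus>\<^bsub>H\<^esub> h') = \<epsilon> h \<oplus>\<^bsub>K\<^esub> \<epsilon> h'"
  and counit_mult: "\<lbrakk>h \<in> carrier H; h' \<in> carrier H\<rbrakk> \<Longrightarrow> \<epsilon> (h \<otimes>\<^bsub>H\<^esub> h') = \<epsilon> h \<otimes>\<^bsub>K\<^esub> \<epsilon> h'"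
  and counit_one: "\<epsilon> \<one>\<^bsub>H\<^esub> = \<one>\<^bsub>K\<^esub>"
  using ring_hom_memE[OF counit_ring_hom] by blast+

lemma antipode_closed [simp]: "h \<in> carrier H \<Longrightarrow> \<S> h \<in> carrier H"
  using HomD(1)[OF antipode_hom] .

lemma sw_hom: "\<lbrakk>left_module K U; bilinear K H H U f\<rbrakk> \<Longrightarrow> sw U f \<in> Hom K H U"
  using Hom_comp[OF comult_hom HH.lift_hom(1)] unfolding sweedler_def[abs_def] .

lemma sw_cong:
  assumes "left_module K U" "bilinear K H H U f" "h \<in> carrier H"
    "\<And>a b. \<lbrakk>a \<in> carrier H; b \<in> carrier H\<rbrakk> \<Longrightarrow> f a b = g a b"
  shows "sw U f h = sw U g h"
  unfolding sweedler_def by (rule HH.lift_cong[OF assms(1,2) comult_closed[OF assms(3)] assms(4)])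

lemma hom_sw:
  assumes "left_module K U" "left_module K U'" "bilinear K H H U f" "g \<in> Hom K U U'" "h \<in> carrier H"
  shows "g (sw U f h) = sw U' (\<lambda>a b. g (f a b)) h"
  unfolding sweedler_def by (rule HH.hom_lift[OF assms(1-4) comult_closed[OF assms(5)]])

lemma sw_param_hom:
  assumes "left_module K U" "left_module K Y" "\<And>y. y \<in> carrier Y \<Longrightarrow> bilinear K H H U (f y)"
    "\<And>a b. \<lbrakk>a \<in> carrier H; b \<in> carrier H\<rbrakk> \<Longrightarrow> (\<lambda>y. f y a b) \<in> Hom K Y U" "h \<in> carrier H"
  shows "(\<lambda>y. sw U (f y) h) \<in> Hom K Y U"
  unfolding sweedler_def by (rule HH.lift_param_hom[OF assms(1-4) comult_closed[OF assms(5)]])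

lemma sw_left_bilinear:
  assumes U: "left_module K U" and Y: "left_module K Y" and k: "trilinear K H H Y U k"
  shows "bilinear K H Y U (\<lambda>x y. sw U (\<lambda>a b. k a b y) x)"
proof (rule bilinearI)
  show "(\<lambda>y. sw U (\<lambda>a b. k a b y) x) \<in> Hom K Y U" if "x \<in> carrier H" for x
    by (rule sw_param_hom[OF U Y trilinearD(3)[OF k] trilinearD(6)[OF k] that])
  show "(\<lambda>x. sw U (\<lambda>a b. k a b y) x) \<in> Hom K H U" if "y \<in> carrier Y" for y
    using sw_hom[OF U trilinearD(3)[OF k that]] by simp
qed

lemma sw_right_bilinear:
  assumes U: "left_module K U" and Y: "left_module K Y" and k: "trilinear K Y H H U k"
  shows "bilinear K Y H U (\<lambda>y x. sw U (k y) x)"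
proof (rule bilinearI)
  show "(\<lambda>y. sw U (k y) x) \<in> Hom K Y U" if "x \<in> carrier H" for x
    by (rule sw_param_hom[OF U Y trilinearD(1)[OF k] trilinearD(4)[OF k] that])
  show "(\<lambda>x. sw U (k y) x) \<in> Hom K H U" if "y \<in> carrier Y" for y
    using sw_hom[OF U trilinearD(1)[OF k that]] by simp
qed

lemma sw_swap:
  assumes U: "left_module K U"
    and f: "\<And>a b. \<lbrakk>a \<in> carrier H; b \<in> carrier H\<rbrakk> \<Longrightarrow> bilinear K H H U (f a b)"
      "\<And>c d. \<lbrakk>c \<in> carrier H; d \<in> carrier H\<rbrakk> \<Longrightarrow> bilinear K H H U (\<lambda>a b. f a b c d)"
    and h: "h \<in> carrier H" "h' \<in> carrier H"
  shows "sw U (\<lambda>a b. sw U (f a b) h') h = sw U (\<lambda>c d. sw U (\<lambda>a b. f a b c d) h) h'"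
  unfolding sweedler_def
  by (rule lift_swap[OF HH.tensor_product_axioms HH.tensor_product_axioms U f comult_closed[OF h(1)] comult_closed[OF h(2)]])

text \<open>
  The coassociativity axiom is an equation between elements of \<open>H \<otimes> (H \<otimes> H)\<close>.  Apply to both sides
  the linear map \<open>L\<close> that is induced by the trilinear map \<open>g\<close>.
\<close>

lemma coassoc:
  assumes U: "left_module K U" and g: "trilinear K H H H U g" and h: "h \<in> carrier H"
  shows "sw U (\<lambda>a b. sw U (\<lambda>a\<^sub>1 a\<^sub>2. g a\<^sub>1 a\<^sub>2 b) a) h = sw U (\<lambda>a b. sw U (g a) b) h"
proof -
  let ?T2 = "tensor K H H" and ?T3 = "tensor K H (tensor K H H)"
  let ?p2 = "pure_tensor K H H" and ?p3 = "pure_tensor K H (tensor K H H)"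
  define L where "L = tensor_lift K U (\<lambda>a t. tensor_lift K U (g a) t)"
  have b: "bilinear K H ?T2 U (\<lambda>a t. tensor_lift K U (g a) t)"
  proof (rule bilinearI)
    show "tensor_lift K U (g a) \<in> Hom K ?T2 U" if "a \<in> carrier H" for a
      by (rule HH.lift_hom(1)[OF U trilinearD(1)[OF g that]])
    show "(\<lambda>a. tensor_lift K U (g a) t) \<in> Hom K H U" if "t \<in> carrier ?T2" for t
      by (rule HH.lift_param_hom[OF U H_left_module trilinearD(1)[OF g] trilinearD(4)[OF g] that])
  qed
  have L: "L \<in> Hom K ?T3 U" unfolding L_def by (rule HHH.lift_hom(1)[OF U b])
  have Lp: "L (?p3 a t) = tensor_lift K U (g a) t" if "a \<in> carrier H" "t \<in> carrier ?T2" for a t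
    unfolding L_def by (rule HHH.lift_hom(2)[OF U b that])
  have Lpp: "L (?p3 a (?p2 b c)) = g a b c" if "a \<in> carrier H" "b \<in> carrier H" "c \<in> carrier H" for a b c
    unfolding Lp[OF that(1) HH.pure_closed[OF that(2,3)]] by (rule HH.lift_hom(2)[OF U trilinearD(1)[OF g that(1)] that(2,3)])
  have T3: "left_module K ?T3" by (rule HHH.T_left_module)
  have p: "trilinear K H H H ?T3 (\<lambda>a b c. ?p3 a (?p2 b c))"
  proof (rule trilinearI)
    show "(\<lambda>c. ?p3 a (?p2 b c)) \<in> Hom K H ?T3" if "a \<in> carrier H" "b \<in> carrier H" for a b
      by (rule Hom_comp[OF bilinearD(1)[OF HH.pure_bilinear that(2)] bilinearD(1)[OF HHH.pure_bilinear that(1)]])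
    show "(\<lambda>b. ?p3 a (?p2 b c)) \<in> Hom K H ?T3" if "a \<in> carrier H" "c \<in> carrier H" for a c
      by (rule Hom_comp[OF bilinearD(2)[OF HH.pure_bilinear that(2)] bilinearD(1)[OF HHH.pure_bilinear that(1)]])
    show "(\<lambda>a. ?p3 a (?p2 b c)) \<in> Hom K H ?T3" if "b \<in> carrier H" "c \<in> carrier H" for b c
      by (rule bilinearD(2)[OF HHH.pure_bilinear HH.pure_closed[OF that]])
  qed
  have p': "bilinear K H H ?T3 (\<lambda>a b. ?p3 a (comult H b))"
    by (rule bilinear_comp_args[OF HHH.pure_bilinear Hom_id comult_hom])
  have "L (sw ?T3 (\<lambda>a b. sw ?T3 (\<lambda>a\<^sub>1 a\<^sub>2. ?p3 a\<^sub>1 (?p2 a\<^sub>2 b)) a) h) = L (sw ?T3 (\<lambda>a b. ?p3 a (comult H b)) h)"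
    using hopf h unfolding hopf_algebra_def by simp
  moreover have "L (sw ?T3 (\<lambda>a b. sw ?T3 (\<lambda>a\<^sub>1 a\<^sub>2. ?p3 a\<^sub>1 (?p2 a\<^sub>2 b)) a) h) = sw U (\<lambda>a b. sw U (\<lambda>a\<^sub>1 a\<^sub>2. g a\<^sub>1 a\<^sub>2 b) a) h"
  proof -
    have "sw U (\<lambda>a\<^sub>1 a\<^sub>2. g a\<^sub>1 a\<^sub>2 b) a = L (sw ?T3 (\<lambda>a\<^sub>1 a\<^sub>2. ?p3 a\<^sub>1 (?p2 a\<^sub>2 b)) a)"
      if "a \<in> carrier H" "b \<in> carrier H" for a b
      unfolding hom_sw[OF T3 U trilinearD(3)[OF p that(2)] L that(1)]
      by (rule sw_cong[OF U trilinearD(3)[OF g that(2)] that(1)]) (simp only: Lpp that)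
    note * = sw_cong[OF U sw_left_bilinear[OF U H_left_module g] h this]
    show ?thesis by (rule trans[OF hom_sw[OF T3 U sw_left_bilinear[OF T3 H_left_module p] L h] *[symmetric]])
  qed
  moreover have "L (sw ?T3 (\<lambda>a b. ?p3 a (comult H b)) h) = sw U (\<lambda>a b. sw U (g a) b) h"
    unfolding hom_sw[OF T3 U p' L h]
    by (rule sw_cong[OF U bilinear_comp[OF p' L] h]) (simp only: Lp comult_closed sweedler_def)
  ultimately show ?thesis by simp
qed

lemma counit_bilinear:
  assumes U: "left_module K U" and f: "f \<in> Hom K X U"
  shows "bilinear K H X U (\<lambda>a b. \<epsilon> a \<odot>\<^bsub>U\<^esub> f b)" "bilinear K X H U (\<lambda>a b. \<epsilon> b \<odot>\<^bsub>U\<^esub> f a)"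
proof -
  interpret U: left_module K U by (rule U)
  have 1: "(\<lambda>b. c \<odot>\<^bsub>U\<^esub> f b) \<in> Hom K X U" if "c \<in> carrier K" for c
    using that HomD[OF f] by (intro HomI) (simp_all add: U.lsmult_closed U.lsmult_r_distr U.lsmult_assoc[symmetric] K.m_comm)
  have 2: "(\<lambda>a. \<epsilon> a \<odot>\<^bsub>U\<^esub> f b) \<in> Hom K H U" if "b \<in> carrier X" for b
    using HomD(1)[OF f that] by (intro HomI) (simp_all add: U.lsmult_closed counit_add counit_smult U.lsmult_l_distr U.lsmult_assoc)
  show "bilinear K H X U (\<lambda>a b. \<epsilon> a \<odot>\<^bsub>U\<^esub> f b)" "bilinear K X H U (\<lambda>a b. \<epsilon> b \<odot>\<^bsub>U\<^esub> f a)"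
    by (intro bilinearI 1 2 counit_closed; assumption)+
qed

lemma counit_sw:
  assumes U: "left_module K U" and f: "f \<in> Hom K H U" and h: "h \<in> carrier H"
  shows "sw U (\<lambda>a b. \<epsilon> a \<odot>\<^bsub>U\<^esub> f b) h = f h" "sw U (\<lambda>a b. \<epsilon> b \<odot>\<^bsub>U\<^esub> f a) h = f h"
proof -
  have ax: "sw H (\<lambda>a b. \<epsilon> a \<odot>\<^bsub>H\<^esub> b) h = h" "sw H (\<lambda>a b. \<epsilon> b \<odot>\<^bsub>H\<^esub> a) h = h"
    using hopf h unfolding hopf_algebra_def by blast+
  note b = counit_bilinear[OF H_left_module Hom_id]
  have "f (sw H (\<lambda>a b. \<epsilon> a \<odot>\<^bsub>H\<^esub> b) h) = sw U (\<lambda>a b. \<epsilon> a \<odot>\<^bsub>U\<^esub> f b) h"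
    unfolding hom_sw[OF H_left_module U b(1) f h]
    by (rule sw_cong[OF U bilinear_comp[OF b(1) f] h]) (simp add: HomD(3)[OF f])
  then show "sw U (\<lambda>a b. \<epsilon> a \<odot>\<^bsub>U\<^esub> f b) h = f h" unfolding ax(1) by simp
  have "f (sw H (\<lambda>a b. \<epsilon> b \<odot>\<^bsub>H\<^esub> a) h) = sw U (\<lambda>a b. \<epsilon> b \<odot>\<^bsub>U\<^esub> f a) h"
    unfolding hom_sw[OF H_left_module U b(2) f h]
    by (rule sw_cong[OF U bilinear_comp[OF b(2) f] h]) (simp add: HomD(3)[OF f])
  then show "sw U (\<lambda>a b. \<epsilon> b \<odot>\<^bsub>U\<^esub> f a) h = f h" unfolding ax(2) by simp
qed

lemma mult_bilinear: "bilinear K H H H (\<otimes>\<^bsub>H\<^esub>)"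
  by (intro bilinearI HomI) (simp_all add: H.r_distr H.l_distr smult_mult)

lemma smult_bilinear:
  assumes "left_module H W" shows "bilinear K H (sr W) (sr W) (\<odot>\<^bsub>W\<^esub>)"
proof -
  interpret W: left_module H W by fact
  show ?thesis
  proof (rule bilinearI)
    show "(\<odot>\<^bsub>W\<^esub>) h \<in> Hom K (sr W) (sr W)" if h: "h \<in> carrier H" for h
      using h smult_sr(2)[OF assms _ h] by (intro HomI) (simp_all add: W.lsmult_closed W.lsmult_r_distr)
    show "(\<lambda>h. h \<odot>\<^bsub>W\<^esub> w) \<in> Hom K H (sr W)" if w: "w \<in> carrier (sr W)" for w
      using w smult_sr(1)[OF assms, of _ _ w] by (intro HomI) (simp_all add: W.lsmult_closed W.lsmult_l_distr)
  qed
qed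

text \<open>
  The comultiplication is multiplicative.
\<close>

lemma sw_mult:
  assumes U: "left_module K U" and f: "bilinear K H H U f" and h: "h \<in> carrier H" "k \<in> carrier H"
  shows "sw U f (h \<otimes>\<^bsub>H\<^esub> k) = sw U (\<lambda>a b. sw U (\<lambda>a' b'. f (a \<otimes>\<^bsub>H\<^esub> a') (b \<otimes>\<^bsub>H\<^esub> b')) k) h"
proof -
  let ?T2 = "tensor K H H" and ?p2 = "pure_tensor K H H"
  have p: "bilinear K H H ?T2 (\<lambda>a' b'. ?p2 (a \<otimes>\<^bsub>H\<^esub> a') (b \<otimes>\<^bsub>H\<^esub> b'))" if "a \<in> carrier H" "b \<in> carrier H" for a b
    by (rule bilinear_comp_args[OF HH.pure_bilinear bilinearD(1)[OF mult_bilinear that(1)] bilinearD(1)[OF mult_bilinear that(2)]])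
  have p': "bilinear K H H ?T2 (\<lambda>a b. ?p2 (a \<otimes>\<^bsub>H\<^esub> a') (b \<otimes>\<^bsub>H\<^esub> b'))" if "a' \<in> carrier H" "b' \<in> carrier H" for a' b'
    by (rule bilinear_comp_args[OF HH.pure_bilinear bilinearD(2)[OF mult_bilinear that(1)] bilinearD(2)[OF mult_bilinear that(2)]])
  define m where "m = (\<lambda>a b. sw ?T2 (\<lambda>a' b'. ?p2 (a \<otimes>\<^bsub>H\<^esub> a') (b \<otimes>\<^bsub>H\<^esub> b')) k)"
  have m: "bilinear K H H ?T2 m"
    unfolding m_def sweedler_def
    by (rule HH.lift_bilinear[OF HH.T_left_module H_left_module H_left_module p p' comult_closed[OF h(2)]])
  have c: "comult H (h \<otimes>\<^bsub>H\<^esub> k) = sw ?T2 m h"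
    using ring_hom_mult[OF comult_ring_hom h] by (simp add: tensor_algebra_def sweedler_def m_def)
  have "sw U f (h \<otimes>\<^bsub>H\<^esub> k) = tensor_lift K U f (sw ?T2 m h)"
    unfolding sweedler_def[of K H U f] c ..
  also have "\<dots> = sw U (\<lambda>a b. tensor_lift K U f (m a b)) h"
    by (rule hom_sw[OF HH.T_left_module U m HH.lift_hom(1)[OF U f] h(1)])
  also have "\<dots> = sw U (\<lambda>a b. sw U (\<lambda>a' b'. f (a \<otimes>\<^bsub>H\<^esub> a') (b \<otimes>\<^bsub>H\<^esub> b')) k) h"
  proof (rule sw_cong[OF U bilinear_comp[OF m HH.lift_hom(1)[OF U f]] h(1)])
    fix a b assume ab: "a \<in> carrier H" "b \<in> carrier H"
    show "tensor_lift K U f (m a b) = sw U (\<lambda>a' b'. f (a \<otimes>\<^bsub>H\<^esub> a') (b \<otimes>\<^bsub>H\<^esub> b')) k"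
      unfolding m_def hom_sw[OF HH.T_left_module U p[OF ab] HH.lift_hom(1)[OF U f] h(2)]
      by (rule sw_cong[OF U bilinear_comp[OF p[OF ab] HH.lift_hom(1)[OF U f]] h(2)])
        (simp add: HH.lift_hom(2)[OF U f] ab)
  qed
  finally show ?thesis .
qed

lemma sw_one:
  assumes U: "left_module K U" and f: "bilinear K H H U f"
  shows "sw U f \<one>\<^bsub>H\<^esub> = f \<one>\<^bsub>H\<^esub> \<one>\<^bsub>H\<^esub>"
  using ring_hom_one[OF comult_ring_hom] HH.lift_hom(2)[OF U f H.one_closed H.one_closed]
  by (simp add: sweedler_def tensor_algebra_def)

lemma antipode_sw:
  assumes "h \<in> carrier H"
  shows "sw H (\<lambda>a b. \<S> a \<otimes>\<^bsub>H\<^esub> b) h = \<epsilon> h \<odot>\<^bsub>H\<^esub> \<one>\<^bsub>H\<^esub>" "sw H (\<lambda>a b. a \<otimes>\<^bsub>H\<^esub> \<S> b) h = \<epsilon> h \<odot>\<^bsub>H\<^esub> \<one>\<^bsub>H\<^esub>"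
  using hopf assms unfolding hopf_algebra_def by blast+

text \<open>
  Together with the rules for the antipode and for module actions, these reduce the linearity of a
  summand in one variable to the structure of the term.
\<close>

lemma mult_Hom:
  "\<lbrakk>f \<in> Hom K X H; c \<in> carrier H\<rbrakk> \<Longrightarrow> (\<lambda>x. f x \<otimes>\<^bsub>H\<^esub> c) \<in> Hom K X H"
  "\<lbrakk>f \<in> Hom K X H; c \<in> carrier H\<rbrakk> \<Longrightarrow> (\<lambda>x. c \<otimes>\<^bsub>H\<^esub> f x) \<in> Hom K X H"
  using Hom_comp[OF _ bilinearD(1)[OF mult_bilinear]] Hom_comp[OF _ bilinearD(2)[OF mult_bilinear]] by auto

lemma antipode_Hom: "f \<in> Hom K X H \<Longrightarrow> (\<lambda>x. \<S> (f x)) \<in> Hom K X H"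
  by (rule Hom_comp[OF _ antipode_hom])

lemma smult_Hom_left:
  assumes "left_module H W" "f \<in> Hom K X H" "w \<in> carrier W"
  shows "(\<lambda>x. f x \<odot>\<^bsub>W\<^esub> w) \<in> Hom K X (sr W)"
  by (rule Hom_comp[OF assms(2) bilinearD(2)[OF smult_bilinear[OF assms(1)]]]) (simp add: assms(3))

lemma smult_Hom_right:
  assumes "left_module H W" "f \<in> Hom K X (sr W)" "c \<in> carrier H"
  shows "(\<lambda>x. c \<odot>\<^bsub>W\<^esub> f x) \<in> Hom K X (sr W)"
  by (rule Hom_comp[OF assms(2) bilinearD(1)[OF smult_bilinear[OF assms(1)] assms(3)]])

lemmas linear_intros = Hom_id mult_Hom antipode_Hom

text \<open>
  The antipode is a convolution inverse of the identity, and inverses are unique: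
  \<open>G(x) = \<Sum> G(x\<^sub>1) x\<^sub>2 S(x\<^sub>3) = \<Sum> c \<epsilon>(x\<^sub>1) S(x\<^sub>2) = c S(x)\<close>.
\<close>

lemma antipode_unique:
  assumes G: "G \<in> Hom K H H" and c: "c \<in> carrier K"
    and inv: "\<And>x. x \<in> carrier H \<Longrightarrow> sw H (\<lambda>a b. G a \<otimes>\<^bsub>H\<^esub> b) x = \<epsilon> x \<odot>\<^bsub>H\<^esub> (c \<odot>\<^bsub>H\<^esub> \<one>\<^bsub>H\<^esub>)" and x: "x \<in> carrier H"
  shows "G x = c \<odot>\<^bsub>H\<^esub> \<S> x"
proof -
  note HM = H_left_module
  have g: "trilinear K H H H H (\<lambda>a b d. (G a \<otimes>\<^bsub>H\<^esub> b) \<otimes>\<^bsub>H\<^esub> \<S> d)"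
    by (intro trilinearI linear_intros Hom_comp[OF Hom_id G] H.m_closed HomD(1)[OF G] antipode_closed; assumption)
  have b1: "bilinear K H H H (\<lambda>a b. G a \<otimes>\<^bsub>H\<^esub> b)"
    by (intro bilinearI linear_intros Hom_comp[OF Hom_id G] H.m_closed HomD(1)[OF G]; assumption)
  have b2: "bilinear K H H H (\<lambda>a b. a \<otimes>\<^bsub>H\<^esub> \<S> b)"
    by (intro bilinearI linear_intros H.m_closed antipode_closed; assumption)
  have cS: "(\<lambda>x. c \<odot>\<^bsub>H\<^esub> \<S> x) \<in> Hom K H H"
    using HomD[OF antipode_hom] c by (intro HomI) (simp_all add: HK.lsmult_r_distr HK.lsmult_assoc[symmetric] K.m_comm)
  have "G x = sw H (\<lambda>a b. \<epsilon> b \<odot>\<^bsub>H\<^esub> G a) x" by (rule counit_sw(2)[OF HM G x, symmetric])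
  also have "\<dots> = sw H (\<lambda>a b. sw H (\<lambda>a' b'. (G a \<otimes>\<^bsub>H\<^esub> a') \<otimes>\<^bsub>H\<^esub> \<S> b') b) x"
  proof (rule sw_cong[OF HM counit_bilinear(2)[OF HM G] x])
    fix a b assume ab: "a \<in> carrier H" "b \<in> carrier H"
    have Ga: "G a \<in> carrier H" using HomD(1)[OF G ab(1)] .
    have "sw H (\<lambda>a' b'. (G a \<otimes>\<^bsub>H\<^esub> a') \<otimes>\<^bsub>H\<^esub> \<S> b') b = sw H (\<lambda>a' b'. G a \<otimes>\<^bsub>H\<^esub> (a' \<otimes>\<^bsub>H\<^esub> \<S> b')) b"
      by (rule sw_cong[OF HM trilinearD(1)[OF g ab(1)] ab(2)]) (simp add: H.m_assoc Ga)
    also have "\<dots> = G a \<otimes>\<^bsub>H\<^esub> sw H (\<lambda>a' b'. a' \<otimes>\<^bsub>H\<^esub> \<S> b') b"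
      by (rule hom_sw[OF HM HM b2 bilinearD(1)[OF mult_bilinear Ga] ab(2), symmetric])
    finally show "\<epsilon> b \<odot>\<^bsub>H\<^esub> G a = sw H (\<lambda>a' b'. (G a \<otimes>\<^bsub>H\<^esub> a') \<otimes>\<^bsub>H\<^esub> \<S> b') b"
      using Ga ab by (simp add: antipode_sw smult_mult)
  qed
  also have "\<dots> = sw H (\<lambda>a b. sw H (\<lambda>a\<^sub>1 a\<^sub>2. (G a\<^sub>1 \<otimes>\<^bsub>H\<^esub> a\<^sub>2) \<otimes>\<^bsub>H\<^esub> \<S> b) a) x"
    by (rule coassoc[OF HM g x, symmetric])
  also have "\<dots> = sw H (\<lambda>a b. \<epsilon> a \<odot>\<^bsub>H\<^esub> (c \<odot>\<^bsub>H\<^esub> \<S> b)) x"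
  proof (rule sw_cong[OF HM sw_left_bilinear[OF HM HM g] x])
    fix a b assume ab: "a \<in> carrier H" "b \<in> carrier H"
    have "sw H (\<lambda>a\<^sub>1 a\<^sub>2. (G a\<^sub>1 \<otimes>\<^bsub>H\<^esub> a\<^sub>2) \<otimes>\<^bsub>H\<^esub> \<S> b) a = sw H (\<lambda>a\<^sub>1 a\<^sub>2. G a\<^sub>1 \<otimes>\<^bsub>H\<^esub> a\<^sub>2) a \<otimes>\<^bsub>H\<^esub> \<S> b"
      by (rule hom_sw[OF HM HM b1 bilinearD(2)[OF mult_bilinear antipode_closed[OF ab(2)]] ab(1), symmetric])
    also have "\<dots> = \<epsilon> a \<odot>\<^bsub>H\<^esub> (c \<odot>\<^bsub>H\<^esub> \<S> b)" using ab c by (simp add: inv smult_mult)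
    finally show "sw H (\<lambda>a\<^sub>1 a\<^sub>2. (G a\<^sub>1 \<otimes>\<^bsub>H\<^esub> a\<^sub>2) \<otimes>\<^bsub>H\<^esub> \<S> b) a = \<epsilon> a \<odot>\<^bsub>H\<^esub> (c \<odot>\<^bsub>H\<^esub> \<S> b)" .
  qed
  also have "\<dots> = c \<odot>\<^bsub>H\<^esub> \<S> x" by (rule counit_sw(1)[OF HM cS x])
  finally show ?thesis .
qed

text \<open>
  This would be immediate from \<open>S(h x) = S(x) S(h)\<close>.  Instead, \<open>G(x) = \<Sum> S(h\<^sub>1 x) h\<^sub>2\<close> satisfies
  \<open>\<Sum> G(x\<^sub>1) x\<^sub>2 = \<Sum> S((h x)\<^sub>1) (h x)\<^sub>2 = \<epsilon>(h) \<epsilon>(x)\<close>, so \<open>antipode_unique\<close> applies.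
\<close>

lemma antipode_cancel:
  assumes h: "h \<in> carrier H" and x: "x \<in> carrier H"
  shows "sw H (\<lambda>a b. \<S> (a \<otimes>\<^bsub>H\<^esub> x) \<otimes>\<^bsub>H\<^esub> b) h = \<epsilon> h \<odot>\<^bsub>H\<^esub> \<S> x"
proof (rule antipode_unique[OF _ counit_closed[OF h] _ x])
  note HM = H_left_module
  have b: "bilinear K H H H (\<lambda>a b. \<S> (a \<otimes>\<^bsub>H\<^esub> x) \<otimes>\<^bsub>H\<^esub> b)" if "x \<in> carrier H" for x
    by (intro bilinearI linear_intros that H.m_closed antipode_closed; assumption?)
  have p: "(\<lambda>x. \<S> (a \<otimes>\<^bsub>H\<^esub> x) \<otimes>\<^bsub>H\<^esub> b) \<in> Hom K H H" if "a \<in> carrier H" "b \<in> carrier H" for a b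
    by (intro linear_intros that)
  show G: "(\<lambda>x. sw H (\<lambda>a b. \<S> (a \<otimes>\<^bsub>H\<^esub> x) \<otimes>\<^bsub>H\<^esub> b) h) \<in> Hom K H H"
    by (rule sw_param_hom[OF HM HM b p h])
  fix y assume y: "y \<in> carrier H"
  have b0: "bilinear K H H H (\<lambda>a b. \<S> a \<otimes>\<^bsub>H\<^esub> b)"
    by (intro bilinearI linear_intros H.m_closed antipode_closed; assumption?)
  have q1: "bilinear K H H H (\<lambda>a b. (\<S> (c \<otimes>\<^bsub>H\<^esub> a) \<otimes>\<^bsub>H\<^esub> d) \<otimes>\<^bsub>H\<^esub> b)" if "c \<in> carrier H" "d \<in> carrier H" for c d
    by (intro bilinearI linear_intros that H.m_closed antipode_closed; assumption?)
  have q2: "bilinear K H H H (\<lambda>c d. (\<S> (c \<otimes>\<^bsub>H\<^esub> a) \<otimes>\<^bsub>H\<^esub> d) \<otimes>\<^bsub>H\<^esub> b)" if "a \<in> carrier H" "b \<in> carrier H" for a b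
    by (intro bilinearI linear_intros that H.m_closed antipode_closed; assumption?)
  have "sw H (\<lambda>a b. sw H (\<lambda>c d. \<S> (c \<otimes>\<^bsub>H\<^esub> a) \<otimes>\<^bsub>H\<^esub> d) h \<otimes>\<^bsub>H\<^esub> b) y =
    sw H (\<lambda>a b. sw H (\<lambda>c d. (\<S> (c \<otimes>\<^bsub>H\<^esub> a) \<otimes>\<^bsub>H\<^esub> d) \<otimes>\<^bsub>H\<^esub> b) h) y"
  proof (rule sw_cong[OF HM _ y])
    show "bilinear K H H H (\<lambda>a b. sw H (\<lambda>c d. \<S> (c \<otimes>\<^bsub>H\<^esub> a) \<otimes>\<^bsub>H\<^esub> d) h \<otimes>\<^bsub>H\<^esub> b)"
      by (rule bilinear_comp_args[OF mult_bilinear G Hom_id])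
    show "sw H (\<lambda>c d. \<S> (c \<otimes>\<^bsub>H\<^esub> a) \<otimes>\<^bsub>H\<^esub> d) h \<otimes>\<^bsub>H\<^esub> b = sw H (\<lambda>c d. (\<S> (c \<otimes>\<^bsub>H\<^esub> a) \<otimes>\<^bsub>H\<^esub> d) \<otimes>\<^bsub>H\<^esub> b) h"
      if ab: "a \<in> carrier H" "b \<in> carrier H" for a b
      by (rule hom_sw[OF HM HM b[OF ab(1)] bilinearD(2)[OF mult_bilinear ab(2)] h])
  qed
  also have "\<dots> = sw H (\<lambda>c d. sw H (\<lambda>a b. (\<S> (c \<otimes>\<^bsub>H\<^esub> a) \<otimes>\<^bsub>H\<^esub> d) \<otimes>\<^bsub>H\<^esub> b) y) h"
    by (rule sw_swap[OF HM q2 q1 y h])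
  also have "\<dots> = sw H (\<lambda>c d. sw H (\<lambda>a b. \<S> (c \<otimes>\<^bsub>H\<^esub> a) \<otimes>\<^bsub>H\<^esub> (d \<otimes>\<^bsub>H\<^esub> b)) y) h"
  proof (rule sw_cong[OF HM _ h])
    show "bilinear K H H H (\<lambda>c d. sw H (\<lambda>a b. (\<S> (c \<otimes>\<^bsub>H\<^esub> a) \<otimes>\<^bsub>H\<^esub> d) \<otimes>\<^bsub>H\<^esub> b) y)"
      unfolding sweedler_def by (rule HH.lift_bilinear[OF HM HM HM q1 q2 comult_closed[OF y]])
    show "sw H (\<lambda>a b. (\<S> (c \<otimes>\<^bsub>H\<^esub> a) \<otimes>\<^bsub>H\<^esub> d) \<otimes>\<^bsub>H\<^esub> b) y = sw H (\<lambda>a b. \<S> (c \<otimes>\<^bsub>H\<^esub> a) \<otimes>\<^bsub>H\<^esub> (d \<otimes>\<^bsub>H\<^esub> b)) y"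
      if cd: "c \<in> carrier H" "d \<in> carrier H" for c d
      by (rule sw_cong[OF HM q1[OF cd] y]) (simp add: H.m_assoc cd)
  qed
  also have "\<dots> = sw H (\<lambda>a b. \<S> a \<otimes>\<^bsub>H\<^esub> b) (h \<otimes>\<^bsub>H\<^esub> y)" by (rule sw_mult[OF HM b0 h y, symmetric])
  also have "\<dots> = \<epsilon> y \<odot>\<^bsub>H\<^esub> (\<epsilon> h \<odot>\<^bsub>H\<^esub> \<one>\<^bsub>H\<^esub>)"
    using h y by (simp add: antipode_sw counit_mult HK.lsmult_assoc[symmetric] K.m_comm)
  finally show "sw H (\<lambda>a b. sw H (\<lambda>c d. \<S> (c \<otimes>\<^bsub>H\<^esub> a) \<otimes>\<^bsub>H\<^esub> d) h \<otimes>\<^bsub>H\<^esub> b) y = \<epsilon> y \<odot>\<^bsub>H\<^esub> (\<epsilon> h \<odot>\<^bsub>H\<^esub> \<one>\<^bsub>H\<^esub>)" .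
qed

end

section \<open>The trace of a linear map\<close>

context fd_hopf_algebra
begin

text \<open>
  The linear maps from \<open>A\<close> to \<open>B\<close> form an \<open>H\<close>-module, and this is the action of \<open>\<Lambda>\<close> on \<open>f\<close>.
\<close>

definition trace :: "('h, 'x, 'e) module_scheme \<Rightarrow> ('h, 'y, 'f) module_scheme \<Rightarrow> 'h \<Rightarrow> ('x \<Rightarrow> 'y) \<Rightarrow> 'x \<Rightarrow> 'y" where
  "trace A B \<Lambda> f x = sw (sr B) (\<lambda>a b. a \<odot>\<^bsub>B\<^esub> f (\<S> b \<odot>\<^bsub>A\<^esub> x)) \<Lambda>"

text \<open>
  Since \<open>h \<Lambda> = \<epsilon>(h) \<Lambda>\<close>, the sum \<open>\<Sum> h\<^sub>1 \<Lambda>\<^sub>1 f(S(h\<^sub>2 \<Lambda>\<^sub>2) h\<^sub>3 x)\<close> over \<open>h\<close> and \<open>\<Lambda>\<close> can be evaluated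
  in two ways.  The components \<open>h\<^sub>1\<close> and \<open>h\<^sub>2\<close> together give \<open>\<Sum> \<epsilon>(h\<^sub>1) \<Lambda>\<^sub>1 f(S(\<Lambda>\<^sub>2) h\<^sub>2 x)\<close>, the
  trace at \<open>h x\<close>.  The components \<open>h\<^sub>2\<close> and \<open>h\<^sub>3\<close> cancel by \<open>antipode_cancel\<close>, which leaves \<open>h\<close>
  times the trace at \<open>x\<close>.
\<close>

lemma trace_hom:
  assumes A: "left_module H A" and B: "left_module H B" and f: "f \<in> Hom K (sr A) (sr B)" and \<Lambda>: "left_integral H \<Lambda>"
  shows "trace A B \<Lambda> f \<in> Hom H A B"
proof -
  interpret A: left_module H A by (rule A)
  interpret B: left_module H B by (rule B)
  note HM = H_left_module and SA = sr_left_module[OF A] and SB = sr_left_module[OF B]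
  have \<Lambda>c: "\<Lambda> \<in> carrier H" and \<Lambda>i: "\<And>h. h \<in> carrier H \<Longrightarrow> h \<otimes>\<^bsub>H\<^esub> \<Lambda> = \<epsilon> h \<odot>\<^bsub>H\<^esub> \<Lambda>"
    using \<Lambda> unfolding left_integral_def by blast+
  have fc: "\<And>x. x \<in> carrier A \<Longrightarrow> f x \<in> carrier B" using HomD(1)[OF f] by simp
  note lin = linear_intros smult_Hom_left[OF A] smult_Hom_right[OF A] smult_Hom_left[OF B] smult_Hom_right[OF B] Hom_comp[OF _ f]
  note cl = H.m_closed A.lsmult_closed B.lsmult_closed antipode_closed fc
  define k where "k = (\<lambda>y u v. u \<odot>\<^bsub>B\<^esub> f (\<S> v \<odot>\<^bsub>A\<^esub> y))"
  have k3: "trilinear K H H (sr A) (sr B) (\<lambda>u v y. k y u v)"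
    unfolding k_def by (intro trilinearI lin; simp add: cl)
  note kb = trilinearD(3)[OF k3, simplified sr_simps] and kl = trilinearD(6)[OF k3]
  \<comment> \<open>the trace with \<open>\<Lambda>\<close> replaced by a variable element\<close>
  define P where "P = (\<lambda>u y. sw (sr B) (k y) u)"
  have tr: "trace A B \<Lambda> f x = P \<Lambda> x" for x unfolding trace_def P_def k_def ..
  have Pb: "bilinear K H (sr A) (sr B) P" unfolding P_def using sw_left_bilinear[OF SB SA k3] .
  note PD = bilinearD[OF Pb, simplified sr_simps]
  have lin_tr: "P \<Lambda> \<in> Hom K (sr A) (sr B)" by (rule PD(1)[OF \<Lambda>c])
  show ?thesis
  proof (rule HomI)
    show "trace A B \<Lambda> f x \<in> carrier B" if "x \<in> carrier A" for x
      unfolding tr using PD(3)[OF \<Lambda>c] that by simp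
    show "trace A B \<Lambda> f (x \<oplus>\<^bsub>A\<^esub> y) = trace A B \<Lambda> f x \<oplus>\<^bsub>B\<^esub> trace A B \<Lambda> f y" if "x \<in> carrier A" "y \<in> carrier A" for x y
      unfolding tr using PD(5)[OF \<Lambda>c] that by simp
    fix h x assume h: "h \<in> carrier H" and x: "x \<in> carrier A"
    have Px: "P \<Lambda> x \<in> carrier B" using PD(3)[OF \<Lambda>c] x by simp
    \<comment> \<open>the summand, with \<open>a\<close>, \<open>b\<close>, \<open>d\<close> for the three components of \<open>h\<close>\<close>
    define g where "g = (\<lambda>a b d. sw (sr B) (\<lambda>u v. k (d \<odot>\<^bsub>A\<^esub> x) (a \<otimes>\<^bsub>H\<^esub> u) (b \<otimes>\<^bsub>H\<^esub> v)) \<Lambda>)"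
    have kk: "bilinear K H H (sr B) (\<lambda>u v. k y (a \<otimes>\<^bsub>H\<^esub> u) (b \<otimes>\<^bsub>H\<^esub> v))" if "a \<in> carrier H" "b \<in> carrier H" "y \<in> carrier A" for a b y
      by (rule bilinear_comp_args[OF kb[OF that(3)] bilinearD(1)[OF mult_bilinear that(1)] bilinearD(1)[OF mult_bilinear that(2)]])
    have g3: "trilinear K H H H (sr B) g"
    proof (rule trilinearI)
      show "g a b \<in> Hom K H (sr B)" if "a \<in> carrier H" "b \<in> carrier H" for a b
        unfolding g_def
      proof (rule sw_param_hom[OF SB HM kk _ \<Lambda>c])
        show "(\<lambda>d. k (d \<odot>\<^bsub>A\<^esub> x) (a \<otimes>\<^bsub>H\<^esub> u) (b \<otimes>\<^bsub>H\<^esub> v)) \<in> Hom K H (sr B)" if "u \<in> carrier H" "v \<in> carrier H" for u v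
          unfolding k_def using that \<open>a \<in> carrier H\<close> \<open>b \<in> carrier H\<close> x by (intro lin cl)
      qed (simp_all add: that x cl)
      show "(\<lambda>b. g a b d) \<in> Hom K H (sr B)" if "a \<in> carrier H" "d \<in> carrier H" for a d
        unfolding g_def
      proof (rule sw_param_hom[OF SB HM kk _ \<Lambda>c])
        show "(\<lambda>b. k (d \<odot>\<^bsub>A\<^esub> x) (a \<otimes>\<^bsub>H\<^esub> u) (b \<otimes>\<^bsub>H\<^esub> v)) \<in> Hom K H (sr B)" if "u \<in> carrier H" "v \<in> carrier H" for u v
          unfolding k_def using that \<open>a \<in> carrier H\<close> \<open>d \<in> carrier H\<close> x by (intro lin cl)
      qed (simp_all add: that x cl)
      show "(\<lambda>a. g a b d) \<in> Hom K H (sr B)" if "b \<in> carrier H" "d \<in> carrier H" for b d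
        unfolding g_def
      proof (rule sw_param_hom[OF SB HM kk _ \<Lambda>c])
        show "(\<lambda>a. k (d \<odot>\<^bsub>A\<^esub> x) (a \<otimes>\<^bsub>H\<^esub> u) (b \<otimes>\<^bsub>H\<^esub> v)) \<in> Hom K H (sr B)" if "u \<in> carrier H" "v \<in> carrier H" for u v
          unfolding k_def using that \<open>b \<in> carrier H\<close> \<open>d \<in> carrier H\<close> x by (intro lin cl)
      qed (simp_all add: that x cl)
    qed
    have gP: "sw (sr B) (\<lambda>a b. g a b d) u = P (u \<otimes>\<^bsub>H\<^esub> \<Lambda>) (d \<odot>\<^bsub>A\<^esub> x)" if "u \<in> carrier H" "d \<in> carrier H" for u d
      unfolding g_def P_def using sw_mult[OF SB kb[OF A.lsmult_closed[OF that(2) x]] that(1) \<Lambda>c] by simp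
    have gr: "sw (sr B) (g a) b = \<epsilon> b \<odot>\<^bsub>sr B\<^esub> (a \<odot>\<^bsub>B\<^esub> P \<Lambda> x)" if ab: "a \<in> carrier H" "b \<in> carrier H" for a b
    proof -
      let ?F = "\<lambda>c d u v. (a \<otimes>\<^bsub>H\<^esub> u) \<odot>\<^bsub>B\<^esub> f ((\<S> (c \<otimes>\<^bsub>H\<^esub> v) \<otimes>\<^bsub>H\<^esub> d) \<odot>\<^bsub>A\<^esub> x)"
      have F1: "bilinear K H H (sr B) (?F c d)" if "c \<in> carrier H" "d \<in> carrier H" for c d
        using that ab x by (intro bilinearI lin cl)
      have F2: "bilinear K H H (sr B) (\<lambda>c d. ?F c d u v)" if "u \<in> carrier H" "v \<in> carrier H" for u v
        using that ab x by (intro bilinearI lin cl)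
      have "sw (sr B) (g a) b = sw (sr B) (\<lambda>c d. sw (sr B) (?F c d) \<Lambda>) b"
      proof (rule sw_cong[OF SB trilinearD(1)[OF g3 ab(1)] ab(2)])
        show "g a c d = sw (sr B) (?F c d) \<Lambda>" if cd: "c \<in> carrier H" "d \<in> carrier H" for c d
          unfolding g_def
          by (rule sw_cong[OF SB kk[OF ab(1) cd(1) A.lsmult_closed[OF cd(2) x]] \<Lambda>c])
            (simp add: k_def A.lsmult_assoc cd x)
      qed
      also have "\<dots> = sw (sr B) (\<lambda>u v. sw (sr B) (\<lambda>c d. ?F c d u v) b) \<Lambda>"
        by (rule sw_swap[OF SB F1 F2 ab(2) \<Lambda>c])
      also have "\<dots> = sw (sr B) (\<lambda>u v. \<epsilon> b \<odot>\<^bsub>sr B\<^esub> (a \<odot>\<^bsub>B\<^esub> k x u v)) \<Lambda>"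
      proof (rule sw_cong[OF SB _ \<Lambda>c])
        show "bilinear K H H (sr B) (\<lambda>u v. sw (sr B) (\<lambda>c d. ?F c d u v) b)"
          unfolding sweedler_def by (rule HH.lift_bilinear[OF SB HM HM F2 F1 comult_closed[OF ab(2)]])
        fix u v assume uv: "u \<in> carrier H" "v \<in> carrier H"
        have b1: "bilinear K H H H (\<lambda>c d. \<S> (c \<otimes>\<^bsub>H\<^esub> v) \<otimes>\<^bsub>H\<^esub> d)" using uv by (intro bilinearI lin cl)
        have l1: "(\<lambda>z. (a \<otimes>\<^bsub>H\<^esub> u) \<odot>\<^bsub>B\<^esub> f (z \<odot>\<^bsub>A\<^esub> x)) \<in> Hom K H (sr B)" using ab uv x by (intro lin cl)
        have "sw (sr B) (\<lambda>c d. ?F c d u v) b = (a \<otimes>\<^bsub>H\<^esub> u) \<odot>\<^bsub>B\<^esub> f (sw H (\<lambda>c d. \<S> (c \<otimes>\<^bsub>H\<^esub> v) \<otimes>\<^bsub>H\<^esub> d) b \<odot>\<^bsub>A\<^esub> x)"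
          by (rule hom_sw[OF HM SB b1 l1 ab(2), symmetric])
        also have "\<dots> = (a \<otimes>\<^bsub>H\<^esub> u) \<odot>\<^bsub>B\<^esub> f ((\<epsilon> b \<odot>\<^bsub>H\<^esub> \<S> v) \<odot>\<^bsub>A\<^esub> x)"
          by (simp only: antipode_cancel[OF ab(2) uv(2)])
        also have "\<dots> = \<epsilon> b \<odot>\<^bsub>sr B\<^esub> ((a \<otimes>\<^bsub>H\<^esub> u) \<odot>\<^bsub>B\<^esub> f (\<S> v \<odot>\<^bsub>A\<^esub> x))"
          by (rule HomD(3)[OF l1 counit_closed[OF ab(2)] antipode_closed[OF uv(2)]])
        also have "\<dots> = \<epsilon> b \<odot>\<^bsub>sr B\<^esub> (a \<odot>\<^bsub>B\<^esub> k x u v)"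
          unfolding k_def using B.lsmult_assoc[OF ab(1) uv(1) fc[OF A.lsmult_closed[OF antipode_closed[OF uv(2)] x]]] by simp
        finally show "sw (sr B) (\<lambda>c d. ?F c d u v) b = \<epsilon> b \<odot>\<^bsub>sr B\<^esub> (a \<odot>\<^bsub>B\<^esub> k x u v)" .
      qed
      also have "\<dots> = \<epsilon> b \<odot>\<^bsub>sr B\<^esub> (a \<odot>\<^bsub>B\<^esub> P \<Lambda> x)"
        unfolding P_def
      proof (rule hom_sw[OF SB SB kb[OF x] _ \<Lambda>c, symmetric])
        show "(\<lambda>y. \<epsilon> b \<odot>\<^bsub>sr B\<^esub> (a \<odot>\<^bsub>B\<^esub> y)) \<in> Hom K (sr B) (sr B)"
          unfolding sr_simps using ab by (intro lin HK.lsmult_closed counit_closed H.one_closed)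
      qed
      finally show ?thesis .
    qed
    have 1: "sw (sr B) (\<lambda>a b. sw (sr B) (\<lambda>a\<^sub>1 a\<^sub>2. g a\<^sub>1 a\<^sub>2 b) a) h = sw (sr B) (\<lambda>a b. sw (sr B) (g a) b) h"
      by (rule coassoc[OF SB g3 h])
    have "sw (sr B) (\<lambda>a b. sw (sr B) (\<lambda>a\<^sub>1 a\<^sub>2. g a\<^sub>1 a\<^sub>2 b) a) h = sw (sr B) (\<lambda>a b. \<epsilon> a \<odot>\<^bsub>sr B\<^esub> P \<Lambda> (b \<odot>\<^bsub>A\<^esub> x)) h"
    proof (rule sw_cong[OF SB sw_left_bilinear[OF SB HM g3] h])
      show "sw (sr B) (\<lambda>a\<^sub>1 a\<^sub>2. g a\<^sub>1 a\<^sub>2 b) a = \<epsilon> a \<odot>\<^bsub>sr B\<^esub> P \<Lambda> (b \<odot>\<^bsub>A\<^esub> x)" if "a \<in> carrier H" "b \<in> carrier H" for a b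
        unfolding gP[OF that] \<Lambda>i[OF that(1)]
        using HomD(3)[OF bilinearD(2)[OF Pb] counit_closed[OF that(1)] \<Lambda>c, of "b \<odot>\<^bsub>A\<^esub> x"] A.lsmult_closed[OF that(2) x] by simp
    qed
    also have "\<dots> = P \<Lambda> (h \<odot>\<^bsub>A\<^esub> x)"
      by (rule counit_sw(1)[OF SB _ h]) (intro Hom_comp[OF _ lin_tr] lin x)
    finally have 2: "sw (sr B) (\<lambda>a b. sw (sr B) (\<lambda>a\<^sub>1 a\<^sub>2. g a\<^sub>1 a\<^sub>2 b) a) h = P \<Lambda> (h \<odot>\<^bsub>A\<^esub> x)" .
    have "sw (sr B) (\<lambda>a b. sw (sr B) (g a) b) h = sw (sr B) (\<lambda>a b. \<epsilon> b \<odot>\<^bsub>sr B\<^esub> (a \<odot>\<^bsub>B\<^esub> P \<Lambda> x)) h"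
      by (rule sw_cong[OF SB sw_right_bilinear[OF SB HM g3] h]) (rule gr)
    also have "\<dots> = h \<odot>\<^bsub>B\<^esub> P \<Lambda> x"
      by (rule counit_sw(2)[OF SB _ h]) (intro lin Px)
    finally show "trace A B \<Lambda> f (h \<odot>\<^bsub>A\<^esub> x) = h \<odot>\<^bsub>B\<^esub> trace A B \<Lambda> f x"
      unfolding tr using 1 2 by simp
  qed
qed

end

section \<open>Smash products\<close>

locale smash = fd_hopf_algebra K H
  for K :: "('k, 'c) ring_scheme" and H :: "('k, 'h, 'd) hopf_scheme" +
  fixes R :: "('k, 'r, 'e) module_scheme" and act :: "'h \<Rightarrow> 'r \<Rightarrow> 'r"
  assumes module_algebra: "module_algebra K H R act"
begin

abbreviation "T \<equiv> smash_product K H R act"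

sublocale R: ring R using module_algebra unfolding module_algebra_def k_algebra_def by blast

lemma R_left_module: "left_module K R"
  using module_algebra vectorspace_iff[OF field] unfolding module_algebra_def k_algebra_def by blast

sublocale RK: left_module K R by (rule R_left_module)

sublocale RH: tensor_product K R H by unfold_locales

abbreviation hash (infixl "\<sharp>" 75) where "r \<sharp> h \<equiv> pure_tensor K R H r h"

lemma act_left_module: "left_module H (with_action R act)"
  using module_algebra unfolding module_algebra_def by blast

lemma R_smult_mult:
  assumes "c \<in> carrier K" "x \<in> carrier R" "y \<in> carrier R"
  shows "(c \<odot>\<^bsub>R\<^esub> x) \<otimes>\<^bsub>R\<^esub> y = c \<odot>\<^bsub>R\<^esub> (x \<otimes>\<^bsub>R\<^esub> y)" "x \<otimes>\<^bsub>R\<^esub> (c \<odot>\<^bsub>R\<^esub> y) = c \<odot>\<^bsub>R\<^esub> (x \<otimes>\<^bsub>R\<^esub> y)"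
  using assms module_algebra unfolding module_algebra_def k_algebra_def by blast+

lemma act_closed [simp]: "\<lbrakk>h \<in> carrier H; r \<in> carrier R\<rbrakk> \<Longrightarrow> act h r \<in> carrier R"
  and act_add_left: "\<lbrakk>h \<in> carrier H; h' \<in> carrier H; r \<in> carrier R\<rbrakk> \<Longrightarrow> act (h \<oplus>\<^bsub>H\<^esub> h') r = act h r \<oplus>\<^bsub>R\<^esub> act h' r"
  and act_add_right: "\<lbrakk>h \<in> carrier H; r \<in> carrier R; r' \<in> carrier R\<rbrakk> \<Longrightarrow> act h (r \<oplus>\<^bsub>R\<^esub> r') = act h r \<oplus>\<^bsub>R\<^esub> act h r'"
  and act_mult: "\<lbrakk>h \<in> carrier H; h' \<in> carrier H; r \<in> carrier R\<rbrakk> \<Longrightarrow> act (h \<otimes>\<^bsub>H\<^esub> h') r = act h (act h' r)"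
  and act_one: "r \<in> carrier R \<Longrightarrow> act \<one>\<^bsub>H\<^esub> r = r"
  using left_module.lsmult_closed[OF act_left_module] left_module.lsmult_l_distr[OF act_left_module]
    left_module.lsmult_r_distr[OF act_left_module] left_module.lsmult_assoc[OF act_left_module]
    left_module.lsmult_one[OF act_left_module] by (simp_all add: with_action_def)

lemma act_smult_left: "\<lbrakk>c \<in> carrier K; h \<in> carrier H; r \<in> carrier R\<rbrakk> \<Longrightarrow> act (c \<odot>\<^bsub>H\<^esub> h) r = c \<odot>\<^bsub>R\<^esub> act h r"
  and act_unit: "h \<in> carrier H \<Longrightarrow> act h \<one>\<^bsub>R\<^esub> = \<epsilon> h \<odot>\<^bsub>R\<^esub> \<one>\<^bsub>R\<^esub>"
  using module_algebra unfolding module_algebra_def by blast+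

lemma act_smult_right:
  assumes "c \<in> carrier K" "h \<in> carrier H" "r \<in> carrier R"
  shows "act h (c \<odot>\<^bsub>R\<^esub> r) = c \<odot>\<^bsub>R\<^esub> act h r"
proof -
  have "c \<odot>\<^bsub>R\<^esub> r = act (c \<odot>\<^bsub>H\<^esub> \<one>\<^bsub>H\<^esub>) r" using assms by (simp add: act_smult_left act_one)
  then have "act h (c \<odot>\<^bsub>R\<^esub> r) = act (h \<otimes>\<^bsub>H\<^esub> (c \<odot>\<^bsub>H\<^esub> \<one>\<^bsub>H\<^esub>)) r" using assms by (simp add: act_mult)
  then show ?thesis using assms by (simp add: smult_mult act_smult_left)
qed

lemma act_bilinear: "bilinear K H R R act"
  by (intro bilinearI HomI) (simp_all add: act_add_left act_add_right act_smult_left act_smult_right)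

lemma R_mult_bilinear: "bilinear K R R R (\<otimes>\<^bsub>R\<^esub>)"
  by (intro bilinearI HomI) (simp_all add: R.r_distr R.l_distr R_smult_mult)

lemmas smash_linear_intros = linear_intros
  Hom_comp[OF _ bilinearD(1)[OF act_bilinear]] Hom_comp[OF _ bilinearD(2)[OF act_bilinear]]
  Hom_comp[OF _ bilinearD(1)[OF R_mult_bilinear]] Hom_comp[OF _ bilinearD(2)[OF R_mult_bilinear]]
  Hom_comp[OF _ bilinearD(1)[OF RH.pure_bilinear]] Hom_comp[OF _ bilinearD(2)[OF RH.pure_bilinear]]

lemma T_simps [simp]: "carrier T = carrier (tensor K R H)" "x \<oplus>\<^bsub>T\<^esub> y = x \<oplus>\<^bsub>tensor K R H\<^esub> y"
  "c \<odot>\<^bsub>T\<^esub> x = c \<odot>\<^bsub>tensor K R H\<^esub> x" "\<zero>\<^bsub>T\<^esub> = \<zero>\<^bsub>tensor K R H\<^esub>" "\<one>\<^bsub>T\<^esub> = \<one>\<^bsub>R\<^esub> \<sharp> \<one>\<^bsub>H\<^esub>"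
  by (simp_all add: smash_product_def)

text \<open>
  To evaluate the product on pure tensors, its defining sums have to be shown multilinear.
\<close>

lemma smash_mult:
  shows "\<lbrakk>r \<in> carrier R; h \<in> carrier H; r' \<in> carrier R; h' \<in> carrier H\<rbrakk> \<Longrightarrow>
      (r \<sharp> h) \<otimes>\<^bsub>T\<^esub> (r' \<sharp> h') = sw (tensor K R H) (\<lambda>a b. (r \<otimes>\<^bsub>R\<^esub> act a r') \<sharp> (b \<otimes>\<^bsub>H\<^esub> h')) h"
    and "t \<in> carrier T \<Longrightarrow> (\<lambda>s. s \<otimes>\<^bsub>T\<^esub> t) \<in> Hom K (tensor K R H) (tensor K R H)"
proof -
  let ?T = "tensor K R H"
  let ?B = "\<lambda>r h r' h' a b. (r \<otimes>\<^bsub>R\<^esub> act a r') \<sharp> (b \<otimes>\<^bsub>H\<^esub> h')"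
  note TM = RH.T_left_module and HM = H_left_module and RM = R_left_module
  note intros = smash_linear_intros RH.pure_closed H.m_closed R.m_closed act_closed
  define m where "m = (\<lambda>r h r' h'. sw ?T (?B r h r' h') h)"
  have b1: "bilinear K H H ?T (?B r h r' h')" if "r \<in> carrier R" "r' \<in> carrier R" "h' \<in> carrier H" for r h r' h'
    using that by (intro bilinearI intros)
  have m1: "bilinear K R H ?T (m r h)" if rh: "r \<in> carrier R" "h \<in> carrier H" for r h
  proof -
    have "bilinear K R H ?T (\<lambda>r' h'. sw ?T (?B r h r' h') h)"
      unfolding sweedler_def
    proof (rule HH.lift_bilinear[OF TM RM HM b1[OF rh(1)] _ comult_closed[OF rh(2)]])
      show "bilinear K R H ?T (\<lambda>r' h'. ?B r h r' h' a b)" if "a \<in> carrier H" "b \<in> carrier H" for a b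
        using that rh by (intro bilinearI intros)
    qed
    then show ?thesis unfolding m_def .
  qed
  have m2: "bilinear K R H ?T (\<lambda>r h. m r h r' h')" if r'h': "r' \<in> carrier R" "h' \<in> carrier H" for r' h'
  proof -
    have "trilinear K R H H ?T (\<lambda>r a b. ?B r h r' h' a b)" for h
      using r'h' by (intro trilinearI intros)
    from sw_right_bilinear[OF TM RM this] show ?thesis unfolding m_def .
  qed
  have m3: "bilinear K R H ?T (\<lambda>r h. tensor_lift K ?T (m r h) t)" if "t \<in> carrier ?T" for t
    by (rule RH.lift_bilinear[OF TM RM HM m1 m2 that])
  have mT: "s \<otimes>\<^bsub>T\<^esub> t = tensor_lift K ?T (\<lambda>r h. tensor_lift K ?T (m r h) t) s" for s t
    unfolding m_def smash_product_def by simp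
  show "(r \<sharp> h) \<otimes>\<^bsub>T\<^esub> (r' \<sharp> h') = sw ?T (?B r h r' h') h"
    if "r \<in> carrier R" "h \<in> carrier H" "r' \<in> carrier R" "h' \<in> carrier H"
    unfolding mT RH.lift_hom(2)[OF TM m3[OF RH.pure_closed[OF that(3,4)]] that(1,2)]
      RH.lift_hom(2)[OF TM m1[OF that(1,2)] that(3,4)] unfolding m_def ..
  show "(\<lambda>s. s \<otimes>\<^bsub>T\<^esub> t) \<in> Hom K ?T ?T" if "t \<in> carrier T"
    unfolding mT using RH.lift_hom(1)[OF TM m3] that by simp
qed

lemma smash_mult_special:
  shows "\<lbrakk>h \<in> carrier H; h' \<in> carrier H\<rbrakk> \<Longrightarrow> (\<one>\<^bsub>R\<^esub> \<sharp> h) \<otimes>\<^bsub>T\<^esub> (\<one>\<^bsub>R\<^esub> \<sharp> h') = \<one>\<^bsub>R\<^esub> \<sharp> (h \<otimes>\<^bsub>H\<^esub> h')"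
    and "\<lbrakk>r \<in> carrier R; r' \<in> carrier R; h \<in> carrier H\<rbrakk> \<Longrightarrow> (r \<sharp> \<one>\<^bsub>H\<^esub>) \<otimes>\<^bsub>T\<^esub> (r' \<sharp> h) = (r \<otimes>\<^bsub>R\<^esub> r') \<sharp> h"
    and "\<lbrakk>h \<in> carrier H; r \<in> carrier R\<rbrakk> \<Longrightarrow> (\<one>\<^bsub>R\<^esub> \<sharp> h) \<otimes>\<^bsub>T\<^esub> (r \<sharp> \<one>\<^bsub>H\<^esub>) = sw (tensor K R H) (\<lambda>a b. act a r \<sharp> b) h"
proof -
  note TM = RH.T_left_module
  note intros = smash_linear_intros RH.pure_closed H.m_closed R.m_closed act_closed R.one_closed H.one_closed
  have b1: "bilinear K H H (tensor K R H) (\<lambda>a b. (r \<otimes>\<^bsub>R\<^esub> act a r') \<sharp> (b \<otimes>\<^bsub>H\<^esub> h'))"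
    if "r \<in> carrier R" "r' \<in> carrier R" "h' \<in> carrier H" for r r' h'
    using that by (intro bilinearI intros)
  have l: "(\<lambda>z. \<one>\<^bsub>R\<^esub> \<sharp> (z \<otimes>\<^bsub>H\<^esub> h')) \<in> Hom K H (tensor K R H)" if "h' \<in> carrier H" for h'
    using that by (intro intros)
  note P = bilinearD[OF RH.pure_bilinear]
  show "(\<one>\<^bsub>R\<^esub> \<sharp> h) \<otimes>\<^bsub>T\<^esub> (\<one>\<^bsub>R\<^esub> \<sharp> h') = \<one>\<^bsub>R\<^esub> \<sharp> (h \<otimes>\<^bsub>H\<^esub> h')" if h: "h \<in> carrier H" "h' \<in> carrier H" for h h'
  proof -
    have "(\<one>\<^bsub>R\<^esub> \<sharp> h) \<otimes>\<^bsub>T\<^esub> (\<one>\<^bsub>R\<^esub> \<sharp> h') = sw (tensor K R H) (\<lambda>a b. \<epsilon> a \<odot>\<^bsub>tensor K R H\<^esub> (\<one>\<^bsub>R\<^esub> \<sharp> (b \<otimes>\<^bsub>H\<^esub> h'))) h"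
      unfolding smash_mult(1)[OF R.one_closed h(1) R.one_closed h(2)]
      by (rule sw_cong[OF TM b1 h(1)]) (simp_all add: act_unit P(6) RK.lsmult_closed h)
    also have "\<dots> = \<one>\<^bsub>R\<^esub> \<sharp> (h \<otimes>\<^bsub>H\<^esub> h')" by (rule counit_sw(1)[OF TM l[OF h(2)] h(1)])
    finally show ?thesis .
  qed
  show "(r \<sharp> \<one>\<^bsub>H\<^esub>) \<otimes>\<^bsub>T\<^esub> (r' \<sharp> h) = (r \<otimes>\<^bsub>R\<^esub> r') \<sharp> h" if "r \<in> carrier R" "r' \<in> carrier R" "h \<in> carrier H" for r r' h
    unfolding smash_mult(1)[OF that(1) H.one_closed that(2,3)] sw_one[OF TM b1[OF that]] using that by (simp add: act_one)
  show "(\<one>\<^bsub>R\<^esub> \<sharp> h) \<otimes>\<^bsub>T\<^esub> (r \<sharp> \<one>\<^bsub>H\<^esub>) = sw (tensor K R H) (\<lambda>a b. act a r \<sharp> b) h" if h: "h \<in> carrier H" "r \<in> carrier R" for h r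
    unfolding smash_mult(1)[OF R.one_closed h(1,2) H.one_closed]
    by (rule sw_cong[OF TM b1 h(1)]) (simp_all add: h)
qed

end

section \<open>Modules over the smash product\<close>

context smash
begin

definition hopf_restriction :: "(('r \<times> 'h \<Rightarrow> 'k) set, 'm, 'f) module_scheme \<Rightarrow> ('h, 'm) module" where
  "hopf_restriction M = with_action M (\<lambda>h v. (\<one>\<^bsub>R\<^esub> \<sharp> h) \<odot>\<^bsub>M\<^esub> v)"

end

text \<open>
  A \<open>T\<close>-module is handled through its restrictions to \<open>H\<close>, written \<open>M\<^sub>H\<close>, and to \<open>R\<close>, given by
  \<open>mul\<close>; the relation between them is \<open>smult_mul\<close>.
\<close>

locale smash_module = smash K H R act
  for K :: "('k, 'c) ring_scheme" and H :: "('k, 'h, 'd) hopf_scheme"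
    and R :: "('k, 'r, 'e) module_scheme" and act :: "'h \<Rightarrow> 'r \<Rightarrow> 'r" +
  fixes M :: "(('r \<times> 'h \<Rightarrow> 'k) set, 'm, 'f) module_scheme"
  assumes M: "left_module (smash_product K H R act) M"
begin

sublocale M: left_module "smash_product K H R act" M by (rule M)

abbreviation M\<^sub>H :: "('h, 'm) module" where
  "M\<^sub>H \<equiv> hopf_restriction M"

definition mul :: "'r \<Rightarrow> 'm \<Rightarrow> 'm" where
  "mul r v = (r \<sharp> \<one>\<^bsub>H\<^esub>) \<odot>\<^bsub>M\<^esub> v"

lemma M\<^sub>H_simps [simp]: "carrier M\<^sub>H = carrier M" "x \<oplus>\<^bsub>M\<^sub>H\<^esub> y = x \<oplus>\<^bsub>M\<^esub> y" "\<zero>\<^bsub>M\<^sub>H\<^esub> = \<zero>\<^bsub>M\<^esub>"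
    "h \<odot>\<^bsub>M\<^sub>H\<^esub> v = (\<one>\<^bsub>R\<^esub> \<sharp> h) \<odot>\<^bsub>M\<^esub> v"
  by (simp_all add: hopf_restriction_def with_action_simps)

lemma pure_carrier [simp]: "\<lbrakk>r \<in> carrier R; h \<in> carrier H\<rbrakk> \<Longrightarrow> r \<sharp> h \<in> carrier T"
  by simp

lemma M\<^sub>H_left_module: "left_module H M\<^sub>H"
proof -
  note P = bilinearD[OF RH.pure_bilinear]
  have "abelian_group M\<^sub>H"
    by (rule abelian_group_record_cong[OF M.M.abelian_group_axioms]) (simp_all add: hopf_restriction_def with_action_def)
  then show ?thesis
  proof (rule left_moduleI[rotated])
    fix h k v assume hk: "h \<in> carrier H" "k \<in> carrier H" and v: "v \<in> carrier M\<^sub>H"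
    show "(h \<oplus>\<^bsub>H\<^esub> k) \<odot>\<^bsub>M\<^sub>H\<^esub> v = h \<odot>\<^bsub>M\<^sub>H\<^esub> v \<oplus>\<^bsub>M\<^sub>H\<^esub> k \<odot>\<^bsub>M\<^sub>H\<^esub> v"
      using M.lsmult_l_distr[of "\<one>\<^bsub>R\<^esub> \<sharp> h" "\<one>\<^bsub>R\<^esub> \<sharp> k" v] hk v P(5)[OF R.one_closed hk] by simp
    show "(h \<otimes>\<^bsub>H\<^esub> k) \<odot>\<^bsub>M\<^sub>H\<^esub> v = h \<odot>\<^bsub>M\<^sub>H\<^esub> (k \<odot>\<^bsub>M\<^sub>H\<^esub> v)"
      using M.lsmult_assoc[of "\<one>\<^bsub>R\<^esub> \<sharp> h" "\<one>\<^bsub>R\<^esub> \<sharp> k" v] hk v smash_mult_special(1)[OF hk] by simp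
  next
    fix v assume "v \<in> carrier M\<^sub>H" then show "\<one>\<^bsub>H\<^esub> \<odot>\<^bsub>M\<^sub>H\<^esub> v = v" using M.lsmult_one[of v] by simp
  qed (auto simp: M.lsmult_r_distr intro: H.ring_axioms)
qed

lemma scalar_action:
  assumes c: "c \<in> carrier K" and t: "t \<in> carrier T" and v: "v \<in> carrier M"
  shows "(c \<odot>\<^bsub>T\<^esub> t) \<odot>\<^bsub>M\<^esub> v = c \<odot>\<^bsub>sr M\<^sub>H\<^esub> (t \<odot>\<^bsub>M\<^esub> v)"
proof -
  have one: "\<one>\<^bsub>T\<^esub> \<in> carrier (tensor K R H)" by simp
  have eq: "c \<odot>\<^bsub>T\<^esub> \<one>\<^bsub>T\<^esub> = \<one>\<^bsub>R\<^esub> \<sharp> (c \<odot>\<^bsub>H\<^esub> \<one>\<^bsub>H\<^esub>)"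
    using bilinearD(7)[OF RH.pure_bilinear c R.one_closed H.one_closed] by simp
  have "(c \<odot>\<^bsub>T\<^esub> \<one>\<^bsub>T\<^esub>) \<otimes>\<^bsub>T\<^esub> t = c \<odot>\<^bsub>T\<^esub> (\<one>\<^bsub>T\<^esub> \<otimes>\<^bsub>T\<^esub> t)"
    using HomD(3)[OF smash_mult(2)[OF t] c one] by (simp only: T_simps(3))
  then have "c \<odot>\<^bsub>T\<^esub> t = (\<one>\<^bsub>R\<^esub> \<sharp> (c \<odot>\<^bsub>H\<^esub> \<one>\<^bsub>H\<^esub>)) \<otimes>\<^bsub>T\<^esub> t" unfolding eq using M.R.l_one[OF t] by simp
  then show ?thesis using M.lsmult_assoc[of "\<one>\<^bsub>R\<^esub> \<sharp> (c \<odot>\<^bsub>H\<^esub> \<one>\<^bsub>H\<^esub>)" t v] c t v HK.lsmult_closed by simp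
qed

lemma eval_Hom:
  assumes v: "v \<in> carrier M" shows "(\<lambda>t. t \<odot>\<^bsub>M\<^esub> v) \<in> Hom K (tensor K R H) (sr M\<^sub>H)"
proof (rule HomI)
  show "t \<odot>\<^bsub>M\<^esub> v \<in> carrier (sr M\<^sub>H)" if "t \<in> carrier (tensor K R H)" for t
    using M.lsmult_closed[of t v] that v by simp
  show "(s \<oplus>\<^bsub>tensor K R H\<^esub> t) \<odot>\<^bsub>M\<^esub> v = s \<odot>\<^bsub>M\<^esub> v \<oplus>\<^bsub>sr M\<^sub>H\<^esub> t \<odot>\<^bsub>M\<^esub> v"
    if "s \<in> carrier (tensor K R H)" "t \<in> carrier (tensor K R H)" for s t
    using M.lsmult_l_distr[of s t v] that v by simp
  show "(c \<odot>\<^bsub>tensor K R H\<^esub> t) \<odot>\<^bsub>M\<^esub> v = c \<odot>\<^bsub>sr M\<^sub>H\<^esub> (t \<odot>\<^bsub>M\<^esub> v)"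
    if "c \<in> carrier K" "t \<in> carrier (tensor K R H)" for c t
    using scalar_action[of c t v] that v by (simp del: sr_simps)
qed

lemma mul_closed [simp]: "\<lbrakk>r \<in> carrier R; v \<in> carrier M\<rbrakk> \<Longrightarrow> mul r v \<in> carrier M"
  unfolding mul_def using M.lsmult_closed[OF pure_carrier] by simp

lemma pure_smult:
  assumes "r \<in> carrier R" "h \<in> carrier H" "v \<in> carrier M"
  shows "(r \<sharp> h) \<odot>\<^bsub>M\<^esub> v = mul r (h \<odot>\<^bsub>M\<^sub>H\<^esub> v)"
  using M.lsmult_assoc[OF pure_carrier[OF assms(1) H.one_closed] pure_carrier[OF R.one_closed assms(2)] assms(3)]
    smash_mult_special(2)[OF assms(1) R.one_closed assms(2)] assms by (simp add: mul_def)

lemma mul_Hom: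
  assumes r: "r \<in> carrier R" shows "mul r \<in> Hom K (sr M\<^sub>H) (sr M\<^sub>H)"
proof (rule HomI)
  show "mul r v \<in> carrier (sr M\<^sub>H)" if "v \<in> carrier (sr M\<^sub>H)" for v using that r by simp
  show "mul r (v \<oplus>\<^bsub>sr M\<^sub>H\<^esub> w) = mul r v \<oplus>\<^bsub>sr M\<^sub>H\<^esub> mul r w" if "v \<in> carrier (sr M\<^sub>H)" "w \<in> carrier (sr M\<^sub>H)" for v w
    unfolding mul_def using M.lsmult_r_distr[OF pure_carrier[OF r H.one_closed]] that by simp
  fix c v assume c: "c \<in> carrier K" and "v \<in> carrier (sr M\<^sub>H)"
  then have v: "v \<in> carrier M" by simp
  have "mul r (c \<odot>\<^bsub>sr M\<^sub>H\<^esub> v) = (r \<sharp> (c \<odot>\<^bsub>H\<^esub> \<one>\<^bsub>H\<^esub>)) \<odot>\<^bsub>M\<^esub> v"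
    using pure_smult[OF r HK.lsmult_closed[OF c H.one_closed] v] by simp
  also have "\<dots> = (c \<odot>\<^bsub>T\<^esub> (r \<sharp> \<one>\<^bsub>H\<^esub>)) \<odot>\<^bsub>M\<^esub> v" using bilinearD(7)[OF RH.pure_bilinear c r H.one_closed] by simp
  also have "\<dots> = c \<odot>\<^bsub>sr M\<^sub>H\<^esub> mul r v"
    unfolding mul_def by (rule scalar_action[OF c pure_carrier[OF r H.one_closed] v])
  finally show "mul r (c \<odot>\<^bsub>sr M\<^sub>H\<^esub> v) = c \<odot>\<^bsub>sr M\<^sub>H\<^esub> mul r v" .
qed

lemma pure_smult_bilinear:
  assumes v: "v \<in> carrier M" shows "bilinear K R H (sr M\<^sub>H) (\<lambda>r h. (r \<sharp> h) \<odot>\<^bsub>M\<^esub> v)"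
  by (rule bilinear_comp[OF RH.pure_bilinear eval_Hom[OF v]])

text \<open>
  In \<open>T\<close>, \<open>(1 \<sharp> h)(r \<sharp> 1) = \<Sum> h\<^sub>1 r \<sharp> h\<^sub>2\<close>.
\<close>

lemma smult_mul:
  assumes h: "h \<in> carrier H" and r: "r \<in> carrier R" and v: "v \<in> carrier M"
  shows "h \<odot>\<^bsub>M\<^sub>H\<^esub> mul r v = sw (sr M\<^sub>H) (\<lambda>a b. (act a r \<sharp> b) \<odot>\<^bsub>M\<^esub> v) h"
proof -
  have b: "bilinear K H H (tensor K R H) (\<lambda>a b. act a r \<sharp> b)"
    by (rule bilinear_comp_args[OF RH.pure_bilinear bilinearD(2)[OF act_bilinear r] Hom_id])
  have "h \<odot>\<^bsub>M\<^sub>H\<^esub> mul r v = ((\<one>\<^bsub>R\<^esub> \<sharp> h) \<otimes>\<^bsub>T\<^esub> (r \<sharp> \<one>\<^bsub>H\<^esub>)) \<odot>\<^bsub>M\<^esub> v"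
    unfolding mul_def M\<^sub>H_simps by (rule M.lsmult_assoc[symmetric]) (simp_all add: h r v)
  also have "\<dots> = sw (sr M\<^sub>H) (\<lambda>a b. (act a r \<sharp> b) \<odot>\<^bsub>M\<^esub> v) h"
    unfolding smash_mult_special(3)[OF h r]
    by (rule hom_sw[OF RH.T_left_module sr_left_module[OF M\<^sub>H_left_module] b eval_Hom[OF v] h])
  finally show ?thesis .
qed

text \<open>
  \<open>h (s v) = \<Sum> (h\<^sub>1 s) (h\<^sub>2 v) = \<Sum> \<epsilon>(h\<^sub>1) s (h\<^sub>2 v) = s (h v)\<close>.
\<close>

lemma invariant_mul_commute:
  assumes s: "s \<in> invariants H R act" and h: "h \<in> carrier H" and v: "v \<in> carrier M"
  shows "mul s (h \<odot>\<^bsub>M\<^sub>H\<^esub> v) = h \<odot>\<^bsub>M\<^sub>H\<^esub> mul s v"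
proof -
  have sR: "s \<in> carrier R" and inv: "\<And>h. h \<in> carrier H \<Longrightarrow> act h s = \<epsilon> h \<odot>\<^bsub>R\<^esub> s" using s unfolding invariants_def by blast+
  note SM = sr_left_module[OF M\<^sub>H_left_module] and P = pure_smult_bilinear[OF v]
  have b: "bilinear K H H (sr M\<^sub>H) (\<lambda>a b. (act a s \<sharp> b) \<odot>\<^bsub>M\<^esub> v)"
    by (rule bilinear_comp_args[OF P bilinearD(2)[OF act_bilinear sR] Hom_id])
  have "h \<odot>\<^bsub>M\<^sub>H\<^esub> mul s v = sw (sr M\<^sub>H) (\<lambda>a b. (act a s \<sharp> b) \<odot>\<^bsub>M\<^esub> v) h" by (rule smult_mul[OF h sR v])
  also have "\<dots> = sw (sr M\<^sub>H) (\<lambda>a b. \<epsilon> a \<odot>\<^bsub>sr M\<^sub>H\<^esub> ((s \<sharp> b) \<odot>\<^bsub>M\<^esub> v)) h"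
    by (rule sw_cong[OF SM b h]) (simp only: inv bilinearD(6)[OF P] sR counit_closed)
  also have "\<dots> = (s \<sharp> h) \<odot>\<^bsub>M\<^esub> v" by (rule counit_sw(1)[OF SM bilinearD(1)[OF P sR] h])
  finally show ?thesis using pure_smult[OF sR h v] by simp
qed

text \<open>
  \<open>\<Sum> h\<^sub>1 (r (S(h\<^sub>2) v)) = \<Sum> (h\<^sub>1 r) (h\<^sub>2 S(h\<^sub>3) v) = (h r) v\<close>.
\<close>

lemma trace_mul:
  assumes h: "h \<in> carrier H" and r: "r \<in> carrier R" and v: "v \<in> carrier M"
  shows "trace M\<^sub>H M\<^sub>H h (mul r) v = mul (act h r) v"
proof -
  note HM = H_left_module and SM = sr_left_module[OF M\<^sub>H_left_module] and P = pure_smult_bilinear[OF v]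
  define g where "g = (\<lambda>a b d. (act a r \<sharp> (b \<otimes>\<^bsub>H\<^esub> \<S> d)) \<odot>\<^bsub>M\<^esub> v)"
  have aH: "(\<lambda>a. act a r) \<in> Hom K H R" by (rule bilinearD(2)[OF act_bilinear r])
  have g: "trilinear K H H H (sr M\<^sub>H) g" unfolding g_def
  proof (rule trilinearI)
    show "(\<lambda>d. (act a r \<sharp> (b \<otimes>\<^bsub>H\<^esub> \<S> d)) \<odot>\<^bsub>M\<^esub> v) \<in> Hom K H (sr M\<^sub>H)" if "a \<in> carrier H" "b \<in> carrier H" for a b
      by (rule Hom_comp[OF mult_Hom(2)[OF antipode_hom that(2)] bilinearD(1)[OF P act_closed[OF that(1) r]]])
    show "(\<lambda>b. (act a r \<sharp> (b \<otimes>\<^bsub>H\<^esub> \<S> d)) \<odot>\<^bsub>M\<^esub> v) \<in> Hom K H (sr M\<^sub>H)" if "a \<in> carrier H" "d \<in> carrier H" for a d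
      by (rule Hom_comp[OF mult_Hom(1)[OF Hom_id antipode_closed[OF that(2)]] bilinearD(1)[OF P act_closed[OF that(1) r]]])
    show "(\<lambda>a. (act a r \<sharp> (b \<otimes>\<^bsub>H\<^esub> \<S> d)) \<odot>\<^bsub>M\<^esub> v) \<in> Hom K H (sr M\<^sub>H)" if "b \<in> carrier H" "d \<in> carrier H" for b d
      by (rule Hom_comp[OF aH bilinearD(2)[OF P H.m_closed[OF that(1) antipode_closed[OF that(2)]]]])
  qed
  have "sw (sr M\<^sub>H) (\<lambda>a b. sw (sr M\<^sub>H) (\<lambda>a\<^sub>1 a\<^sub>2. g a\<^sub>1 a\<^sub>2 b) a) h = trace M\<^sub>H M\<^sub>H h (mul r) v"
    unfolding trace_def
  proof (rule sw_cong[OF SM sw_left_bilinear[OF SM HM g] h])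
    fix a b assume ab: "a \<in> carrier H" "b \<in> carrier H"
    have w: "\<S> b \<odot>\<^bsub>M\<^sub>H\<^esub> v \<in> carrier M" using ab v M.lsmult_closed[OF pure_carrier] by simp
    have "sw (sr M\<^sub>H) (\<lambda>a\<^sub>1 a\<^sub>2. g a\<^sub>1 a\<^sub>2 b) a = sw (sr M\<^sub>H) (\<lambda>a\<^sub>1 a\<^sub>2. (act a\<^sub>1 r \<sharp> a\<^sub>2) \<odot>\<^bsub>M\<^esub> (\<S> b \<odot>\<^bsub>M\<^sub>H\<^esub> v)) a"
    proof (rule sw_cong[OF SM trilinearD(3)[OF g ab(2)] ab(1)])
      fix c d assume cd: "c \<in> carrier H" "d \<in> carrier H"
      have "g c d b = mul (act c r) ((d \<otimes>\<^bsub>H\<^esub> \<S> b) \<odot>\<^bsub>M\<^sub>H\<^esub> v)"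
        unfolding g_def by (rule pure_smult) (simp_all add: cd ab r v)
      also have "\<dots> = mul (act c r) (d \<odot>\<^bsub>M\<^sub>H\<^esub> (\<S> b \<odot>\<^bsub>M\<^sub>H\<^esub> v))"
        using left_module.lsmult_assoc[OF M\<^sub>H_left_module cd(2) antipode_closed[OF ab(2)], of v] v by (simp del: M\<^sub>H_simps(4))
      also have "\<dots> = (act c r \<sharp> d) \<odot>\<^bsub>M\<^esub> (\<S> b \<odot>\<^bsub>M\<^sub>H\<^esub> v)"
        by (rule pure_smult[symmetric]) (simp_all only: act_closed cd r w)
      finally show "g c d b = (act c r \<sharp> d) \<odot>\<^bsub>M\<^esub> (\<S> b \<odot>\<^bsub>M\<^sub>H\<^esub> v)" .
    qed
    also have "\<dots> = a \<odot>\<^bsub>M\<^sub>H\<^esub> mul r (\<S> b \<odot>\<^bsub>M\<^sub>H\<^esub> v)" by (rule smult_mul[OF ab(1) r w, symmetric])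
    finally show "sw (sr M\<^sub>H) (\<lambda>a\<^sub>1 a\<^sub>2. g a\<^sub>1 a\<^sub>2 b) a = a \<odot>\<^bsub>M\<^sub>H\<^esub> mul r (\<S> b \<odot>\<^bsub>M\<^sub>H\<^esub> v)" .
  qed
  then have "trace M\<^sub>H M\<^sub>H h (mul r) v = sw (sr M\<^sub>H) (\<lambda>a b. sw (sr M\<^sub>H) (g a) b) h"
    using coassoc[OF SM g h] by simp
  also have "\<dots> = sw (sr M\<^sub>H) (\<lambda>a b. \<epsilon> b \<odot>\<^bsub>sr M\<^sub>H\<^esub> mul (act a r) v) h"
  proof (rule sw_cong[OF SM sw_right_bilinear[OF SM HM g] h])
    fix a b assume ab: "a \<in> carrier H" "b \<in> carrier H"
    have b: "bilinear K H H H (\<lambda>b d. b \<otimes>\<^bsub>H\<^esub> \<S> d)"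
      by (rule bilinear_comp_args[OF mult_bilinear Hom_id antipode_hom])
    have ar: "act a r \<in> carrier R" by (rule act_closed[OF ab(1) r])
    have "sw (sr M\<^sub>H) (g a) b = (act a r \<sharp> sw H (\<lambda>b d. b \<otimes>\<^bsub>H\<^esub> \<S> d) b) \<odot>\<^bsub>M\<^esub> v"
      unfolding g_def by (rule hom_sw[OF HM SM b bilinearD(1)[OF P ar] ab(2), symmetric])
    also have "\<dots> = \<epsilon> b \<odot>\<^bsub>sr M\<^sub>H\<^esub> mul (act a r) v"
      unfolding antipode_sw(2)[OF ab(2)] mul_def by (rule bilinearD(7)[OF P counit_closed[OF ab(2)] ar H.one_closed])
    finally show "sw (sr M\<^sub>H) (g a) b = \<epsilon> b \<odot>\<^bsub>sr M\<^sub>H\<^esub> mul (act a r) v" .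
  qed
  also have "\<dots> = mul (act h r) v"
    unfolding mul_def by (rule counit_sw(2)[OF SM Hom_comp[OF aH bilinearD(2)[OF P H.one_closed]] h])
  finally show ?thesis .
qed

end

section \<open>Finiteness over the invariants\<close>

context fd_algebra
begin

text \<open>
  A section is the inverse of \<open>f\<close> on a complement of its kernel.
\<close>

lemma linear_section:
  assumes V: "left_module K V" and W: "left_module K W" and f: "f \<in> Hom K V W" "f ` carrier V = carrier W"
  shows "\<exists>s\<in>Hom K W V. \<forall>w\<in>carrier W. f (s w) = w"
proof -
  interpret V: left_module K V by (rule V)
  interpret f: left_module_hom K V W f by (rule left_module_homI[OF V W f(1)])
  define N where "N = {x \<in> carrier V. f x = \<zero>\<^bsub>W\<^esub>}"
  have N: "Module.submodule N K V" unfolding N_def by (rule f.ker_submodule)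
  have idem: "\<exists>e\<in>L. \<forall>x\<in>L. x \<ominus>\<^bsub>K\<^esub> x \<otimes>\<^bsub>K\<^esub> e \<in> {\<zero>\<^bsub>K\<^esub>}" if L: "Module.submodule L K (regular K)" for L
  proof -
    interpret KK: left_module K "regular K" by (rule regular_left_module[OF K.ring_axioms])
    note LD = KK.submoduleD[OF L]
    show ?thesis
    proof (cases "L \<subseteq> {\<zero>\<^bsub>K\<^esub>}")
      case True
      then show ?thesis using LD(2) by (intro bexI[of _ "\<zero>\<^bsub>K\<^esub>"]) auto
    next
      case False
      then obtain x where x: "x \<in> L" "x \<noteq> \<zero>\<^bsub>K\<^esub>" by blast
      then have xK: "x \<in> carrier K" using LD(7) by simp
      have "inv\<^bsub>K\<^esub> x \<otimes>\<^bsub>K\<^esub> x \<in> L" using LD(4)[of "inv\<^bsub>K\<^esub> x" x] x xK K.field_Units by simp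
      then have "\<one>\<^bsub>K\<^esub> \<in> L" using xK x(2) K.field_Units by simp
      then show ?thesis using LD(7) by (intro bexI[of _ "\<one>\<^bsub>K\<^esub>"]) auto
    qed
  qed
  obtain C where C: "Module.submodule C K V" "{\<zero>\<^bsub>V\<^esub>} \<subseteq> C" "N \<inter> C \<subseteq> {\<zero>\<^bsub>V\<^esub>}" "submodule_plus V N C = carrier V"
    using V.relative_complement[OF N V.zero_submodule, of "{\<zero>\<^bsub>K\<^esub>}"] idem by auto
  obtain p where p: "p \<in> Hom K V (V\<lparr>carrier := C\<rparr>)" "\<And>x. x \<in> carrier V \<Longrightarrow> x \<ominus>\<^bsub>V\<^esub> p x \<in> N"
    using V.direct_projection[OF N C(1,3,4)] by blast
  note CD = V.submoduleD[OF C(1)]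
  have p': "p \<in> Hom K V V" by (rule Hom_cod_extend[OF p(1) CD(1)])
  interpret p: left_module_hom K V V p by (rule left_module_homI[OF V V p'])
  have pC: "p x \<in> C" if "x \<in> carrier V" for x using HomD(1)[OF p(1) that] by simp
  have fp: "f (p x) = f x" if x: "x \<in> carrier V" for x
  proof -
    have "f x \<ominus>\<^bsub>W\<^esub> f (p x) = \<zero>\<^bsub>W\<^esub>" using p(2)[OF x] f.minus[OF x p.closed[OF x]] unfolding N_def by simp
    then show ?thesis using f.closed[OF x] f.closed[OF p.closed[OF x]] by simp
  qed
  have eq: "x = y" if xy: "x \<in> C" "y \<in> C" "f x = f y" for x y
  proof -
    have "x \<ominus>\<^bsub>V\<^esub> y \<in> N \<inter> C" unfolding N_def using xy CD(6,7) by (simp add: f.N.M.r_neg a_minus_def)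
    then have "x \<ominus>\<^bsub>V\<^esub> y = \<zero>\<^bsub>V\<^esub>" using C(3) by blast
    then show ?thesis using xy CD(7) by simp
  qed
  have "\<exists>x. x \<in> C \<and> f x = w" if "w \<in> carrier W" for w
  proof -
    have "w \<in> f ` carrier V" using that f(2) by simp
    then obtain v where "w = f v" "v \<in> carrier V" by (rule imageE)
    then show ?thesis using pC[of v] fp[of v] by auto
  qed
  note ex = this
  define s where "s = (\<lambda>w. SOME x. x \<in> C \<and> f x = w)"
  have s: "s w \<in> C" "f (s w) = w" if "w \<in> carrier W" for w
    using someI_ex[OF ex[OF that]] unfolding s_def by simp_all
  have "s \<in> Hom K W V"
  proof (rule HomI)
    show "s w \<in> carrier V" if "w \<in> carrier W" for w using s(1)[OF that] CD(7) by blast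
    show "s (v \<oplus>\<^bsub>W\<^esub> w) = s v \<oplus>\<^bsub>V\<^esub> s w" if "v \<in> carrier W" "w \<in> carrier W" for v w
      using that s CD(3,7) by (intro eq) simp_all
    show "s (c \<odot>\<^bsub>W\<^esub> w) = c \<odot>\<^bsub>V\<^esub> s w" if "c \<in> carrier K" "w \<in> carrier W" for c w
      using that s CD(4,7) by (intro eq) (simp_all add: f.N.lsmult_closed)
  qed
  then show ?thesis using s(2) by blast
qed

end

context smash
begin

abbreviation "S \<equiv> R\<lparr>carrier := invariants H R act\<rparr>"

lemma invariantsD:
  assumes "s \<in> invariants H R act"
  shows "s \<in> carrier R" "\<And>h. h \<in> carrier H \<Longrightarrow> act h s = \<epsilon> h \<odot>\<^bsub>R\<^esub> s"
  using assms unfolding invariants_def by blast+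

lemma act_zero: "h \<in> carrier H \<Longrightarrow> act h \<zero>\<^bsub>R\<^esub> = \<zero>\<^bsub>R\<^esub>"
  using left_module_hom.zero[OF left_module_homI[OF R_left_module R_left_module bilinearD(1)[OF act_bilinear]]] .

lemma invariants_submodule: "Module.submodule (invariants H R act) K R"
proof (rule RK.submoduleI)
  show "c \<odot>\<^bsub>R\<^esub> r \<in> invariants H R act" if "c \<in> carrier K" "r \<in> invariants H R act" for c r
    using that unfolding invariants_def
    by (simp add: RK.lsmult_closed act_smult_right RK.lsmult_assoc[symmetric] K.m_comm)
qed (auto simp: invariants_def act_zero act_add_right RK.lsmult_r_distr)

lemma integral_image_invariant:
  assumes \<Lambda>: "left_integral H \<Lambda>" and r: "r \<in> carrier R" shows "act \<Lambda> r \<in> invariants H R act"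
proof -
  have "\<Lambda> \<in> carrier H" "\<And>h. h \<in> carrier H \<Longrightarrow> h \<otimes>\<^bsub>H\<^esub> \<Lambda> = \<epsilon> h \<odot>\<^bsub>H\<^esub> \<Lambda>"
    using \<Lambda> unfolding left_integral_def by blast+
  then show ?thesis using r unfolding invariants_def by (simp add: act_mult[symmetric] act_smult_left)
qed

lemma integral_image_submodule:
  assumes \<Lambda>: "left_integral H \<Lambda>" shows "Module.submodule (act \<Lambda> ` carrier R) K S"
proof -
  have \<Lambda>c: "\<Lambda> \<in> carrier H" using \<Lambda> unfolding left_integral_def by blast
  interpret a: left_module_hom K R R "act \<Lambda>"
    by (rule left_module_homI[OF R_left_module R_left_module bilinearD(1)[OF act_bilinear \<Lambda>c]])
  show ?thesis unfolding RK.submodule_of_submodule[OF invariants_submodule]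
    using a.image_submodule[OF RK.carrier_submodule] integral_image_invariant[OF \<Lambda>] by blast
qed

end

context smash_module
begin

lemma mul_add_left: "\<lbrakk>r \<in> carrier R; s \<in> carrier R; v \<in> carrier M\<rbrakk> \<Longrightarrow> mul (r \<oplus>\<^bsub>R\<^esub> s) v = mul r v \<oplus>\<^bsub>M\<^esub> mul s v"
  and mul_smult_left: "\<lbrakk>c \<in> carrier K; r \<in> carrier R; v \<in> carrier M\<rbrakk> \<Longrightarrow> mul (c \<odot>\<^bsub>R\<^esub> r) v = c \<odot>\<^bsub>sr M\<^sub>H\<^esub> mul r v"
  unfolding mul_def using bilinearD(4)[OF pure_smult_bilinear, of v r s "\<one>\<^bsub>H\<^esub>"]
    bilinearD(6)[OF pure_smult_bilinear, of v c r "\<one>\<^bsub>H\<^esub>"] by simp_all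

lemma mul_pure:
  assumes "r \<in> carrier R" "s \<in> carrier R" "h \<in> carrier H" "v \<in> carrier M"
  shows "mul r ((s \<sharp> h) \<odot>\<^bsub>M\<^esub> v) = ((r \<otimes>\<^bsub>R\<^esub> s) \<sharp> h) \<odot>\<^bsub>M\<^esub> v"
  unfolding mul_def smash_mult_special(2)[OF assms(1-3), symmetric]
  by (rule M.lsmult_assoc[symmetric]) (simp_all add: assms)

lemma mul_mult:
  assumes "r \<in> carrier R" "s \<in> carrier R" "v \<in> carrier M"
  shows "mul (r \<otimes>\<^bsub>R\<^esub> s) v = mul r (mul s v)"
  using mul_pure[OF assms(1,2) H.one_closed assms(3)] unfolding mul_def by simp

lemma invariants_act_left_module:
  assumes "ring S" shows "left_module S (with_action M\<^sub>H mul)"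
proof (rule left_moduleI)
  note MH = M\<^sub>H_left_module
  interpret MH: left_module H M\<^sub>H by (rule MH)
  show "abelian_group (with_action M\<^sub>H mul)"
    by (rule abelian_group_record_cong[OF MH.M.abelian_group_axioms]) (simp_all add: with_action_def)
  show "ring S" by fact
  show "\<one>\<^bsub>S\<^esub> \<odot>\<^bsub>with_action M\<^sub>H mul\<^esub> v = v" if "v \<in> carrier (with_action M\<^sub>H mul)" for v
    using M.lsmult_one[of v] that by (simp add: mul_def)
  show "s \<odot>\<^bsub>with_action M\<^sub>H mul\<^esub> (v \<oplus>\<^bsub>with_action M\<^sub>H mul\<^esub> w) =
      s \<odot>\<^bsub>with_action M\<^sub>H mul\<^esub> v \<oplus>\<^bsub>with_action M\<^sub>H mul\<^esub> s \<odot>\<^bsub>with_action M\<^sub>H mul\<^esub> w"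
    if "s \<in> carrier S" "v \<in> carrier (with_action M\<^sub>H mul)" "w \<in> carrier (with_action M\<^sub>H mul)" for s v w
    using that HomD(2)[OF mul_Hom[OF invariantsD(1)], of s v w] by simp
qed (use invariantsD(1) in \<open>simp_all add: mul_add_left mul_mult\<close>)

text \<open>
  Here \<open>tor_finite\<close> and \<open>fin_kernel_cover_exists\<close> are applied to the canonical surjection \<open>\<pi>\<close> from
  the free \<open>H\<close>-module on \<open>carrier M\<close>, with the ring \<open>S\<close> of invariants, the \<open>S\<close>-module \<open>R\<close>, and the
  ideal \<open>\<Lambda>R\<close> in the place of \<open>I\<close>.
\<close>

lemma finite_kernel_cover:
  assumes \<Lambda>: "left_integral H \<Lambda>"
    and noeth: "noetherian_module S (with_action R (monoid.mult R))"
    and quot: "fg_module K (quotient_module S (act \<Lambda> ` carrier R))"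
    and fgM: "fg_module T M"
  shows "\<exists>(X :: ('h, 'm \<Rightarrow> 'h) module) (I :: 'm set) b f \<pi>. dual_basis H X I b f \<and> fin_kernel_cover X \<pi> M\<^sub>H"
proof -
  have \<Lambda>c: "\<Lambda> \<in> carrier H" using \<Lambda> unfolding left_integral_def by blast
  note MH = M\<^sub>H_left_module
  interpret MH: left_module H M\<^sub>H by (rule MH)
  interpret SK: left_module K S by (rule RK.submodule_left_module[OF invariants_submodule])
  have S_ring: "ring S" using noeth unfolding noetherian_module_def left_module_def by blast
  let ?W = "with_action M\<^sub>H mul"
  have W: "left_module S ?W" by (rule invariants_act_left_module[OF S_ring])
  interpret W: left_module S ?W by (rule W)
  let ?X = "free_module H (carrier M)"
  have X: "left_module H ?X" by (rule free_module_left_module[OF H.ring_axioms])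
  note DB = free_module_dual_basis[OF H.ring_axioms, of "carrier M"]
  define \<pi> where "\<pi> = (\<lambda>x. lin_comb H M\<^sub>H (carrier M) x (\<lambda>v. v))"
  have \<pi>: "\<pi> \<in> Hom H ?X M\<^sub>H" unfolding \<pi>_def by (rule lin_comb_hom[OF DB MH]) simp
  have "v \<in> \<pi> ` carrier ?X" if v: "v \<in> carrier M" for v
  proof
    show "v = \<pi> (free_basis H v)" unfolding \<pi>_def free_basis_def using MH.lin_comb_delta[of v "carrier M" "\<lambda>v. v"] v by simp
    show "free_basis H v \<in> carrier ?X" using free_basis_carrier[OF H.ring_axioms v] .
  qed
  then have \<pi>s: "\<pi> ` carrier ?X = carrier M\<^sub>H" using HomD(1)[OF \<pi>] by auto
  obtain A where A: "finite A" "A \<subseteq> carrier M" "\<And>N. Module.submodule N T M \<Longrightarrow> A \<subseteq> N \<Longrightarrow> N = carrier M"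
    using fgM by (rule fg_moduleE) (rule that)
  obtain B where B: "finite B" "B \<subseteq> carrier H" "\<And>N. Module.submodule N K H \<Longrightarrow> B \<subseteq> N \<Longrightarrow> N = carrier H"
    using fg by (rule fg_moduleE) (rule that)
  \<comment> \<open>with \<open>A\<close> generating \<open>M\<close> over \<open>T\<close> and \<open>B\<close> spanning \<open>H\<close>, these maps from \<open>R\<close> to \<open>M\<close> have images
    that together span \<open>T A = M\<close>\<close>
  define \<Psi> where "\<Psi> = (\<lambda>(b, a). \<lambda>r. (r \<sharp> b) \<odot>\<^bsub>M\<^esub> a) ` (B \<times> A)"
  have \<Psi>fin: "finite \<Psi>" unfolding \<Psi>_def using A(1) B(1) by simp
  have \<Psi>Hom: "\<Psi> \<subseteq> Hom S (with_action R (monoid.mult R)) ?W"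
  proof
    fix \<psi> assume "\<psi> \<in> \<Psi>"
    then obtain p where p: "p \<in> B \<times> A" "\<psi> = (\<lambda>(b, a). \<lambda>r. (r \<sharp> b) \<odot>\<^bsub>M\<^esub> a) p"
      unfolding \<Psi>_def by (elim imageE)
    obtain b a where "p = (b, a)" by (rule prod.exhaust)
    then have ba: "b \<in> carrier H" "a \<in> carrier M" and \<psi>: "\<psi> = (\<lambda>r. (r \<sharp> b) \<odot>\<^bsub>M\<^esub> a)"
      using p A(2) B(2) by auto
    note P = bilinearD[OF pure_smult_bilinear[OF ba(2)]]
    show "\<psi> \<in> Hom S (with_action R (monoid.mult R)) ?W" unfolding \<psi>
    proof (rule HomI)
      show "(r \<sharp> b) \<odot>\<^bsub>M\<^esub> a \<in> carrier ?W" if "r \<in> carrier (with_action R (monoid.mult R))" for r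
        using P(3)[of r b] that ba by simp
      show "((r \<oplus>\<^bsub>with_action R (monoid.mult R)\<^esub> s) \<sharp> b) \<odot>\<^bsub>M\<^esub> a = (r \<sharp> b) \<odot>\<^bsub>M\<^esub> a \<oplus>\<^bsub>?W\<^esub> (s \<sharp> b) \<odot>\<^bsub>M\<^esub> a"
        if "r \<in> carrier (with_action R (monoid.mult R))" "s \<in> carrier (with_action R (monoid.mult R))" for r s
        using P(4)[of r s b] that ba by simp
      show "((s \<odot>\<^bsub>with_action R (monoid.mult R)\<^esub> r) \<sharp> b) \<odot>\<^bsub>M\<^esub> a = s \<odot>\<^bsub>?W\<^esub> ((r \<sharp> b) \<odot>\<^bsub>M\<^esub> a)"
        if "s \<in> carrier S" "r \<in> carrier (with_action R (monoid.mult R))" for r s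
        using mul_pure[of s r b a] invariantsD(1)[of s] that ba by simp
    qed
  qed
  have gen: "N = carrier M\<^sub>H" if N: "Module.submodule N S ?W" and gN: "\<And>\<psi>. \<psi> \<in> \<Psi> \<Longrightarrow> \<psi> ` carrier (with_action R (monoid.mult R)) \<subseteq> N" for N
  proof -
    note ND = W.submoduleD[OF N]
    have one: "c \<odot>\<^bsub>R\<^esub> \<one>\<^bsub>R\<^esub> \<in> carrier S" if "c \<in> carrier K" for c
      using that RK.submoduleD(4)[OF invariants_submodule that] act_unit by (simp add: invariants_def)
    have NK: "Module.submodule N K (sr M\<^sub>H)"
    proof (rule left_module.submoduleI[OF sr_left_module[OF MH]])
      fix c v assume c: "c \<in> carrier K" and v: "v \<in> N"
      have vM: "v \<in> carrier M" using ND(7)[OF v] by simp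
      have "mul \<one>\<^bsub>R\<^esub> v = v" using M.lsmult_one[OF vM] by (simp add: mul_def)
      then have "c \<odot>\<^bsub>sr M\<^sub>H\<^esub> v = mul (c \<odot>\<^bsub>R\<^esub> \<one>\<^bsub>R\<^esub>) v" using mul_smult_left[OF c R.one_closed vM] by simp
      then show "c \<odot>\<^bsub>sr M\<^sub>H\<^esub> v \<in> N" using ND(4)[OF one[OF c] v] by simp
    qed (use ND in auto)
    have tN: "t \<odot>\<^bsub>M\<^esub> a \<in> N" if t: "t \<in> carrier T" and a: "a \<in> A" for t a
    proof -
      have aM: "a \<in> carrier M" using a A(2) by blast
      have pN: "(r \<sharp> h) \<odot>\<^bsub>M\<^esub> a \<in> N" if r: "r \<in> carrier R" and h: "h \<in> carrier H" for r h
      proof -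
        interpret e: left_module_hom K H "sr M\<^sub>H" "\<lambda>h. (r \<sharp> h) \<odot>\<^bsub>M\<^esub> a"
          by (rule left_module_homI[OF H_left_module sr_left_module[OF MH] bilinearD(1)[OF pure_smult_bilinear[OF aM] r]])
        have "{h \<in> carrier H. (r \<sharp> h) \<odot>\<^bsub>M\<^esub> a \<in> N} = carrier H"
        proof (rule B(3)[OF e.vimage_submodule[OF NK]])
          have "(r \<sharp> b) \<odot>\<^bsub>M\<^esub> a \<in> N" if b: "b \<in> B" for b
          proof -
            have "(\<lambda>r. (r \<sharp> b) \<odot>\<^bsub>M\<^esub> a) \<in> \<Psi>"
              unfolding \<Psi>_def by (rule image_eqI[of _ _ "(b, a)"]) (simp_all add: a b)
            from gN[OF this] show ?thesis using r by auto
          qed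
          then show "B \<subseteq> {h \<in> carrier H. (r \<sharp> h) \<odot>\<^bsub>M\<^esub> a \<in> N}" using B(2) by blast
        qed
        then show ?thesis using h by blast
      qed
      interpret e: left_module_hom K "tensor K R H" "sr M\<^sub>H" "\<lambda>t. t \<odot>\<^bsub>M\<^esub> a"
        by (rule left_module_homI[OF RH.T_left_module sr_left_module[OF MH] eval_Hom[OF aM]])
      have "{t \<in> carrier (tensor K R H). t \<odot>\<^bsub>M\<^esub> a \<in> N} = carrier (tensor K R H)"
        by (rule RH.T_generated[OF e.vimage_submodule[OF NK]]) (simp add: pN)
      then show ?thesis using t by auto
    qed
    \<comment> \<open>the largest \<open>T\<close>-submodule of \<open>M\<close> contained in \<open>N\<close>\<close>
    define L where "L = {v \<in> carrier M. \<forall>t\<in>carrier T. t \<odot>\<^bsub>M\<^esub> v \<in> N}"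
    have "Module.submodule L T M"
    proof (rule M.submoduleI)
      show "L \<subseteq> carrier M" unfolding L_def by blast
      show "\<zero>\<^bsub>M\<^esub> \<in> L" unfolding L_def using ND(2) M.lsmult_r_null by simp
      show "v \<oplus>\<^bsub>M\<^esub> w \<in> L" if "v \<in> L" "w \<in> L" for v w
        using that ND(3) unfolding L_def by (auto simp: M.lsmult_r_distr simp del: T_simps)
      show "t \<odot>\<^bsub>M\<^esub> v \<in> L" if t: "t \<in> carrier T" and v: "v \<in> L" for t v
      proof -
        have vM: "v \<in> carrier M" and vN: "\<And>t. t \<in> carrier T \<Longrightarrow> t \<odot>\<^bsub>M\<^esub> v \<in> N" using v unfolding L_def by blast+
        have "t' \<odot>\<^bsub>M\<^esub> (t \<odot>\<^bsub>M\<^esub> v) \<in> N" if t': "t' \<in> carrier T" for t'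
          using vN[OF M.R.m_closed[OF t' t]] M.lsmult_assoc[OF t' t vM] by simp
        then show ?thesis unfolding L_def using M.lsmult_closed[OF t vM] by blast
      qed
    qed
    moreover have "A \<subseteq> L" unfolding L_def using A(2) tN by blast
    ultimately have L: "L = carrier M" by (rule A(3))
    have "v \<in> N" if v: "v \<in> carrier M" for v
    proof -
      have "v \<in> L" using v L by simp
      then have "\<one>\<^bsub>T\<^esub> \<odot>\<^bsub>M\<^esub> v \<in> N" using M.R.one_closed unfolding L_def by blast
      then show ?thesis using M.lsmult_one[OF v] by simp
    qed
    then show ?thesis using ND(1) by auto
  qed
  let ?I = "act \<Lambda> ` carrier R"
  note IS = integral_image_submodule[OF \<Lambda>]
  obtain Q where Q: "finite Q" "Q \<subseteq> carrier (quotient_module S ?I)"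
    "\<And>N. Module.submodule N K (quotient_module S ?I) \<Longrightarrow> Q \<subseteq> N \<Longrightarrow> N = carrier (quotient_module S ?I)"
    using quot by (rule fg_moduleE) (rule that)
  have "\<forall>q\<in>Q. \<exists>e. e \<in> carrier S \<and> q = ?I +>\<^bsub>S\<^esub> e"
  proof
    fix q assume "q \<in> Q"
    then have "q \<in> carrier (quotient_module S ?I)" using Q(2) by (rule rev_subsetD)
    then show "\<exists>e. e \<in> carrier S \<and> q = ?I +>\<^bsub>S\<^esub> e" unfolding SK.quotient_module_carrier Bex_def .
  qed
  then obtain e where "\<forall>q\<in>Q. e q \<in> carrier S \<and> q = ?I +>\<^bsub>S\<^esub> e q" unfolding bchoice_iff ..
  then have e: "\<And>q. q \<in> Q \<Longrightarrow> e q \<in> carrier S" "\<And>q. q \<in> Q \<Longrightarrow> q = ?I +>\<^bsub>S\<^esub> e q" by simp_all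
  have EI: "N = carrier S" if N: "Module.submodule N K S" "e ` Q \<subseteq> N" "?I \<subseteq> N" for N
  proof -
    interpret q: left_module_hom K S "quotient_module S ?I" "\<lambda>x. ?I +>\<^bsub>S\<^esub> x"
      by (rule left_module_homI[OF SK.left_module_axioms SK.quotient_left_module[OF IS] SK.quotient_hom[OF IS]])
    note ND = SK.submoduleD[OF N(1)]
    have "(\<lambda>x. ?I +>\<^bsub>S\<^esub> x) ` N = carrier (quotient_module S ?I)"
    proof (rule Q(3)[OF q.image_submodule[OF N(1)]])
      show "Q \<subseteq> (\<lambda>x. ?I +>\<^bsub>S\<^esub> x) ` N" using e(2) N(2) by blast
    qed
    then have im: "\<exists>n\<in>N. ?I +>\<^bsub>S\<^esub> s = ?I +>\<^bsub>S\<^esub> n" if "s \<in> carrier S" for s using q.closed[OF that] by blast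
    have "s \<in> N" if s: "s \<in> carrier S" for s
    proof -
      obtain n where n: "n \<in> N" "?I +>\<^bsub>S\<^esub> s = ?I +>\<^bsub>S\<^esub> n" using im[OF s] by blast
      have nS: "n \<in> carrier S" by (rule ND(7)[OF n(1)])
      have "s \<ominus>\<^bsub>S\<^esub> n \<in> N" using n(2) SK.coset_eq_iff[OF IS s nS] N(3) by blast
      from ND(3)[OF this n(1)] show ?thesis using SK.M.minus_eq SK.M.a_assoc SK.M.l_neg SK.M.r_zero SK.M.a_inv_closed s nS by metis
    qed
    then show ?thesis using ND(1) by blast
  qed
  \<comment> \<open>the lift of multiplication by \<open>\<Lambda>r\<close> is the trace of \<open>v \<mapsto> \<psi>(r v)\<close>\<close>
  obtain \<psi> where \<psi>: "\<psi> \<in> Hom K (sr M\<^sub>H) (sr ?X)" "\<And>v. v \<in> carrier M \<Longrightarrow> \<pi> (\<psi> v) = v"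
    using linear_section[OF sr_left_module[OF X] sr_left_module[OF MH] sr_Hom[OF \<pi>]] \<pi>s by auto
  have lift: "\<exists>\<sigma>\<in>Hom H M\<^sub>H ?X. \<forall>v\<in>carrier M\<^sub>H. \<pi> (\<sigma> v) = mul i v" if i: "i \<in> ?I" for i
  proof -
    obtain r where r: "r \<in> carrier R" "i = act \<Lambda> r" using i by blast
    have f: "(\<lambda>v. \<psi> (mul r v)) \<in> Hom K (sr M\<^sub>H) (sr ?X)" by (rule Hom_comp[OF mul_Hom[OF r(1)] \<psi>(1)])
    have "\<pi> (trace M\<^sub>H ?X \<Lambda> (\<lambda>v. \<psi> (mul r v)) v) = mul i v" if v: "v \<in> carrier M\<^sub>H" for v
    proof -
      have vM: "v \<in> carrier M" using v by simp
      have Sv: "(\<lambda>b. \<S> b \<odot>\<^bsub>M\<^sub>H\<^esub> v) \<in> Hom K H (sr M\<^sub>H)" by (rule smult_Hom_left[OF MH antipode_hom v])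
      have b: "bilinear K H H (sr ?X) (\<lambda>a b. a \<odot>\<^bsub>?X\<^esub> \<psi> (mul r (\<S> b \<odot>\<^bsub>M\<^sub>H\<^esub> v)))"
        by (rule bilinear_comp_args[OF smult_bilinear[OF X] Hom_id Hom_comp[OF Sv f]])
      have "\<pi> (trace M\<^sub>H ?X \<Lambda> (\<lambda>v. \<psi> (mul r v)) v) =
        sw (sr M\<^sub>H) (\<lambda>a b. \<pi> (a \<odot>\<^bsub>?X\<^esub> \<psi> (mul r (\<S> b \<odot>\<^bsub>M\<^sub>H\<^esub> v)))) \<Lambda>"
        unfolding trace_def by (rule hom_sw[OF sr_left_module[OF X] sr_left_module[OF MH] b sr_Hom[OF \<pi>] \<Lambda>c])
      also have "\<dots> = trace M\<^sub>H M\<^sub>H \<Lambda> (mul r) v"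
        unfolding trace_def
      proof (rule sw_cong[OF sr_left_module[OF MH] bilinear_comp[OF b sr_Hom[OF \<pi>]] \<Lambda>c])
        fix a b assume ab: "a \<in> carrier H" "b \<in> carrier H"
        have w: "mul r (\<S> b \<odot>\<^bsub>M\<^sub>H\<^esub> v) \<in> carrier M"
          using mul_closed[OF r(1)] MH.lsmult_closed[OF antipode_closed[OF ab(2)] v] by simp
        have "\<pi> (a \<odot>\<^bsub>?X\<^esub> \<psi> (mul r (\<S> b \<odot>\<^bsub>M\<^sub>H\<^esub> v))) = a \<odot>\<^bsub>M\<^sub>H\<^esub> \<pi> (\<psi> (mul r (\<S> b \<odot>\<^bsub>M\<^sub>H\<^esub> v)))"
          by (rule HomD(3)[OF \<pi> ab(1)]) (use HomD(1)[OF \<psi>(1)] w in simp)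
        then show "\<pi> (a \<odot>\<^bsub>?X\<^esub> \<psi> (mul r (\<S> b \<odot>\<^bsub>M\<^sub>H\<^esub> v))) = a \<odot>\<^bsub>M\<^sub>H\<^esub> mul r (\<S> b \<odot>\<^bsub>M\<^sub>H\<^esub> v)"
          unfolding \<psi>(2)[OF w] .
      qed
      also have "\<dots> = mul i v" unfolding r(2) by (rule trace_mul[OF \<Lambda>c r(1) vM])
      finally show ?thesis .
    qed
    then show ?thesis using trace_hom[OF MH X f \<Lambda>] by blast
  qed
  have comm: "mul s (h \<odot>\<^bsub>M\<^sub>H\<^esub> v) = h \<odot>\<^bsub>M\<^sub>H\<^esub> mul s v" if "s \<in> carrier S" "h \<in> carrier H" "v \<in> carrier M\<^sub>H" for s h v
    using invariant_mul_commute[of s h v] that by simp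
  have scal: "mul (c \<odot>\<^bsub>S\<^esub> s) v = c \<odot>\<^bsub>sr M\<^sub>H\<^esub> mul s v" if "c \<in> carrier K" "s \<in> carrier S" "v \<in> carrier M\<^sub>H" for c s v
    using mul_smult_left[of c s v] invariantsD(1)[of s] that by simp
  have E: "finite (e ` Q)" "e ` Q \<subseteq> carrier S" using Q(1) e(1) by auto
  have I: "?I \<subseteq> carrier S" using integral_image_invariant[OF \<Lambda>] by auto
  obtain U where U: "finite U" "U \<subseteq> {x \<in> carrier ?X. \<pi> x = \<zero>\<^bsub>M\<^sub>H\<^esub>}"
    "{x \<in> carrier ?X. \<pi> x = \<zero>\<^bsub>M\<^sub>H\<^esub>} \<inter> rmul ?X (carrier ?X) \<subseteq>
      submodule_plus ?X (submodule_hull H ?X U) (rmul ?X {x \<in> carrier ?X. \<pi> x = \<zero>\<^bsub>M\<^sub>H\<^esub>})"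
    using tor_finite[OF X MH \<pi> \<pi>s W comm scal SK.left_module_axioms noeth \<Psi>fin \<Psi>Hom gen E I EI lift] by blast
  show ?thesis using fin_kernel_cover_exists[OF DB MH \<pi> \<pi>s U] by blast
qed

end

section \<open>The Grothendieck group\<close>

lemma (in left_module) cong_left_module:
  assumes "carrier N = carrier M" "\<zero>\<^bsub>N\<^esub> = \<zero>\<^bsub>M\<^esub>" "ring.add N = ring.add M"
    and smult: "\<And>a x. \<lbrakk>a \<in> carrier R; x \<in> carrier M\<rbrakk> \<Longrightarrow> a \<odot>\<^bsub>N\<^esub> x = a \<odot>\<^bsub>M\<^esub> x"
  shows "left_module R N"
  by (rule left_moduleI[OF R.ring_axioms abelian_group_record_cong[OF M.abelian_group_axioms assms(1-3)]])
    (simp_all add: assms lsmult_closed lsmult_l_distr lsmult_r_distr lsmult_assoc lsmult_one)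

text \<open>
  The function \<open>n\<close> extends to a homomorphism \<open>\<phi>\<close> on the free abelian group, which maps the
  relations of \<open>G\<^sub>0\<close> to multiples of \<open>\<delta>\<close>.  The class of \<open>N\<close> has order \<open>0\<close> if no positive multiple
  of it vanishes, and the statement is then trivial.
\<close>

lemma additive_dvd_ord:
  fixes n :: "('a, (nat \<Rightarrow> 'a) set) module \<Rightarrow> int"
  assumes add: "\<And>M' M M''. \<lbrakk>M' \<in> fg_modules R; M \<in> fg_modules R; M'' \<in> fg_modules R; short_exact R M' M M''\<rbrakk>
      \<Longrightarrow> \<delta> dvd n M - (n M' + n M'')"
    and N: "N \<in> fg_modules R"
  shows "\<delta> dvd int (group.ord (G0 R) (G0_relations R #>\<^bsub>free_Abelian_group (fg_modules R)\<^esub> frag_of N)) * n N"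
proof -
  let ?F = "free_Abelian_group (fg_modules R)" and ?Rel = "G0_relations R"
  let ?gen = "{frag_of M - (frag_of M' + frag_of M'') | M' M M''.
          M' \<in> fg_modules R \<and> M \<in> fg_modules R \<and> M'' \<in> fg_modules R \<and> short_exact R M' M M''}"
  interpret F: comm_group ?F by (rule abelian_free_Abelian_group)
  have gen_sub: "?gen \<subseteq> carrier ?F"
  proof
    fix x assume "x \<in> ?gen"
    then obtain M' M M'' where x: "x = frag_of M - (frag_of M' + frag_of M'')"
      and M: "M' \<in> fg_modules R" "M \<in> fg_modules R" "M'' \<in> fg_modules R" by blast
    have "frag_of M' \<otimes>\<^bsub>?F\<^esub> frag_of M'' \<in> carrier ?F"
      using M by (intro F.m_closed) (simp_all del: carrier_free_Abelian_group_iff)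
    then have "frag_of M \<otimes>\<^bsub>?F\<^esub> inv\<^bsub>?F\<^esub> (frag_of M' + frag_of M'') \<in> carrier ?F"
      using M by (intro F.m_closed F.inv_closed) (simp_all del: carrier_free_Abelian_group_iff inv_free_Abelian_group)
    moreover have "inv\<^bsub>?F\<^esub> (frag_of M' + frag_of M'') = - (frag_of M' + frag_of M'')"
      using \<open>frag_of M' \<otimes>\<^bsub>?F\<^esub> frag_of M'' \<in> carrier ?F\<close> by (intro inv_free_Abelian_group) simp
    ultimately show "x \<in> carrier ?F" unfolding x diff_conv_add_uminus by (simp only: mult_free_Abelian_group)
  qed
  have Rel: "subgroup ?Rel ?F" unfolding G0_relations_def by (rule F.generate_is_subgroup[OF gen_sub])
  interpret Rel: normal ?Rel ?F by (rule F.normal_iff_subgroup[THEN iffD2, OF Rel])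
  interpret G: group "G0 R" unfolding G0_def by (rule Rel.factorgroup_is_group)
  \<comment> \<open>\<open>frag_extend\<close> takes its values in free abelian groups, hence the detour through the one on \<open>unit\<close>\<close>
  define \<phi> where "\<phi> = (\<lambda>x. poly_mapping.lookup (frag_extend (\<lambda>M. frag_cmul (n M) (frag_of ())) x) ())"
  have \<phi>_of: "\<phi> (frag_of M) = n M" for M unfolding \<phi>_def by simp
  have \<phi>_add: "\<phi> (x + y) = \<phi> x + \<phi> y" for x y unfolding \<phi>_def by (simp add: frag_extend_add lookup_add)
  have \<phi>_diff: "\<phi> (x - y) = \<phi> x - \<phi> y" for x y unfolding \<phi>_def by (simp add: frag_extend_diff lookup_minus)
  have \<phi>_neg: "\<phi> (- x) = - \<phi> x" for x unfolding \<phi>_def by (simp add: frag_extend_minus)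
  have \<phi>_cmul: "\<phi> (frag_cmul k x) = k * \<phi> x" for k x unfolding \<phi>_def by (simp add: frag_extend_cmul)
  have \<phi>_gen: "\<delta> dvd \<phi> x" if "x \<in> ?gen" for x using that add by (auto simp: \<phi>_diff \<phi>_add \<phi>_of)
  have \<phi>_Rel: "\<delta> dvd \<phi> x" if "x \<in> ?Rel" for x
    using that unfolding G0_relations_def
  proof (induction rule: generate.induct)
    case one
    show ?case unfolding one_free_Abelian_group \<phi>_def by simp
  next
    case (incl h)
    then show ?case by (rule \<phi>_gen)
  next
    case (inv h)
    then have "inv\<^bsub>?F\<^esub> h = - h" using subsetD[OF gen_sub inv] by (intro inv_free_Abelian_group) (simp only: carrier_free_Abelian_group_iff)
    then show ?case using \<phi>_gen[OF inv] by (simp add: \<phi>_neg)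
  next
    case (eng h1 h2)
    then show ?case by (simp add: \<phi>_add)
  qed
  have Nc: "frag_of N \<in> carrier ?F" using N by simp
  let ?c = "?Rel #>\<^bsub>?F\<^esub> frag_of N"
  let ?k = "group.ord (G0 R) ?c"
  have hom: "(\<lambda>a. ?Rel #>\<^bsub>?F\<^esub> a) \<in> hom ?F (G0 R)" unfolding G0_def by (rule Rel.r_coset_hom_Mod)
  interpret h: group_hom ?F "G0 R" "\<lambda>a. ?Rel #>\<^bsub>?F\<^esub> a" by unfold_locales (rule hom)
  have c: "?c \<in> carrier (G0 R)" by (rule h.hom_closed[OF Nc])
  have "?Rel #>\<^bsub>?F\<^esub> (frag_of N [^]\<^bsub>?F\<^esub> ?k) = ?c [^]\<^bsub>G0 R\<^esub> ?k" by (rule h.hom_nat_pow[OF Nc])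
  also have "\<dots> = \<one>\<^bsub>G0 R\<^esub>" by (rule G.pow_ord_eq_1[OF c])
  also have "\<dots> = ?Rel" unfolding G0_def FactGroup_def by simp
  finally have "frag_of N [^]\<^bsub>?F\<^esub> ?k \<in> ?Rel" by (rule F.coset_join1[OF _ F.nat_pow_closed[OF Nc] Rel])
  then show ?thesis using \<phi>_Rel[of "frag_of N [^]\<^bsub>?F\<^esub> ?k"] unfolding pow_free_Abelian_group \<phi>_cmul \<phi>_of by simp
qed

context fd_algebra
begin

text \<open>
  The number \<open>n(V)\<close>.  The type of \<open>X\<close> has to be fixed in the definition; by \<open>ker_dim_unique\<close> it
  does not matter modulo \<open>\<delta>\<close>.
\<close>

definition syzygy_dim :: "('h, 'v, 'f) module_scheme \<Rightarrow> nat" where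
  "syzygy_dim V = (SOME n. \<exists>(X :: ('h, 'v \<Rightarrow> 'h) module) (I :: 'v set) b f \<pi>.
     dual_basis H X I b f \<and> fin_kernel_cover X \<pi> V \<and> n = ker_dim X \<pi> V)"

lemma syzygy_dim:
  fixes V :: "('h, 'v, 'f) module_scheme"
  assumes "\<exists>(X :: ('h, 'v \<Rightarrow> 'h) module) (I :: 'v set) b f \<pi>. dual_basis H X I b f \<and> fin_kernel_cover X \<pi> V"
  obtains X :: "('h, 'v \<Rightarrow> 'h) module" and I :: "'v set" and b f \<pi>
  where "dual_basis H X I b f" "fin_kernel_cover X \<pi> V" "syzygy_dim V = ker_dim X \<pi> V"
proof -
  let ?P = "\<lambda>n. \<exists>(X :: ('h, 'v \<Rightarrow> 'h) module) (I :: 'v set) b f \<pi>.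
     dual_basis H X I b f \<and> fin_kernel_cover X \<pi> V \<and> n = ker_dim X \<pi> V"
  have "\<exists>n. ?P n" using assms by blast
  then have "?P (syzygy_dim V)" unfolding syzygy_dim_def by (rule someI_ex)
  then show ?thesis using that by blast
qed

lemma dvd_diff_if_mod_eq: "(a::nat) mod m = b mod m \<Longrightarrow> int m dvd int a - int b"
  by (metis mod_eq_dvd_iff zmod_int)

lemma syzygy_dim_extension:
  fixes V :: "('h, 'v, 'f) module_scheme" and W :: "('h, 'w, 'f') module_scheme" and V'' :: "('h, 'u, 'f'') module_scheme"
  assumes V: "\<exists>(X :: ('h, 'v \<Rightarrow> 'h) module) (I :: 'v set) b f \<pi>. dual_basis H X I b f \<and> fin_kernel_cover X \<pi> V"
    and W: "\<exists>(X :: ('h, 'w \<Rightarrow> 'h) module) (I :: 'w set) b f \<pi>. dual_basis H X I b f \<and> fin_kernel_cover X \<pi> W"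
    and V'': "\<exists>(X :: ('h, 'u \<Rightarrow> 'h) module) (I :: 'u set) b f \<pi>. dual_basis H X I b f \<and> fin_kernel_cover X \<pi> V''"
    and i: "i \<in> Hom H V W" "inj_on i (carrier V)" and g: "g \<in> Hom H W V''" "g ` carrier W = carrier V''"
    and exact: "i ` carrier V = {x \<in> carrier W. g x = \<zero>\<^bsub>V''\<^esub>}"
  shows "int (proj_dim_gcd K H) dvd int (syzygy_dim W) - (int (syzygy_dim V) + int (syzygy_dim V''))"
proof -
  obtain X :: "('h, 'v \<Rightarrow> 'h) module" and I :: "'v set" and b f \<pi> where X: "dual_basis H X I b f" "fin_kernel_cover X \<pi> V" "syzygy_dim V = ker_dim X \<pi> V"
    using V by (rule syzygy_dim) (rule that)
  obtain X'' :: "('h, 'u \<Rightarrow> 'h) module" and I'' :: "'u set" and b'' f'' \<pi>'' where X'': "dual_basis H X'' I'' b'' f''" "fin_kernel_cover X'' \<pi>'' V''" "syzygy_dim V'' = ker_dim X'' \<pi>'' V''"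
    using V'' by (rule syzygy_dim) (rule that)
  obtain Y :: "('h, 'w \<Rightarrow> 'h) module" and J :: "'w set" and c h \<rho> where Y: "dual_basis H Y J c h" "fin_kernel_cover Y \<rho> W" "syzygy_dim W = ker_dim Y \<rho> W"
    using W by (rule syzygy_dim) (rule that)
  have WM: "left_module H W" using Y(2) unfolding fin_kernel_cover_def by blast
  obtain \<rho>' where \<rho>': "fin_kernel_cover (direct_sum X X'') \<rho>' W"
    "ker_dim (direct_sum X X'') \<rho>' W = ker_dim X \<pi> V + ker_dim X'' \<pi>'' V''"
    using ker_dim_extension[OF X(1) X''(1) X(2) X''(2) WM i g exact] by blast
  show ?thesis
    using dvd_diff_if_mod_eq[OF ker_dim_unique[OF Y(1) direct_sum_dual_basis[OF X(1) X''(1)] Y(2) \<rho>'(1)]]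
    unfolding Y(3) X(3) X''(3) \<rho>'(2) by simp
qed

lemma syzygy_dim_finite:
  fixes V :: "('h, 'v, 'f) module_scheme"
  assumes V: "\<exists>(X :: ('h, 'v \<Rightarrow> 'h) module) (I :: 'v set) b f \<pi>. dual_basis H X I b f \<and> fin_kernel_cover X \<pi> V"
    and fd: "left_module H V" "fg_module H V"
  shows "int (proj_dim_gcd K H) dvd int (syzygy_dim V) + int (sdim V)"
proof -
  obtain X :: "('h, 'v \<Rightarrow> 'h) module" and I :: "'v set" and b f \<pi> where X: "dual_basis H X I b f" "fin_kernel_cover X \<pi> V" "syzygy_dim V = ker_dim X \<pi> V"
    using V by (rule syzygy_dim) (rule that)
  obtain Y :: "('h, nat \<Rightarrow> 'h) module" and J :: "nat set" and c h \<rho> where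
    Y: "dual_basis H Y J c h" "fin_kernel_cover Y \<rho> V" "proj_dim_gcd K H dvd ker_dim Y \<rho> V + sdim V"
    using ker_dim_finite[OF fd] by blast
  have 1: "int (proj_dim_gcd K H) dvd int (ker_dim X \<pi> V) - int (ker_dim Y \<rho> V)"
    by (rule dvd_diff_if_mod_eq[OF ker_dim_unique[OF X(1) Y(1) X(2) Y(2)]])
  have 2: "int (proj_dim_gcd K H) dvd int (ker_dim Y \<rho> V + sdim V)" using Y(3) by (simp only: int_dvd_int_iff)
  show ?thesis using dvd_add[OF 1 2] unfolding X(3) by simp
qed

end

context smash_module
begin

lemma scalar_restriction_smult:
  "\<lbrakk>c \<in> carrier K; v \<in> carrier M\<rbrakk> \<Longrightarrow> c \<odot>\<^bsub>scalar_restriction T M\<^esub> v = c \<odot>\<^bsub>sr M\<^sub>H\<^esub> v"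
  using scalar_action[of c "\<one>\<^bsub>T\<^esub>" v] M.lsmult_one[of v] M.R.one_closed by (simp add: scalar_restriction_def)

lemma scalar_restriction_simps: "carrier (scalar_restriction T M) = carrier M" "\<zero>\<^bsub>scalar_restriction T M\<^esub> = \<zero>\<^bsub>M\<^esub>"
    "ring.add (scalar_restriction T M) = ring.add M"
  by (simp_all add: scalar_restriction_def with_action_def)

lemma scalar_restriction_left_module: "left_module K (scalar_restriction T M)"
proof (rule left_module.cong_left_module[OF sr_left_module[OF M\<^sub>H_left_module]])
  show "c \<odot>\<^bsub>scalar_restriction T M\<^esub> v = c \<odot>\<^bsub>sr M\<^sub>H\<^esub> v" if "c \<in> carrier K" "v \<in> carrier (sr M\<^sub>H)" for c v
    using that scalar_restriction_smult[of c v] by (simp del: sr_simps(4))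
qed (simp_all add: scalar_restriction_def hopf_restriction_def with_action_def)

lemma scalar_restriction_Hom: "(\<lambda>v. v) \<in> Hom K (scalar_restriction T M) (sr M\<^sub>H)"
  by (rule HomI) (simp_all add: scalar_restriction_simps scalar_restriction_smult del: sr_simps(4))

text \<open>
  The vector space underlying \<open>M\<close> as a \<open>T\<close>-module and the one underlying \<open>M\<^sub>H\<close> have the same
  scalar multiplication on the scalars in \<open>carrier K\<close>, but are not equal as records.
\<close>

lemma fg_if_finite_dimensional:
  assumes fd: "fg_module K (scalar_restriction T M)"
  shows "fg_module K (sr M\<^sub>H)" "fg_module T M" "vectorspace.dim K (scalar_restriction T M) = sdim M\<^sub>H"
proof -
  note SM = sr_left_module[OF M\<^sub>H_left_module]
  note V = scalar_restriction_left_module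
  show fg': "fg_module K (sr M\<^sub>H)"
    by (rule fg_module_image[OF V SM scalar_restriction_Hom _ fd]) (simp add: scalar_restriction_simps)
  show "vectorspace.dim K (scalar_restriction T M) = sdim M\<^sub>H"
    by (rule dim_bij[OF field V SM fd scalar_restriction_Hom]) (simp add: scalar_restriction_simps bij_betw_def)
  obtain A where A: "finite A" "A \<subseteq> carrier (sr M\<^sub>H)" "\<And>N. \<lbrakk>Module.submodule N K (sr M\<^sub>H); A \<subseteq> N\<rbrakk> \<Longrightarrow> N = carrier (sr M\<^sub>H)"
    using fg' by (rule fg_moduleE) (rule that)
  have "N = carrier M" if N: "Module.submodule N T M" "A \<subseteq> N" for N
  proof -
    note ND = M.submoduleD[OF N(1)]
    have "Module.submodule N K (sr M\<^sub>H)"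
    proof (rule left_module.submoduleI[OF SM])
      show "c \<odot>\<^bsub>sr M\<^sub>H\<^esub> v \<in> N" if "c \<in> carrier K" "v \<in> N" for c v
        using ND(4)[OF pure_carrier[OF R.one_closed HK.lsmult_closed[OF that(1) H.one_closed]] that(2)] by simp
    qed (use ND in auto)
    then show ?thesis using A(3) N(2) by simp
  qed
  then show "fg_module T M" unfolding fg_module_def using M A(1,2) by auto
qed

end

context smash
begin

lemma smash_moduleI: "left_module T M \<Longrightarrow> smash_module K H R act M"
  by (intro smash_module.intro smash_module_axioms.intro smash_axioms)

lemma hopf_restriction_Hom: "f \<in> Hom T M N \<Longrightarrow> f \<in> Hom H (hopf_restriction M) (hopf_restriction N)"
  using HomD[of f T M N] by (intro HomI) (simp_all add: hopf_restriction_def)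

lemma counit_nonzero: "\<one>\<^bsub>H\<^esub> \<noteq> \<zero>\<^bsub>H\<^esub>"
proof
  assume "\<one>\<^bsub>H\<^esub> = \<zero>\<^bsub>H\<^esub>"
  then have "\<one>\<^bsub>H\<^esub> = \<zero>\<^bsub>K\<^esub> \<odot>\<^bsub>H\<^esub> \<one>\<^bsub>H\<^esub>" by simp
  then have "\<epsilon> \<one>\<^bsub>H\<^esub> = \<zero>\<^bsub>K\<^esub> \<otimes>\<^bsub>K\<^esub> \<epsilon> \<one>\<^bsub>H\<^esub>" using counit_smult[of "\<zero>\<^bsub>K\<^esub>" "\<one>\<^bsub>H\<^esub>"] by simp
  then show False unfolding counit_one by simp
qed

text \<open>
  With \<open>k\<close> the order of the class, additivity of \<open>syzygy_dim\<close> yields \<open>\<delta> | k n(M)\<close>, and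
  \<open>\<delta> | n(M) + dim M\<close> turns this into \<open>\<delta> | k dim M\<close>.
\<close>

lemma order_divisible:
  assumes \<Lambda>: "left_integral H \<Lambda>"
    and noeth: "noetherian_module S (with_action R (monoid.mult R))"
    and quot: "fg_module K (quotient_module S (act \<Lambda> ` carrier R))"
    and M: "left_module T M" and fd: "fg_module K (scalar_restriction T M)"
  shows "(proj_dim_gcd K H div gcd (proj_dim_gcd K H) (vectorspace.dim K (scalar_restriction T M))) dvd
    group.ord (G0 T) (G0_class T M)"
proof -
  let ?\<delta> = "proj_dim_gcd K H" and ?d = "vectorspace.dim K (scalar_restriction T M)"
  interpret M: smash_module K H R act M by (rule smash_moduleI[OF M])
  have fgM: "fg_module T M" by (rule M.fg_if_finite_dimensional(2)[OF fd])
  define N where "N = (SOME N. N \<in> fg_modules T \<and> module_iso T M N)"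
  have N: "N \<in> fg_modules T" "module_iso T M N"
    using someI_ex[of "\<lambda>N. N \<in> fg_modules T \<and> module_iso T M N"] fg_module_representative[OF fgM] unfolding N_def by blast+
  have fgD: "fg_module T L" "left_module T L" if "L \<in> fg_modules T" for L
    using that unfolding fg_modules_def fg_module_def by blast+
  interpret N: smash_module K H R act N by (rule smash_moduleI[OF fgD(2)[OF N(1)]])
  have cover: "\<exists>(X :: ('h, (nat \<Rightarrow> ('r \<times> 'h \<Rightarrow> 'k) set) set \<Rightarrow> 'h) module)
      (I :: (nat \<Rightarrow> ('r \<times> 'h \<Rightarrow> 'k) set) set set) b f \<pi>.
      dual_basis H X I b f \<and> fin_kernel_cover X \<pi> (hopf_restriction L)" if "L \<in> fg_modules T" for L
  proof -
    interpret L: smash_module K H R act L by (rule smash_moduleI[OF fgD(2)[OF that]])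
    show ?thesis by (rule L.finite_kernel_cover[OF \<Lambda> noeth quot fgD(1)[OF that]])
  qed
  let ?n = "\<lambda>L. int (syzygy_dim (hopf_restriction L))"
  have "int ?\<delta> dvd ?n L - (?n L' + ?n L'')"
    if L: "L' \<in> fg_modules T" "L \<in> fg_modules T" "L'' \<in> fg_modules T" and ex: "short_exact T L' L L''" for L' L L''
  proof -
    obtain i g where ig: "i \<in> Hom T L' L" "g \<in> Hom T L L''" "inj_on i (carrier L')" "i ` carrier L' = a_kernel L L'' g" "g ` carrier L = carrier L''"
      using ex unfolding short_exact_def by (elim bexE conjE) (rule that)
    have c: "carrier (hopf_restriction P) = carrier P" "\<zero>\<^bsub>hopf_restriction P\<^esub> = \<zero>\<^bsub>P\<^esub>"
      for P :: "(('r \<times> 'h \<Rightarrow> 'k) set, (nat \<Rightarrow> ('r \<times> 'h \<Rightarrow> 'k) set) set) module"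
      by (simp_all add: hopf_restriction_def)
    show ?thesis
      by (rule syzygy_dim_extension[OF cover[OF L(1)] cover[OF L(2)] cover[OF L(3)] hopf_restriction_Hom[OF ig(1)] _ hopf_restriction_Hom[OF ig(2)]])
        (simp_all add: c ig(3,5) ig(4)[unfolded a_kernel_def'])
  qed
  from additive_dvd_ord[of T "int ?\<delta>" ?n, OF this N(1)]
  have 1: "int ?\<delta> dvd int (group.ord (G0 T) (G0_class T M)) * ?n N"
    unfolding G0_class_def N_def[symmetric] by simp
  have fgMH: "fg_module H (hopf_restriction M)"
    using fg_sr_iff[OF M.M\<^sub>H_left_module] M.fg_if_finite_dimensional(1)[OF fd] by blast
  obtain f where f: "f \<in> Hom T M N" "bij_betw f (carrier M) (carrier N)" using N(2) unfolding module_iso_def by blast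
  have fH: "f \<in> Hom H (hopf_restriction M) (hopf_restriction N)" by (rule hopf_restriction_Hom[OF f(1)])
  have fb: "bij_betw f (carrier (hopf_restriction M)) (carrier (hopf_restriction N))" using f(2) by simp
  have dim: "?d = sdim (hopf_restriction N)"
    using sdim_bij[OF M.M\<^sub>H_left_module N.M\<^sub>H_left_module fgMH fH fb] M.fg_if_finite_dimensional(3)[OF fd] by simp
  have fgNH: "fg_module H (hopf_restriction N)"
    by (rule fg_module_image[OF M.M\<^sub>H_left_module N.M\<^sub>H_left_module fH _ fgMH]) (use fb in \<open>simp add: bij_betw_def\<close>)
  have 2: "int ?\<delta> dvd ?n N + int ?d"
    unfolding dim by (rule syzygy_dim_finite[OF cover[OF N(1)] N.M\<^sub>H_left_module fgNH])
  let ?k = "group.ord (G0 T) (G0_class T M)"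
  have "int ?\<delta> dvd int ?k * (?n N + int ?d) - int ?k * ?n N" by (rule dvd_diff[OF dvd_mult[OF 2] 1])
  moreover have "int ?k * (?n N + int ?d) - int ?k * ?n N = int (?k * ?d)" by (simp add: algebra_simps)
  ultimately have "int ?\<delta> dvd int (?k * ?d)" by (simp only:)
  then have kd: "?\<delta> dvd ?k * ?d" by (simp only: int_dvd_int_iff)
  have \<delta>0: "?\<delta> \<noteq> 0" by (rule proj_dim_gcd_pos[OF counit_nonzero])
  show ?thesis
  proof -
    define g where "g = gcd ?\<delta> ?d"
    have g0: "g \<noteq> 0" unfolding g_def using \<delta>0 by simp
    have "(?\<delta> div g) * g dvd (?k * (?d div g)) * g" using kd unfolding g_def by (simp add: mult.assoc)
    then have "?\<delta> div g dvd ?k * (?d div g)" using g0 by simp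
    moreover have "coprime (?\<delta> div g) (?d div g)" unfolding g_def using \<delta>0 by (intro div_gcd_coprime) simp
    ultimately show ?thesis unfolding g_def[symmetric] by (simp add: coprime_dvd_mult_left_iff)
  qed
qed

end

theorem corollary3p3:
  fixes K :: "'k ring"
    and H :: "('k, 'h) hopf"
    and R :: "('k, 'r) module"
    and act :: "'h \<Rightarrow> 'r \<Rightarrow> 'r"
    and \<Lambda> :: 'h
    and T :: "('k, ('r \<times> 'h \<Rightarrow> 'k) set) module"
    and M :: "(('r \<times> 'h \<Rightarrow> 'k) set, 'm) module"
    and \<delta> d :: nat
  assumes "field K"
    and "hopf_algebra K H"
    and "vectorspace.fin_dim K H"
    and "left_integral H \<Lambda>" and "\<Lambda> \<noteq> \<zero>\<^bsub>H\<^esub>"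
    and "module_algebra K H R act"
    and "T = smash_product K H R act"
    and "noetherian_module (R\<lparr>carrier := invariants H R act\<rparr>) (with_action R (monoid.mult R))"
    and "vectorspace.fin_dim K
           (quotient_module (R\<lparr>carrier := invariants H R act\<rparr>) (act \<Lambda> ` carrier R))"
    and "\<delta> = proj_dim_gcd K H"
    and "left_module T M"
    and "vectorspace.fin_dim K (scalar_restriction T M)"
    and "d = vectorspace.dim K (scalar_restriction T M)"
  shows "(\<delta> div gcd \<delta> d) dvd group.ord (G0 T) (G0_class T M)"
proof -
  have alg: "k_algebra K H" using assms(2) unfolding hopf_algebra_def by blast
  then have "left_module K H" using vectorspace_iff[OF assms(1)] unfolding k_algebra_def by blast
  then have "fg_module K H" using fin_dim_iff[OF assms(1)] assms(3) by blast
  then interpret smash K H R act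
    using assms(1,2,6) alg by (intro smash.intro fd_hopf_algebra.intro fd_algebra.intro fd_hopf_algebra_axioms.intro smash_axioms.intro)
  interpret M: smash_module K H R act M using assms(11) smash_moduleI unfolding assms(7) by blast
  interpret S: left_module K "R\<lparr>carrier := invariants H R act\<rparr>"
    by (rule RK.submodule_left_module[OF invariants_submodule])
  show ?thesis
    unfolding assms(7,10,13)
  proof (rule order_divisible[OF assms(4,8)])
    show "fg_module K (quotient_module (R\<lparr>carrier := invariants H R act\<rparr>) (act \<Lambda> ` carrier R))"
      using fin_dim_iff[OF assms(1) S.quotient_left_module[OF integral_image_submodule[OF assms(4)]]] assms(9) by blast
    show "left_module (smash_product K H R act) M" by (rule M.M)
    show "fg_module K (scalar_restriction (smash_product K H R act) M)"
      using fin_dim_iff[OF assms(1) M.scalar_restriction_left_module] assms(12) unfolding assms(7) by blast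
  qed
qed

end
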